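(* Let $d\ge 2$ and $e\in(0,\infty)$. For $\mu\in\mathscr P_e$ with $H_e(\mu|M_e)<+\infty$, let $i_e(\cdot|\mu)\colon[0,+\infty)\to[0,+\infty]$ be the function defined in the context. Then $i_e(\cdot|\mu)$ does not depend on $\mu$ (among all $\mu\in\mathscr P_e$ with $H_e(\mu|M_e)<+\infty$), and it is continuous and convex on $[0,+\infty)$. Furthermore, for every $q\in(0,+\infty)$, $$i_e(q|\mu)=\lim_{T\to\infty}\frac1T\inf_{(\boldsymbol\pi,\boldsymbol Q)\in\mathscr A_{e,T}(q|\mu)}J_{e,T}(\boldsymbol\pi,\boldsymbol Q),$$ and $i_e(\cdot|\mu)$ vanishes on the interval $[0,\bar q_e]$, where $\bar q_e=\frac12\int M_e(dv)M_e(dv_* )B(v-v_*,\omega)\,d\omega$.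
   Context: Fix an integer $d\ge2$ and $e\in(0,\infty)$. $d\omega$ is the Haar (rotation invariant) measure on the unit sphere $\mathbb S_{d-1}\subset\mathbb R^d$. The collision kernel is $B(v-v_*,\omega)=\frac12|(v-v_* )\cdot\omega|$. Given $v,v_*\in\mathbb R^d$, $\omega\in\mathbb S_{d-1}$, the post-collisional velocities are $v'=v+(\omega\cdot(v_*-v))\omega$, $v_*'=v_*-(\omega\cdot(v_*-v))\omega$. Write $\zeta_0(v)=|v|^2/2$, $\zeta(v)=v$, $\boldsymbol\zeta=(\zeta_0,\zeta)$. $\mathscr P_e$ is the set of probability measures $\pi$ on $\mathbb R^d$ with $\pi(\zeta_0)\le e$ and $\pi(\zeta)=0$, with the weak topology (it is compact). $M_\epsilon$ is the Maxwellian (centred isotropic Gaussian) on $\mathbb R^d$ with $M_\epsilon(\zeta_0)=\epsilon$. For $\pi\in\mathscr P_e$ with density $f$ with respect to Lebesgue measure, $H_e(\pi|M_e)=\int f\log f\,dv+\frac d2\big(\log\frac{4\pi e}{d}+1\big)$ (where the $\pi$ inside the logarithm is the number $3.14\ldots$); $H_e(\pi|M_e)=+\infty$ if $\pi$ is not absolutely continuous. Equivalently $H_e(\pi|M_e)=\mathrm{Ent}(\pi|M_e)+\frac{d}{2e}[e-\pi(\zeta_0)]$, with $\mathrm{Ent}$ the relative entropy. For $T>0$: $D([0,T];\mathscr P_e)$ is the Skorokhod space of càdlàg paths; $\mathscr M_T$ is the set of finite measures $\boldsymbol Q$ on $[0,T]\times\mathbb R^{2d}\times\mathbb R^{2d}$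 with $\boldsymbol Q(dt;dv,dv_*,dv',dv_*')=\boldsymbol Q(dt;dv_*,dv,dv',dv_*')=\boldsymbol Q(dt;dv,dv_*,dv_*',dv')$, with the weak topology. $\mathscr S_{e,T}$ is the set of pairs $(\boldsymbol\pi,\boldsymbol Q)\in D([0,T];\mathscr P_e)\times\mathscr M_T$ satisfying, for every $\phi\in C^1_b([0,T]\times\mathbb R^d)$, the balance equation $$\pi_T(\phi_T)-\pi_0(\phi_0)-\int_0^T dt\,\pi_t(\partial_t\phi_t)-\int\boldsymbol Q(dt;dv,dv_*,dv',dv_*')\,\bar\nabla\phi_t(v,v_*,v',v_*')=0,$$ where $\bar\nabla\phi(v,v_*,v',v_*')=\phi(v')+\phi(v_*')-\phi(v)-\phi(v_* )$. Let $r(v,v_*;\cdot)$ be the measure on $\mathbb R^{2d}$ which is the image of $B(v-v_*,\omega)\,d\omega$ under $\omega\mapsto(v',v_*')$. For $\boldsymbol\pi\in D([0,T];\mathscr P_e)$ set $\boldsymbol Q^{\boldsymbol\pi}(dt;dv,dv_*,dv',dv_*')=\frac12dt\,\pi_t(dv)\pi_t(dv_* )\,r(v,v_*;dv',dv_*')$. Let $\mathscr S^{\mathrm{ac}}_{e,T}$ be the set of $(\boldsymbol\pi,\boldsymbol Q)\in\mathscr S_{e,T}$ with $\boldsymbol\pi\in C([0,T];\mathscr P_e)$ and $\boldsymbol Q\ll\boldsymbol Q^{\boldsymbol\pi}$. The dynamical rate function $J_{e,T}\colon\mathscr S_{e,T}\to[0,\infty]$ is $$J_{e,T}(\boldsymbol\pi,\boldsymbol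 Q)=\int d\boldsymbol Q^{\boldsymbol\pi}\Big[\frac{d\boldsymbol Q}{d\boldsymbol Q^{\boldsymbol\pi}}\log\frac{d\boldsymbol Q}{d\boldsymbol Q^{\boldsymbol\pi}}-\Big(\frac{d\boldsymbol Q}{d\boldsymbol Q^{\boldsymbol\pi}}-1\Big)\Big]$$ if $(\boldsymbol\pi,\boldsymbol Q)\in\mathscr S^{\mathrm{ac}}_{e,T}$, and $+\infty$ otherwise. For $\mu\in\mathscr P_e$ with $H_e(\mu|M_e)<+\infty$ and $q\in(0,\infty)$, let $\mathscr A_{e,T}(q|\mu)=\{(\boldsymbol\pi,\boldsymbol Q)\in\mathscr S_{e,T}:\pi_T=\pi_0=\mu,\ \boldsymbol Q(1)=Tq\}$ (where $\boldsymbol Q(1)$ is the total mass), and $$i_e(q|\mu)=\inf_{T>0}\frac1T\inf_{(\boldsymbol\pi,\boldsymbol Q)\in\mathscr A_{e,T}(q|\mu)}J_{e,T}(\boldsymbol\pi,\boldsymbol Q),\qquad i_e(0|\mu)=\liminf_{q\downarrow0}i_e(q|\mu).$$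
   Formalization: The reference flux Q^π is replaced by its average with its image under exchanging v' and v'_*; for d = 3 this changes nothing, while for d ≠ 3 the unsymmetrized Q^π is not in M_T and i_e would be strictly positive on (0, q̄_e]. *)

theory Defs
  imports "HOL-Probability.Probability"
begin

section \<open>Collisions\<close>

text \<open>
  The normalisation of the rotation invariant measure on the sphere is left free: results are
  stated for every finite nonzero rotation invariant Borel measure \<open>\<sigma>\<close> on the unit sphere.
\<close>

definition haar_sphere :: "(real^'d) measure \<Rightarrow> bool" where
  "haar_sphere \<sigma> \<longleftrightarrow>
     sets \<sigma> = sets (restrict_space borel (sphere 0 1)) \<and>
     finite_measure \<sigma> \<and> emeasure \<sigma> (space \<sigma>) \<noteq> 0 \<and>
     (\<forall>R :: real^'d^'d. rotation_matrix R \<longrightarrow> distr \<sigma> \<sigma> (\<lambda>\<omega>. R *v \<omega>) = \<sigma>)"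

definition kernel_B :: "real^'d \<Rightarrow> real^'d \<Rightarrow> real" where
  "kernel_B w \<omega> = \<bar>w \<bullet> \<omega>\<bar> / 2"

definition post_velocities :: "real^'d \<Rightarrow> real^'d \<Rightarrow> real^'d \<Rightarrow> (real^'d) \<times> (real^'d)" where
  "post_velocities v vs \<omega> =
     (v + (\<omega> \<bullet> (vs - v)) *\<^sub>R \<omega>, vs - (\<omega> \<bullet> (vs - v)) *\<^sub>R \<omega>)"

definition collision_rate ::
    "(real^'d) measure \<Rightarrow> real^'d \<Rightarrow> real^'d \<Rightarrow> ((real^'d) \<times> (real^'d)) measure" where
  "collision_rate \<sigma> v vs =
     distr (density \<sigma> (\<lambda>\<omega>. ennreal (kernel_B (v - vs) \<omega>))) borel (post_velocities v vs)"

section \<open>One-particle distributions\<close>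

text \<open>
  The bound on the second moment makes the identity map integrable, so that the vanishing Bochner
  integral below says that the mean velocity is zero.
\<close>

definition prob_energy :: "real \<Rightarrow> (real^'d) measure set" where
  "prob_energy e = {\<pi>. prob_space \<pi> \<and> sets \<pi> = sets borel \<and>
     (\<integral>\<^sup>+ v. ennreal ((norm v)\<^sup>2 / 2) \<partial>\<pi>) \<le> ennreal e \<and> (\<integral> v. v \<partial>\<pi>) = 0}"

definition weak_topology :: "real \<Rightarrow> (real^'d) measure topology" where
  "weak_topology e = topology_generated_by
     {{\<pi> \<in> prob_energy e. (\<integral> v. \<phi> v \<partial>\<pi>) \<in> U} | \<phi> U.
        continuous_on UNIV (\<phi> :: real^'d \<Rightarrow> real) \<and> bounded (range \<phi>) \<and> open (U :: real set)}"

text \<open>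
  The Maxwellian is the product of centred one-dimensional Gaussians of variance
  \<open>2 * \<epsilon> / d\<close>, which has mean energy \<open>\<epsilon>\<close>.
\<close>

definition maxwellian :: "real \<Rightarrow> (real^'d) measure" where
  "maxwellian \<epsilon> = density lborel (\<lambda>v. ennreal
     (\<Prod>i\<in>UNIV. normal_density 0 (sqrt (2 * \<epsilon> / real CARD('d))) (v $ i)))"

text \<open>
  The integral of \<open>f * ln f\<close> is the difference of the integrals of its positive and negative parts.
  The second one is finite on \<open>prob_energy e\<close>, hence \<open>\<infinity> - \<infinity>\<close> does not occur there.
\<close>

definition entropy_H :: "real \<Rightarrow> (real^'d) measure \<Rightarrow> ereal" where
  "entropy_H e \<pi> =
     (if absolutely_continuous lborel \<pi> then
        (let f = (\<lambda>v. enn2real (RN_deriv lborel \<pi> v)) in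
           enn2ereal (\<integral>\<^sup>+ v. ennreal (f v * ln (f v)) \<partial>lborel)
         - enn2ereal (\<integral>\<^sup>+ v. ennreal (- (f v * ln (f v))) \<partial>lborel)
         + ereal (real CARD('d) / 2 * (ln (4 * pi * e / real CARD('d)) + 1)))
      else \<infinity>)"

definition finite_entropy :: "real \<Rightarrow> (real^'d) measure set" where
  "finite_entropy e = {\<mu> \<in> prob_energy e. entropy_H e \<mu> < \<infinity>}"

section \<open>Paths and fluxes\<close>

text \<open>Paths are functions on the whole real line; only their values on \<open>{0..T}\<close> are relevant.\<close>

definition cadlag_paths :: "real \<Rightarrow> real \<Rightarrow> (real \<Rightarrow> (real^'d) measure) set" where
  "cadlag_paths e T = {\<pi>. (\<forall>t\<in>{0..T}. \<pi> t \<in> prob_energy e) \<and>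
     (\<forall>t\<in>{0..<T}. limitin (weak_topology e) \<pi> (\<pi> t) (at_right t)) \<and>
     (\<forall>t\<in>{0<..T}. \<exists>\<nu>. limitin (weak_topology e) \<pi> \<nu> (at_left t))}"

definition continuous_paths :: "real \<Rightarrow> real \<Rightarrow> (real \<Rightarrow> (real^'d) measure) set" where
  "continuous_paths e T = {\<pi>. continuous_map (top_of_set {0..T}) (weak_topology e) \<pi>}"

text \<open>A point \<open>(t, v, vs, v', vs')\<close> records a collision at time \<open>t\<close>.\<close>

type_synonym 'd collision =
  "real \<times> (real^'d) \<times> (real^'d) \<times> (real^'d) \<times> (real^'d)"

definition collision_space :: "real \<Rightarrow> 'd::finite collision measure" where
  "collision_space T = restrict_space borel ({0..T} \<times> UNIV)"

fun swap_in :: "'d::finite collision \<Rightarrow> 'd collision" where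
  "swap_in (t, v, vs, v', vs') = (t, vs, v, v', vs')"

fun swap_out :: "'d::finite collision \<Rightarrow> 'd collision" where
  "swap_out (t, v, vs, v', vs') = (t, v, vs, vs', v')"

definition flux_measures :: "real \<Rightarrow> 'd::finite collision measure set" where
  "flux_measures T = {Q. sets Q = sets (collision_space T) \<and> finite_measure Q \<and>
     distr Q Q swap_in = Q \<and> distr Q Q swap_out = Q}"

text \<open>
  \<open>C1b T \<phi> D\<close>: the function \<open>\<phi>\<close> is bounded and continuously differentiable on
  \<open>{0..T} \<times> UNIV\<close> (one-sided at the end points), with bounded derivative \<open>D\<close>.
\<close>

definition C1b ::
    "real \<Rightarrow> (real \<times> (real^'d) \<Rightarrow> real) \<Rightarrow> (real \<times> (real^'d) \<Rightarrow> (real \<times> (real^'d)) \<Rightarrow>\<^sub>L real) \<Rightarrow> bool"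
  where
  "C1b T \<phi> D \<longleftrightarrow>
     (\<forall>p \<in> {0..T} \<times> UNIV. (\<phi> has_derivative blinfun_apply (D p)) (at p within {0..T} \<times> UNIV)) \<and>
     continuous_on ({0..T} \<times> UNIV) D \<and>
     bounded (\<phi> ` ({0..T} \<times> UNIV)) \<and> bounded (D ` ({0..T} \<times> UNIV))"

fun collision_gradient :: "(real \<times> (real^'d) \<Rightarrow> real) \<Rightarrow> 'd::finite collision \<Rightarrow> real" where
  "collision_gradient \<phi> (t, v, vs, v', vs') = \<phi> (t, v') + \<phi> (t, vs') - \<phi> (t, v) - \<phi> (t, vs)"

text \<open>Here \<open>D (t, v) (1, 0)\<close> is the time derivative of \<open>\<phi>\<close> at \<open>(t, v)\<close>.\<close>

definition balanced_pairs ::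
    "real \<Rightarrow> real \<Rightarrow> ((real \<Rightarrow> (real^'d) measure) \<times> 'd collision measure) set" where
  "balanced_pairs e T = {(\<pi>, Q). \<pi> \<in> cadlag_paths e T \<and> Q \<in> flux_measures T \<and>
     (\<forall>\<phi> D. C1b T \<phi> D \<longrightarrow>
        (\<integral> v. \<phi> (T, v) \<partial>\<pi> T) - (\<integral> v. \<phi> (0, v) \<partial>\<pi> 0)
        - (LINT t:{0..T}|lborel. (\<integral> v. blinfun_apply (D (t, v)) (1, 0) \<partial>\<pi> t))
        - (\<integral> c. collision_gradient \<phi> c \<partial>Q) = 0)}"

section \<open>The dynamical rate function\<close>

definition ordered_flux ::
    "(real^'d) measure \<Rightarrow> real \<Rightarrow> (real \<Rightarrow> (real^'d) measure) \<Rightarrow> 'd collision measure" where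
  "ordered_flux \<sigma> T \<pi> =
     measure_of (space (collision_space T)) (sets (collision_space T))
       (\<lambda>A. (1/2) * (\<integral>\<^sup>+ t\<in>{0..T}. (\<integral>\<^sup>+ v. (\<integral>\<^sup>+ vs. (\<integral>\<^sup>+ p.
          indicator A (t, v, vs, p) \<partial>collision_rate \<sigma> v vs) \<partial>\<pi> t) \<partial>\<pi> t) \<partial>lborel))"

text \<open>
  The reference flux is to be understood as an element of \<open>flux_measures T\<close>: the outgoing pair
  is unordered. With \<open>B = \<bar>(v - v\<^sub>*) \<bullet> \<omega>\<bar> / 2\<close> the measure \<open>ordered_flux \<sigma> T \<pi>\<close> is
  invariant under \<open>swap_out\<close> for every path only in dimension three, because the image of
  \<open>B d\<omega>\<close> on the sphere of outgoing directions has a density proportional to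
  \<open>\<bar>\<omega> \<bullet> (v - v\<^sub>*)\<bar>\<close> raised to the power \<open>3 - d\<close>. In general one has to
  average over the two labellings of the outgoing particles; for \<open>d = 3\<close> this changes nothing.
  The averaging does not affect the total mass nor the action on symmetric test functions, such as
  \<open>collision_gradient \<phi>\<close>. Without it, a flux in \<open>flux_measures T\<close> could not be equal to the
  reference flux if \<open>d \<noteq> 3\<close>, and solutions of the Boltzmann equation would have positive cost.
\<close>

definition boltzmann_flux ::
    "(real^'d) measure \<Rightarrow> real \<Rightarrow> (real \<Rightarrow> (real^'d) measure) \<Rightarrow> 'd collision measure" where
  "boltzmann_flux \<sigma> T \<pi> =
     measure_of (space (collision_space T)) (sets (collision_space T))
       (\<lambda>A. (emeasure (ordered_flux \<sigma> T \<pi>) A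
            + emeasure (distr (ordered_flux \<sigma> T \<pi>) (collision_space T) swap_out) A) / 2)"

definition ac_pairs ::
    "(real^'d) measure \<Rightarrow> real \<Rightarrow> real \<Rightarrow> ((real \<Rightarrow> (real^'d) measure) \<times> 'd collision measure) set"
  where
  "ac_pairs \<sigma> e T = {(\<pi>, Q) \<in> balanced_pairs e T.
     \<pi> \<in> continuous_paths e T \<and> absolutely_continuous (boltzmann_flux \<sigma> T \<pi>) Q}"

definition rate_J ::
    "(real^'d) measure \<Rightarrow> real \<Rightarrow> real \<Rightarrow> (real \<Rightarrow> (real^'d) measure) \<Rightarrow> 'd collision measure \<Rightarrow> ennreal"
  where
  "rate_J \<sigma> e T \<pi> Q =
     (if (\<pi>, Q) \<in> ac_pairs \<sigma> e T then
        (\<integral>\<^sup>+ c. (let x = enn2real (RN_deriv (boltzmann_flux \<sigma> T \<pi>) Q c)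
               in ennreal (x * ln x - (x - 1))) \<partial>boltzmann_flux \<sigma> T \<pi>)
      else \<infinity>)"

section \<open>The rate function of the number of collisions\<close>

definition cycles ::
    "real \<Rightarrow> real \<Rightarrow> (real^'d) measure \<Rightarrow> real \<Rightarrow>
      ((real \<Rightarrow> (real^'d) measure) \<times> 'd collision measure) set" where
  "cycles e T \<mu> q = {(\<pi>, Q) \<in> balanced_pairs e T.
     \<pi> T = \<mu> \<and> \<pi> 0 = \<mu> \<and> emeasure Q (space Q) = ennreal (T * q)}"

definition mean_cost ::
    "(real^'d) measure \<Rightarrow> real \<Rightarrow> (real^'d) measure \<Rightarrow> real \<Rightarrow> real \<Rightarrow> ennreal" where
  "mean_cost \<sigma> e \<mu> q T = (INF (\<pi>, Q) \<in> cycles e T \<mu> q. rate_J \<sigma> e T \<pi> Q) / ennreal T"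

definition rate_i ::
    "(real^'d) measure \<Rightarrow> real \<Rightarrow> (real^'d) measure \<Rightarrow> real \<Rightarrow> ennreal" where
  "rate_i \<sigma> e \<mu> q =
     (if q = 0 then Liminf (at_right 0) (\<lambda>q'. INF T\<in>{0<..}. mean_cost \<sigma> e \<mu> q' T)
      else (INF T\<in>{0<..}. mean_cost \<sigma> e \<mu> q T))"

definition typical_q :: "(real^'d) measure \<Rightarrow> real \<Rightarrow> ennreal" where
  "typical_q \<sigma> e = (1/2) * (\<integral>\<^sup>+ v. (\<integral>\<^sup>+ vs. (\<integral>\<^sup>+ \<omega>.
     ennreal (kernel_B (v - vs) \<omega>) \<partial>\<sigma>) \<partial>maxwellian e) \<partial>maxwellian e)"

end

theory Submission imports Defs begin

text \<open>
  Two paths of finite cost can be concatenated, and their costs add up. If any two distributions of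
  finite entropy can be connected at finite cost, then it is asymptotically optimal to travel from
  \<open>\<mu>\<close> to \<open>\<nu>\<close>, to repeat a good cycle at \<open>\<nu>\<close> many times and to travel back. Hence the mean cost does
  not depend on \<open>\<mu>\<close> and converges to its infimum, and splitting the time between two cycles gives
  convexity. At the Maxwellian of energy \<open>\<epsilon> \<le> e\<close> the stationary path has no cost, and its collision
  rate \<open>sqrt (\<epsilon> / e) * typical_q \<sigma> e\<close> takes all values in the zero set.

  To connect \<open>f0\<close> and \<open>f1\<close> we interpolate linearly between the densities, which preserves the
  constraints on the energy and on the mean, and look for a symmetric flux \<open>p\<close> with divergence
  \<open>f1 - f0\<close> whose entropy relative to products of the densities is finite. Let the collisions send
  the mass of \<open>h = f0 - f1\<close> to the other corners of random rectangles of size \<open>r\<close>: the total effect is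
  that \<open>h\<close> is replaced by its convolution with a Lipschitz kernel of size \<open>r\<close>. As \<open>h\<close> has total
  integral \<open>0\<close>, iterating this with geometrically growing sizes makes its mass decay geometrically,
  while the entropy only sees the logarithms of the sizes. One of the end points is a density with
  polynomial tails, the reciprocal of which has a harmless logarithm.
\<close>

text \<open>The difficulty is to make the smoothing kernel regular. Fluxes are measured against
  \<open>coll\<close>, the law of collisions of Lebesgue distributed velocities, and a rectangle is
  weighted by a function of its four side lengths; the weight thus has all symmetries of a
  collision, and each corner of the random rectangle is Lebesgue distributed. In polar coordinates
  the laws of the two corners next to \<open>v\<close> carry singular factors
  \<open>r ^ (1 - d)\<close> and \<open>1 / r\<close>; the order \<open>2 * d\<close> at which the
  weight vanishes on degenerate rectangles cancels them. The opposite corner is lost in the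
  collision and counts negatively, so the kernel may be signed, with integral one and L1 norm above
  one. Iterating at a fixed size need not contract; the gain comes from growing sizes, since a
  function with zero integral keeps a mass of at most its first moment over the size, up to a
  constant. Unbounded densities enter only the first step, where their own entropy pays; all later
  iterates are bounded. The polynomial tail makes the price of layer \<open>n\<close> linear in
  \<open>n\<close>, against a mass of order \<open>1 / 2 ^ n\<close>.\<close>

abbreviation (input) nn_lborel :: "('a::euclidean_space \<Rightarrow> ennreal) \<Rightarrow> ennreal" (binder "NBINT " 10) where
  "nn_lborel f \<equiv> \<integral>\<^sup>+x. f x \<partial>lborel"

abbreviation (input) borel_fun :: "('a::topological_space => 'b::topological_space) set" where
  "borel_fun == borel_measurable borel"

section \<open>Rotation invariant measures\<close>

text \<open>Uniqueness of Haar measure: integrate \<open>F (x + y) * indicator (ball 0 1) y\<close> in both orders.\<close>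

lemma translation_invariant_eq_lborel:
  fixes N :: "'a::euclidean_space measure"
  assumes "sets N = sets borel" "sigma_finite_measure N"
    and inv: "\<And>F c. F \<in> borel_fun ==> (\<integral>\<^sup>+x. F (x + c) \<partial>N) = (\<integral>\<^sup>+x. F x \<partial>N)"
    and ball: "emeasure N (ball 0 1) = emeasure lborel (ball (0::'a) 1)"
  shows "N = lborel"
proof (rule measure_eqI)
  interpret N: sigma_finite_measure N by fact
  interpret pair_sigma_finite lborel N ..
  have [measurable_cong]: "sets N = sets borel" by fact
  define B where "B = (ball 0 1 :: 'a set)"
  have [measurable]: "B \<in> sets borel" by (simp add: B_def)
  fix A assume "A \<in> sets N"
  then have [measurable]: "A \<in> sets borel" using assms by simp
  have lb: "(NBINT x. F (x + c)) = (NBINT x. F x)"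
    if [measurable]: "F \<in> borel_fun" for F :: "'a => ennreal" and c
  proof -
    have "(NBINT x. F x) = (\<integral>\<^sup>+x. F x \<partial>distr lborel borel ((+) c))"
      by (simp add: lborel_distr_plus)
    then show ?thesis by (simp add: nn_integral_distr add.commute)
  qed
  have "emeasure lborel A * emeasure N B
      = (\<integral>\<^sup>+y. (NBINT x. indicator A (x + y) * indicator B y) \<partial>N)"
    by (simp add: nn_integral_multc lb[of "indicator A"] nn_integral_cmult)
  also have "... = (NBINT x. (\<integral>\<^sup>+y. indicator A (x + y) * indicator B y \<partial>N))"
    by (rule Fubini') measurable
  also have "... = (NBINT x. (\<integral>\<^sup>+y. indicator A y * indicator B (y - x) \<partial>N))"
  proof (rule nn_integral_cong)
    fix x :: 'a
    have "(\<integral>\<^sup>+y. indicator A (x + y) * indicator B y \<partial>N)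
        = (\<integral>\<^sup>+y. indicator A (x + (y + - x)) * indicator B (y + - x) \<partial>N)"
      by (rule inv[symmetric]) measurable
    then show "(\<integral>\<^sup>+y. indicator A (x + y) * indicator B y \<partial>N)
        = (\<integral>\<^sup>+y. indicator A y * indicator B (y - x) \<partial>N)" by simp
  qed
  also have "... = (\<integral>\<^sup>+y. (NBINT x. indicator A y * indicator B (y - x)) \<partial>N)"
    by (rule Fubini'[symmetric]) measurable
  also have "... = (\<integral>\<^sup>+y. indicator A y * emeasure lborel B \<partial>N)"
  proof (rule nn_integral_cong)
    fix y :: 'a
    have "(NBINT x. indicator B (y - x)) = (NBINT x. indicator B (x + (- y)))"
      by (intro nn_integral_cong) (auto simp: B_def indicator_def dist_norm norm_minus_commute)
    also have "... = emeasure lborel B" by (subst lb) auto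
    finally show "(NBINT x. indicator A y * indicator B (y - x)) = indicator A y * emeasure lborel B"
      by (simp add: nn_integral_cmult)
  qed
  also have "... = emeasure N A * emeasure lborel B" by (simp add: nn_integral_multc)
  finally have eq: "emeasure lborel A * emeasure lborel B = emeasure N A * emeasure lborel B"
    using ball by (simp add: B_def)
  have "emeasure lborel B ~= 0"
    using content_ball_pos[of 1 "0::'a"] by (auto simp: measure_def B_def)
  moreover have "emeasure lborel B ~= \<infinity>"
    using emeasure_lborel_ball_finite[of "0::'a" 1] by (simp add: B_def less_top)
  ultimately show "emeasure N A = emeasure lborel A"
    using eq by (simp add: mult.commute[of _ "emeasure lborel B"] ennreal_mult_cancel_left)
qed (use assms in simp)

text \<open>A linear isometry is onto, so a translation after it is a translation before it: the
  image of Lebesgue measure is translation invariant. The mass of the unit ball is kept because the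
  preimage of a ball about 0 is that ball.\<close>

lemma distr_lborel_orthogonal:
  fixes f :: "real^'n => real^'n"
  assumes f: "orthogonal_transformation f"
  shows "distr lborel borel f = lborel"
proof (rule translation_invariant_eq_lborel)
  have lin: "linear f" and surj: "surj f" and norm: "\<And>x. norm (f x) = norm x"
    using f by (auto simp: orthogonal_transformation_linear orthogonal_transformation_surj
        orthogonal_transformation_norm)
  have [measurable]: "f \<in> borel_fun"
    by (intro borel_measurable_continuous_onI linear_continuous_on)
       (use lin linear_conv_bounded_linear in blast)
  have preimage: "f -` cball 0 r = cball 0 r" "f -` ball 0 r = ball 0 r" for r
    using norm by auto
  show "emeasure (distr lborel borel f) (ball 0 1) = emeasure lborel (ball (0::real^'n) 1)"
    using preimage by (simp add: emeasure_distr)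
  show "sigma_finite_measure (distr lborel borel f)"
  proof (intro sigma_finite_measure.intro exI[of _ "range (\<lambda>n::nat. cball 0 (real n))"] conjI)
    show "\<Union> (range (\<lambda>n::nat. cball (0::real^'n) (real n))) = space (distr lborel borel f)"
      by (auto intro: real_arch_simple)
    show "\<forall>a\<in>range (\<lambda>n::nat. cball (0::real^'n) (real n)). emeasure (distr lborel borel f) a ~= \<infinity>"
      using preimage emeasure_lborel_cball_finite[of "0::real^'n"] by (auto simp: emeasure_distr less_top)
  qed auto
  fix F :: "real^'n => ennreal" and c assume [measurable]: "F \<in> borel_fun"
  obtain b where b: "f b = c" using surj by (metis surjD)
  have "(\<integral>\<^sup>+x. F (x + c) \<partial>distr lborel borel f) = (NBINT x. F (f (b + x)))"
    using b by (simp add: nn_integral_distr linear_add[OF lin] add.commute)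
  also have "... = (\<integral>\<^sup>+x. F (f x) \<partial>distr lborel borel ((+) b))"
    by (simp add: nn_integral_distr)
  finally show "(\<integral>\<^sup>+x. F (x + c) \<partial>distr lborel borel f) = (\<integral>\<^sup>+x. F x \<partial>distr lborel borel f)"
    by (simp add: lborel_distr_plus nn_integral_distr)
qed simp

lemma nn_integral_lborel_orthogonal:
  fixes f :: "real^'n => real^'n" and F :: "real^'n => ennreal"
  assumes f: "orthogonal_transformation f" and [measurable]: "F \<in> borel_fun"
  shows "(NBINT x. F (f x)) = (NBINT x. F x)"
proof -
  have [measurable]: "f \<in> borel_fun"
    by (intro borel_measurable_continuous_onI linear_continuous_on)
       (use f linear_conv_bounded_linear orthogonal_transformation_linear in blast)
  have "(NBINT x. F x) = (\<integral>\<^sup>+x. F x \<partial>distr lborel borel f)"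
    using f by (simp add: distr_lborel_orthogonal)
  then show ?thesis by (simp add: nn_integral_distr)
qed

section \<open>Recovering a measure from integrals of continuous functions\<close>

lemma infdist_tent_tendsto_indicator:
  fixes C :: "'a::metric_space set"
  assumes "closed C" "C ~= {}"
  shows "(\<lambda>n. max 0 (1 - real n * infdist x C)) \<longlonglongrightarrow> indicator C x"
proof (cases "x \<in> C")
  case False
  then have pos: "infdist x C > 0"
    using in_closed_iff_infdist_zero[OF assms] infdist_nonneg[of x C] by (simp add: less_eq_real_def)
  have "\<forall>\<^sub>F n in sequentially. max 0 (1 - real n * infdist x C) = 0"
  proof -
    obtain N :: nat where N: "1 / infdist x C < N" using reals_Archimedean2 by blast
    show ?thesis
    proof (rule eventually_sequentiallyI[of N])
      fix n assume "N <= n"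
      then have "1 / infdist x C <= real n" using N by linarith
      then have "1 <= real n * infdist x C" using pos by (simp add: field_simps)
      then show "max 0 (1 - real n * infdist x C) = 0" by simp
    qed
  qed
  then show ?thesis using False by (simp add: tendsto_eventually)
qed (simp add: max_def)

text \<open>Passes from integrals of bounded continuous functions to masses of closed sets. This
  serves to identify measures and to obtain the measurability of weakly continuous paths.\<close>

lemma tendsto_integral_tent:
  fixes C :: "'a::metric_space set"
  assumes "finite_measure M" "sets M = sets borel" "closed C" "C ~= {}"
  shows "(\<lambda>n. \<integral>x. max 0 (1 - real n * infdist x C) \<partial>M) \<longlonglongrightarrow> measure M C"
proof -
  interpret finite_measure M by fact
  have [measurable_cong]: "sets M = sets borel" by fact
  have [measurable]: "C \<in> sets borel" using assms by auto
  have [measurable]: "(\<lambda>x. max 0 (1 - real n * infdist x C)) \<in> borel_fun" for n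
    by (intro borel_measurable_continuous_onI continuous_intros)
  have "(\<lambda>n. \<integral>x. max 0 (1 - real n * infdist x C) \<partial>M) \<longlonglongrightarrow> (\<integral>x. indicator C x \<partial>M)"
  proof (rule integral_dominated_convergence[where w="\<lambda>_. 1"])
    show "AE x in M. (\<lambda>n. max 0 (1 - real n * infdist x C)) \<longlonglongrightarrow> indicator C x"
      using infdist_tent_tendsto_indicator[OF assms(3,4)] by simp
    show "AE x in M. norm (max 0 (1 - real i * infdist x C)) <= 1" for i
      by (simp add: infdist_nonneg)
  qed simp_all
  moreover have "C \<inter> space M = C" using sets_eq_imp_space_eq[OF assms(2)] by auto
  ultimately show ?thesis by simp
qed

lemma measure_eqI_closed:
  fixes M N :: "'a::metric_space measure"
  assumes "finite_measure M" "finite_measure N" "sets M = sets borel" "sets N = sets borel"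
    and eq: "\<And>C. closed C ==> measure M C = measure N C"
  shows "M = N"
proof (rule measure_eqI_generator_eq[where E="{C. closed C}" and \<Omega>=UNIV and A="\<lambda>_. UNIV"])
  show "Int_stable {C::'a set. closed C}" by (auto simp: Int_stable_def)
  show "emeasure M X = emeasure N X" if "X \<in> {C. closed C}" for X
    using eq that assms(1,2) by (simp add: finite_measure.emeasure_eq_measure)
  show "sets M = sigma_sets UNIV {C. closed C}" "sets N = sigma_sets UNIV {C. closed C}"
    using assms(3,4) by (simp_all add: borel_eq_closed)
  show "emeasure M UNIV ~= \<infinity>" for i :: nat
    using finite_measure.emeasure_finite[OF assms(1)] by simp
qed auto

text \<open>The point-separating algebra of finite sums of exponentials: Stone-Weierstrass applies
  to it, and its integrals are known from the Laplace transform.\<close>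

inductive exp_sum :: "(real^'n => real) => bool" where
  exp_sum_exp: "exp_sum (\<lambda>x. c * exp (a \<bullet> x))"
| exp_sum_add: "exp_sum f ==> exp_sum g ==> exp_sum (\<lambda>x. f x + g x)"

lemma exp_sum_const: "exp_sum (\<lambda>x. c)"
  using exp_sum_exp[of c 0] by simp

lemma exp_sum_mult_exp: "exp_sum f ==> exp_sum (\<lambda>x. c * exp (a \<bullet> x) * f x)"
proof (induction rule: exp_sum.induct)
  case (exp_sum_exp c' a')
  have "(\<lambda>x. c * exp (a \<bullet> x) * (c' * exp (a' \<bullet> x))) = (\<lambda>x. (c * c') * exp ((a + a') \<bullet> x))"
    by (auto simp: inner_add_left exp_add)
  then show ?case using exp_sum.exp_sum_exp by simp
next
  case (exp_sum_add f g)
  then show ?case using exp_sum.exp_sum_add by (simp add: distrib_left)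
qed

lemma exp_sum_mult: "exp_sum f ==> exp_sum g ==> exp_sum (\<lambda>x. f x * g x)"
proof (induction rule: exp_sum.induct)
  case (exp_sum_add f h)
  then show ?case using exp_sum.exp_sum_add by (simp add: distrib_right)
qed (rule exp_sum_mult_exp)

lemma exp_sum_continuous: "exp_sum f ==> continuous_on S f"
  by (induction rule: exp_sum.induct) (auto intro!: continuous_intros)

lemma exp_sum_dense:
  fixes f :: "real^'n => real"
  assumes "compact S" "continuous_on S f" "0 < e"
  obtains g where "exp_sum g" "\<And>x. x \<in> S ==> \<bar>f x - g x\<bar> < e"
proof -
  have "\<exists>g. exp_sum g \<and> (\<forall>x\<in>S. \<bar>f x - g x\<bar> < e)"
  proof (rule Stone_Weierstrass_HOL[OF assms(1)])
    show "exp_sum f \<and> exp_sum g ==> exp_sum (\<lambda>x. f x + g x)" for f g :: "real^'n => real"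
      using exp_sum.exp_sum_add by blast
    show "exp_sum f \<and> exp_sum g ==> exp_sum (\<lambda>x. f x * g x)" for f g :: "real^'n => real"
      using exp_sum_mult by blast
    fix x y :: "real^'n" assume "x \<in> S \<and> y \<in> S \<and> x ~= y"
    then have "(x - y) \<bullet> (x - y) ~= 0" by simp
    then have "x \<bullet> (x - y) ~= y \<bullet> (x - y)"
      unfolding inner_diff_left by simp
    then have "exp ((x - y) \<bullet> x) ~= exp ((x - y) \<bullet> y)" by (simp add: inner_commute)
    then show "\<exists>f. exp_sum f \<and> f x ~= f y"
      using exp_sum.exp_sum_exp[of 1 "x - y"] by (intro exI[of _ "\<lambda>z. 1 * exp ((x - y) \<bullet> z)"]) auto
  qed (use assms exp_sum_const exp_sum_continuous in auto)
  then show ?thesis using that by blast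
qed

definition rotation_invariant :: "(real^'d) measure => bool" where
  "rotation_invariant M \<longleftrightarrow>
     (\<forall>R :: real^'d^'d. rotation_matrix R \<longrightarrow> distr M borel (\<lambda>x. R *v x) = M)"

lemma borel_measurable_matrix_vector_mult [measurable]:
  "(\<lambda>x. (R :: real^'n^'m) *v x) \<in> borel_fun"
  by (intro borel_measurable_continuous_onI linear_continuous_on matrix_vector_mul_bounded_linear)

lemma rotation_matrix_orthogonal:
  fixes R :: "real^'n^'n"
  shows "rotation_matrix R ==> orthogonal_transformation ((*v) R)"
  by (simp add: orthogonal_transformation_matrix rotation_matrix_def matrix_vector_mul_linear)

lemma rotation_matrix_norm: "rotation_matrix R ==> norm (R *v x) = norm (x::real^'n)"
  using rotation_matrix_orthogonal orthogonal_transformation_norm by blast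

lemma rotation_matrix_inner: "rotation_matrix R ==> (R *v x) \<bullet> (R *v y) = x \<bullet> (y::real^'n)"
  using rotation_matrix_orthogonal by (auto simp: orthogonal_transformation_def)

text \<open>Rotations of determinant one act transitively on spheres once the dimension is at least
  two.\<close>

lemma rotation_matrix_exists:
  fixes a b :: "real^'n"
  assumes "2 <= CARD('n)" "norm a = norm b"
  obtains R where "rotation_matrix R" "R *v a = b"
proof -
  obtain f where f: "orthogonal_transformation f" "det (matrix f) = 1" "f a = b"
    using rotation_exists[OF assms] by blast
  then have "rotation_matrix (matrix f)"
    by (simp add: rotation_matrix_def orthogonal_transformation_matrix)
  moreover have "matrix f *v a = b"
    using f by (simp add: matrix_works orthogonal_transformation_linear)
  ultimately show ?thesis using that by blast
qed

lemma nn_integral_rotation: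
  assumes "rotation_invariant M" "rotation_matrix R" "sets M = sets borel" "F \<in> borel_fun"
  shows "(\<integral>\<^sup>+x. F (R *v x) \<partial>M) = (\<integral>\<^sup>+x. F x \<partial>M)"
proof -
  have [measurable_cong]: "sets M = sets borel" by fact
  have [measurable]: "F \<in> borel_fun" by fact
  have "(\<integral>\<^sup>+x. F x \<partial>M) = (\<integral>\<^sup>+x. F x \<partial>distr M borel (\<lambda>x. R *v x))"
    using assms by (simp add: rotation_invariant_def)
  also have "... = (\<integral>\<^sup>+x. F (R *v x) \<partial>M)" by (rule nn_integral_distr) measurable
  finally show ?thesis by simp
qed

text \<open>The Haar measure of the sphere regarded as a measure on the whole space that charges
  only unit vectors. The sigma-algebra is then the Borel one, at the price of statements that hold
  for almost every \<open>u\<close>.\<close>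

locale sphere_measure =
  fixes s :: "(real^'d) measure"
  assumes sets_s [measurable_cong, simp]: "sets s = sets borel"
    and finite_s: "finite_measure s"
    and nonzero_s: "emeasure s UNIV ~= 0"
    and norm_s: "AE u in s. norm u = 1"
    and rotation_s: "rotation_invariant s"
    and dim: "2 <= CARD('d)"
begin

sublocale finite_measure s by (rule finite_s)

abbreviation (input) nn_sphere :: "(real^'d => ennreal) => ennreal" (binder "NSINT " 10) where
  "nn_sphere f == \<integral>\<^sup>+x. f x \<partial>s"

text \<open>Invariance of \<open>M\<close> replaces \<open>a\<close> by
  \<open>norm a *\<^sub>R u\<close>, and after exchanging the integrals invariance of
  \<open>s\<close> replaces \<open>x\<close> by \<open>norm x *\<^sub>R e\<close>. What is left sees
  \<open>M\<close> only through the law of the norm.\<close>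

lemma rotation_invariant_laplace:
  fixes M :: "(real^'d) measure"
  assumes "finite_measure M" and [measurable_cong]: "sets M = sets borel"
    and rot: "rotation_invariant M" and e: "norm e = 1"
  shows "(\<integral>\<^sup>+x. ennreal (exp (a \<bullet> x)) \<partial>M) * emeasure s UNIV
    = (\<integral>\<^sup>+t. (NSINT u. ennreal (exp (norm a * (t * (u \<bullet> e))))) \<partial>distr M borel norm)"
proof -
  interpret M: finite_measure M by fact
  interpret pair_sigma_finite s M ..
  have space_s: "space s = UNIV" by (simp add: sets_eq_imp_space_eq[OF sets_s])
  have "(\<integral>\<^sup>+x. ennreal (exp (a \<bullet> x)) \<partial>M) * emeasure s UNIV
      = (NSINT u. (\<integral>\<^sup>+x. ennreal (exp (a \<bullet> x)) \<partial>M))"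
    by (simp add: space_s)
  also have "... = (NSINT u. (\<integral>\<^sup>+x. ennreal (exp ((norm a *\<^sub>R u) \<bullet> x)) \<partial>M))"
  proof (rule nn_integral_cong_AE, use norm_s in eventually_elim)
    fix u :: "real^'d" assume "norm u = 1"
    then obtain R where R: "rotation_matrix R" "R *v a = norm a *\<^sub>R u"
      using rotation_matrix_exists[OF dim, of a "norm a *\<^sub>R u"] by auto
    have "(\<integral>\<^sup>+x. ennreal (exp ((norm a *\<^sub>R u) \<bullet> (R *v x))) \<partial>M) = (\<integral>\<^sup>+x. ennreal (exp ((norm a *\<^sub>R u) \<bullet> x)) \<partial>M)"
      by (rule nn_integral_rotation[OF rot R(1) assms(2)]) measurable
    moreover have "(norm a *\<^sub>R u) \<bullet> (R *v x) = a \<bullet> x" for x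
      using rotation_matrix_inner[OF R(1)] by (simp flip: R(2))
    ultimately show "(\<integral>\<^sup>+x. ennreal (exp (a \<bullet> x)) \<partial>M) = (\<integral>\<^sup>+x. ennreal (exp ((norm a *\<^sub>R u) \<bullet> x)) \<partial>M)" by simp
  qed
  also have "... = (\<integral>\<^sup>+x. (NSINT u. ennreal (exp ((norm a *\<^sub>R u) \<bullet> x))) \<partial>M)"
    by (rule Fubini'[symmetric]) measurable
  also have "... = (\<integral>\<^sup>+x. (NSINT u. ennreal (exp (norm a * (norm x * (u \<bullet> e))))) \<partial>M)"
  proof (rule nn_integral_cong)
    fix x :: "real^'d"
    obtain R where R: "rotation_matrix R" "R *v (norm x *\<^sub>R e) = x"
      using rotation_matrix_exists[OF dim, of "norm x *\<^sub>R e" x] e by auto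
    have inner: "(R *v u) \<bullet> x = norm x * (u \<bullet> e)" for u
      using rotation_matrix_inner[OF R(1), of u "norm x *\<^sub>R e"] R(2) by simp
    have "(NSINT u. ennreal (exp (norm a * (u \<bullet> x)))) = (NSINT u. ennreal (exp (norm a * ((R *v u) \<bullet> x))))"
      by (rule nn_integral_rotation[OF rotation_s R(1), symmetric]) simp_all
    then show "(NSINT u. ennreal (exp ((norm a *\<^sub>R u) \<bullet> x))) = (NSINT u. ennreal (exp (norm a * (norm x * (u \<bullet> e)))))"
      by (simp add: inner)
  qed
  also have "... = (\<integral>\<^sup>+t. (NSINT u. ennreal (exp (norm a * (t * (u \<bullet> e))))) \<partial>distr M borel norm)"
    by (rule nn_integral_distr[symmetric]) measurable
  finally show ?thesis .
qed

text \<open>The measure \<open>s\<close> serves as a reference to average exponentials over directions; hence the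
  Laplace transforms of both measures are determined by the law of the norm.\<close>

lemma rotation_invariant_eqI:
  fixes M N :: "(real^'d) measure"
  assumes "finite_measure M" "finite_measure N"
    and sM [measurable_cong]: "sets M = sets borel" and sN [measurable_cong]: "sets N = sets borel"
    and rot: "rotation_invariant M" "rotation_invariant N"
    and norm: "\<And>I. I \<in> sets borel ==> emeasure M {x. norm x \<in> I} = emeasure N {x. norm x \<in> I}"
    and supp: "AE x in N. norm x <= r"
  shows "M = N"
proof -
  have space: "space M = UNIV" "space N = UNIV"
    by (simp_all add: sets_eq_imp_space_eq[OF sM] sets_eq_imp_space_eq[OF sN])
  have law: "distr M borel norm = distr N borel norm"
    by (rule measure_eqI) (simp_all add: emeasure_distr space vimage_def norm)
  \<comment> \<open>The bound on the support passes from \<open>N\<close> to \<open>M\<close>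
    because the norms have the same law.\<close>
  have "AE t in distr N borel norm. t <= r" using supp by (subst AE_distr_iff) auto
  then have suppM: "AE x in M. norm x <= r" unfolding law[symmetric] by (subst (asm) AE_distr_iff) auto
  obtain k :: 'd where True by simp
  have exp_eq: "(\<integral>\<^sup>+x. ennreal (exp (a \<bullet> x)) \<partial>M) = (\<integral>\<^sup>+x. ennreal (exp (a \<bullet> x)) \<partial>N)" for a
  proof -
    have "emeasure s UNIV * (\<integral>\<^sup>+x. ennreal (exp (a \<bullet> x)) \<partial>M) = emeasure s UNIV * (\<integral>\<^sup>+x. ennreal (exp (a \<bullet> x)) \<partial>N)"
      using rotation_invariant_laplace[OF assms(1) sM rot(1), of "axis k 1" a]
        rotation_invariant_laplace[OF assms(2) sN rot(2), of "axis k 1" a]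
      by (simp add: law mult.commute[of _ "emeasure s UNIV"])
    then show ?thesis using nonzero_s emeasure_finite[of UNIV] by (simp add: ennreal_mult_cancel_left)
  qed
  have int': "integrable K f"
    if "finite_measure K" "sets K = sets borel" and ae: "AE x in K. norm x <= r" and f: "continuous_on UNIV f"
    for K and f :: "real^'d => real"
  proof -
    interpret K: finite_measure K by fact
    have "bounded (f ` cball 0 r)"
      by (intro compact_imp_bounded compact_continuous_image compact_cball continuous_on_subset[OF f subset_UNIV])
    then obtain B where B: "\<forall>y\<in>f ` cball 0 r. norm y <= B" unfolding bounded_iff ..
    have "AE x in K. norm (f x) <= B" using ae by eventually_elim (use B in auto)
    then show ?thesis
      by (rule K.integrable_const_bound)
        (use borel_measurable_continuous_onI[OF f] that(2) in \<open>simp add: measurable_cong_sets[OF that(2) refl]\<close>)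
  qed
  note int = int'[OF assms(1) sM suppM] int'[OF assms(2) sN supp]
  have sum_eq: "(\<integral>x. f x \<partial>M) = (\<integral>x. f x \<partial>N)" if "exp_sum f" for f :: "real^'d => real"
    using that
  proof (induction rule: exp_sum.induct)
    case (exp_sum_exp c a)
    then show ?case using exp_eq[of a] by (simp add: integral_eq_nn_integral)
  next
    case (exp_sum_add f g)
    then show ?case using int[of f] int[of g] by (simp add: exp_sum_continuous)
  qed
  have cont_eq: "(\<integral>x. f x \<partial>M) = (\<integral>x. f x \<partial>N)" if f: "continuous_on UNIV f" for f :: "real^'d => real"
  proof -
    let ?m = "measure M UNIV + measure N UNIV"
    have H: "\<bar>(\<integral>x. f x \<partial>M) - (\<integral>x. f x \<partial>N)\<bar> <= e * ?m" if "e > 0" for e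
    proof -
      \<comment> \<open>Both measures live on \<open>cball 0 r\<close>, so uniform approximation on
        this compact set is enough.\<close>
      obtain g where g: "exp_sum g" "\<And>x. x \<in> cball 0 r ==> \<bar>f x - g x\<bar> < e"
        by (rule exp_sum_dense[OF compact_cball continuous_on_subset[OF f subset_UNIV] \<open>e > 0\<close>]) (rule that)
      have gc: "continuous_on UNIV g" using g(1) by (rule exp_sum_continuous)
      have close: "\<bar>(\<integral>x. f x \<partial>K) - (\<integral>x. g x \<partial>K)\<bar> <= e * measure K UNIV"
        if "finite_measure K" "sets K = sets borel" and ae: "AE x in K. norm x <= r" for K
      proof -
        interpret K: finite_measure K by fact
        note i = int'[OF that f] int'[OF that gc]
        have "\<bar>(\<integral>x. f x \<partial>K) - (\<integral>x. g x \<partial>K)\<bar> = \<bar>\<integral>x. f x - g x \<partial>K\<bar>" using i by simp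
        also have "... <= (\<integral>x. e \<partial>K)"
        proof (rule order_trans[OF integral_abs_bound], rule integral_mono_AE)
          show "AE x in K. \<bar>f x - g x\<bar> <= e" using ae by eventually_elim (use g(2) in \<open>simp add: less_imp_le\<close>)
        qed (use i in simp_all)
        finally show ?thesis using sets_eq_imp_space_eq[OF that(2)] by (simp add: mult.commute)
      qed
      show ?thesis
        using close[OF assms(1) sM suppM] close[OF assms(2) sN supp] sum_eq[OF g(1)]
        by (simp add: distrib_left)
    qed
    have "\<bar>(\<integral>x. f x \<partial>M) - (\<integral>x. f x \<partial>N)\<bar> <= 0"
    proof (rule field_le_epsilon)
      fix e :: real assume e: "e > 0"
      \<comment> \<open>The \<open>+ 1\<close> keeps the divisor positive when both measures
        vanish.\<close>
      have m: "0 < ?m + 1" by (simp add: add_nonneg_pos)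
      then have "\<bar>(\<integral>x. f x \<partial>M) - (\<integral>x. f x \<partial>N)\<bar> <= e / (?m + 1) * ?m" using e by (intro H) simp
      also have "... <= e" using m e by (simp add: pos_divide_le_eq)
      finally show "\<bar>(\<integral>x. f x \<partial>M) - (\<integral>x. f x \<partial>N)\<bar> <= 0 + e" by simp
    qed
    then show ?thesis by simp
  qed
  show "M = N"
  proof (rule measure_eqI_closed)
    fix C :: "(real^'d) set" assume C: "closed C"
    show "measure M C = measure N C"
    proof (cases "C = {}")
      case False
      have "(\<integral>x. max 0 (1 - real n * infdist x C) \<partial>M) = (\<integral>x. max 0 (1 - real n * infdist x C) \<partial>N)" for n
        by (intro cont_eq continuous_intros)
      then show ?thesis
        using LIMSEQ_unique[OF tendsto_integral_tent[OF assms(1) sM C False]] tendsto_integral_tent[OF assms(2) sN C False] by simp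
    qed simp
  qed fact+
qed

end

text \<open>Replaces polar coordinates: by homogeneity the law of a norm or of a coordinate has a
  power as its distribution function, and the half-lines \<open>{..r}\<close> form an
  intersection-stable generator of the Borel sets.\<close>

lemma power_law_measure:
  fixes N :: "real measure"
  assumes [measurable_cong]: "sets N = sets borel" and n: "0 < n" and C: "0 <= C"
    and atMost: "\<And>r. 0 < r ==> emeasure N {..r} = ennreal (C * r ^ n)"
  shows "N = density lborel (\<lambda>r. ennreal (C * n * (r ^ (n - 1) * indicator {0<..} r)))" (is "_ = ?D")
proof (rule measure_eqI_generator_eq[where E="range atMost" and \<Omega>=UNIV and A="\<lambda>i::nat. {..real i}"])
  show "Int_stable (range (atMost :: real => _))" by (auto simp: Int_stable_def)
  show "sets N = sigma_sets UNIV (range atMost)" "sets ?D = sigma_sets UNIV (range atMost)"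
    using assms(1) by (simp_all add: borel_eq_atMost)
  show "(\<Union>i. {..real i}) = UNIV" using real_arch_simple by auto
  \<comment> \<open>\<open>atMost\<close> says nothing about \<open>r \<le> 0\<close>; monotonicity
    bounds the mass there by \<open>C * x ^ n\<close> for every positive \<open>x\<close>.\<close>
  have zero: "emeasure N {..r} = 0" if "r <= 0" for r
  proof -
    have "emeasure N {..r} <= ennreal e" if "e > 0" for e
    proof -
      \<comment> \<open>Ensures \<open>C * x ^ n \<le> C * x \<le> e\<close>; the \<open>+ 1\<close>
        covers \<open>C = 0\<close>.\<close>
      define x where "x = min 1 (e / (C + 1))"
      have x: "0 < x" "x <= 1" "x <= e / (C + 1)" using \<open>e > 0\<close> C by (auto simp: x_def)
      have "emeasure N {..r} <= emeasure N {..x}" using x \<open>r <= 0\<close> by (intro emeasure_mono) auto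
      also have "... = ennreal (C * x ^ n)" using x by (intro atMost)
      also have "... <= ennreal e"
      proof (rule ennreal_leI)
        have "C * x ^ n <= C * x" using x n C power_decreasing[of 1 n x] by (intro mult_left_mono) auto
        also have "... <= C * (e / (C + 1))" using x C by (intro mult_left_mono) auto
        also have "... <= e" using C \<open>e > 0\<close> by (simp add: field_simps)
        finally show "C * x ^ n <= e" .
      qed
      finally show ?thesis .
    qed
    then have "emeasure N {..r} <= 0" by (metis add_0 ennreal_le_epsilon)
    then show ?thesis by simp
  qed
  show "emeasure N {..real i} ~= \<infinity>" for i
    using atMost[of "real i"] zero[of "real i"] by (cases "i = 0") auto
  fix X :: "real set" assume "X \<in> range atMost"
  then obtain r where r: "X = {..r}" by auto
  show "emeasure N X = emeasure ?D X"
  proof (cases "r <= 0")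
    case True
    have "emeasure ?D X = (NBINT x. ennreal (C * n * (x ^ (n - 1) * indicator {0<..} x)) * indicator {..r} x)"
      unfolding r by (subst emeasure_density) simp_all
    also have "... = (\<integral>\<^sup>+x. 0 \<partial>(lborel :: real measure))"
      by (rule nn_integral_cong) (use True in \<open>auto simp: indicator_def\<close>)
    finally show ?thesis using zero[OF True] r by simp
  next
    case False
    then have "0 < r" by simp
    have "emeasure ?D X = (NBINT x. ennreal (C * n * (x ^ (n - 1))) * indicator {0..r} x)"
      unfolding r using AE_lborel_singleton[of "0::real"]
      by (subst emeasure_density) (auto intro!: nn_integral_cong_AE simp: indicator_def)
    also have "... = ennreal (C * r ^ n - C * 0 ^ n)"
      by (rule nn_integral_FTC_Icc[where F="\<lambda>x. C * x ^ n"])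
        (use C \<open>0 < r\<close> in \<open>auto intro!: derivative_eq_intros\<close>)
    finally show ?thesis using atMost[OF \<open>0 < r\<close>] r n by (simp add: power_0_left)
  qed
qed auto

lemma nn_integral_lborel_scale:
  fixes F :: "real^'n => ennreal"
  assumes [measurable]: "F \<in> borel_fun" and c: "\<And>i. 0 < c i"
  shows "(NBINT x. F x) = ennreal (\<Prod>i\<in>UNIV. c i) * (NBINT x. F (\<chi> i. c i * x $ i))"
proof -
  \<comment> \<open>Reads the scaling factor off a basis vector: its value at
    \<open>axis i 1\<close> is \<open>c i\<close>.\<close>
  let ?c = "\<lambda>j::real^'n. \<Sum>i\<in>UNIV. c i * j $ i"
  let ?f = "\<lambda>x::real^'n. 0 + (\<Sum>j\<in>Basis. (?c j * (x \<bullet> j)) *\<^sub>R j)"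
  have Basis: "(Basis :: (real^'n) set) = (\<lambda>i. axis i 1) ` UNIV" by (auto simp: Basis_vec_def)
  have inj: "inj (\<lambda>i::'n. axis i (1::real))" by (auto simp: inj_on_def axis_eq_axis)
  have c_axis: "?c (axis i 1) = c i" for i
    by (simp add: axis_def if_distrib cong: if_cong)
  have "?f x = (\<Sum>i\<in>UNIV. (c i * x $ i) *\<^sub>R axis i 1)" for x
    by (simp add: Basis sum.reindex[OF inj] c_axis inner_axis)
  then have f: "?f x = (\<chi> i. c i * x $ i)" for x
    by (simp add: vec_eq_iff axis_def if_distrib cong: if_cong)
  have p: "(\<Prod>j\<in>Basis. \<bar>?c j\<bar>) = (\<Prod>i\<in>UNIV. c i)"
    using c by (simp add: Basis prod.reindex[OF inj] c_axis abs_of_pos)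
  have [measurable]: "(\<lambda>x::real^'n. \<chi> i. c i * x $ i) \<in> borel_fun"
    by (intro borel_measurable_continuous_onI continuous_intros)
  have "lborel = density (distr lborel borel ?f) (\<lambda>x. ennreal (\<Prod>j\<in>Basis. \<bar>?c j\<bar>))"
    by (rule lborel_affine_euclidean) (use c in \<open>auto simp: Basis c_axis less_imp_neq[symmetric]\<close>)
  then have "lborel = density (distr lborel borel (\<lambda>x. \<chi> i. c i * x $ i)) (\<lambda>x. ennreal (\<Prod>i\<in>UNIV. c i))"
    unfolding f p .
  then have "(NBINT x. F x)
      = (\<integral>\<^sup>+x. F x \<partial>density (distr lborel borel (\<lambda>x. \<chi> i. c i * x $ i)) (\<lambda>x. ennreal (\<Prod>i\<in>UNIV. c i)))"
    by simp
  then show ?thesis by (simp add: nn_integral_density nn_integral_distr nn_integral_cmult)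
qed

text \<open>The volume of a ball is a power of its radius; differentiating it brings in the surface
  area of the unit sphere.\<close>

lemma nn_integral_lborel_norm:
  fixes f :: "real => ennreal"
  assumes [measurable]: "f \<in> borel_fun"
  shows "(NBINT x. f (norm (x::real^'n)))
    = (NBINT r. ennreal (unit_ball_vol CARD('n) * CARD('n) * (r ^ (CARD('n) - 1) * indicator {0<..} r)) * f r)"
proof -
  have "distr lborel borel (norm :: real^'n => real)
    = density lborel (\<lambda>r. ennreal (unit_ball_vol CARD('n) * CARD('n) * (r ^ (CARD('n) - 1) * indicator {0<..} r)))"
  proof (rule power_law_measure)
    fix r :: real assume "0 < r"
    have "norm -` {..r} = cball (0::real^'n) r" by auto
    then show "emeasure (distr lborel borel (norm :: real^'n => real)) {..r}
        = ennreal (unit_ball_vol CARD('n) * r ^ CARD('n))"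
      using \<open>0 < r\<close> by (simp add: emeasure_distr emeasure_cball)
  qed auto
  moreover have "(NBINT x. f (norm (x::real^'n))) = (\<integral>\<^sup>+r. f r \<partial>distr lborel borel (norm :: real^'n => real))"
    by (simp add: nn_integral_distr)
  ultimately show ?thesis by (simp add: nn_integral_density)
qed

definition perp :: "real^'n => real^'n => real^'n" where
  "perp u y = y - (y \<bullet> u) *\<^sub>R u"

lemma perp_measurable [measurable (raw)]:
  assumes [measurable]: "f \<in> borel_measurable M" "g \<in> borel_measurable M"
  shows "(\<lambda>x. perp (f x) (g x)) \<in> borel_measurable M"
  unfolding perp_def by measurable

lemma perp_axis: "perp (axis k 1) y = (\<chi> i. if i = k then 0 else y $ i)"
proof -
  have "y \<bullet> axis k 1 = y $ k" by (simp add: inner_axis)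
  then show ?thesis unfolding perp_def by (simp add: vec_eq_iff axis_def)
qed

lemma norm_square_perp:
  fixes y :: "real^'n"
  assumes "norm u = 1"
  shows "(norm y)\<^sup>2 = (y \<bullet> u)\<^sup>2 + (norm (perp u y))\<^sup>2"
proof -
  have "u \<bullet> u = 1" using assms by (simp add: dot_square_norm)
  then show ?thesis
    unfolding power2_norm_eq_inner perp_def
    by (simp add: inner_diff_left inner_diff_right inner_commute power2_eq_square)
qed

lemma cylinder_finite:
  fixes f :: "real^'n => ennreal"
  assumes [measurable]: "f \<in> borel_fun"
    and "\<And>y. f y <= ennreal B" "\<And>y. norm y > R ==> f y = 0"
  shows "(NBINT y. f y) < \<infinity>"
proof -
  have "(NBINT y. f y) <= (NBINT y. ennreal B * indicator (cball (0::real^'n) R) y)"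
    by (intro nn_integral_mono) (use assms(2,3) in \<open>auto simp: indicator_def not_le\<close>)
  also have "... = ennreal B * emeasure lborel (cball (0::real^'n) R)"
    by (rule nn_integral_cmult_indicator) simp
  also have "... < \<infinity>" using emeasure_lborel_cball_finite[of "0::real^'n" R]
    by (simp add: ennreal_mult_less_top)
  finally show ?thesis .
qed

text \<open>Stretching coordinate \<open>k\<close> alone leaves \<open>perp (axis k 1)\<close>
  unchanged and multiplies volume by the factor. Under the weight, the absolute value of that
  coordinate is therefore distributed like a multiple of Lebesgue measure on the half-line.\<close>

lemma nn_integral_axis_law:
  fixes f g :: "real => ennreal" and k :: "'n::finite"
  assumes [measurable]: "f \<in> borel_fun" "g \<in> borel_fun"
    and bound: "\<And>r. g r <= 1" "\<And>r. r \<ge> 1 ==> g r = 0"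
  defines "C \<equiv> enn2real (NBINT y. g (norm (perp (axis k 1) (y::real^'n))) * indicator {..1} \<bar>y $ k\<bar>)"
  shows "(NBINT y. g (norm (perp (axis k 1) (y::real^'n))) * f \<bar>y $ k\<bar>)
    = (NBINT r. ennreal (C * indicator {0<..} r) * f r)"
proof -
  let ?N = "distr (density lborel (\<lambda>y::real^'n. g (norm (perp (axis k 1) y)))) borel (\<lambda>y. \<bar>y $ k\<bar>)"
  let ?I = "\<lambda>r. (NBINT y. g (norm (perp (axis k 1) (y::real^'n))) * indicator {..r} \<bar>y $ k\<bar>)"
  \<comment> \<open>Where the integrand is nonzero both components have length at most 1, so that
    \<open>norm y \<le> 2\<close>.\<close>
  have "?I 1 < \<infinity>"
  proof (rule cylinder_finite[where B=1 and R=2])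
    fix y :: "real^'n" assume y: "norm y > 2"
    have "(norm y)\<^sup>2 = (y $ k)\<^sup>2 + (norm (perp (axis k 1) y))\<^sup>2"
      using norm_square_perp[of "axis k 1" y] by (simp add: inner_axis)
    moreover have "(norm y)\<^sup>2 > 2\<^sup>2" using y by (intro power_strict_mono) auto
    moreover have "(y $ k)\<^sup>2 <= 1" if "\<bar>y $ k\<bar> <= 1" using that by (simp add: abs_square_le_1)
    moreover have "(norm (perp (axis k 1) y))\<^sup>2 <= 1" if "norm (perp (axis k 1) y) < 1"
      using that by (simp add: abs_square_le_1)
    ultimately show "g (norm (perp (axis k 1) y)) * indicator {..1} \<bar>y $ k\<bar> = 0"
      using bound(2) by (cases "norm (perp (axis k 1) y) < 1") (auto simp: indicator_def)
  qed (use bound in \<open>auto simp: indicator_def\<close>)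
  then have C: "?I 1 = ennreal C" by (simp add: C_def)
  have C0: "0 <= C" by (simp add: C_def)
  have "?N = density lborel (\<lambda>r. ennreal (C * real 1 * (r ^ (1 - 1) * indicator {0<..} r)))"
  proof (rule power_law_measure)
    fix r :: real assume r: "0 < r"
    have "emeasure ?N {..r} = ?I r"
      by (subst nn_integral_indicator[symmetric])
        (simp_all add: nn_integral_distr nn_integral_density del: nn_integral_indicator)
    also have "... = ennreal (\<Prod>i\<in>UNIV. if i = k then r else 1) *
       (NBINT y. g (norm (perp (axis k 1) (\<chi> i. (if i = k then r else 1) * (y::real^'n) $ i))) *
          indicator {..r} \<bar>(\<chi> i. (if i = k then r else 1) * y $ i) $ k\<bar>)"
      by (rule nn_integral_lborel_scale) (use r in auto)
    also have "(\<Prod>i\<in>UNIV. if i = k then r else 1) = r" by simp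
    also have "(NBINT y. g (norm (perp (axis k 1) (\<chi> i. (if i = k then r else 1) * (y::real^'n) $ i))) *
          indicator {..r} \<bar>(\<chi> i. (if i = k then r else 1) * y $ i) $ k\<bar>) = ?I 1"
    proof (rule nn_integral_cong)
      fix y :: "real^'n"
      have "perp (axis k 1) (\<chi> i. (if i = k then r else 1) * y $ i) = perp (axis k 1) y"
        unfolding perp_axis by (simp add: vec_eq_iff)
      then show "g (norm (perp (axis k 1) (\<chi> i. (if i = k then r else 1) * y $ i))) *
          indicator {..r} \<bar>(\<chi> i. (if i = k then r else 1) * y $ i) $ k\<bar>
        = g (norm (perp (axis k 1) y)) * indicator {..1} \<bar>y $ k\<bar>"
        using r by (simp add: indicator_def abs_mult)
    qed
    finally show "emeasure ?N {..r} = ennreal (C * r ^ 1)"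
      using r C0 unfolding C by (simp add: ennreal_mult mult.commute[of "ennreal C"] mult.commute[of C])
  qed (auto simp: C_def)
  then have "(\<integral>\<^sup>+r. f r \<partial>?N) = (NBINT r. ennreal (C * indicator {0<..} r) * f r)"
    by (simp add: nn_integral_density)
  then show ?thesis by (simp add: nn_integral_distr nn_integral_density)
qed

text \<open>The counterpart of \<open>nn_integral_axis_law\<close>: all coordinates except
  \<open>k\<close> are stretched, so the orthogonal part behaves like the norm in dimension
  \<open>CARD('n) - 1\<close>.\<close>

lemma nn_integral_perp_law:
  fixes f g :: "real => ennreal" and k :: "'n::finite"
  assumes [measurable]: "f \<in> borel_fun" "g \<in> borel_fun"
    and bound: "\<And>r. g r <= 1" "\<And>r. r \<ge> 1 ==> g r = 0" and dim: "2 <= CARD('n)"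
  defines "C \<equiv> enn2real (NBINT y. g \<bar>(y::real^'n) $ k\<bar> * indicator {..1} (norm (perp (axis k 1) y)))"
  shows "(NBINT y. g \<bar>(y::real^'n) $ k\<bar> * f (norm (perp (axis k 1) y)))
    = (NBINT r. ennreal (C * real (CARD('n) - 1) * (r ^ (CARD('n) - 2) * indicator {0<..} r)) * f r)"
proof -
  let ?N = "distr (density lborel (\<lambda>y::real^'n. g \<bar>y $ k\<bar>)) borel (\<lambda>y. norm (perp (axis k 1) y))"
  let ?I = "\<lambda>r. (NBINT y. g \<bar>(y::real^'n) $ k\<bar> * indicator {..r} (norm (perp (axis k 1) y)))"
  have "?I 1 < \<infinity>"
  proof (rule cylinder_finite[where B=1 and R=2])
    fix y :: "real^'n" assume y: "norm y > 2"
    have "(norm y)\<^sup>2 = (y $ k)\<^sup>2 + (norm (perp (axis k 1) y))\<^sup>2"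
      using norm_square_perp[of "axis k 1" y] by (simp add: inner_axis)
    moreover have "(norm y)\<^sup>2 > 2\<^sup>2" using y by (intro power_strict_mono) auto
    moreover have "(y $ k)\<^sup>2 <= 1" if "\<bar>y $ k\<bar> < 1" using that by (simp add: abs_square_le_1)
    moreover have "(norm (perp (axis k 1) y))\<^sup>2 <= 1" if "norm (perp (axis k 1) y) <= 1"
      using that by (simp add: abs_square_le_1)
    ultimately show "g \<bar>y $ k\<bar> * indicator {..1} (norm (perp (axis k 1) y)) = 0"
      using bound(2) by (cases "\<bar>y $ k\<bar> < 1") (auto simp: indicator_def)
  qed (use bound in \<open>auto simp: indicator_def\<close>)
  then have C: "?I 1 = ennreal C" by (simp add: C_def)
  have C0: "0 <= C" by (simp add: C_def)
  have "?N = density lborel (\<lambda>r. ennreal (C * real (CARD('n) - 1) * (r ^ (CARD('n) - 1 - 1) * indicator {0<..} r)))"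
  proof (rule power_law_measure)
    fix r :: real assume r: "0 < r"
    have "emeasure ?N {..r} = ?I r"
      by (subst nn_integral_indicator[symmetric])
        (simp_all add: nn_integral_distr nn_integral_density del: nn_integral_indicator)
    also have "... = ennreal (\<Prod>i\<in>UNIV. if i = k then 1 else r) *
       (NBINT y. g \<bar>(\<chi> i. (if i = k then 1 else r) * (y::real^'n) $ i) $ k\<bar> *
          indicator {..r} (norm (perp (axis k 1) (\<chi> i. (if i = k then 1 else r) * y $ i))))"
      by (rule nn_integral_lborel_scale) (use r in auto)
    also have "(\<Prod>i\<in>UNIV. if i = k then 1 else r) = r ^ (CARD('n) - 1)"
      by (simp add: prod.If_cases Compl_eq_Diff_UNIV card_Diff_singleton)
    also have "(NBINT y. g \<bar>(\<chi> i. (if i = k then 1 else r) * (y::real^'n) $ i) $ k\<bar> *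
          indicator {..r} (norm (perp (axis k 1) (\<chi> i. (if i = k then 1 else r) * y $ i)))) = ?I 1"
    proof (rule nn_integral_cong)
      fix y :: "real^'n"
      have "perp (axis k 1) (\<chi> i. (if i = k then 1 else r) * y $ i) = r *\<^sub>R perp (axis k 1) y"
        unfolding perp_axis by (simp add: vec_eq_iff)
      then show "g \<bar>(\<chi> i. (if i = k then 1 else r) * y $ i) $ k\<bar> *
          indicator {..r} (norm (perp (axis k 1) (\<chi> i. (if i = k then 1 else r) * y $ i)))
        = g \<bar>y $ k\<bar> * indicator {..1} (norm (perp (axis k 1) y))"
        using r by (simp add: indicator_def)
    qed
    finally show "emeasure ?N {..r} = ennreal (C * r ^ (CARD('n) - 1))"
      using r C0 unfolding C by (simp add: ennreal_mult mult.commute[of "ennreal C"] mult.commute[of C])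
  qed (use dim in \<open>auto simp: C_def\<close>)
  then have "(\<integral>\<^sup>+r. f r \<partial>?N) = (NBINT r. ennreal (C * real (CARD('n) - 1) * (r ^ (CARD('n) - 2) * indicator {0<..} r)) * f r)"
    by (simp add: nn_integral_density numeral_2_eq_2)
  then show ?thesis by (simp add: nn_integral_distr nn_integral_density)
qed

section \<open>Weights on rectangles\<close>

definition clamp01 :: "real => real" where
  "clamp01 r = max 0 (min r 1)"

text \<open>The power of \<open>r\<close> will absorb the factors of polar coordinates; the square
  makes \<open>bump (2 * n)\<close> the square of the function \<open>side n\<close>.\<close>

definition bump :: "nat => real => real" where
  "bump n r = clamp01 r ^ n * (1 - clamp01 r)\<^sup>2"

lemma clamp01_bounds: "0 <= clamp01 r" "clamp01 r <= 1"
  by (auto simp: clamp01_def)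

lemma clamp01_measurable [measurable]: "clamp01 \<in> borel_fun"
  unfolding clamp01_def by measurable

lemma clamp01_lipschitz: "\<bar>clamp01 a - clamp01 b\<bar> <= \<bar>a - b\<bar>"
  by (auto simp: clamp01_def)

lemma bump_bounds: "0 <= bump n r" "bump n r <= 1"
proof -
  show "0 <= bump n r" using clamp01_bounds by (simp add: bump_def)
  have "clamp01 r ^ n <= 1" "(1 - clamp01 r)\<^sup>2 <= 1"
    using clamp01_bounds[of r] by (auto intro!: power_le_one)
  then show "bump n r <= 1"
    unfolding bump_def using clamp01_bounds[of r] by (intro mult_le_one) auto
qed

lemma bump_eq_0: "1 <= r ==> bump n r = 0"
  by (simp add: bump_def clamp01_def)

lemma bump_measurable [measurable]: "bump n \<in> borel_fun"
  unfolding bump_def by measurable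

text \<open>Trades a power of \<open>r\<close> from polar coordinates against the order of vanishing
  of the profile at 0.\<close>

lemma bump_shift: "0 < r ==> r ^ m * bump n r = bump (m + n) r"
  by (cases "r < 1") (simp_all add: bump_def clamp01_def power_add)

text \<open>For functions bounded by one, the Lipschitz constants of the factors of a product add
  up: \<open>n\<close> from the power and \<open>2\<close> from the square.\<close>

lemma bump_lipschitz: "\<bar>bump n a - bump n b\<bar> <= real (n + 2) * \<bar>a - b\<bar>"
proof -
  let ?x = "clamp01 a" and ?y = "clamp01 b"
  have mult: "\<bar>p * q - p' * q'\<bar> <= \<bar>p - p'\<bar> + \<bar>q - q'\<bar>"
    if "\<bar>p'\<bar> <= 1" "\<bar>q\<bar> <= 1" for p q p' q' :: real
  proof -
    have "p * q - p' * q' = (p - p') * q + p' * (q - q')" by (simp add: algebra_simps)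
    also have "\<bar>...\<bar> <= \<bar>p - p'\<bar> * \<bar>q\<bar> + \<bar>p'\<bar> * \<bar>q - q'\<bar>"
      using abs_triangle_ineq[of "(p - p') * q" "p' * (q - q')"] by (simp only: abs_mult)
    also have "... <= \<bar>p - p'\<bar> * 1 + 1 * \<bar>q - q'\<bar>"
      using that by (intro add_mono mult_mono) auto
    finally show ?thesis by simp
  qed
  have pow: "\<bar>x ^ n - y ^ n\<bar> <= real n * \<bar>x - y\<bar>" if "0 <= x" "x <= 1" "0 <= y" "y <= 1" for x y n
  proof (induction n)
    case (Suc n)
    have "\<bar>x ^ Suc n - y ^ Suc n\<bar> <= \<bar>x - y\<bar> + \<bar>x ^ n - y ^ n\<bar>"
      unfolding power_Suc using that by (intro mult) (auto intro: power_le_one)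
    with Suc show ?case by (simp add: algebra_simps)
  qed simp
  have "\<bar>bump n a - bump n b\<bar> <= \<bar>?x ^ n - ?y ^ n\<bar> + \<bar>(1 - ?x)\<^sup>2 - (1 - ?y)\<^sup>2\<bar>"
    unfolding bump_def using clamp01_bounds[of a] clamp01_bounds[of b]
    by (intro mult) (auto intro: power_le_one)
  also have "... <= real n * \<bar>?x - ?y\<bar> + real 2 * \<bar>(1 - ?x) - (1 - ?y)\<bar>"
    using clamp01_bounds[of a] clamp01_bounds[of b] by (intro add_mono pow) auto
  also have "... = real (n + 2) * \<bar>?x - ?y\<bar>" by (simp add: algebra_simps abs_minus_commute)
  also have "... <= real (n + 2) * \<bar>a - b\<bar>"
    by (intro mult_left_mono clamp01_lipschitz) simp
  finally show ?thesis .
qed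

lemma perp_rotation:
  fixes R :: "real^'n^'n"
  assumes "rotation_matrix R"
  shows "perp (R *v u) (R *v y) = R *v perp u y"
  by (simp add: perp_def rotation_matrix_inner[OF assms] matrix_vector_mult_diff_distrib
      matrix_vector_mult_scaleR)

text \<open>The rectangle with corners \<open>0\<close>, \<open>(y \<bullet> u) *\<^sub>R u\<close>, \<open>perp u y\<close> and \<open>y\<close> receives the weight
  \<open>rect y u\<close>; its first factor is the collision kernel.\<close>

definition rect :: "real^'d => real^'d => real" where
  "rect y u = \<bar>y \<bullet> u\<bar> / 2 * bump (2 * CARD('d)) \<bar>y \<bullet> u\<bar> * bump (2 * CARD('d)) (norm (perp u y))"

lemma rect_measurable [measurable (raw)]:
  assumes [measurable]: "f \<in> borel_measurable M" "g \<in> borel_measurable M"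
  shows "(\<lambda>x. rect (f x) (g x)) \<in> borel_measurable M"
  unfolding rect_def by measurable

lemma rect_rotation:
  "rotation_matrix R ==> rect (R *v y) (R *v u) = rect y u"
  by (simp add: rect_def rotation_matrix_inner perp_rotation rotation_matrix_norm)

lemma half_bump: "0 <= r ==> r / 2 * bump n r = bump (Suc n) r / 2"
  using bump_shift[of r 1 n] by (cases "r = 0") (auto simp: bump_def clamp01_def)

text \<open>The collision kernel raises the order of the first profile by one; in this form the
  weight is visibly bounded and Lipschitz.\<close>

lemma rect_eq:
  fixes y :: "real^'d"
  shows "rect y u = bump (Suc (2 * CARD('d))) \<bar>y \<bullet> u\<bar> / 2 * bump (2 * CARD('d)) (norm (perp u y))"
  unfolding rect_def by (subst half_bump) simp_all

lemma rect_bounds: "0 <= rect y u" "rect y u <= 1"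
proof -
  show "0 <= rect y u" by (simp add: rect_eq bump_bounds)
  have "bump (Suc (2 * CARD('a))) \<bar>y \<bullet> u\<bar> / 2 <= 1"
    using bump_bounds(2)[of "Suc (2 * CARD('a))" "\<bar>y \<bullet> u\<bar>"] by simp
  then show "rect y u <= 1"
    unfolding rect_eq using bump_bounds by (intro mult_le_one) auto
qed

lemma rect_eq_0:
  assumes "norm u = 1" "norm y > 2"
  shows "rect y u = 0"
proof (rule ccontr)
  assume nz: "rect y u ~= 0"
  have "\<not> 1 <= \<bar>y \<bullet> u\<bar>" "\<not> 1 <= norm (perp u y)"
    using nz by (auto simp: rect_eq bump_eq_0)
  then have "(y \<bullet> u)\<^sup>2 <= 1" "(norm (perp u y))\<^sup>2 <= 1"
    by (simp_all add: abs_square_le_1)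
  moreover have "(norm y)\<^sup>2 > 2\<^sup>2" using assms by (intro power_strict_mono) auto
  ultimately show False using norm_square_perp[OF assms(1), of y] by simp
qed

section \<open>Laws of the corners of a random rectangle\<close>

context sphere_measure
begin

lemma nn_integral_sphere_rotation:
  assumes R: "rotation_matrix R" and [measurable]: "case_prod G \<in> borel_measurable (borel \<Otimes>\<^sub>M borel)"
  shows "(NSINT u. (NBINT y. G (R *v u) (R *v y))) = (NSINT u. (NBINT y. G u y))"
proof -
  have "(NSINT u. (NBINT y. G (R *v u) (R *v y))) = (NSINT u. (NBINT y. G (R *v u) y))"
    by (intro nn_integral_cong nn_integral_lborel_orthogonal[OF rotation_matrix_orthogonal[OF R]])
      measurable
  also have "... = (NSINT u. (NBINT y. G u y))"
    by (rule nn_integral_rotation[OF rotation_s R sets_s]) measurable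
  finally show ?thesis .
qed

text \<open>Rotating \<open>axis k 1\<close> to \<open>u\<close> shows that the inner integral is
  the same for every unit vector \<open>u\<close>, so that only the total mass of \<open>s\<close>
  remains.\<close>

lemma nn_integral_sphere_radial:
  assumes [measurable]: "case_prod G \<in> borel_measurable (borel \<Otimes>\<^sub>M borel)"
  shows "(NSINT u. (NBINT y. G \<bar>y \<bullet> u\<bar> (norm (perp u y))))
    = emeasure s UNIV * (NBINT y. G \<bar>(y::real^'d) $ k\<bar> (norm (perp (axis k 1) y)))"
proof -
  let ?c = "(NBINT y. G \<bar>(y::real^'d) $ k\<bar> (norm (perp (axis k 1) y)))"
  have "(NSINT u. (NBINT y. G \<bar>y \<bullet> u\<bar> (norm (perp u y)))) = (NSINT u. ?c)"
  proof (rule nn_integral_cong_AE, use norm_s in eventually_elim)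
    fix u :: "real^'d" assume "norm u = 1"
    then obtain R where R: "rotation_matrix R" "R *v axis k 1 = u"
      using rotation_matrix_exists[OF dim, of "axis k 1" u] by auto
    have "(NBINT y. G \<bar>y \<bullet> u\<bar> (norm (perp u y)))
        = (NBINT y. G \<bar>(R *v y) \<bullet> u\<bar> (norm (perp u (R *v y))))"
      by (intro nn_integral_lborel_orthogonal[OF rotation_matrix_orthogonal[OF R(1)], symmetric])
        measurable
    also have "... = ?c"
    proof (rule nn_integral_cong)
      fix y :: "real^'d"
      have "(R *v y) \<bullet> u = y $ k" "norm (perp u (R *v y)) = norm (perp (axis k 1) y)"
        using rotation_matrix_inner[OF R(1), of y "axis k 1"] perp_rotation[OF R(1), of "axis k 1" y]
        by (simp_all add: R inner_axis rotation_matrix_norm[OF R(1)])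
      then show "G \<bar>(R *v y) \<bullet> u\<bar> (norm (perp u (R *v y))) = G \<bar>y $ k\<bar> (norm (perp (axis k 1) y))"
        by simp
    qed
    finally show "(NBINT y. G \<bar>y \<bullet> u\<bar> (norm (perp u y))) = ?c" .
  qed
  then show ?thesis by (simp add: sets_eq_imp_space_eq[OF sets_s] mult.commute)
qed

lemma emeasure_s_finite: "emeasure s UNIV < top"
  using emeasure_finite[of UNIV] unfolding infinity_ennreal_def less_top .

lemma rect_finite: "(NSINT u. (NBINT y. ennreal (rect y u))) < \<infinity>"
proof -
  have "(NSINT u. (NBINT y. ennreal (rect y u)))
      <= (NSINT u. (NBINT y. indicator (cball (0::real^'d) 2) y))"
    by (intro nn_integral_mono_AE, use norm_s in eventually_elim)
      (intro nn_integral_mono, auto simp: indicator_def rect_bounds rect_eq_0 not_le)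
  also have "... = emeasure lborel (cball (0::real^'d) 2) * emeasure s UNIV"
    by (simp add: sets_eq_imp_space_eq[OF sets_s])
  also have "... < \<infinity>"
    using emeasure_lborel_cball_finite[of "0::real^'d" 2] emeasure_s_finite
    by (simp add: ennreal_mult_less_top)
  finally show ?thesis .
qed

lemma radial_density:
  fixes n :: nat
  assumes c: "0 <= c"
  defines "N \<equiv> density lborel (\<lambda>x::real^'d. ennreal (c * bump n (norm x)))"
  shows "finite_measure N" "rotation_invariant N"
proof -
  have "(NBINT x. ennreal (c * bump n (norm (x::real^'d)))) < \<infinity>"
    by (rule cylinder_finite[where B=c and R=1])
      (use c bump_bounds in \<open>auto simp: bump_eq_0 mult_left_le intro!: ennreal_leI\<close>)
  then show "finite_measure N"
    by (intro finite_measureI) (simp add: N_def emeasure_density)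
  show "rotation_invariant N"
    unfolding rotation_invariant_def
  proof (intro allI impI)
    fix R :: "real^'d^'d" assume R: "rotation_matrix R"
    show "distr N borel ((*v) R) = N"
    proof (rule measure_eqI)
      fix A :: "(real^'d) set" assume "A \<in> sets (distr N borel ((*v) R))"
      then have [measurable]: "A \<in> sets borel" by simp
      have "emeasure (distr N borel ((*v) R)) A = (\<integral>\<^sup>+x. indicator A x \<partial>distr N borel ((*v) R))"
        by simp
      also have "... = (NBINT x. ennreal (c * bump n (norm x)) * indicator A (R *v x))"
        by (simp add: N_def nn_integral_distr nn_integral_density del: nn_integral_indicator)
      also have "... = (NBINT x. ennreal (c * bump n (norm (R *v x))) * indicator A (R *v x))"
        by (simp add: rotation_matrix_norm[OF R])
      also have "... = (NBINT x. ennreal (c * bump n (norm x)) * indicator A x)"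
        by (rule nn_integral_lborel_orthogonal[OF rotation_matrix_orthogonal[OF R]]) measurable
      also have "... = emeasure N A" by (simp add: N_def emeasure_density)
      finally show "emeasure (distr N borel ((*v) R)) A = emeasure N A" .
    qed (simp add: N_def)
  qed
qed

text \<open>An equivariant corner map sends the rectangle weights to a rotation invariant measure,
  and \<open>rotation_invariant_eqI\<close> then asks only for the law of the norm. This reduces
  densities on the whole space to one-dimensional integrals.\<close>

lemma radial_law:
  fixes H :: "real^'d => real^'d => real^'d"
  assumes [measurable]: "case_prod H \<in> borel_measurable (borel \<Otimes>\<^sub>M borel)"
    and equivariant: "\<And>R u y. rotation_matrix R ==> H (R *v u) (R *v y) = R *v H u y"
    and c: "0 <= c"
    and norm_law: "\<And>I. I \<in> sets borel ==>
      (NSINT u. (NBINT y. ennreal (rect y u) * indicator I (norm (H u y))))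
      = (NBINT x. ennreal (c * bump n (norm (x::real^'d))) * indicator I (norm x))"
    and [measurable]: "F \<in> borel_fun"
  shows "(NSINT u. (NBINT y. ennreal (rect y u) * F (H u y)))
      = (NBINT x. ennreal (c * bump n (norm x)) * F x)"
proof -
  interpret pair_sigma_finite s lborel ..
  define M where "M = distr (density (s \<Otimes>\<^sub>M lborel) (\<lambda>p. ennreal (rect (snd p) (fst p)))) borel (case_prod H)"
  define N where "N = density lborel (\<lambda>x::real^'d. ennreal (c * bump n (norm x)))"
  have M: "(\<integral>\<^sup>+x. F x \<partial>M) = (NSINT u. (NBINT y. ennreal (rect y u) * F (H u y)))"
    if [measurable]: "F \<in> borel_fun" for F
  proof -
    have "(\<integral>\<^sup>+x. F x \<partial>M) = (\<integral>\<^sup>+p. ennreal (rect (snd p) (fst p)) * F (case_prod H p) \<partial>(s \<Otimes>\<^sub>M lborel))"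
      unfolding M_def by (simp add: nn_integral_distr nn_integral_density)
    also have "... = (NSINT u. (NBINT y. ennreal (rect y u) * F (H u y)))"
      by (subst lborel.nn_integral_fst[symmetric]) simp_all
    finally show ?thesis .
  qed
  have em: "emeasure M A = (NSINT u. (NBINT y. ennreal (rect y u) * indicator A (H u y)))"
    if [measurable]: "A \<in> sets borel" for A
    using M[of "indicator A"] that by (simp add: M_def)
  have "M = N"
  proof (rule rotation_invariant_eqI[where r=1])
    show "finite_measure M"
    proof (rule finite_measureI)
      have "emeasure M UNIV = (NSINT u. (NBINT y. ennreal (rect y u)))"
        by (subst em) simp_all
      then show "emeasure M (space M) ~= \<infinity>" using rect_finite by (simp add: M_def)
    qed
    show "rotation_invariant M"
      unfolding rotation_invariant_def
    proof (intro allI impI)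
      fix R :: "real^'d^'d" assume R: "rotation_matrix R"
      show "distr M borel ((*v) R) = M"
      proof (rule measure_eqI)
        fix A :: "(real^'d) set" assume "A \<in> sets (distr M borel ((*v) R))"
        then have [measurable]: "A \<in> sets borel" by simp
        have "emeasure (distr M borel ((*v) R)) A = (\<integral>\<^sup>+x. indicator A x \<partial>distr M borel ((*v) R))"
          by simp
        also have "... = (\<integral>\<^sup>+x. indicator A (R *v x) \<partial>M)"
          by (rule nn_integral_distr) (simp_all add: M_def)
        also have "... = (NSINT u. (NBINT y. ennreal (rect y u) * indicator A (R *v H u y)))"
          by (subst M) simp_all
        also have "... = (NSINT u. (NBINT y. ennreal (rect (R *v y) (R *v u)) * indicator A (H (R *v u) (R *v y))))"
          by (simp add: equivariant[OF R] rect_rotation[OF R])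
        also have "... = (NSINT u. (NBINT y. ennreal (rect y u) * indicator A (H u y)))"
          by (rule nn_integral_sphere_rotation[OF R,
                where G="\<lambda>u y. ennreal (rect y u) * indicator A (H u y)"]) measurable
        also have "... = emeasure M A" by (rule em[symmetric]) measurable
        finally show "emeasure (distr M borel ((*v) R)) A = emeasure M A" .
      qed (simp add: M_def)
    qed
    show "finite_measure N" "rotation_invariant N" unfolding N_def by (rule radial_density[OF c])+
    have "norm x <= 1" if "0 < c * bump n (norm x)" for x :: "real^'d"
      using that bump_eq_0[of "norm x" n] by (cases "norm x <= 1") auto
    then show "AE x in N. norm x <= 1" unfolding N_def by (subst AE_density) auto
    fix I :: "real set" assume [measurable]: "I \<in> sets borel"
    have "{x::real^'d. norm x \<in> I} \<in> sets borel" by measurable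
    moreover have "emeasure N {x. norm x \<in> I} = (NBINT x. ennreal (c * bump n (norm (x::real^'d))) * indicator I (norm x))"
      unfolding N_def by (subst emeasure_density) (auto intro!: nn_integral_cong simp: indicator_def)
    moreover have "emeasure M {x. norm x \<in> I} = (NSINT u. (NBINT y. ennreal (rect y u) * indicator I (norm (H u y))))"
      by (subst em) (simp_all add: indicator_def)
    ultimately show "emeasure M {x. norm x \<in> I} = emeasure N {x. norm x \<in> I}"
      using norm_law[of I] by simp
  qed (simp_all add: M_def N_def)
  then show ?thesis
    using M[of F] by (simp add: N_def nn_integral_density)
qed

text \<open>In dimension \<open>d\<close> the norm of this corner has a density proportional to
  \<open>bump (2 * d + 1)\<close>; dividing by the factor \<open>r ^ (d - 1)\<close> of Lebesgue
  measure leaves the order \<open>d + 2\<close>. The order \<open>2 * d\<close> in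
  \<open>rect\<close> is what keeps the result regular at 0.\<close>

lemma par_law:
  obtains c where "0 <= c" "\<And>F. F \<in> borel_fun ==>
    (NSINT u. (NBINT y. ennreal (rect y u) * F ((y \<bullet> u) *\<^sub>R u)))
      = (NBINT x. ennreal (c * bump (CARD('d) + 2) (norm x)) * F x)"
proof -
  obtain k :: 'd where True by simp
  let ?d = "CARD('d)"
  let ?g = "\<lambda>r. ennreal (bump (2 * ?d) r)"
  define C where "C = enn2real (NBINT y. ?g (norm (perp (axis k 1) (y::real^'d))) * indicator {..1} \<bar>y $ k\<bar>)"
  define S where "S = measure s UNIV"
  have S: "emeasure s UNIV = ennreal S" "0 <= S" by (simp_all add: S_def emeasure_eq_measure)
  define V where "V = unit_ball_vol ?d * ?d"
  have V: "V > 0" by (simp add: V_def)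
  \<comment> \<open>Mass of \<open>s\<close> times the constant of
    \<open>nn_integral_axis_law\<close>, over the area \<open>V\<close> of the unit sphere; the
    \<open>2\<close> is that of the collision kernel.\<close>
  define c where "c = S * C / (2 * V)"
  have c: "0 <= c" using V S by (simp add: c_def C_def)
  have "(NSINT u. (NBINT y. ennreal (rect y u) * F ((y \<bullet> u) *\<^sub>R u)))
      = (NBINT x. ennreal (c * bump (CARD('d) + 2) (norm x)) * F x)"
    if F: "F \<in> borel_fun" for F
  proof (rule radial_law[OF _ _ c _ F])
    fix I :: "real set" assume [measurable]: "I \<in> sets borel"
    let ?f = "\<lambda>r. ennreal (bump (Suc (2 * ?d)) r / 2) * indicator I r"
    have "(NSINT u. (NBINT y. ennreal (rect y u) * indicator I (norm ((y \<bullet> u) *\<^sub>R u))))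
        = (NSINT u. (NBINT y. ?g (norm (perp u y)) * ?f \<bar>y \<bullet> u\<bar>))"
    proof (rule nn_integral_cong_AE, use norm_s in eventually_elim)
      fix u :: "real^'d" assume "norm u = 1"
      then have "norm ((y \<bullet> u) *\<^sub>R u) = \<bar>y \<bullet> u\<bar>" for y by simp
      moreover have "ennreal (rect y u)
          = ?g (norm (perp u y)) * ennreal (bump (Suc (2 * ?d)) \<bar>y \<bullet> u\<bar> / 2)" for y
        unfolding rect_eq by (subst ennreal_mult[symmetric]) (simp_all add: bump_bounds mult.commute)
      ultimately show "(NBINT y. ennreal (rect y u) * indicator I (norm ((y \<bullet> u) *\<^sub>R u)))
          = (NBINT y. ?g (norm (perp u y)) * ?f \<bar>y \<bullet> u\<bar>)"
        by (simp only: mult.assoc)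
    qed
    also have "... = ennreal S * (NBINT y. ?g (norm (perp (axis k 1) (y::real^'d))) * ?f \<bar>y $ k\<bar>)"
      unfolding S(1)[symmetric]
      by (rule nn_integral_sphere_radial[where G="\<lambda>a b. ?g b * ?f a"]) measurable
    also have "(NBINT y. ?g (norm (perp (axis k 1) (y::real^'d))) * ?f \<bar>y $ k\<bar>)
        = (NBINT r. ennreal (C * indicator {0<..} r) * ?f r)"
      unfolding C_def by (rule nn_integral_axis_law) (auto simp: bump_bounds bump_eq_0)
    also have "ennreal S * ... = (NBINT r. ennreal S * (ennreal (C * indicator {0<..} r) * ?f r))"
      by (rule nn_integral_cmult[symmetric]) measurable
    also have "... = (NBINT r. ennreal (V * (r ^ (?d - 1) * indicator {0<..} r)) *
        (ennreal (c * bump (?d + 2) r) * indicator I r))"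
    proof (rule nn_integral_cong)
      fix r :: real
      show "ennreal S * (ennreal (C * indicator {0<..} r) * ?f r)
        = ennreal (V * (r ^ (?d - 1) * indicator {0<..} r)) * (ennreal (c * bump (?d + 2) r) * indicator I r)"
      proof (cases "0 < r")
        case True
        have "r ^ (?d - 1) * bump (?d + 2) r = bump (Suc (2 * ?d)) r"
          using bump_shift[OF True, of "?d - 1" "?d + 2"] dim by (simp add: Suc_diff_le mult_2)
        then have "S * (C * (bump (Suc (2 * ?d)) r / 2)) = V * r ^ (?d - 1) * (c * bump (?d + 2) r)"
          using V by (simp add: c_def field_simps)
        then show ?thesis
          using True V c S by (simp add: indicator_def ennreal_mult[symmetric] bump_bounds C_def)
      qed simp
    qed
    also have "... = (NBINT x. ennreal (c * bump (?d + 2) (norm (x::real^'d))) * indicator I (norm x))"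
      unfolding V_def by (rule nn_integral_lborel_norm[symmetric]) measurable
    finally show "(NSINT u. (NBINT y. ennreal (rect y u) * indicator I (norm ((y \<bullet> u) *\<^sub>R u))))
      = (NBINT x. ennreal (c * bump (?d + 2) (norm (x::real^'d))) * indicator I (norm x))" .
  qed (simp_all add: rotation_matrix_inner matrix_vector_mult_scaleR)
  then show ?thesis using c that by blast
qed

text \<open>The orthogonal part lives in a hyperplane, so in dimension \<open>d\<close> its norm has
  a density proportional to \<open>r ^ (d - 2) * bump (2 * d) r\<close>. Dividing by
  \<open>r ^ (d - 1)\<close> costs one order.\<close>

lemma perp_law:
  obtains c where "0 <= c" "\<And>F. F \<in> borel_fun ==>
    (NSINT u. (NBINT y. ennreal (rect y u) * F (perp u y)))
      = (NBINT x. ennreal (c * bump (2 * CARD('d) - 1) (norm x)) * F x)"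
proof -
  obtain k :: 'd where True by simp
  let ?d = "CARD('d)"
  let ?g = "\<lambda>r. ennreal (bump (Suc (2 * ?d)) r / 2)"
  define C where "C = enn2real (NBINT y. ?g \<bar>(y::real^'d) $ k\<bar> * indicator {..1} (norm (perp (axis k 1) y)))"
  define S where "S = measure s UNIV"
  have S: "emeasure s UNIV = ennreal S" "0 <= S" by (simp_all add: S_def emeasure_eq_measure)
  define V where "V = unit_ball_vol ?d * ?d"
  have V: "V > 0" by (simp add: V_def)
  define c where "c = S * C * real (?d - 1) / V"
  have c: "0 <= c" using V S by (simp add: c_def C_def)
  have "(NSINT u. (NBINT y. ennreal (rect y u) * F (perp u y)))
      = (NBINT x. ennreal (c * bump (2 * CARD('d) - 1) (norm x)) * F x)"
    if F: "F \<in> borel_fun" for F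
  proof (rule radial_law[OF _ _ c _ F])
    fix I :: "real set" assume [measurable]: "I \<in> sets borel"
    let ?f = "\<lambda>r. ennreal (bump (2 * ?d) r) * indicator I r"
    have "(NSINT u. (NBINT y. ennreal (rect y u) * indicator I (norm (perp u y))))
        = (NSINT u. (NBINT y. ?g \<bar>y \<bullet> u\<bar> * ?f (norm (perp u y))))"
    proof (intro nn_integral_cong)
      fix u y :: "real^'d"
      have "ennreal (rect y u) = ?g \<bar>y \<bullet> u\<bar> * ennreal (bump (2 * ?d) (norm (perp u y)))"
        unfolding rect_eq by (subst ennreal_mult[symmetric]) (simp_all add: bump_bounds)
      then show "ennreal (rect y u) * indicator I (norm (perp u y)) = ?g \<bar>y \<bullet> u\<bar> * ?f (norm (perp u y))"
        by (simp only: mult.assoc)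
    qed
    also have "... = ennreal S * (NBINT y. ?g \<bar>(y::real^'d) $ k\<bar> * ?f (norm (perp (axis k 1) y)))"
      unfolding S(1)[symmetric]
      by (rule nn_integral_sphere_radial[where G="\<lambda>a b. ?g a * ?f b"]) measurable
    also have "(NBINT y. ?g \<bar>(y::real^'d) $ k\<bar> * ?f (norm (perp (axis k 1) y)))
        = (NBINT r. ennreal (C * real (?d - 1) * (r ^ (?d - 2) * indicator {0<..} r)) * ?f r)"
      unfolding C_def
    proof (rule nn_integral_perp_law)
      show "?g r <= 1" for r
        using bump_bounds(2)[of "Suc (2 * ?d)" r] by (simp add: ennreal_le_1)
    qed (use dim in \<open>auto simp: bump_eq_0\<close>)
    also have "ennreal S * ... = (NBINT r. ennreal S * (ennreal (C * real (?d - 1) * (r ^ (?d - 2) * indicator {0<..} r)) * ?f r))"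
      by (rule nn_integral_cmult[symmetric]) measurable
    also have "... = (NBINT r. ennreal (V * (r ^ (?d - 1) * indicator {0<..} r)) *
        (ennreal (c * bump (2 * ?d - 1) r) * indicator I r))"
    proof (rule nn_integral_cong)
      fix r :: real
      show "ennreal S * (ennreal (C * real (?d - 1) * (r ^ (?d - 2) * indicator {0<..} r)) * ?f r)
        = ennreal (V * (r ^ (?d - 1) * indicator {0<..} r)) * (ennreal (c * bump (2 * ?d - 1) r) * indicator I r)"
      proof (cases "0 < r")
        case True
        have "r ^ (?d - 1) * bump (2 * ?d - 1) r = r ^ (?d - 2) * bump (2 * ?d) r"
          using bump_shift[OF True] dim by (simp add: numeral_2_eq_2)
        then have "S * (C * real (?d - 1) * r ^ (?d - 2) * bump (2 * ?d) r) = V * r ^ (?d - 1) * (c * bump (2 * ?d - 1) r)"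
          using V by (simp add: c_def field_simps)
        then show ?thesis
          using True V c S by (simp add: indicator_def ennreal_mult[symmetric] bump_bounds C_def)
      qed simp
    qed
    also have "... = (NBINT x. ennreal (c * bump (2 * ?d - 1) (norm (x::real^'d))) * indicator I (norm x))"
      unfolding V_def by (rule nn_integral_lborel_norm[symmetric]) measurable
    finally show "(NSINT u. (NBINT y. ennreal (rect y u) * indicator I (norm (perp u y))))
      = (NBINT x. ennreal (c * bump (2 * ?d - 1) (norm (x::real^'d))) * indicator I (norm x))" .
  qed (simp_all add: perp_rotation)
  then show ?thesis using c that by blast
qed

end

lemma nn_integral_lborel_scaleR:
  fixes F :: "real^'n => ennreal"
  assumes [measurable]: "F \<in> borel_fun" and r: "0 < r"
  shows "(NBINT x. F x) = (NBINT x. ennreal (r ^ CARD('n)) * F (r *\<^sub>R x))"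
proof -
  have "(\<chi> i. r * x $ i) = r *\<^sub>R x" for x :: "real^'n" by (simp add: vec_eq_iff)
  then show ?thesis
    using nn_integral_lborel_scale[of F "\<lambda>_. r"] r by (simp add: nn_integral_cmult)
qed

lemma nn_integral_lborel_shift:
  fixes F :: "'a::euclidean_space => ennreal"
  assumes [measurable]: "F \<in> borel_fun"
  shows "(NBINT x. F (c + x)) = (NBINT x. F x)"
proof -
  have "(NBINT x. F x) = (\<integral>\<^sup>+x. F x \<partial>distr lborel borel ((+) c))"
    by (simp add: lborel_distr_plus)
  then show ?thesis by (simp add: nn_integral_distr)
qed

lemma kernel_B_measurable [measurable (raw)]:
  assumes [measurable]: "f \<in> borel_measurable M" "g \<in> borel_measurable M"
  shows "(\<lambda>x. kernel_B (f x) (g x)) \<in> borel_measurable M"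
  unfolding kernel_B_def by measurable

lemma post_velocities_measurable [measurable (raw)]:
  assumes [measurable]: "f \<in> borel_measurable M" "g \<in> borel_measurable M" "h \<in> borel_measurable M"
  shows "(\<lambda>x. post_velocities (f x) (g x) (h x)) \<in> borel_measurable M"
  unfolding post_velocities_def by measurable

text \<open>The two factors contribute \<open>2 * d + 3\<close> and \<open>2 * (2 * d + 2)\<close>,
  the latter because projecting off \<open>u\<close> is estimated by the factor 2; the sum is at
  most \<open>8 * d + 8\<close>.\<close>

lemma rect_lipschitz:
  fixes y :: "real^'d"
  assumes "norm u = 1"
  shows "\<bar>rect y u - rect z u\<bar> <= real (8 * CARD('d) + 8) * norm (y - z)"
proof -
  let ?n = "2 * CARD('d)"
  let ?a = "bump (Suc ?n) \<bar>y \<bullet> u\<bar> / 2" and ?a' = "bump (Suc ?n) \<bar>z \<bullet> u\<bar> / 2"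
  let ?b = "bump ?n (norm (perp u y))" and ?b' = "bump ?n (norm (perp u z))"
  have par: "\<bar>y \<bullet> u - z \<bullet> u\<bar> <= norm (y - z)"
    using Cauchy_Schwarz_ineq2[of "y - z" u] assms by (simp add: inner_diff_left)
  have "perp u y - perp u z = (y - z) - ((y - z) \<bullet> u) *\<^sub>R u"
    by (simp add: perp_def inner_diff_left algebra_simps)
  then have "norm (perp u y - perp u z) <= norm (y - z) + \<bar>(y - z) \<bullet> u\<bar>"
    using norm_triangle_ineq4[of "y - z" "((y - z) \<bullet> u) *\<^sub>R u"] assms by simp
  then have perp: "norm (perp u y - perp u z) <= 2 * norm (y - z)"
    using par by (simp add: inner_diff_left)
  have A: "\<bar>?a - ?a'\<bar> <= real (?n + 3) * norm (y - z)"
  proof -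
    have "\<bar>bump (Suc ?n) \<bar>y \<bullet> u\<bar> - bump (Suc ?n) \<bar>z \<bullet> u\<bar>\<bar> <= real (Suc ?n + 2) * \<bar>\<bar>y \<bullet> u\<bar> - \<bar>z \<bullet> u\<bar>\<bar>"
      by (rule bump_lipschitz)
    also have "... <= real (Suc ?n + 2) * norm (y - z)"
      using par by (intro mult_left_mono) auto
    finally show ?thesis by (simp add: algebra_simps)
  qed
  have B: "\<bar>?b - ?b'\<bar> <= real (?n + 2) * (2 * norm (y - z))"
  proof -
    have "\<bar>?b - ?b'\<bar> <= real (?n + 2) * \<bar>norm (perp u y) - norm (perp u z)\<bar>"
      by (rule bump_lipschitz)
    also have "... <= real (?n + 2) * (2 * norm (y - z))"
      using perp norm_triangle_ineq3[of "perp u y" "perp u z"] by (intro mult_left_mono) auto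
    finally show ?thesis .
  qed
  have "rect y u - rect z u = (?a - ?a') * ?b + ?a' * (?b - ?b')"
    unfolding rect_eq by (simp add: algebra_simps)
  also have "\<bar>...\<bar> <= \<bar>?a - ?a'\<bar> * \<bar>?b\<bar> + \<bar>?a'\<bar> * \<bar>?b - ?b'\<bar>"
    using abs_triangle_ineq[of "(?a - ?a') * ?b" "?a' * (?b - ?b')"] by (simp only: abs_mult)
  also have "... <= \<bar>?a - ?a'\<bar> * 1 + 1 * \<bar>?b - ?b'\<bar>"
    using bump_bounds[of "Suc ?n" "\<bar>z \<bullet> u\<bar>"] bump_bounds[of ?n "norm (perp u y)"]
    by (intro add_mono mult_left_mono mult_right_mono) auto
  also have "... <= real (8 * CARD('d) + 8) * norm (y - z)"
  proof -
    define N where "N = norm (y - z)"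
    define P where "P = real CARD('d) * N"
    have "0 <= N" "0 <= P" by (simp_all add: N_def P_def)
    moreover have "real (?n + 3) * N = 2 * P + 3 * N" "real (?n + 2) * (2 * N) = 4 * P + 4 * N"
      "real (8 * CARD('d) + 8) * N = 8 * P + 8 * N"
      by (simp_all add: P_def algebra_simps)
    ultimately show ?thesis using A B unfolding N_def[symmetric] mult_1_left mult_1_right by linarith
  qed
  finally show ?thesis .
qed

text \<open>The square root of \<open>bump (2 * n)\<close>. Each side length of a rectangle occurs
  twice among its four sides, so a product of \<open>side\<close> over the sides produces
  \<open>bump\<close> of both lengths.\<close>

definition side :: "nat => real => real" where
  "side n r = clamp01 r ^ n * (1 - clamp01 r)"

lemma side_square: "side n r * side n r = bump (2 * n) r"
  by (simp add: side_def bump_def power2_eq_square power_mult_distrib mult_2 power_add)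

lemma side_bounds: "0 <= side n r" "side n r <= 1"
proof -
  show "0 <= side n r" using clamp01_bounds by (simp add: side_def)
  have "clamp01 r ^ n <= 1" using clamp01_bounds[of r] by (intro power_le_one)
  then show "side n r <= 1"
    unfolding side_def using clamp01_bounds[of r] by (intro mult_le_one) auto
qed

lemma side_eq_0: "1 <= r ==> side n r = 0"
  by (simp add: side_def clamp01_def)

lemma side_measurable [measurable]: "side n \<in> borel_fun"
  unfolding side_def by measurable

lemma AE_nonzero_ex:
  assumes "AE x in M. P x" "emeasure M (space M) ~= 0"
  shows "\<exists>x. P x"
proof (rule ccontr)
  assume "\<not> (\<exists>x. P x)"
  then have "AE x in M. False" using assms(1) by simp
  then show False using assms(2) AE_iff_measurable[of "space M" M "\<lambda>_. False"] by simp
qed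

section \<open>The collision measure and the weights of rectangles\<close>

context sphere_measure
begin

definition rect_mass :: real where
  "rect_mass = enn2real (NSINT u. (NBINT y. ennreal (rect y u)))"

lemma rect_mass_eq: "(NSINT u. (NBINT y. ennreal (rect y u))) = ennreal rect_mass"
  using rect_finite by (simp add: rect_mass_def)

text \<open>For a single unit vector \<open>u\<close> the weight is nonzero on a nonempty open set.
  The witness needs a direction orthogonal to \<open>u\<close>, which exists as the dimension is at
  least two.\<close>

lemma rect_mass_pos: "0 < rect_mass"
proof (rule ccontr)
  assume "\<not> 0 < rect_mass"
  then have "(NSINT u. (NBINT y. ennreal (rect y u))) = 0"
    unfolding rect_mass_eq by (simp add: rect_mass_def ennreal_eq_0_iff)
  then have "AE u in s. (NBINT y. ennreal (rect y u)) = 0"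
    by (subst (asm) nn_integral_0_iff_AE) measurable
  with norm_s have "AE u in s. norm u = 1 \<and> (NBINT y. ennreal (rect y u)) = 0"
    by eventually_elim simp
  moreover have "emeasure s (space s) ~= 0"
    using nonzero_s by (simp add: sets_eq_imp_space_eq[OF sets_s])
  ultimately have "\<exists>u::real^'d. norm u = 1 \<and> (NBINT y. ennreal (rect y u)) = 0"
    using AE_nonzero_ex[of "\<lambda>u. norm u = 1 \<and> (NBINT y. ennreal (rect y u)) = 0" s] by simp
  then obtain u where u: "norm (u::real^'d) = 1" "(NBINT y. ennreal (rect y u)) = 0"
    by (elim exE conjE)
  obtain \<eta> where \<eta>: "\<eta> ~= 0" "orthogonal u \<eta>"
    using vector_in_orthogonal_basis[of u] orthogonal_to_vector_exists[of u] dim by auto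
  \<comment> \<open>Component \<open>1/2\<close> along \<open>u\<close> and an orthogonal part of
    length \<open>1/2\<close>: both profiles are positive there.\<close>
  define x where "x = (1/2) *\<^sub>R u + (1 / (2 * norm \<eta>)) *\<^sub>R \<eta>"
  have x1: "x \<bullet> u = 1/2"
    using u \<eta> by (simp add: x_def inner_add_left inner_add_right orthogonal_def inner_commute dot_square_norm)
  have x2: "norm (perp u x) = 1/2"
    using \<eta> by (simp add: perp_def x1) (simp add: x_def)
  define U where "U = {y. 0 < \<bar>y \<bullet> u\<bar> \<and> \<bar>y \<bullet> u\<bar> < 1 \<and> 0 < norm (perp u y) \<and> norm (perp u y) < 1}"
  have "open U"
    unfolding U_def perp_def by (intro open_Collect_conj open_Collect_less continuous_intros)
  moreover have "x \<in> U" unfolding U_def mem_Collect_eq x1 x2 by simp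
  ultimately have "\<not> negligible U" using open_not_negligible by blast
  have "AE y in lborel. rect y u = 0"
  proof -
    have "AE y in lborel. ennreal (rect y u) = 0"
      using u(2) by (subst (asm) nn_integral_0_iff_AE) measurable
    then show ?thesis by eventually_elim (use rect_bounds(1)[of _ u] in \<open>simp add: ennreal_eq_0_iff antisym\<close>)
  qed
  moreover have "rect y u ~= 0" if "y \<in> U" for y
    using that by (auto simp: rect_def U_def bump_def clamp01_def min_def max_def split: if_splits)
  ultimately have "AE y in lborel. y \<notin> U" by (auto elim!: eventually_mono)
  then have "AE y in lebesgue. y \<notin> U" by (rule AE_completion)
  then have "negligible U" by (simp add: negligible_iff_null_sets AE_iff_null_sets[symmetric] \<open>open U\<close>)
  with \<open>\<not> negligible U\<close> show False by simp
qed

text \<open>The reference measure for fluxes, Lebesgue in both incoming velocities. Up to the factor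
  \<open>1/2\<close> and the labelling of the outgoing pair, the flux produced by a velocity density
  \<open>f\<close> has density \<open>f v * f w\<close> relative to it, while \<open>coll\<close>
  itself is invariant under reversing collisions.\<close>

definition coll :: "((real^'d) \<times> (real^'d) \<times> (real^'d) \<times> (real^'d)) measure" where
  "coll = distr (density (lborel \<Otimes>\<^sub>M (lborel \<Otimes>\<^sub>M s)) (\<lambda>p. ennreal (kernel_B (fst p - fst (snd p)) (snd (snd p)))))
     borel (\<lambda>p. (fst p, fst (snd p), post_velocities (fst p) (fst (snd p)) (snd (snd p))))"

abbreviation (input) nn_coll :: "((real^'d) \<times> (real^'d) \<times> (real^'d) \<times> (real^'d) => ennreal) => ennreal" (binder "NCINT " 10) where
  "nn_coll f == \<integral>\<^sup>+c. f c \<partial>coll"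

abbreviation (input) integral_coll :: "((real^'d) \<times> (real^'d) \<times> (real^'d) \<times> (real^'d) => real) => real" (binder "LCINT " 10) where
  "integral_coll f == \<integral>c. f c \<partial>coll"

lemma sets_coll [measurable_cong, simp]: "sets coll = sets borel"
  by (simp add: coll_def)

lemma nn_integral_coll:
  assumes [measurable]: "F \<in> borel_fun"
  shows "(NCINT c. F c) =
    (NBINT v. (NBINT w. (NSINT u. ennreal (kernel_B (v - w) u) * F (v, w, post_velocities v w u))))"
proof -
  interpret ls: pair_sigma_finite lborel s ..
  interpret lls: pair_sigma_finite lborel "lborel \<Otimes>\<^sub>M s" ..
  have "(NCINT c. F c) = (\<integral>\<^sup>+p. ennreal (kernel_B (fst p - fst (snd p)) (snd (snd p))) *
      F (fst p, fst (snd p), post_velocities (fst p) (fst (snd p)) (snd (snd p))) \<partial>(lborel \<Otimes>\<^sub>M (lborel \<Otimes>\<^sub>M s)))"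
    unfolding coll_def by (subst nn_integral_distr) (simp_all add: nn_integral_density)
  then show ?thesis
    by (simp add: nn_integral_fst[symmetric] sigma_finite_measure.nn_integral_fst[OF ls.sigma_finite_measure_axioms, symmetric])
qed

text \<open>Depends only on the lengths of the four sides, whence its symmetries. In the divisor,
  \<open>r ^ CARD('d)\<close> comes from the substitution \<open>w = v + r *\<^sub>R y\<close> and
  one more \<open>r\<close> from the kernel, which is homogeneous of degree one.\<close>

definition corner_weight :: "real => (real^'d) \<times> (real^'d) \<times> (real^'d) \<times> (real^'d) => real" where
  "corner_weight r c = (case c of (v, w, v', w') =>
     (let f = (\<lambda>x. side CARD('d) (norm x / r)) in f (v' - v) * f (w' - v) * f (v' - w) * f (w' - w))
       / (rect_mass * r ^ Suc CARD('d)))"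

lemma corner_weight_measurable [measurable]: "corner_weight r \<in> borel_fun"
  unfolding corner_weight_def Let_def borel_prod[symmetric] split_beta by measurable

text \<open>The substitution \<open>w = v + r *\<^sub>R y\<close> turns the product of kernel and
  weight into \<open>rect y u / rect_mass\<close>: the base corner \<open>v\<close> is Lebesgue
  distributed, and the rectangle attached to it is random, independent of \<open>v\<close> and
  magnified by \<open>r\<close>.\<close>

lemma nn_integral_corner_weight:
  assumes [measurable]: "F \<in> borel_fun" and r: "0 < r"
  shows "(NCINT c. ennreal (corner_weight r c) * F c) =
    (NBINT v. (NSINT u. (NBINT y. ennreal (rect y u / rect_mass) *
        F (v, v + r *\<^sub>R y, v + (r * (y \<bullet> u)) *\<^sub>R u, v + r *\<^sub>R perp u y))))"
proof -
  interpret pair_sigma_finite s lborel ..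
  let ?G = "\<lambda>v w u. ennreal (kernel_B (v - w) u) *
      (ennreal (corner_weight r (v, w, post_velocities v w u)) * F (v, w, post_velocities v w u))"
  have "(NCINT c. ennreal (corner_weight r c) * F c)
      = (NBINT v. (NBINT w. (NSINT u. ?G v w u)))"
    by (rule nn_integral_coll) measurable
  also have "... = (NBINT v. (NSINT u. (NBINT w. ?G v w u)))"
    by (intro nn_integral_cong Fubini') measurable
  also have "... = (NBINT v. (NSINT u. (NBINT y. ennreal (rect y u / rect_mass) *
        F (v, v + r *\<^sub>R y, v + (r * (y \<bullet> u)) *\<^sub>R u, v + r *\<^sub>R perp u y))))"
  proof (rule nn_integral_cong, rule nn_integral_cong_AE, use norm_s in eventually_elim)
    fix v u :: "real^'d" assume u: "norm u = 1"
    have "(NBINT w. ?G v w u) = (NBINT y. ?G v (v + y) u)"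
      by (rule nn_integral_lborel_shift[symmetric]) measurable
    also have "... = (NBINT y. ennreal (r ^ CARD('d)) * ?G v (v + r *\<^sub>R y) u)"
      by (rule nn_integral_lborel_scaleR) (use r in measurable)
    also have "... = (NBINT y. ennreal (rect y u / rect_mass) *
        F (v, v + r *\<^sub>R y, v + (r * (y \<bullet> u)) *\<^sub>R u, v + r *\<^sub>R perp u y))"
    proof (rule nn_integral_cong)
      fix y :: "real^'d"
      have post: "post_velocities v (v + r *\<^sub>R y) u = (v + (r * (y \<bullet> u)) *\<^sub>R u, v + r *\<^sub>R perp u y)"
        by (simp add: post_velocities_def perp_def inner_commute algebra_simps)
      let ?a = "side CARD('d) \<bar>y \<bullet> u\<bar>" and ?b = "side CARD('d) (norm (perp u y))"
      \<comment> \<open>The sides at the opposite corner are those at \<open>v\<close> reversed, so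
        each length occurs twice and \<open>side_square\<close> applies.\<close>
      have diffs: "v + (r * (y \<bullet> u)) *\<^sub>R u - (v + r *\<^sub>R y) = - (r *\<^sub>R perp u y)"
        "v + r *\<^sub>R perp u y - (v + r *\<^sub>R y) = - ((r * (y \<bullet> u)) *\<^sub>R u)"
        by (simp_all add: perp_def algebra_simps)
      have "corner_weight r (v, v + r *\<^sub>R y, v + (r * (y \<bullet> u)) *\<^sub>R u, v + r *\<^sub>R perp u y)
          = (?a * ?b * ?b * ?a) / (rect_mass * r ^ Suc CARD('d))"
        unfolding corner_weight_def Let_def prod.case diffs using r u by (simp add: abs_mult)
      also have "?a * ?b * ?b * ?a = bump (2 * CARD('d)) \<bar>y \<bullet> u\<bar> * bump (2 * CARD('d)) (norm (perp u y))"
        by (simp flip: side_square)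
      finally have w: "corner_weight r (v, v + r *\<^sub>R y, v + (r * (y \<bullet> u)) *\<^sub>R u, v + r *\<^sub>R perp u y)
          = bump (2 * CARD('d)) \<bar>y \<bullet> u\<bar> * bump (2 * CARD('d)) (norm (perp u y)) / (rect_mass * r ^ Suc CARD('d))" .
      have k: "kernel_B (v - (v + r *\<^sub>R y)) u = r * (\<bar>y \<bullet> u\<bar> / 2)"
        using r by (simp add: kernel_B_def abs_mult)
      have "r ^ CARD('d) * (kernel_B (v - (v + r *\<^sub>R y)) u *
          corner_weight r (v, v + r *\<^sub>R y, v + (r * (y \<bullet> u)) *\<^sub>R u, v + r *\<^sub>R perp u y)) = rect y u / rect_mass"
        unfolding w k rect_def using r rect_mass_pos by (simp add: field_simps)
      moreover have "0 <= kernel_B (v - (v + r *\<^sub>R y)) u"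
        "0 <= corner_weight r (v, v + r *\<^sub>R y, v + (r * (y \<bullet> u)) *\<^sub>R u, v + r *\<^sub>R perp u y)"
        unfolding w k using r rect_mass_pos by (simp_all add: bump_bounds)
      ultimately show "ennreal (r ^ CARD('d)) * ?G v (v + r *\<^sub>R y) u = ennreal (rect y u / rect_mass) *
        F (v, v + r *\<^sub>R y, v + (r * (y \<bullet> u)) *\<^sub>R u, v + r *\<^sub>R perp u y)"
        unfolding post using r by (simp add: ennreal_mult[symmetric] mult.assoc[symmetric])
    qed
    finally show "(NBINT w. ?G v w u) = (NBINT y. ennreal (rect y u / rect_mass) *
        F (v, v + r *\<^sub>R y, v + (r * (y \<bullet> u)) *\<^sub>R u, v + r *\<^sub>R perp u y))" .
  qed
  finally show ?thesis .
qed

end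

lemma measure_eqI_nn_integral:
  assumes "sets M = sets N" "\<And>F. F \<in> borel_measurable N ==> (\<integral>\<^sup>+x. F x \<partial>M) = (\<integral>\<^sup>+x. F x \<partial>N)"
  shows "M = N"
proof (rule measure_eqI)
  fix A assume "A \<in> sets M"
  then show "emeasure M A = emeasure N A" using assms(1) assms(2)[of "indicator A"] by simp
qed fact

text \<open>The integrand is at most \<open>L * norm z\<close> and vanishes outside the two balls of
  radius 2 about \<open>0\<close> and \<open>z\<close>.\<close>

lemma lipschitz_translation:
  fixes f :: "real^'n => real"
  assumes [measurable]: "f \<in> borel_fun"
    and lip: "\<And>x y. \<bar>f x - f y\<bar> <= L * norm (x - y)" and supp: "\<And>x. norm x > 2 ==> f x = 0"
  shows "(NBINT y. ennreal \<bar>f (y - z) - f y\<bar>) <= ennreal (2 * L * measure lborel (cball (0::real^'n) 2) * norm z)"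
proof -
  let ?B = "cball (0::real^'n) 2"
  have [measurable]: "?B \<in> sets borel" by simp
  \<comment> \<open>\<open>L\<close> is nonnegative because these two points are at distance
    1.\<close>
  have "0 <= \<bar>f (axis undefined 1) - f 0\<bar>" by simp
  also have "... <= L * norm (axis undefined 1 - 0 :: real^'n)" by (rule lip)
  finally have L: "0 <= L" by simp
  have "(NBINT y. ennreal \<bar>f (y - z) - f y\<bar>)
      <= (NBINT y. ennreal (L * norm z) * (indicator ?B (- z + y) + indicator ?B y))"
  proof (rule nn_integral_mono)
    fix y
    show "ennreal \<bar>f (y - z) - f y\<bar> <= ennreal (L * norm z) * (indicator ?B (- z + y) + indicator ?B y)"
    proof (cases "norm (y - z) <= 2 \<or> norm y <= 2")
      case True
      then have "1 <= (indicator ?B (- z + y) + indicator ?B y :: ennreal)"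
        by (auto simp: indicator_def)
      then have "ennreal (L * norm z) * 1 <= ennreal (L * norm z) * (indicator ?B (- z + y) + indicator ?B y)"
        by (intro mult_left_mono) auto
      moreover have "ennreal \<bar>f (y - z) - f y\<bar> <= ennreal (L * norm z)"
        using lip[of "y - z" y] by (intro ennreal_leI) simp
      ultimately show ?thesis by simp
    qed (simp add: supp)
  qed
  also have "... = ennreal (L * norm z) * ((NBINT y. indicator ?B (- z + y)) + (NBINT y. indicator ?B y))"
    by (simp add: nn_integral_cmult nn_integral_add)
  also have "(NBINT y. indicator ?B (- z + y)) = (NBINT y. indicator ?B y)"
    by (rule nn_integral_lborel_shift) simp
  also have "(NBINT y. indicator ?B y) = ennreal (measure lborel ?B)"
    using emeasure_lborel_cball_finite[of "0::real^'n" 2] by (simp add: emeasure_eq_ennreal_measure)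
  also have "ennreal (L * norm z) * (ennreal (measure lborel ?B) + ennreal (measure lborel ?B))
      = ennreal (2 * L * measure lborel ?B * norm z)"
    using L by (simp add: ennreal_mult[symmetric] ennreal_plus[symmetric] del: ennreal_plus)
  finally show ?thesis .
qed

definition dilate :: "real => (real^'n => real) => real^'n => real" where
  "dilate r f x = f (x /\<^sub>R r) / r ^ CARD('n)"

lemma dilate_measurable [measurable (raw)]:
  assumes [measurable]: "f \<in> borel_fun" "g \<in> borel_measurable M"
  shows "(\<lambda>x. dilate r f (g x)) \<in> borel_measurable M"
  unfolding dilate_def by measurable

lemma nn_integral_dilate:
  fixes F :: "real^'n => ennreal"
  assumes [measurable]: "F \<in> borel_fun" "f \<in> borel_fun" and r: "0 < r"
  shows "(NBINT x. ennreal (dilate r f x) * F x) = (NBINT x. ennreal (f x) * F (r *\<^sub>R x))"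
proof -
  have "(NBINT x. ennreal (dilate r f x) * F x)
      = (NBINT x. ennreal (r ^ CARD('n)) * (ennreal (dilate r f (r *\<^sub>R x)) * F (r *\<^sub>R x)))"
    by (rule nn_integral_lborel_scaleR) (use r in measurable)
  also have "... = (NBINT x. ennreal (f x) * F (r *\<^sub>R x))"
    using r by (simp add: dilate_def mult.assoc[symmetric] ennreal_mult'[symmetric])
  finally show ?thesis .
qed

section \<open>Symmetries of the collision measure\<close>

context sphere_measure
begin

text \<open>Coordinates \<open>v\<close> and \<open>y = w - v\<close>, with \<open>v\<close>
  innermost: for fixed \<open>u\<close>, reversing a collision becomes a translation of
  \<open>v\<close> and an orthogonal map of \<open>y\<close>.\<close>

lemma nn_integral_coll_shifted:
  assumes [measurable]: "F \<in> borel_fun"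
  shows "(NCINT c. F c) = (NSINT u. (NBINT y. (NBINT v. ennreal (\<bar>y \<bullet> u\<bar> / 2) *
     F (v, v + y, v + (y \<bullet> u) *\<^sub>R u, v + perp u y))))"
proof -
  interpret ls: pair_sigma_finite "lborel :: (real^'d) measure" s ..
  let ?F = "\<lambda>v y u. ennreal (\<bar>y \<bullet> u\<bar> / 2) * F (v, v + y, v + (y \<bullet> u) *\<^sub>R u, v + perp u y)"
  have "(NCINT c. F c) = (NBINT v. (NBINT w. (NSINT u. ennreal (kernel_B (v - w) u) *
      F (v, w, post_velocities v w u))))"
    by (rule nn_integral_coll) measurable
  also have "... = (NBINT v. (NBINT y. (NSINT u. ennreal (kernel_B (v - (v + y)) u) *
      F (v, v + y, post_velocities v (v + y) u))))"
    by (intro nn_integral_cong nn_integral_lborel_shift[symmetric]) measurable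
  also have "... = (NBINT v. (NBINT y. (NSINT u. ?F v y u)))"
    by (simp add: kernel_B_def post_velocities_def perp_def inner_commute algebra_simps)
  also have "... = (NBINT y. (NBINT v. (NSINT u. ?F v y u)))"
    by (rule lborel_pair.Fubini') measurable
  also have "... = (NBINT y. (NSINT u. (NBINT v. ?F v y u)))"
    by (intro nn_integral_cong ls.Fubini'[symmetric]) measurable
  also have "... = (NSINT u. (NBINT y. (NBINT v. ?F v y u)))"
    by (rule ls.Fubini'[symmetric]) measurable
  finally show ?thesis .
qed

lemma coll_swap: "distr coll borel (\<lambda>(v, w, v', w'). (w, v, w', v')) = coll"
proof (rule measure_eqI_nn_integral)
  fix F :: "(real^'d) \<times> (real^'d) \<times> (real^'d) \<times> (real^'d) => ennreal"
  assume "F \<in> borel_measurable coll"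
  then have [measurable]: "F \<in> borel_fun" by simp
  have [measurable]: "(\<lambda>(v, w, v', w'). (w, v, w', v')) \<in> borel_measurable (borel :: ((real^'d) \<times> (real^'d) \<times> (real^'d) \<times> (real^'d)) measure)"
    unfolding borel_prod[symmetric] by measurable
  let ?G = "\<lambda>v w. (NSINT u. ennreal (kernel_B (v - w) u) * F (v, w, post_velocities v w u))"
  have post: "(case post_velocities v w u of (v', w') => (w, v, w', v')) = (w, v, post_velocities w v u)" for v w u :: "real^'d"
    by (simp add: post_velocities_def inner_diff_right algebra_simps)
  have ker: "kernel_B (v - w) u = kernel_B (w - v) u" for v w u :: "real^'d"
    by (simp add: kernel_B_def inner_diff_left abs_minus_commute)
  have "(\<integral>\<^sup>+c. F c \<partial>distr coll borel (\<lambda>(v, w, v', w'). (w, v, w', v'))) = (NCINT c. F (case c of (v, w, v', w') => (w, v, w', v')))"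
    by (rule nn_integral_distr) measurable
  also have "... = (NBINT v. (NBINT w. ?G w v))"
    by (subst nn_integral_coll) (simp_all add: post ker)
  also have "... = (NBINT w. (NBINT v. ?G w v))"
    by (rule lborel_pair.Fubini') measurable
  also have "... = (NCINT c. F c)"
    by (rule nn_integral_coll[symmetric]) measurable
  finally show "(\<integral>\<^sup>+c. F c \<partial>distr coll borel (\<lambda>(v, w, v', w'). (w, v, w', v'))) = (NCINT c. F c)" .
qed simp

lemma reflection_orthogonal:
  fixes u :: "real^'n"
  assumes "norm u = 1"
  shows "orthogonal_transformation (\<lambda>y. y - (2 * (y \<bullet> u)) *\<^sub>R u)"
proof -
  have "u \<bullet> u = 1" using assms by (simp add: dot_square_norm)
  then show ?thesis
    unfolding orthogonal_transformation_def
    by (auto intro!: linearI simp: inner_add_left inner_diff_left inner_diff_right algebra_simps inner_commute)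
qed

text \<open>Microscopic reversibility. For fixed \<open>u\<close> the reversed collision is obtained
  by reflecting \<open>y\<close> in the hyperplane orthogonal to \<open>u\<close> and translating
  \<open>v\<close> by a multiple of \<open>u\<close>. Both maps preserve Lebesgue measure, and the
  kernel sees only the absolute value of \<open>y \<bullet> u\<close>.\<close>

lemma coll_reverse: "distr coll borel (\<lambda>(v, w, v', w'). (v', w', v, w)) = coll"
proof (rule measure_eqI_nn_integral)
  fix F :: "(real^'d) \<times> (real^'d) \<times> (real^'d) \<times> (real^'d) => ennreal"
  assume "F \<in> borel_measurable coll"
  then have [measurable]: "F \<in> borel_fun" by simp
  have [measurable]: "(\<lambda>(v, w, v', w'). (v', w', v, w)) \<in> borel_measurable (borel :: ((real^'d) \<times> (real^'d) \<times> (real^'d) \<times> (real^'d)) measure)"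
    unfolding borel_prod[symmetric] by measurable
  let ?G = "\<lambda>u y. (NBINT v. ennreal (\<bar>y \<bullet> u\<bar> / 2) * F (v, v + y, v + (y \<bullet> u) *\<^sub>R u, v + perp u y))"
  have "(\<integral>\<^sup>+c. F c \<partial>distr coll borel (\<lambda>(v, w, v', w'). (v', w', v, w))) = (NCINT c. F (case c of (v, w, v', w') => (v', w', v, w)))"
    by (rule nn_integral_distr) measurable
  also have "... = (NSINT u. (NBINT y. (NBINT v. ennreal (\<bar>y \<bullet> u\<bar> / 2) *
      F (v + (y \<bullet> u) *\<^sub>R u, v + perp u y, v, v + y))))"
    by (subst nn_integral_coll_shifted) simp_all
  also have "... = (NSINT u. (NBINT y. ?G u y))"
  proof (rule nn_integral_cong_AE, use norm_s in eventually_elim)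
    fix u :: "real^'d" assume u: "norm u = 1"
    then have "u \<bullet> u = 1" by (simp add: dot_square_norm)
    let ?r = "\<lambda>y. y - (2 * (y \<bullet> u)) *\<^sub>R u"
    have "(NBINT v. ennreal (\<bar>y \<bullet> u\<bar> / 2) * F (v + (y \<bullet> u) *\<^sub>R u, v + perp u y, v, v + y)) = ?G u (?r y)" for y
    proof -
      have r: "?r y \<bullet> u = - (y \<bullet> u)" using \<open>u \<bullet> u = 1\<close> by (simp add: inner_diff_left)
      have eqs: "- ((y \<bullet> u) *\<^sub>R u) + v + (y \<bullet> u) *\<^sub>R u = v"
        "- ((y \<bullet> u) *\<^sub>R u) + v + perp u y = v + ?r y"
        "- ((y \<bullet> u) *\<^sub>R u) + v = v + (?r y \<bullet> u) *\<^sub>R u"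
        "- ((y \<bullet> u) *\<^sub>R u) + v + y = v + perp u (?r y)" for v
        unfolding perp_def r by (simp_all add: vec_eq_iff)
      have "(NBINT v. ennreal (\<bar>y \<bullet> u\<bar> / 2) * F (v + (y \<bullet> u) *\<^sub>R u, v + perp u y, v, v + y))
          = (NBINT v. ennreal (\<bar>y \<bullet> u\<bar> / 2) * F (- ((y \<bullet> u) *\<^sub>R u) + v + (y \<bullet> u) *\<^sub>R u,
              - ((y \<bullet> u) *\<^sub>R u) + v + perp u y, - ((y \<bullet> u) *\<^sub>R u) + v, - ((y \<bullet> u) *\<^sub>R u) + v + y))"
        by (rule nn_integral_lborel_shift[symmetric]) measurable
      also have "... = ?G u (?r y)"
        unfolding eqs(1,2,4) unfolding eqs(3) r by simp
      finally show ?thesis .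
    qed
    moreover have "(NBINT y. ?G u (?r y)) = (NBINT y. ?G u y)"
      by (rule nn_integral_lborel_orthogonal[OF reflection_orthogonal[OF u]]) measurable
    ultimately show "(NBINT y. (NBINT v. ennreal (\<bar>y \<bullet> u\<bar> / 2) *
        F (v + (y \<bullet> u) *\<^sub>R u, v + perp u y, v, v + y))) = (NBINT y. ?G u y)"
      by simp
  qed
  also have "... = (NCINT c. F c)"
    by (rule nn_integral_coll_shifted[symmetric]) measurable
  finally show "(\<integral>\<^sup>+c. F c \<partial>distr coll borel (\<lambda>(v, w, v', w'). (v', w', v, w))) = (NCINT c. F c)" .
qed simp

end

lemma borel_measurable_fst_snd [measurable]:
  "fst \<in> borel_fun" "snd \<in> borel_fun"
  by (intro borel_measurable_continuous_onI continuous_intros)+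

lemma nn_integral_dilate_shift:
  fixes F :: "real^'n => ennreal"
  assumes [measurable]: "F \<in> borel_fun" "f \<in> borel_fun" and r: "0 < r"
  shows "(NBINT z. ennreal (dilate r f (z - v)) * F z) = (NBINT x. ennreal (f x) * F (v + r *\<^sub>R x))"
proof -
  have "(NBINT z. ennreal (dilate r f (z - v)) * F z)
      = (NBINT z. ennreal (dilate r f (v + z - v)) * F (v + z))"
    by (rule nn_integral_lborel_shift[symmetric]) measurable
  also have "... = (NBINT z. ennreal (dilate r f z) * F (v + z))" by simp
  also have "... = (NBINT x. ennreal (f x) * F (v + r *\<^sub>R x))"
    using nn_integral_dilate[of "\<lambda>z. F (v + z)" f r] r by simp
  finally show ?thesis .
qed

lemma integrable_mult_bounded:
  fixes h g :: "'a => real"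
  assumes "integrable M h" "g \<in> borel_measurable M" "\<And>x. \<bar>g x\<bar> <= B"
  shows "integrable M (\<lambda>x. h x * g x)"
proof (rule Bochner_Integration.integrable_bound)
  show "integrable M (\<lambda>x. h x * B)" using assms(1) by simp
  show "(\<lambda>x. h x * g x) \<in> borel_measurable M" using assms by measurable
  have "0 <= B" using assms(3)[of undefined] by linarith
  show "AE x in M. norm (h x * g x) <= norm (h x * B)"
    using assms(3) \<open>0 <= B\<close> by (auto simp: abs_mult intro!: mult_left_mono)
qed

section \<open>Moving mass to a corner as a convolution\<close>

definition dilated_conv :: "real => (real^'n => real) => (real^'n => real) => real^'n => real" where
  "dilated_conv r f h z = (LBINT v. h v * dilate r f (z - v))"

lemma dilated_conv_measurable [measurable (raw)]:
  assumes [measurable]: "f \<in> borel_fun" "h \<in> borel_fun" "g \<in> borel_measurable M"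
  shows "(\<lambda>x. dilated_conv r f h (g x)) \<in> borel_measurable M"
  unfolding dilated_conv_def by measurable

lemma dilated_conv_integrand:
  assumes h: "integrable lborel h" and [measurable]: "f \<in> borel_fun"
    and "\<And>x. \<bar>f x\<bar> <= B" "0 < r"
  shows "integrable lborel (\<lambda>v. h v * dilate r f (z - v))"
proof (rule integrable_mult_bounded[OF h])
  show "\<bar>dilate r f (z - v)\<bar> <= B / r ^ CARD('a)" for v
    using assms(3)[of "(z - v) /\<^sub>R r"] \<open>0 < r\<close> by (simp add: dilate_def divide_right_mono)
qed measurable

context sphere_measure
begin

lemma rect_law_mass: "(NSINT u. (NBINT y. ennreal (rect y u / rect_mass))) = 1"
proof -
  have "(NSINT u. (NBINT y. ennreal (rect y u / rect_mass)))
      = (NSINT u. (NBINT y. ennreal (1 / rect_mass) * ennreal (rect y u)))"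
    using rect_mass_pos by (simp add: ennreal_mult[symmetric] rect_bounds)
  also have "... = ennreal (1 / rect_mass) * ennreal rect_mass"
    by (simp add: nn_integral_cmult rect_mass_eq)
  also have "... = 1" using rect_mass_pos by (simp add: ennreal_mult[symmetric])
  finally show ?thesis .
qed

text \<open>The joint law of the base corner and the corner \<open>X\<close> is first identified on
  nonnegative functions. Since \<open>\<rho>\<close> has mass one, the absolute value of
  \<open>h\<close> stays integrable under it, and the signed identity follows by Fubini.\<close>

lemma corner_integral:
  fixes X :: "(real^'d) \<times> (real^'d) \<times> (real^'d) \<times> (real^'d) => real^'d" and \<rho> :: "real^'d => real"
  assumes [measurable]: "X \<in> borel_fun" "case_prod K \<in> borel_measurable (borel \<Otimes>\<^sub>M borel)"
      "\<rho> \<in> borel_fun" "\<phi> \<in> borel_fun"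
    and rho: "\<And>x. 0 <= \<rho> x" and r: "0 < r"
    and law: "\<And>F. F \<in> borel_fun ==>
      (NSINT u. (NBINT y. ennreal (rect y u / rect_mass) * F (K u y))) = (NBINT x. ennreal (\<rho> x) * F x)"
    and X: "\<And>v y u. X (v, v + r *\<^sub>R y, v + (r * (y \<bullet> u)) *\<^sub>R u, v + r *\<^sub>R perp u y) = v + r *\<^sub>R K u y"
    and h: "integrable lborel h" and \<phi>: "\<And>x. \<bar>\<phi> x\<bar> <= B"
  shows "integrable coll (\<lambda>c. corner_weight r c * (h (fst c) * \<phi> (X c)))"
    and "(LCINT c. corner_weight r c * (h (fst c) * \<phi> (X c))) = (LBINT z. \<phi> z * dilated_conv r \<rho> h z)"
    and "integrable lborel (\<lambda>z. \<phi> z * dilated_conv r \<rho> h z)"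
proof -
  have [measurable]: "h \<in> borel_fun" using h by auto
  define M where "M = density coll (\<lambda>c. ennreal (corner_weight r c))"
  define N where "N = density (lborel \<Otimes>\<^sub>M lborel) (\<lambda>p. ennreal (dilate r \<rho> (snd p - fst p :: real^'d)))"
  have W: "0 <= corner_weight r c" for c
    using rect_mass_pos r by (auto simp: corner_weight_def Let_def side_bounds split: prod.split)
  have D: "0 <= dilate r \<rho> x" for x using rho r by (simp add: dilate_def)
  have [measurable_cong]: "sets M = sets borel" by (simp add: M_def)
  have sets_N [measurable_cong]: "sets N = sets (borel \<Otimes>\<^sub>M borel)"
    unfolding N_def sets_density by (intro sets_pair_measure_cong sets_lborel)
  have mass: "(NBINT x. ennreal (\<rho> x)) = 1"
    using law[of "\<lambda>_. 1"] rect_law_mass by simp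
  have eq: "distr M (borel \<Otimes>\<^sub>M borel) (\<lambda>c. (fst c, X c)) = N"
  proof (rule measure_eqI_nn_integral)
    fix F :: "(real^'d) \<times> (real^'d) => ennreal" assume "F \<in> borel_measurable N"
    then have [measurable]: "F \<in> borel_measurable (borel \<Otimes>\<^sub>M borel)"
      by (simp add: measurable_cong_sets[OF sets_N refl])
    have "(\<integral>\<^sup>+p. F p \<partial>distr M (borel \<Otimes>\<^sub>M borel) (\<lambda>c. (fst c, X c))) = (NCINT c. ennreal (corner_weight r c) * F (fst c, X c))"
      unfolding M_def by (subst nn_integral_distr) (simp_all add: nn_integral_density)
    also have "... = (NBINT v. (NSINT u. (NBINT y. ennreal (rect y u / rect_mass) * F (v, v + r *\<^sub>R K u y))))"
      by (subst nn_integral_corner_weight) (simp_all add: r X)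
    also have "... = (NBINT v. (NBINT x. ennreal (\<rho> x) * F (v, v + r *\<^sub>R x)))"
      by (intro nn_integral_cong law) measurable
    also have "... = (NBINT v. (NBINT z. ennreal (dilate r \<rho> (z - v)) * F (v, z)))"
      by (intro nn_integral_cong nn_integral_dilate_shift[symmetric]) (use r in measurable)
    also have "... = (\<integral>\<^sup>+p. F p \<partial>N)"
      unfolding N_def by (subst nn_integral_density) (simp_all add: lborel.nn_integral_fst[symmetric])
    finally show "(\<integral>\<^sup>+p. F p \<partial>distr M (borel \<Otimes>\<^sub>M borel) (\<lambda>c. (fst c, X c))) = (\<integral>\<^sup>+p. F p \<partial>N)" .
  qed (simp add: sets_N)
  have intN: "integrable N (\<lambda>p. h (fst p))"
  proof (rule integrableI_bounded)
    have "(\<integral>\<^sup>+p. ennreal (norm (h (fst p))) \<partial>N)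
        = (NBINT v. (NBINT z. ennreal (dilate r \<rho> (z - v)) * ennreal \<bar>h v\<bar>))"
      unfolding N_def by (subst nn_integral_density) (simp_all add: lborel.nn_integral_fst[symmetric])
    also have "... = (NBINT v. (NBINT x. ennreal (\<rho> x) * ennreal \<bar>h v\<bar>))"
      by (intro nn_integral_cong nn_integral_dilate_shift) (use r in measurable)
    also have "... = (NBINT v. ennreal \<bar>h v\<bar>)"
      by (simp add: nn_integral_multc mass)
    also have "... < \<infinity>" using h by (simp add: integrable_iff_bounded)
    finally show "(\<integral>\<^sup>+p. ennreal (norm (h (fst p))) \<partial>N) < \<infinity>" .
  qed measurable
  then have int: "integrable N (\<lambda>p. h (fst p) * \<phi> (snd p))"
    by (rule integrable_mult_bounded) (use \<phi> in auto)
  then have "integrable M (\<lambda>c. h (fst c) * \<phi> (X c))"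
    unfolding eq[symmetric] by (subst (asm) integrable_distr_eq) measurable
  then show "integrable coll (\<lambda>c. corner_weight r c * (h (fst c) * \<phi> (X c)))"
    unfolding M_def by (subst (asm) integrable_density) (use W in \<open>simp_all\<close>)
  have int2: "integrable (lborel \<Otimes>\<^sub>M lborel) (\<lambda>p. dilate r \<rho> (snd p - fst p) * (h (fst p) * \<phi> (snd p)))"
    using int unfolding N_def by (subst (asm) integrable_density) (use D in \<open>simp_all\<close>)
  have int3: "integrable (lborel \<Otimes>\<^sub>M lborel) (\<lambda>(v, z). dilate r \<rho> (z - v) * (h v * \<phi> z))"
    using int2 by (simp add: split_beta')
  have inner: "(LBINT v. dilate r \<rho> (z - v) * (h v * \<phi> z)) = \<phi> z * dilated_conv r \<rho> h z" for z
    unfolding dilated_conv_def by (subst integral_mult_right_zero[symmetric]) (simp add: ac_simps)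
  have "(LCINT c. corner_weight r c * (h (fst c) * \<phi> (X c))) = (\<integral>c. h (fst c) * \<phi> (X c) \<partial>M)"
    unfolding M_def by (subst integral_density) (use W in \<open>simp_all\<close>)
  also have "... = (\<integral>p. h (fst p) * \<phi> (snd p) \<partial>N)"
    unfolding eq[symmetric] by (subst integral_distr) measurable
  also have "... = (\<integral>p. dilate r \<rho> (snd p - fst p) * (h (fst p) * \<phi> (snd p)) \<partial>(lborel \<Otimes>\<^sub>M lborel))"
    unfolding N_def by (subst integral_density) (use D in \<open>simp_all\<close>)
  also have "... = (\<integral>(v, z). dilate r \<rho> (z - v) * (h v * \<phi> z) \<partial>(lborel \<Otimes>\<^sub>M lborel))"
    by (simp add: split_beta')
  also have "... = (LBINT z. (LBINT v. dilate r \<rho> (z - v) * (h v * \<phi> z)))"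
    by (rule lborel_pair.integral_snd[symmetric]) (rule int3)
  finally show "(LCINT c. corner_weight r c * (h (fst c) * \<phi> (X c))) = (LBINT z. \<phi> z * dilated_conv r \<rho> h z)"
    unfolding inner .
  show "integrable lborel (\<lambda>z. \<phi> z * dilated_conv r \<rho> h z)"
    using lborel_pair.integrable_snd[OF int3] unfolding inner .
qed

lemma corner_integral_base:
  assumes [measurable]: "\<phi> \<in> borel_fun" and r: "0 < r"
    and h: "integrable lborel h" and \<phi>: "\<And>x. \<bar>\<phi> x\<bar> <= B"
  shows "integrable coll (\<lambda>c. corner_weight r c * (h (fst c) * \<phi> (fst c)))"
    and "(LCINT c. corner_weight r c * (h (fst c) * \<phi> (fst c))) = (LBINT z. \<phi> z * h z)"
proof -
  have [measurable]: "h \<in> borel_fun" using h by auto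
  define M where "M = density coll (\<lambda>c. ennreal (corner_weight r c))"
  have W: "0 <= corner_weight r c" for c
    using rect_mass_pos r by (auto simp: corner_weight_def Let_def side_bounds split: prod.split)
  have [measurable_cong]: "sets M = sets borel" by (simp add: M_def)
  have eq: "distr M borel fst = lborel"
  proof (rule measure_eqI_nn_integral)
    fix F :: "(real^'d) => ennreal" assume "F \<in> borel_measurable lborel"
    then have [measurable]: "F \<in> borel_fun" by simp
    have "(\<integral>\<^sup>+p. F p \<partial>distr M borel fst) = (NCINT c. ennreal (corner_weight r c) * F (fst c))"
      unfolding M_def by (subst nn_integral_distr) (simp_all add: nn_integral_density)
    also have "... = (NBINT v. (NSINT u. (NBINT y. ennreal (rect y u / rect_mass) * F v)))"
      by (subst nn_integral_corner_weight) (simp_all add: r)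
    also have "... = (NBINT v. F v)"
      by (simp add: nn_integral_multc rect_law_mass)
    finally show "(\<integral>\<^sup>+p. F p \<partial>distr M borel fst) = (NBINT v. F v)" .
  qed simp
  have int: "integrable lborel (\<lambda>z. h z * \<phi> z)"
    by (rule integrable_mult_bounded[OF h]) (use \<phi> in auto)
  then have "integrable M (\<lambda>c. h (fst c) * \<phi> (fst c))"
    unfolding eq[symmetric] by (subst (asm) integrable_distr_eq) measurable
  then show "integrable coll (\<lambda>c. corner_weight r c * (h (fst c) * \<phi> (fst c)))"
    unfolding M_def by (subst (asm) integrable_density) (use W in \<open>simp_all\<close>)
  have "(LCINT c. corner_weight r c * (h (fst c) * \<phi> (fst c))) = (\<integral>c. h (fst c) * \<phi> (fst c) \<partial>M)"
    unfolding M_def by (subst integral_density) (use W in \<open>simp_all\<close>)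
  also have "... = (LBINT z. h z * \<phi> z)"
    unfolding eq[symmetric] by (subst integral_distr) measurable
  finally show "(LCINT c. corner_weight r c * (h (fst c) * \<phi> (fst c))) = (LBINT z. \<phi> z * h z)"
    by (simp add: mult.commute)
qed

end

section \<open>Iterated smoothing\<close>

definition pair_gradient :: "(real^'d => real) => (real^'d) \<times> (real^'d) \<times> (real^'d) \<times> (real^'d) => real" where
  "pair_gradient \<phi> = (\<lambda>(v, w, v', w'). \<phi> v' + \<phi> w' - \<phi> v - \<phi> w)"

lemma pair_gradient_eq:
  "pair_gradient \<phi> c = \<phi> (fst (snd (snd c))) + \<phi> (snd (snd (snd c))) - \<phi> (fst c) - \<phi> (fst (snd c))"
  by (simp add: pair_gradient_def split_beta)

text \<open>The kernel may be signed, so its L1 norm, and with it the mass of a convolution, can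
  grow by a factor up to \<open>T\<close>. For simplicity one constant bounds the supremum, the L1
  norm and the L1 modulus of translations.\<close>

locale smoothing_profile =
  fixes \<tau> :: "real^'d => real" and T :: real
  assumes tau_measurable [measurable]: "\<tau> \<in> borel_fun"
    and T: "1 <= T"
    and tau_bound: "\<bar>\<tau> x\<bar> <= T"
    and tau_support: "2 < norm x ==> \<tau> x = 0"
    and tau_norm: "(NBINT x. ennreal \<bar>\<tau> x\<bar>) <= ennreal T"
    and tau_shift: "(NBINT u. ennreal \<bar>\<tau> (u - z) - \<tau> u\<bar>) <= ennreal (T * norm z)"
begin

lemma dilate_tau_norm:
  assumes r: "0 < r"
  shows "(NBINT z. ennreal \<bar>dilate r \<tau> (z - v)\<bar>) <= ennreal T"
proof -
  have "(NBINT z. ennreal \<bar>dilate r \<tau> (z - v)\<bar>) = (NBINT z. ennreal (dilate r (\<lambda>x. \<bar>\<tau> x\<bar>) (z - v)) * 1)"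
    using r by (simp add: dilate_def)
  also have "... = (NBINT x. ennreal \<bar>\<tau> x\<bar> * 1)"
    by (rule nn_integral_dilate_shift) (use r in measurable)
  finally show ?thesis using tau_norm by simp
qed

text \<open>In units of the dilated kernel a translation by \<open>v\<close> is one by
  \<open>v /\<^sub>R r\<close>. This gain of \<open>1 / r\<close> is the source of the
  contraction.\<close>

lemma dilate_tau_shift:
  assumes r: "0 < r"
  shows "(NBINT z. ennreal \<bar>dilate r \<tau> (z - v) - dilate r \<tau> z\<bar>) <= ennreal (T / r * norm v)"
proof -
  have "(NBINT z. ennreal \<bar>dilate r \<tau> (z - v) - dilate r \<tau> z\<bar>)
      = (NBINT z. ennreal (r ^ CARD('d)) * ennreal \<bar>dilate r \<tau> (r *\<^sub>R z - v) - dilate r \<tau> (r *\<^sub>R z)\<bar>)"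
    by (rule nn_integral_lborel_scaleR) (use r in measurable)
  also have "... = (NBINT u. ennreal \<bar>\<tau> (u - v /\<^sub>R r) - \<tau> u\<bar>)"
  proof (rule nn_integral_cong)
    fix z
    have "(r *\<^sub>R z - v) /\<^sub>R r = z - v /\<^sub>R r" using r by (simp add: scaleR_diff_right)
    then have "\<bar>dilate r \<tau> (r *\<^sub>R z - v) - dilate r \<tau> (r *\<^sub>R z)\<bar> = \<bar>\<tau> (z - v /\<^sub>R r) - \<tau> z\<bar> / r ^ CARD('d)"
      using r by (simp add: dilate_def flip: diff_divide_distrib)
    then show "ennreal (r ^ CARD('d)) * ennreal \<bar>dilate r \<tau> (r *\<^sub>R z - v) - dilate r \<tau> (r *\<^sub>R z)\<bar>
        = ennreal \<bar>\<tau> (z - v /\<^sub>R r) - \<tau> z\<bar>"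
      using r by (simp flip: ennreal_mult)
  qed
  also have "... <= ennreal (T * norm (v /\<^sub>R r))" by (rule tau_shift)
  also have "T * norm (v /\<^sub>R r) = T / r * norm v" using r by (simp add: divide_inverse)
  finally show ?thesis .
qed

lemma conv_integrand:
  assumes "integrable lborel h" "0 < r"
  shows "integrable lborel (\<lambda>v. h v * dilate r \<tau> (z - v))"
  using assms by (intro dilated_conv_integrand[where B=T] tau_measurable tau_bound)

lemma conv_bound:
  assumes h: "integrable lborel h" and r: "1 <= r"
  shows "\<bar>dilated_conv r \<tau> h z\<bar> <= T * (LBINT x. \<bar>h x\<bar>)"
proof -
  have d: "\<bar>dilate r \<tau> x\<bar> <= T" for x
  proof -
    have "\<bar>dilate r \<tau> x\<bar> <= T / r ^ CARD('d)"
      using tau_bound r by (simp add: dilate_def divide_right_mono)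
    also have "... <= T / 1" using T r by (intro divide_left_mono) auto
    finally show ?thesis by simp
  qed
  have "\<bar>dilated_conv r \<tau> h z\<bar> <= (LBINT v. \<bar>h v * dilate r \<tau> (z - v)\<bar>)"
    unfolding dilated_conv_def by (rule integral_abs_bound)
  also have "... <= (LBINT v. T * \<bar>h v\<bar>)"
  proof (rule integral_mono)
    show "integrable lborel (\<lambda>v. \<bar>h v * dilate r \<tau> (z - v)\<bar>)"
      using conv_integrand[OF h, of r z] r by simp
    show "\<bar>h v * dilate r \<tau> (z - v)\<bar> <= T * \<bar>h v\<bar>" for v
      using mult_left_mono[OF d[of "z - v"], of "\<bar>h v\<bar>"] by (simp add: abs_mult mult.commute)
  qed (use h in simp)
  finally show ?thesis by simp
qed

text \<open>The kernel \<open>dilate r \<tau>\<close> has range \<open>2 * r\<close>, so the weight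
  at \<open>z\<close> can be replaced by \<open>g'\<close> at the source point before integrating in
  \<open>z\<close>.\<close>

lemma conv_weighted:
  fixes g :: "real^'d => real"
  assumes h: "integrable lborel h" and r: "0 < r" and [measurable]: "g \<in> borel_fun"
    and g: "\<And>z v. norm (z - v) <= 2 * r ==> g z <= g' v" "\<And>z. 0 <= g z"
    and hg: "integrable lborel (\<lambda>v. g' v * \<bar>h v\<bar>)"
  shows "integrable lborel (\<lambda>z. g z * dilated_conv r \<tau> h z)"
    and "(LBINT z. g z * \<bar>dilated_conv r \<tau> h z\<bar>) <= T * (LBINT v. g' v * \<bar>h v\<bar>)"
proof -
  have [measurable]: "h \<in> borel_fun" using h by auto
  have g'0: "0 <= g' v" for v using g(1)[of v v] g(2)[of v] r by simp
  have "(NBINT z. ennreal (g z * \<bar>dilated_conv r \<tau> h z\<bar>))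
      <= (NBINT z. (NBINT v. ennreal (g z) * ennreal \<bar>h v * dilate r \<tau> (z - v)\<bar>))"
  proof (rule nn_integral_mono)
    fix z
    have "ennreal \<bar>dilated_conv r \<tau> h z\<bar> <= (NBINT v. ennreal \<bar>h v * dilate r \<tau> (z - v)\<bar>)"
      unfolding dilated_conv_def
      using integral_norm_bound_ennreal[OF conv_integrand[OF h r, of z]] by simp
    then show "ennreal (g z * \<bar>dilated_conv r \<tau> h z\<bar>)
        <= (NBINT v. ennreal (g z) * ennreal \<bar>h v * dilate r \<tau> (z - v)\<bar>)"
      using g(2) by (simp add: nn_integral_cmult ennreal_mult mult_left_mono)
  qed
  also have "... <= (NBINT z. (NBINT v. ennreal (g' v * \<bar>h v\<bar>) * ennreal \<bar>dilate r \<tau> (z - v)\<bar>))"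
  proof (intro nn_integral_mono)
    fix z v
    show "ennreal (g z) * ennreal \<bar>h v * dilate r \<tau> (z - v)\<bar> <= ennreal (g' v * \<bar>h v\<bar>) * ennreal \<bar>dilate r \<tau> (z - v)\<bar>"
    proof (cases "norm (z - v) <= 2 * r")
      case True
      have "g z * \<bar>h v * dilate r \<tau> (z - v)\<bar> <= g' v * \<bar>h v * dilate r \<tau> (z - v)\<bar>"
        using g(1)[OF True] by (intro mult_right_mono) auto
      then show ?thesis using g(2)[of z] g'0[of v]
        by (simp add: abs_mult mult.assoc flip: ennreal_mult)
    next
      case False
      moreover have "norm ((z - v) /\<^sub>R r) = norm (z - v) / r" using r by (simp add: divide_inverse)
      ultimately have "2 < norm ((z - v) /\<^sub>R r)" using r by (simp add: pos_less_divide_eq)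
      then have "dilate r \<tau> (z - v) = 0" by (simp add: dilate_def tau_support)
      then show ?thesis by simp
    qed
  qed
  also have "... = (NBINT v. (NBINT z. ennreal (g' v * \<bar>h v\<bar>) * ennreal \<bar>dilate r \<tau> (z - v)\<bar>))"
    by (rule lborel_pair.Fubini') (use hg in measurable)
  also have "... <= (NBINT v. ennreal (g' v * \<bar>h v\<bar>) * ennreal T)"
    by (intro nn_integral_mono) (simp add: nn_integral_cmult mult_left_mono dilate_tau_norm[OF r])
  also have "... = (NBINT v. ennreal (T * (g' v * \<bar>h v\<bar>)))"
    using T g'0 by (simp add: mult.commute flip: ennreal_mult)
  also have "... = ennreal (LBINT v. T * (g' v * \<bar>h v\<bar>))"
    by (rule nn_integral_eq_integral) (use hg T g'0 in auto)
  finally have le: "(NBINT z. ennreal (g z * \<bar>dilated_conv r \<tau> h z\<bar>)) <= ennreal (T * (LBINT v. g' v * \<bar>h v\<bar>))"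
    by simp
  show int: "integrable lborel (\<lambda>z. g z * dilated_conv r \<tau> h z)"
    using le g(2) by (intro integrableI_bounded) (auto simp: abs_mult top_unique less_top[symmetric])
  have "0 <= T * (LBINT v. g' v * \<bar>h v\<bar>)"
    using T g'0 by (intro mult_nonneg_nonneg integral_nonneg_AE) auto
  then show "(LBINT z. g z * \<bar>dilated_conv r \<tau> h z\<bar>) <= T * (LBINT v. g' v * \<bar>h v\<bar>)"
    using integral_real_bounded[OF _ le] by blast
qed

text \<open>Since \<open>h\<close> has integral zero, \<open>dilate r \<tau> z\<close> may be
  subtracted from the kernel. The translation bound then exchanges the mass of \<open>h\<close> for
  its first moment and gains \<open>1 / r\<close>.\<close>

lemma conv_contraction:
  assumes h: "integrable lborel h" and r: "0 < r"
    and moment: "integrable lborel (\<lambda>v. norm v * \<bar>h v\<bar>)" and zero: "(LBINT v. h v) = 0"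
  shows "(LBINT z. \<bar>dilated_conv r \<tau> h z\<bar>) <= T / r * (LBINT v. norm v * \<bar>h v\<bar>)"
proof -
  have [measurable]: "h \<in> borel_fun" using h by auto
  have "(NBINT z. ennreal \<bar>dilated_conv r \<tau> h z\<bar>)
      <= (NBINT z. (NBINT v. ennreal \<bar>h v\<bar> * ennreal \<bar>dilate r \<tau> (z - v) - dilate r \<tau> z\<bar>))"
  proof (rule nn_integral_mono)
    fix z
    have int: "integrable lborel (\<lambda>v. h v * dilate r \<tau> (z - v))" "integrable lborel (\<lambda>v. h v * dilate r \<tau> z)"
      using conv_integrand[OF h r] h by auto
    have "dilated_conv r \<tau> h z = (LBINT v. h v * dilate r \<tau> (z - v) - h v * dilate r \<tau> z)"
      unfolding dilated_conv_def using int zero by simp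
    also have "... = (LBINT v. h v * (dilate r \<tau> (z - v) - dilate r \<tau> z))"
      by (simp add: right_diff_distrib)
    finally have eq: "dilated_conv r \<tau> h z = ..." .
    have "integrable lborel (\<lambda>v. h v * (dilate r \<tau> (z - v) - dilate r \<tau> z))"
      using Bochner_Integration.integrable_diff[OF int] by (simp add: right_diff_distrib)
    from integral_norm_bound_ennreal[OF this]
    show "ennreal \<bar>dilated_conv r \<tau> h z\<bar> <= (NBINT v. ennreal \<bar>h v\<bar> * ennreal \<bar>dilate r \<tau> (z - v) - dilate r \<tau> z\<bar>)"
      unfolding eq by (simp add: abs_mult ennreal_mult)
  qed
  also have "... = (NBINT v. (NBINT z. ennreal \<bar>h v\<bar> * ennreal \<bar>dilate r \<tau> (z - v) - dilate r \<tau> z\<bar>))"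
    by (rule lborel_pair.Fubini') measurable
  also have "... <= (NBINT v. ennreal \<bar>h v\<bar> * ennreal (T / r * norm v))"
  proof (rule nn_integral_mono)
    fix v
    have "(NBINT z. ennreal \<bar>h v\<bar> * ennreal \<bar>dilate r \<tau> (z - v) - dilate r \<tau> z\<bar>)
        = ennreal \<bar>h v\<bar> * (NBINT z. ennreal \<bar>dilate r \<tau> (z - v) - dilate r \<tau> z\<bar>)"
      by (rule nn_integral_cmult) measurable
    also have "... <= ennreal \<bar>h v\<bar> * ennreal (T / r * norm v)"
      by (intro mult_left_mono dilate_tau_shift r) simp
    finally show "(NBINT z. ennreal \<bar>h v\<bar> * ennreal \<bar>dilate r \<tau> (z - v) - dilate r \<tau> z\<bar>)
        <= ennreal \<bar>h v\<bar> * ennreal (T / r * norm v)" .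
  qed
  also have "... = (NBINT v. ennreal (T / r * (norm v * \<bar>h v\<bar>)))"
    using T r by (simp add: ac_simps flip: ennreal_mult)
  also have "... = ennreal (LBINT v. T / r * (norm v * \<bar>h v\<bar>))"
    by (rule nn_integral_eq_integral) (use moment T r in auto)
  finally have le: "(NBINT z. ennreal \<bar>dilated_conv r \<tau> h z\<bar>) <= ennreal (T / r * (LBINT v. norm v * \<bar>h v\<bar>))"
    by simp
  have "0 <= T / r * (LBINT v. norm v * \<bar>h v\<bar>)"
    using T r by (intro mult_nonneg_nonneg integral_nonneg_AE) auto
  then show ?thesis using integral_real_bounded[OF _ le] by blast
qed

end

locale smoothing_iteration = smoothing_profile \<tau> T for \<tau> :: "real^'d => real" and T +
  fixes h :: "real^'d => real"
  assumes tau_mass: "\<And>r g. 0 < r ==> integrable lborel g ==>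
      (LBINT z. dilated_conv r \<tau> g z) = (LBINT z. g z)"
    and h_integrable: "integrable lborel h"
    and h_moment: "integrable lborel (\<lambda>v. norm v * \<bar>h v\<bar>)"
    and h_zero: "(LBINT v. h v) = 0"
begin

text \<open>With the factor \<open>10 * T\<^sup>2\<close> both \<open>mass\<close> and \<open>moment\<close> decay like \<open>1 / 2 ^ n\<close>.\<close>

definition scale :: "nat => real" where
  "scale n = (10 * T\<^sup>2) ^ n"

primrec iterate :: "nat => real^'d => real" where
  "iterate 0 = h"
| "iterate (Suc n) = dilated_conv (scale n) \<tau> (iterate n)"

lemma scale_ge_1: "1 <= scale n"
proof -
  have "1 <= T\<^sup>2" using T by (simp add: one_le_power)
  then show ?thesis unfolding scale_def by (intro one_le_power) linarith
qed

lemma scale_Suc: "scale (Suc n) = 10 * T\<^sup>2 * scale n"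
  by (simp add: scale_def)

definition mass :: "nat => real" where "mass n = (LBINT v. \<bar>iterate n v\<bar>)"
text \<open>Divided by \<open>scale n\<close> to be comparable with \<open>mass n\<close>: one
  smoothing step displaces mass by at most \<open>2 * scale n\<close>.\<close>

definition moment :: "nat => real" where "moment n = (LBINT v. norm v * \<bar>iterate n v\<bar>) / scale n"

lemma iterate_regular:
  "integrable lborel (iterate n)" (is ?A)
  "integrable lborel (\<lambda>v. norm v * \<bar>iterate n v\<bar>)" (is ?B)
  "(LBINT v. iterate n v) = 0" (is ?C)
proof -
  have "?A \<and> ?B \<and> ?C"
  proof (induction n)
    case 0
    then show ?case using h_integrable h_moment h_zero by simp
  next
    case (Suc n)
    have s: "0 < scale n" using scale_ge_1[of n] by linarith
    have "integrable lborel (\<lambda>z. 1 * dilated_conv (scale n) \<tau> (iterate n) z)"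
      using Suc s by (intro conv_weighted(1)[where g'="\<lambda>_. 1"]) auto
    moreover have "integrable lborel (\<lambda>z. norm z * dilated_conv (scale n) \<tau> (iterate n) z)"
    proof (rule conv_weighted(1)[where g'="\<lambda>v. norm v + 2 * scale n"])
      show "norm z <= norm v + 2 * scale n" if "norm (z - v) <= 2 * scale n" for z v :: "real^'d"
        using that norm_triangle_sub[of z v] by linarith
      show "integrable lborel (\<lambda>v. (norm v + 2 * scale n) * \<bar>iterate n v\<bar>)"
        using Suc by (simp add: distrib_right)
    qed (use Suc s in auto)
    then have "integrable lborel (\<lambda>z. \<bar>norm z * dilated_conv (scale n) \<tau> (iterate n) z\<bar>)"
      by (rule integrable_abs)
    ultimately show ?case using Suc s by (simp add: tau_mass abs_mult)
  qed
  then show ?A ?B ?C by auto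
qed

lemma iterate_measurable [measurable]: "iterate n \<in> borel_fun"
  using iterate_regular(1)[of n] by auto

lemma mass_nonneg: "0 <= mass n" and moment_nonneg: "0 <= moment n"
  using scale_ge_1[of n] by (auto simp: mass_def moment_def intro!: divide_nonneg_nonneg integral_nonneg_AE)

lemma mass_Suc: "mass (Suc n) <= T * moment n"
  using conv_contraction[OF iterate_regular(1) _ iterate_regular(2,3), of "scale n" n] scale_ge_1[of n]
  by (simp add: mass_def moment_def)

text \<open>A step displaces mass by at most \<open>2 * scale n\<close> and multiplies it by at most
  \<open>T\<close>, while the unit of length grows by \<open>10 * T\<^sup>2\<close>.\<close>

lemma moment_Suc: "moment (Suc n) <= (moment n + 2 * mass n) / (10 * T)"
proof -
  have s: "0 < scale n" using scale_ge_1[of n] by linarith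
  have "(LBINT v. norm v * \<bar>iterate (Suc n) v\<bar>)
      <= T * (LBINT v. (norm v + 2 * scale n) * \<bar>iterate n v\<bar>)"
    unfolding iterate.simps
  proof (rule conv_weighted(2))
    show "norm z <= norm v + 2 * scale n" if "norm (z - v) <= 2 * scale n" for z v :: "real^'d"
      using that norm_triangle_sub[of z v] by linarith
    show "integrable lborel (\<lambda>v. (norm v + 2 * scale n) * \<bar>iterate n v\<bar>)"
      using iterate_regular[of n] by (simp add: distrib_right)
  qed (use iterate_regular s in auto)
  also have "(LBINT v. (norm v + 2 * scale n) * \<bar>iterate n v\<bar>) = scale n * (moment n + 2 * mass n)"
    using iterate_regular[of n] s by (simp add: distrib_right distrib_left mass_def moment_def)
  finally have "moment (Suc n) <= T * (scale n * (moment n + 2 * mass n)) / (10 * T\<^sup>2 * scale n)"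
    unfolding moment_def[of "Suc n"] scale_Suc using s by (intro divide_right_mono) auto
  also have "... = (moment n + 2 * mass n) / (10 * T)"
    using s T by (simp add: power2_eq_square)
  finally show ?thesis .
qed

definition bound :: real where "bound = 2 * T * (moment 0 + mass 0)"

lemma decay: "mass n <= bound / 2 ^ n" "moment n <= bound / 2 ^ n"
proof -
  define D where "D = moment 0 + mass 0"
  have D: "0 <= D" using mass_nonneg moment_nonneg by (simp add: D_def)
  \<comment> \<open>The bound for the mass is weaker by \<open>2 * T\<close>:
    \<open>mass_Suc\<close> has the factor \<open>T\<close> and lags one step behind the
    moment.\<close>
  have main: "mass n <= 2 * T * D / 2 ^ n \<and> moment n <= D / 2 ^ n"
  proof (induction n)
    case 0
    have "1 * D <= 2 * T * D" using T D by (intro mult_right_mono) auto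
    then show ?case using mass_nonneg[of 0] moment_nonneg[of 0] by (simp add: D_def)
  next
    case (Suc n)
    have "mass (Suc n) <= T * (D / 2 ^ n)"
      using mass_Suc[of n] Suc T mult_left_mono[of "moment n" "D / 2 ^ n" T] by linarith
    moreover have "moment (Suc n) <= D / 2 ^ Suc n"
    proof -
      have "moment (Suc n) <= (D / 2 ^ n + 2 * (2 * T * D / 2 ^ n)) / (10 * T)"
        using moment_Suc[of n] Suc T by (elim order_trans) (intro divide_right_mono, auto)
      also have "... <= (T * (D / 2 ^ n) + 2 * (2 * T * D / 2 ^ n)) / (10 * T)"
        using T D mult_right_mono[of 1 T "D / 2 ^ n"] by (intro divide_right_mono add_right_mono) auto
      \<comment> \<open>\<open>(T + 4 * T) / (10 * T) = 1 / 2\<close>: this is where the constant 10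
        in \<open>scale\<close> comes from.\<close>
      also have "... = D / 2 ^ Suc n" using T by (simp add: field_simps)
      finally show ?thesis .
    qed
    ultimately show ?case by simp
  qed
  then show "mass n <= bound / 2 ^ n" by (simp add: bound_def D_def)
  have "1 * D <= 2 * T * D" using T D by (intro mult_right_mono) auto
  then have "D / 2 ^ n <= bound / 2 ^ n" by (simp add: bound_def D_def divide_right_mono)
  then show "moment n <= bound / 2 ^ n" using main by linarith
qed

lemma bound_nonneg: "0 <= bound"
  using T mass_nonneg moment_nonneg by (simp add: bound_def)

text \<open>At scales at least 1 the kernel is bounded by \<open>T\<close>, so every iterate except
  the initial one is bounded, however singular the densities are.\<close>

lemma iterate_bound: "\<bar>iterate (Suc n) z\<bar> <= T * bound"
proof -
  have "\<bar>iterate (Suc n) z\<bar> <= T * mass n"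
    using conv_bound[OF iterate_regular(1) scale_ge_1] by (simp add: mass_def)
  also have "... <= T * bound"
  proof (rule mult_left_mono)
    have "bound / 2 ^ n <= bound / 1" using bound_nonneg by (intro divide_left_mono) auto
    then show "mass n <= bound" using decay(1)[of n] by simp
  qed (use T in simp)
  finally show ?thesis .
qed

end

context sphere_measure
begin

text \<open>Evaluating the test function at a corner amounts to convolving \<open>h\<close> with the
  law of that corner. The laws of the three moving corners are bounded, Lipschitz and supported in
  the ball of radius 2, so their combination is a smoothing profile.\<close>

lemma smoothing_profile_exists:
  obtains \<tau> T where "smoothing_profile \<tau> T"
    "\<And>r h \<phi> B. 0 < r ==> integrable lborel h ==> \<phi> \<in> borel_fun ==> (\<And>x. \<bar>\<phi> x\<bar> <= B) ==>
      (LCINT c. corner_weight r c * (h (fst c) * pair_gradient \<phi> c))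
        = (LBINT z. \<phi> z * (dilated_conv r \<tau> h z - h z))"
    "\<And>r h \<phi> B. 0 < r ==> integrable lborel h ==> \<phi> \<in> borel_fun ==> (\<And>x. \<bar>\<phi> x\<bar> <= B) ==>
      integrable coll (\<lambda>c. corner_weight r c * (h (fst c) * pair_gradient \<phi> c))"
proof -
  let ?d = "CARD('d)"
  obtain a where a: "0 <= a" "\<And>F. F \<in> borel_fun ==>
    (NSINT u. (NBINT y. ennreal (rect y u) * F ((y \<bullet> u) *\<^sub>R u)))
      = (NBINT x. ennreal (a * bump (?d + 2) (norm x)) * F x)"
    by (rule par_law) blast
  obtain b where b: "0 <= b" "\<And>F. F \<in> borel_fun ==>
    (NSINT u. (NBINT y. ennreal (rect y u) * F (perp u y)))
      = (NBINT x. ennreal (b * bump (2 * ?d - 1) (norm x)) * F x)"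
    by (rule perp_law) blast
  note m = rect_mass_pos
  define S where "S = measure s UNIV"
  have S: "0 <= S" by (simp add: S_def)
  have space_s: "space s = UNIV" by (simp add: sets_eq_imp_space_eq[OF sets_s])
  define \<rho>1 where "\<rho>1 x = a * bump (?d + 2) (norm x) / rect_mass" for x :: "real^'d"
  define \<rho>2 where "\<rho>2 x = b * bump (2 * ?d - 1) (norm x) / rect_mass" for x :: "real^'d"
  define \<rho>3 where "\<rho>3 x = (\<integral>u. rect x u \<partial>s) / rect_mass" for x :: "real^'d"
  have rho_meas [measurable]: "\<rho>1 \<in> borel_fun" "\<rho>2 \<in> borel_fun" "\<rho>3 \<in> borel_fun"
    unfolding \<rho>1_def \<rho>2_def \<rho>3_def by measurable
  have rect_int: "integrable s (\<lambda>u. rect x u)" for x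
    by (rule integrable_const_bound[where B=1]) (simp_all add: rect_bounds)
  have rho_nonneg: "0 <= \<rho>1 x" "0 <= \<rho>2 x" "0 <= \<rho>3 x" for x
    using m a b by (auto simp: \<rho>1_def \<rho>2_def \<rho>3_def bump_bounds rect_bounds intro!: divide_nonneg_nonneg integral_nonneg_AE)
  have factor: "(NSINT u. (NBINT y. ennreal (rect y u / rect_mass) * G u y))
      = ennreal (1 / rect_mass) * (NSINT u. (NBINT y. ennreal (rect y u) * G u y))"
    if [measurable]: "case_prod G \<in> borel_measurable (borel \<Otimes>\<^sub>M borel)" for G
  proof -
    have "ennreal (rect y u / rect_mass) = ennreal (1 / rect_mass) * ennreal (rect y u)" for y u :: "real^'d"
      using m by (simp add: rect_bounds flip: ennreal_mult)
    then show ?thesis by (simp add: mult.assoc nn_integral_cmult)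
  qed
  have scale: "ennreal (1 / rect_mass) * (NBINT x. ennreal (c * bump n (norm x)) * F x)
      = (NBINT x. ennreal (c * bump n (norm x) / rect_mass) * F x)"
    if [measurable]: "F \<in> borel_fun" and "0 <= c" for F :: "real^'d => ennreal" and c n
  proof -
    have "ennreal (c * bump n (norm x) / rect_mass) = ennreal (1 / rect_mass) * ennreal (c * bump n (norm x))" for x :: "real^'d"
      using m \<open>0 <= c\<close> by (simp add: bump_bounds flip: ennreal_mult)
    then show ?thesis by (simp add: mult.assoc nn_integral_cmult)
  qed
  have law1: "(NSINT u. (NBINT y. ennreal (rect y u / rect_mass) * F ((y \<bullet> u) *\<^sub>R u)))
      = (NBINT x. ennreal (\<rho>1 x) * F x)"
    if [measurable]: "F \<in> borel_fun" for F
    unfolding \<rho>1_def using a that by (subst factor) (simp_all add: scale)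
  have law2: "(NSINT u. (NBINT y. ennreal (rect y u / rect_mass) * F (perp u y)))
      = (NBINT x. ennreal (\<rho>2 x) * F x)"
    if [measurable]: "F \<in> borel_fun" for F
    unfolding \<rho>2_def using b that by (subst factor) (simp_all add: scale)
  have law3: "(NSINT u. (NBINT y. ennreal (rect y u / rect_mass) * F y))
      = (NBINT x. ennreal (\<rho>3 x) * F x)"
    if [measurable]: "F \<in> borel_fun" for F
  proof -
    interpret ps: pair_sigma_finite s "lborel :: (real^'d) measure" ..
    have "(NSINT u. (NBINT y. ennreal (rect y u / rect_mass) * F y))
        = (NBINT y. (NSINT u. ennreal (rect y u / rect_mass) * F y))"
      by (rule ps.Fubini'[symmetric]) measurable
    also have "... = (NBINT x. ennreal (\<rho>3 x) * F x)"
    proof (rule nn_integral_cong)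
      fix x :: "real^'d"
      have "(NSINT u. ennreal (rect x u / rect_mass)) = ennreal (\<rho>3 x)"
        unfolding \<rho>3_def using rect_int[of x] m
        by (subst nn_integral_eq_integral) (auto simp: rect_bounds)
      then show "(NSINT u. ennreal (rect x u / rect_mass) * F x) = ennreal (\<rho>3 x) * F x"
        by (simp add: nn_integral_multc)
    qed
    finally show ?thesis .
  qed
  \<comment> \<open>Signs as in the gradient: the two outgoing corners gain and the opposite
    incoming corner loses. The loss at the base corner is the term \<open>- h z\<close>.\<close>
  define \<tau> where "\<tau> x = \<rho>1 x + \<rho>2 x - \<rho>3 x" for x
  define B where "B = (a + b + S) / rect_mass"
  define L where "L = (a * real (?d + 4) + b * real (2 * ?d + 1) + S * real (8 * ?d + 8)) / rect_mass"
  define V where "V = measure lborel (cball (0::real^'d) 2)"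
  have BL: "0 <= B" "0 <= L" "0 <= V" using m a b S by (auto simp: B_def L_def V_def)
  have rho1_bd: "\<rho>1 x <= a / rect_mass" and rho2_bd: "\<rho>2 x <= b / rect_mass" for x
    using m a b by (auto simp: \<rho>1_def \<rho>2_def bump_bounds mult_left_le intro!: divide_right_mono)
  have rho3_bd: "\<rho>3 x <= S / rect_mass" for x
  proof -
    have "(\<integral>u. rect x u \<partial>s) <= (\<integral>u. 1 \<partial>s)"
      using rect_int[of x] by (intro integral_mono) (auto simp: rect_bounds)
    then show ?thesis using m by (simp add: \<rho>3_def S_def space_s divide_right_mono)
  qed
  have tau_bd: "\<bar>\<tau> x\<bar> <= B" for x
    using rho_nonneg[of x] rho1_bd[of x] rho2_bd[of x] rho3_bd[of x]
    by (simp add: \<tau>_def B_def add_divide_distrib)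
  have tau_supp: "\<tau> x = 0" if x: "2 < norm x" for x
  proof -
    have "\<rho>1 x = 0" "\<rho>2 x = 0" using x by (simp_all add: \<rho>1_def \<rho>2_def bump_eq_0)
    moreover have "(\<integral>u. rect x u \<partial>s) = (\<integral>u. 0 \<partial>s)"
    proof (rule integral_cong_AE)
      show "AE u in s. rect x u = 0" using norm_s by eventually_elim (simp add: rect_eq_0 x)
    qed measurable
    ultimately show ?thesis by (simp add: \<tau>_def \<rho>3_def)
  qed
  have tau_lip: "\<bar>\<tau> x - \<tau> z\<bar> <= L * norm (x - z)" for x z
  proof -
    have nn: "\<bar>norm x - norm z\<bar> <= norm (x - z)" by (rule norm_triangle_ineq3)
    have bump_lip: "\<bar>c * bump n (norm x) / rect_mass - c * bump n (norm z) / rect_mass\<bar>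
        <= c * real (n + 2) / rect_mass * norm (x - z)" if "0 <= c" for c n
    proof -
      have "\<bar>c * bump n (norm x) / rect_mass - c * bump n (norm z) / rect_mass\<bar>
          = c / rect_mass * \<bar>bump n (norm x) - bump n (norm z)\<bar>"
        using m \<open>0 <= c\<close> by (simp add: abs_mult flip: right_diff_distrib diff_divide_distrib)
      also have "... <= c / rect_mass * (real (n + 2) * norm (x - z))"
        using m \<open>0 <= c\<close>
        by (intro mult_left_mono order_trans[OF bump_lipschitz mult_left_mono[OF nn]]) auto
      finally show ?thesis by simp
    qed
    have "\<bar>(\<integral>u. rect x u \<partial>s) - (\<integral>u. rect z u \<partial>s)\<bar> = \<bar>\<integral>u. rect x u - rect z u \<partial>s\<bar>"
      using rect_int by simp
    also have "... <= (\<integral>u. \<bar>rect x u - rect z u\<bar> \<partial>s)" by (rule integral_abs_bound)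
    also have "... <= (\<integral>u. real (8 * ?d + 8) * norm (x - z) \<partial>s)"
      by (rule integral_mono_AE) (use rect_int norm_s rect_lipschitz in \<open>auto elim!: eventually_mono\<close>)
    also have "... = S * real (8 * ?d + 8) * norm (x - z)" by (simp add: S_def space_s)
    finally have "\<bar>\<rho>3 x - \<rho>3 z\<bar> <= S * real (8 * ?d + 8) / rect_mass * norm (x - z)"
      using m by (simp add: \<rho>3_def divide_right_mono flip: diff_divide_distrib)
    moreover have "\<bar>\<rho>1 x - \<rho>1 z\<bar> <= a * real (?d + 4) / rect_mass * norm (x - z)"
    proof -
      have "?d + 2 + 2 = ?d + 4" by simp
      from bump_lip[OF a(1), of "?d + 2", unfolded this] show ?thesis unfolding \<rho>1_def .
    qed
    moreover have "\<bar>\<rho>2 x - \<rho>2 z\<bar> <= b * real (2 * ?d + 1) / rect_mass * norm (x - z)"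
    proof -
      have "2 * ?d - 1 + 2 = 2 * ?d + 1" using dim by simp
      from bump_lip[OF b(1), of "2 * ?d - 1", unfolded this] show ?thesis unfolding \<rho>2_def .
    qed
    ultimately show ?thesis
      by (simp add: \<tau>_def L_def add_divide_distrib distrib_right)
  qed
  have [measurable]: "\<tau> \<in> borel_fun" unfolding \<tau>_def by measurable
  \<comment> \<open>Covers all requirements at once: 1, the supremum \<open>B\<close>, the L1 norm
    \<open>B * V\<close> and the translation modulus \<open>2 * L * V\<close>.\<close>
  define T where "T = 1 + B + B * V + 2 * L * V"
  have "smoothing_profile \<tau> T"
  proof
    show "1 <= T" using BL by (simp add: T_def)
    show "\<bar>\<tau> x\<bar> <= T" for x
    proof -
      have "0 <= B * V + 2 * L * V" using BL by simp
      then show ?thesis using tau_bd[of x] unfolding T_def by linarith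
    qed
    show "\<tau> x = 0" if "2 < norm x" for x using that by (rule tau_supp)
    have "(NBINT x. ennreal \<bar>\<tau> x\<bar>) <= (NBINT x. ennreal B * indicator (cball (0::real^'d) 2) x)"
      by (intro nn_integral_mono) (auto simp: indicator_def tau_bd tau_supp not_le intro!: ennreal_leI)
    also have "... = ennreal B * emeasure lborel (cball (0::real^'d) 2)"
      by (rule nn_integral_cmult_indicator) simp
    also have "... = ennreal (B * V)"
      using BL emeasure_lborel_cball_finite[of "0::real^'d" 2]
      by (simp add: V_def emeasure_eq_ennreal_measure ennreal_mult)
    also have "... <= ennreal T" using BL by (intro ennreal_leI) (simp add: T_def)
    finally show "(NBINT x. ennreal \<bar>\<tau> x\<bar>) <= ennreal T" .
    fix z :: "real^'d"
    have "(NBINT x. ennreal \<bar>\<tau> (x - z) - \<tau> x\<bar>) <= ennreal (2 * L * V * norm z)"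
      unfolding V_def by (rule lipschitz_translation) (use tau_lip tau_supp in auto)
    also have "... <= ennreal (T * norm z)"
      using BL by (intro ennreal_leI mult_right_mono) (simp_all add: T_def)
    finally show "(NBINT x. ennreal \<bar>\<tau> (x - z) - \<tau> x\<bar>) <= ennreal (T * norm z)" .
  qed measurable
  moreover have
    "(LCINT c. corner_weight r c * (h (fst c) * pair_gradient \<phi> c))
      = (LBINT z. \<phi> z * (dilated_conv r \<tau> h z - h z))" (is ?I)
    "integrable coll (\<lambda>c. corner_weight r c * (h (fst c) * pair_gradient \<phi> c))" (is ?J)
    if r: "0 < r" and h: "integrable lborel h" and \<phi> [measurable]: "\<phi> \<in> borel_fun"
      and \<phi>B: "\<And>x. \<bar>\<phi> x\<bar> <= B'" for r h \<phi> B'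
  proof -
    note c1 = corner_integral[where X="\<lambda>c. fst (snd (snd c))" and K="\<lambda>u y. (y \<bullet> u) *\<^sub>R u" and \<rho>=\<rho>1,
        OF _ _ rho_meas(1) \<phi> rho_nonneg(1) r law1 _ h \<phi>B]
    note c2 = corner_integral[where X="\<lambda>c. snd (snd (snd c))" and K="\<lambda>u y. perp u y" and \<rho>=\<rho>2,
        OF _ _ rho_meas(2) \<phi> rho_nonneg(2) r law2 _ h \<phi>B]
    note c3 = corner_integral[where X="\<lambda>c. fst (snd c)" and K="\<lambda>u y. y" and \<rho>=\<rho>3,
        OF _ _ rho_meas(3) \<phi> rho_nonneg(3) r law3 _ h \<phi>B]
    note c4 = corner_integral_base[OF \<phi> r h \<phi>B]
    have split: "corner_weight r c * (h (fst c) * pair_gradient \<phi> c)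
        = corner_weight r c * (h (fst c) * \<phi> (fst (snd (snd c)))) + corner_weight r c * (h (fst c) * \<phi> (snd (snd (snd c))))
          - corner_weight r c * (h (fst c) * \<phi> (fst c)) - corner_weight r c * (h (fst c) * \<phi> (fst (snd c)))" for c
      by (simp add: pair_gradient_eq algebra_simps)
    have int: "integrable coll (\<lambda>c. corner_weight r c * (h (fst c) * \<phi> (fst (snd (snd c)))))"
      "integrable coll (\<lambda>c. corner_weight r c * (h (fst c) * \<phi> (snd (snd (snd c)))))"
      "integrable coll (\<lambda>c. corner_weight r c * (h (fst c) * \<phi> (fst (snd c))))"
      by (rule c1(1) c2(1) c3(1); simp)+
    show ?J unfolding split using int c4(1) by simp
    have conv: "dilated_conv r \<tau> h z = dilated_conv r \<rho>1 h z + dilated_conv r \<rho>2 h z - dilated_conv r \<rho>3 h z" for z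
    proof -
      have i: "integrable lborel (\<lambda>v. h v * dilate r \<rho>1 (z - v))" "integrable lborel (\<lambda>v. h v * dilate r \<rho>2 (z - v))"
        "integrable lborel (\<lambda>v. h v * dilate r \<rho>3 (z - v))"
        using rho1_bd rho2_bd rho3_bd rho_nonneg r
        by (auto intro!: dilated_conv_integrand[OF h])
      have "h v * dilate r \<tau> (z - v) = h v * dilate r \<rho>1 (z - v) + h v * dilate r \<rho>2 (z - v) - h v * dilate r \<rho>3 (z - v)" for v
        by (simp add: dilate_def \<tau>_def add_divide_distrib diff_divide_distrib algebra_simps)
      then show ?thesis unfolding dilated_conv_def using i by simp
    qed
    have int': "integrable lborel (\<lambda>z. \<phi> z * dilated_conv r \<rho>1 h z)" "integrable lborel (\<lambda>z. \<phi> z * dilated_conv r \<rho>2 h z)"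
      "integrable lborel (\<lambda>z. \<phi> z * dilated_conv r \<rho>3 h z)"
      by (rule c1(3) c2(3) c3(3); simp)+
    have int4: "integrable lborel (\<lambda>z. \<phi> z * h z)"
    proof -
      have "integrable lborel (\<lambda>z. h z * \<phi> z)"
        by (rule integrable_mult_bounded[OF h _ \<phi>B]) simp
      then show ?thesis by (simp add: mult.commute)
    qed
    have "(LCINT c. corner_weight r c * (h (fst c) * pair_gradient \<phi> c))
      = (LCINT c. corner_weight r c * (h (fst c) * \<phi> (fst (snd (snd c)))))
        + (LCINT c. corner_weight r c * (h (fst c) * \<phi> (snd (snd (snd c)))))
        - (LCINT c. corner_weight r c * (h (fst c) * \<phi> (fst c)))
        - (LCINT c. corner_weight r c * (h (fst c) * \<phi> (fst (snd c))))"
      unfolding split using int c4(1) by simp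
    also have "(LCINT c. corner_weight r c * (h (fst c) * \<phi> (fst (snd (snd c))))) = (LBINT z. \<phi> z * dilated_conv r \<rho>1 h z)"
      by (rule c1(2)) simp_all
    also have "(LCINT c. corner_weight r c * (h (fst c) * \<phi> (snd (snd (snd c))))) = (LBINT z. \<phi> z * dilated_conv r \<rho>2 h z)"
      by (rule c2(2)) simp_all
    also have "(LCINT c. corner_weight r c * (h (fst c) * \<phi> (fst (snd c)))) = (LBINT z. \<phi> z * dilated_conv r \<rho>3 h z)"
      by (rule c3(2)) simp_all
    also have "(LCINT c. corner_weight r c * (h (fst c) * \<phi> (fst c))) = (LBINT z. \<phi> z * h z)" by (rule c4(2))
    finally show ?I
      unfolding conv using int' int4 by (simp add: algebra_simps)
  qed
  ultimately show ?thesis by (rule that) blast+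
qed

end

section \<open>Entropy estimates with the positive part of the logarithm\<close>

definition lnp :: "real => real" where "lnp x = max 0 (ln x)"

lemma lnp_measurable [measurable]: "lnp \<in> borel_fun"
  unfolding lnp_def by measurable

lemma lnp_nonneg: "0 <= lnp x" by (simp add: lnp_def)

lemma lnp_mono: "0 <= x ==> x <= y ==> lnp x <= lnp y"
  by (cases "x = 0") (auto simp: lnp_def max_def)

lemma lnp_mult: "0 <= x ==> 0 <= y ==> lnp (x * y) <= lnp x + lnp y"
  by (cases "x = 0 \<or> y = 0") (auto simp: lnp_def ln_mult)

lemma lnp_ge_1: "1 <= x ==> lnp x = ln x"
  by (simp add: lnp_def)

text \<open>Compare with the largest term: the sum is at most \<open>card I\<close> times it, and
  the logarithm of \<open>card I\<close> splits off by subadditivity.\<close>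

lemma sum_lnp_le:
  fixes A :: "'i => real"
  assumes "finite I" "I ~= {}" and A: "\<And>i. i \<in> I ==> 0 <= A i" and m: "0 <= m"
  shows "(\<Sum>i\<in>I. A i) * lnp ((\<Sum>i\<in>I. A i) * m)
    <= real (card I) * (\<Sum>i\<in>I. A i * (ln (real (card I)) + lnp (A i * m)))"
proof -
  obtain j where j: "j \<in> I" "\<And>i. i \<in> I ==> A i <= A j"
    using finite_imageI[OF assms(1), of A] assms(2) Max_in[of "A ` I"] Max_ge[of "A ` I"]
    by (metis (no_types, lifting) image_iff image_is_empty imageI)
  let ?c = "real (card I)"
  have c: "1 <= ?c" using assms(1,2) by (simp add: Suc_le_eq card_gt_0_iff)
  have S: "0 <= (\<Sum>i\<in>I. A i)" "(\<Sum>i\<in>I. A i) <= ?c * A j"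
    using A j sum_bounded_above[of I A "A j"] by (auto intro: sum_nonneg)
  have "(\<Sum>i\<in>I. A i) * lnp ((\<Sum>i\<in>I. A i) * m) <= (?c * A j) * lnp (?c * (A j * m))"
  proof (rule mult_mono[OF S(2) lnp_mono])
    show "(\<Sum>i\<in>I. A i) * m <= ?c * (A j * m)"
      using mult_right_mono[OF S(2) m] by (simp add: mult.assoc)
  qed (use S m c A[OF j(1)] in \<open>auto simp: lnp_nonneg\<close>)
  also have "... <= (?c * A j) * (ln ?c + lnp (A j * m))"
    using lnp_mult[of ?c "A j * m"] c A[OF j(1)] m by (intro mult_left_mono) (auto simp: lnp_ge_1)
  also have "... <= ?c * (\<Sum>i\<in>I. A i * (ln ?c + lnp (A i * m)))"
  proof -
    have "A j * (ln ?c + lnp (A j * m)) <= (\<Sum>i\<in>I. A i * (ln ?c + lnp (A i * m)))"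
      using c A by (intro member_le_sum[OF j(1) _ assms(1)] mult_nonneg_nonneg) (auto simp: lnp_nonneg)
    then show ?thesis using c by (simp add: mult.assoc)
  qed
  finally show ?thesis .
qed

text \<open>The five terms will be those of a flux: one for each corner in the bottom layer, and the
  sum of all other layers.\<close>

lemma five_lnp_le:
  fixes a b c d e m :: real
  assumes "0 <= a" "0 <= b" "0 <= c" "0 <= d" "0 <= e" "0 <= m"
  shows "(a + b + c + d + e) * lnp ((a + b + c + d + e) * m)
    <= 5 * (a * (ln 5 + lnp (a * m)) + b * (ln 5 + lnp (b * m)) + c * (ln 5 + lnp (c * m))
        + d * (ln 5 + lnp (d * m)) + e * (ln 5 + lnp (e * m)))"
proof -
  define A where "A i = [a, b, c, d, e] ! i" for i
  have I: "{..<5::nat} = {0, 1, 2, 3, 4}" by auto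
  have "(\<Sum>i<5. A i) * lnp ((\<Sum>i<5. A i) * m)
    <= real (card {..<5::nat}) * (\<Sum>i<5. A i * (ln (real (card {..<5::nat})) + lnp (A i * m)))"
    by (rule sum_lnp_le) (use assms in \<open>auto simp: A_def I\<close>)
  then show ?thesis by (simp add: A_def I add.assoc[symmetric] del: One_nat_def)
qed

text \<open>Separates the logarithm of the scale from a term linear in \<open>x / s\<close>, which
  is the kind of term that \<open>moment\<close> controls.\<close>

lemma ln_dilated_bound:
  fixes x s :: real
  assumes "0 <= x" "1 <= s"
  shows "ln (1 + x + 2 * s) <= ln s + 2 + x / s"
proof -
  have "1 + x + 2 * s <= s * (1 + (2 + x / s))" using assms by (simp add: field_simps)
  then have "ln (1 + x + 2 * s) <= ln (s * (1 + (2 + x / s)))"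
    using assms by (intro ln_mono) auto
  also have "... = ln s + ln (1 + (2 + x / s))"
    using assms by (intro ln_mult_pos) (auto intro!: add_pos_nonneg)
  also have "ln (1 + (2 + x / s)) <= 2 + x / s"
    using assms by (intro ln_add_one_self_le_self) auto
  finally show ?thesis by simp
qed

section \<open>Symmetry, support and marginals of the rectangle weights\<close>

context sphere_measure
begin

lemma corner_weight_symmetric:
  "corner_weight r (w, v, v', w') = corner_weight r (v, w, v', w')"
  "corner_weight r (v, w, w', v') = corner_weight r (v, w, v', w')"
  "corner_weight r (v', w', v, w) = corner_weight r (v, w, v', w')"
  by (simp_all add: corner_weight_def Let_def norm_minus_commute ac_simps)

lemma corner_weight_nonneg: "0 < r ==> 0 <= corner_weight r c"
  using rect_mass_pos by (auto simp: corner_weight_def Let_def side_bounds split: prod.split)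

lemma corner_weight_le: "1 <= r ==> corner_weight r c <= 1 / (rect_mass * r)"
proof -
  assume r: "1 <= r"
  obtain v w v' w' where c: "c = (v, w, v', w')" by (metis prod.exhaust)
  let ?f = "\<lambda>x. side CARD('d) (norm (x::real^'d) / r)"
  have "?f (v' - v) * ?f (w' - v) * ?f (v' - w) * ?f (w' - w) <= 1"
    by (intro mult_le_one mult_nonneg_nonneg side_bounds)
  then have "corner_weight r c <= 1 / (rect_mass * r ^ Suc CARD('d))"
    unfolding corner_weight_def Let_def c prod.case
    using rect_mass_pos r by (intro divide_right_mono) auto
  also have "... <= 1 / (rect_mass * r)"
  proof (rule divide_left_mono)
    have "r ^ 1 <= r ^ Suc CARD('d)" using r by (intro power_increasing) auto
    then show "rect_mass * r <= rect_mass * r ^ Suc CARD('d)" using rect_mass_pos by simp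
  qed (use rect_mass_pos r in auto)
  finally show ?thesis .
qed

lemma corner_weight_support:
  assumes "corner_weight r (v, w, v', w') ~= 0" and r: "0 < r"
  shows "norm (v' - v) < r" "norm (w' - v) < r" "norm (v' - w) < r" "norm (w' - w) < r"
proof -
  have "norm (x::real^'d) < r" if "side CARD('d) (norm x / r) ~= 0" for x
    using that side_eq_0[of "norm x / r" "CARD('d)"] r
    by (cases "r <= norm x") (auto simp: field_simps)
  then show "norm (v' - v) < r" "norm (w' - v) < r" "norm (v' - w) < r" "norm (w' - w) < r"
    using assms by (auto simp: corner_weight_def Let_def)
qed

lemma swap_measurable [measurable]:
  "(\<lambda>(v, w, v', w'). (w, v, w', v')) \<in> borel_measurable (borel :: ((real^'d) \<times> (real^'d) \<times> (real^'d) \<times> (real^'d)) measure)"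
  "(\<lambda>(v, w, v', w'). (v', w', v, w)) \<in> borel_measurable (borel :: ((real^'d) \<times> (real^'d) \<times> (real^'d) \<times> (real^'d)) measure)"
  unfolding borel_prod[symmetric] by measurable

lemma nn_integral_coll_swap:
  assumes [measurable]: "F \<in> borel_fun"
  shows "(NCINT c. F (case c of (v, w, v', w') => (w, v, w', v'))) = (NCINT c. F c)"
    and "(NCINT c. F (case c of (v, w, v', w') => (v', w', v, w))) = (NCINT c. F c)"
proof -
  have "(NCINT c. F c) = (\<integral>\<^sup>+c. F c \<partial>distr coll borel (\<lambda>(v, w, v', w'). (w, v, w', v')))"
    by (simp add: coll_swap)
  then show "(NCINT c. F (case c of (v, w, v', w') => (w, v, w', v'))) = (NCINT c. F c)"
    by (simp add: nn_integral_distr)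
  have "(NCINT c. F c) = (\<integral>\<^sup>+c. F c \<partial>distr coll borel (\<lambda>(v, w, v', w'). (v', w', v, w)))"
    by (simp add: coll_reverse)
  then show "(NCINT c. F (case c of (v, w, v', w') => (v', w', v, w))) = (NCINT c. F c)"
    by (simp add: nn_integral_distr)
qed

lemma integral_coll_swap:
  fixes F :: "(real^'d) \<times> (real^'d) \<times> (real^'d) \<times> (real^'d) => real"
  assumes F: "integrable coll F"
  shows "integrable coll (\<lambda>c. F (case c of (v, w, v', w') => (w, v, w', v')))"
    and "(LCINT c. F (case c of (v, w, v', w') => (w, v, w', v'))) = (LCINT c. F c)"
    and "integrable coll (\<lambda>c. F (case c of (v, w, v', w') => (v', w', v, w)))"
    and "(LCINT c. F (case c of (v, w, v', w') => (v', w', v, w))) = (LCINT c. F c)"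
proof -
  have [measurable]: "F \<in> borel_fun" using F by (auto simp: measurable_cong_sets[OF sets_coll refl] dest: borel_measurable_integrable)
  show "integrable coll (\<lambda>c. F (case c of (v, w, v', w') => (w, v, w', v')))"
    using F by (subst (asm) coll_swap[symmetric]) (simp add: integrable_distr_eq)
  show "integrable coll (\<lambda>c. F (case c of (v, w, v', w') => (v', w', v, w)))"
    using F by (subst (asm) coll_reverse[symmetric]) (simp add: integrable_distr_eq)
  show "(LCINT c. F (case c of (v, w, v', w') => (w, v, w', v'))) = (LCINT c. F c)"
    by (subst (2) coll_swap[symmetric]) (simp add: integral_distr)
  show "(LCINT c. F (case c of (v, w, v', w') => (v', w', v, w))) = (LCINT c. F c)"
    by (subst (2) coll_reverse[symmetric]) (simp add: integral_distr)
qed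

text \<open>The base corner is Lebesgue distributed by \<open>nn_integral_corner_weight\<close>.
  Exchanging the particles and reversing the collision carry it to the other corners and leave both
  \<open>coll\<close> and the weight unchanged.\<close>

lemma corner_marginal:
  fixes H :: "real^'d => ennreal"
  assumes [measurable]: "H \<in> borel_fun" and r: "0 < r"
  shows "(NCINT c. ennreal (corner_weight r c) * H (fst c)) = (NBINT v. H v)" (is "?L1 = _")
    and "(NCINT c. ennreal (corner_weight r c) * H (fst (snd c))) = (NBINT v. H v)"
    and "(NCINT c. ennreal (corner_weight r c) * H (fst (snd (snd c)))) = (NBINT v. H v)"
    and "(NCINT c. ennreal (corner_weight r c) * H (snd (snd (snd c)))) = (NBINT v. H v)"
proof -
  show 1: "?L1 = (NBINT v. H v)"
    by (subst nn_integral_corner_weight[OF _ r]) (simp_all add: nn_integral_multc rect_law_mass)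
  have swapw: "corner_weight r (case c of (v, w, v', w') => (w, v, w', v')) = corner_weight r c"
    "corner_weight r (case c of (v, w, v', w') => (v', w', v, w)) = corner_weight r c" for c
    by (auto simp: corner_weight_symmetric split: prod.split)
  have corners: "fst (case c of (v, w, v', w') => (w, v, w', v')) = fst (snd c)"
    "fst (case c of (v, w, v', w') => (v', w', v, w)) = fst (snd (snd c))"
    "fst (snd (case c of (v, w, v', w') => (v', w', v, w))) = snd (snd (snd c))"
    for c :: "(real^'d) \<times> (real^'d) \<times> (real^'d) \<times> (real^'d)"
    by (auto split: prod.split)
  show 2: "(NCINT c. ennreal (corner_weight r c) * H (fst (snd c))) = (NBINT v. H v)"
    using nn_integral_coll_swap(1)[of "\<lambda>c. ennreal (corner_weight r c) * H (fst c)"] 1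
    unfolding swapw corners by simp
  show "(NCINT c. ennreal (corner_weight r c) * H (fst (snd (snd c)))) = (NBINT v. H v)"
    using nn_integral_coll_swap(2)[of "\<lambda>c. ennreal (corner_weight r c) * H (fst c)"] 1
    unfolding swapw corners by simp
  show "(NCINT c. ennreal (corner_weight r c) * H (snd (snd (snd c)))) = (NBINT v. H v)"
    using nn_integral_coll_swap(2)[of "\<lambda>c. ennreal (corner_weight r c) * H (fst (snd c))"] 2
    unfolding swapw corners by simp
qed

end

section \<open>Fluxes with prescribed divergence\<close>

type_synonym 'd quad = "(real^'d) \<times> (real^'d) \<times> (real^'d) \<times> (real^'d)"

text \<open>\<open>m\<close> is meant to be the reciprocal of a reference density, so that the
  entropy of a flux relative to a path bounded below by that density is controlled by
  \<open>p * m * m\<close>. The bound on \<open>lnp (m x)\<close> expresses polynomial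
  tails.\<close>

locale steering = sphere_measure s + smoothing_iteration \<tau> T "\<lambda>v. f0 v - f1 v"
  for s :: "(real^'d) measure" and \<tau> T and f0 f1 :: "real^'d => real" +
  fixes m :: "real^'d => real" and K :: real
  assumes divergence: "\<And>r g \<phi> B. 0 < r ==> integrable lborel g ==> \<phi> \<in> borel_fun ==> (\<And>x. \<bar>\<phi> x\<bar> <= B) ==>
      (LCINT c. corner_weight r c * (g (fst c) * pair_gradient \<phi> c))
        = (LBINT z. \<phi> z * (dilated_conv r \<tau> g z - g z))"
    and divergence_integrable: "\<And>r g \<phi> B. 0 < r ==> integrable lborel g ==> \<phi> \<in> borel_fun ==> (\<And>x. \<bar>\<phi> x\<bar> <= B) ==>
      integrable coll (\<lambda>c. corner_weight r c * (g (fst c) * pair_gradient \<phi> c))"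
    and f_measurable [measurable]: "f0 \<in> borel_fun" "f1 \<in> borel_fun"
    and f_nonneg: "\<And>x. 0 <= f0 x" "\<And>x. 0 <= f1 x"
    and f_entropy: "(NBINT x. ennreal (f0 x * lnp (f0 x))) < \<infinity>"
      "(NBINT x. ennreal (f1 x * lnp (f1 x))) < \<infinity>"
    and m_measurable [measurable]: "m \<in> borel_fun"
    and m_nonneg: "\<And>x. 0 <= m x" and K: "0 <= K"
    and m_growth: "\<And>x. lnp (m x) <= K * (1 + ln (1 + norm x))"
begin

text \<open>Collisions carry away the positive part of \<open>iterate n\<close> and reversed
  collisions the negative part, so the layer is nonnegative. Each part is shared between the two
  particles of a pair, whence the division by two and the swap symmetry.\<close>

definition layer :: "nat => 'd quad => real" where
  "layer n = (\<lambda>(v, w, v', w'). corner_weight (scale n) (v, w, v', w') *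
     (max 0 (iterate n v) + max 0 (iterate n w) + max 0 (- iterate n v') + max 0 (- iterate n w')) / 2)"

lemma layer_eq: "layer n c = corner_weight (scale n) c * (max 0 (iterate n (fst c)) + max 0 (iterate n (fst (snd c)))
    + max 0 (- iterate n (fst (snd (snd c)))) + max 0 (- iterate n (snd (snd (snd c))))) / 2"
  by (simp add: layer_def split_beta)

lemma layer_measurable [measurable]: "layer n \<in> borel_fun"
  unfolding layer_eq by measurable

lemma scale_pos: "0 < scale n" using scale_ge_1[of n] by linarith

lemma layer_nonneg: "0 <= layer n c"
  unfolding layer_eq using corner_weight_nonneg[OF scale_pos] by (intro divide_nonneg_nonneg mult_nonneg_nonneg) auto

lemma layer_symmetric:
  "layer n (w, v, v', w') = layer n (v, w, v', w')" "layer n (v, w, w', v') = layer n (v, w, v', w')"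
  by (simp_all add: layer_def corner_weight_symmetric ac_simps)

text \<open>Every corner is Lebesgue distributed, so two halves of the positive part and two halves
  of the negative part add up to the absolute value.\<close>

lemma nn_integral_layer_weighted:
  fixes G :: "real^'d => real"
  assumes [measurable]: "G \<in> borel_fun" and G: "\<And>x. 0 <= G x"
  shows "(NCINT c. ennreal (corner_weight (scale n) c * (max 0 (iterate n (fst c)) * G (fst c)
      + max 0 (iterate n (fst (snd c))) * G (fst (snd c))
      + max 0 (- iterate n (fst (snd (snd c)))) * G (fst (snd (snd c)))
      + max 0 (- iterate n (snd (snd (snd c)))) * G (snd (snd (snd c)))) / 2))
    = (NBINT v. ennreal (\<bar>iterate n v\<bar> * G v))"
proof -
  let ?Z = "corner_weight (scale n)"
  let ?p = "\<lambda>v. ennreal (max 0 (iterate n v) * G v / 2)" and ?q = "\<lambda>v. ennreal (max 0 (- iterate n v) * G v / 2)"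
  have Z: "0 <= ?Z c" for c using corner_weight_nonneg[OF scale_pos] .
  have "ennreal (?Z c * (max 0 (iterate n (fst c)) * G (fst c)
      + max 0 (iterate n (fst (snd c))) * G (fst (snd c))
      + max 0 (- iterate n (fst (snd (snd c)))) * G (fst (snd (snd c)))
      + max 0 (- iterate n (snd (snd (snd c)))) * G (snd (snd (snd c)))) / 2)
    = ennreal (?Z c) * ?p (fst c) + ennreal (?Z c) * ?p (fst (snd c))
      + ennreal (?Z c) * ?q (fst (snd (snd c))) + ennreal (?Z c) * ?q (snd (snd (snd c)))" for c
    using Z[of c] G by (simp add: add_divide_distrib distrib_left flip: ennreal_mult ennreal_plus)
  then have "(NCINT c. ennreal (?Z c * (max 0 (iterate n (fst c)) * G (fst c)
      + max 0 (iterate n (fst (snd c))) * G (fst (snd c))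
      + max 0 (- iterate n (fst (snd (snd c)))) * G (fst (snd (snd c)))
      + max 0 (- iterate n (snd (snd (snd c)))) * G (snd (snd (snd c)))) / 2))
    = (NBINT v. ?p v) + (NBINT v. ?p v) + (NBINT v. ?q v) + (NBINT v. ?q v)"
    using corner_marginal(1)[of ?p, OF _ scale_pos, of n] corner_marginal(2)[of ?p, OF _ scale_pos, of n]
      corner_marginal(3)[of ?q, OF _ scale_pos, of n] corner_marginal(4)[of ?q, OF _ scale_pos, of n]
    by (simp add: nn_integral_add)
  also have "... = (NBINT v. ?p v + ?p v + ?q v + ?q v)"
    by (simp add: nn_integral_add)
  also have "... = (NBINT v. ennreal (\<bar>iterate n v\<bar> * G v))"
  proof (rule nn_integral_cong)
    fix v
    have "max 0 (iterate n v) * G v / 2 + max 0 (iterate n v) * G v / 2 + max 0 (- iterate n v) * G v / 2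
        + max 0 (- iterate n v) * G v / 2 = \<bar>iterate n v\<bar> * G v"
      by (auto simp: max_def)
    then show "?p v + ?p v + ?q v + ?q v = ennreal (\<bar>iterate n v\<bar> * G v)"
      using G by (simp flip: ennreal_plus)
  qed
  finally show ?thesis .
qed

lemma layer_mass: "(NCINT c. ennreal (layer n c)) = ennreal (mass n)"
proof -
  have "(NCINT c. ennreal (layer n c)) = (NBINT v. ennreal \<bar>iterate n v\<bar>)"
    using nn_integral_layer_weighted[of "\<lambda>_. 1" n] by (simp add: layer_eq)
  then show ?thesis
    using iterate_regular(1)[of n] by (simp add: mass_def nn_integral_eq_integral)
qed

lemma layer_integrable: "integrable coll (layer n)" and layer_integral: "(LCINT c. layer n c) = mass n"
proof -
  show "integrable coll (layer n)"
    by (rule integrableI_nonneg) (simp_all add: layer_nonneg layer_mass)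
  show "(LCINT c. layer n c) = mass n"
    by (subst integral_eq_nn_integral) (simp_all add: layer_nonneg layer_mass mass_nonneg)
qed

text \<open>A flux based at one corner replaces its density by the smoothed one, and the four terms
  of the layer are images of such fluxes under exchange and reversal. Reversal changes the sign of
  the gradient, so the positive and the negative part recombine to \<open>iterate n\<close>.\<close>

lemma layer_divergence:
  assumes \<phi> [measurable]: "\<phi> \<in> borel_fun" and B: "\<And>x. \<bar>\<phi> x\<bar> <= B"
  shows "(LCINT c. layer n c * pair_gradient \<phi> c) = (LBINT z. \<phi> z * (iterate (Suc n) z - iterate n z))"
proof -
  let ?s = "\<lambda>(v, w, v', w'). (w, v, w', v')" and ?r = "\<lambda>(v, w, v', w'). (v', w', v, w)"
  define F where "F q = (\<lambda>c. corner_weight (scale n) c * (q (fst c) * pair_gradient \<phi> c))" for q :: "real^'d => real"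
  let ?p = "\<lambda>v. max 0 (iterate n v)" and ?q = "\<lambda>v. max 0 (- iterate n v)"
  have pq: "integrable lborel ?p" "integrable lborel ?q" using iterate_regular(1)[of n] by auto
  have F: "integrable coll (F g)" "(LCINT c. F g c) = (LBINT z. \<phi> z * (dilated_conv (scale n) \<tau> g z - g z))"
    if "integrable lborel g" for g
    unfolding F_def using divergence[OF scale_pos that \<phi> B] divergence_integrable[OF scale_pos that \<phi> B] by auto
  have ints: "integrable coll (\<lambda>c. F ?p c)" "integrable coll (\<lambda>c. F ?p (?s c))"
      "integrable coll (\<lambda>c. F ?q (?r c))" "integrable coll (\<lambda>c. F ?q (?s (?r c)))"
    using F(1)[OF pq(1)] F(1)[OF pq(2)] integral_coll_swap[OF F(1)[OF pq(1)]] integral_coll_swap[OF F(1)[OF pq(2)]]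
      integral_coll_swap(3)[OF integral_coll_swap(1)[OF F(1)[OF pq(2)]]] by auto
  \<comment> \<open>\<open>?s\<close> exchanges the particles and \<open>?r\<close> reverses the
    collision; the gradient is invariant under the first and odd under the second.\<close>
  have eq: "layer n c * pair_gradient \<phi> c = (F ?p c + F ?p (?s c) - F ?q (?r c) - F ?q (?s (?r c))) / 2" for c
    by (cases c) (simp add: layer_def F_def pair_gradient_def corner_weight_symmetric algebra_simps
        add_divide_distrib diff_divide_distrib)
  have "(LCINT c. layer n c * pair_gradient \<phi> c)
      = ((LCINT c. F ?p c) + (LCINT c. F ?p (?s c)) - (LCINT c. F ?q (?r c)) - (LCINT c. F ?q (?s (?r c)))) / 2"
    unfolding eq using ints by simp
  also have "... = (LCINT c. F ?p c) - (LCINT c. F ?q c)"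
    using integral_coll_swap[OF F(1)[OF pq(1)]] integral_coll_swap[OF F(1)[OF pq(2)]]
      integral_coll_swap(4)[OF integral_coll_swap(1)[OF F(1)[OF pq(2)]]] by simp
  also have "... = (LCINT c. F ?p c - F ?q c)"
    using F(1)[OF pq(1)] F(1)[OF pq(2)] by simp
  also have "... = (LCINT c. F (iterate n) c)"
    by (intro Bochner_Integration.integral_cong refl) (auto simp: F_def max_def algebra_simps)
  also have "... = (LBINT z. \<phi> z * (iterate (Suc n) z - iterate n z))"
    using F(2)[OF iterate_regular(1)] by simp
  finally show ?thesis .
qed

definition rest_bound :: real where "rest_bound = 2 * T * bound / rect_mass"

lemma rest_bound_nonneg: "0 <= rest_bound"
  using T bound_nonneg rect_mass_pos by (simp add: rest_bound_def)

lemma scale_ge: "2 ^ n <= scale n"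
proof -
  have "1 <= T\<^sup>2" using T by (simp add: one_le_power)
  then show ?thesis unfolding scale_def by (intro power_mono) auto
qed

text \<open>From index one on the iterates are bounded by \<open>T * bound\<close>, and
  \<open>corner_weight\<close> is at most of order \<open>1 / scale\<close>: all layers above the
  bottom one are summable uniformly in the collision.\<close>

lemma layer_Suc_le: "layer (Suc n) c <= rest_bound / 2 ^ Suc n"
proof -
  have it: "max 0 (iterate (Suc n) x) <= T * bound" "max 0 (- iterate (Suc n) x) <= T * bound" for x
    using iterate_bound[of n x] T bound_nonneg by auto
  have "layer (Suc n) c <= corner_weight (scale (Suc n)) c * (T * bound + T * bound + T * bound + T * bound) / 2"
    unfolding layer_eq using it corner_weight_nonneg[OF scale_pos]
    by (intro divide_right_mono mult_left_mono add_mono) auto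
  also have "... <= 1 / (rect_mass * scale (Suc n)) * (T * bound + T * bound + T * bound + T * bound) / 2"
    using corner_weight_le[OF scale_ge_1] T bound_nonneg
    by (intro divide_right_mono mult_right_mono) auto
  also have "... = rest_bound / scale (Suc n)" by (simp add: rest_bound_def)
  also have "... <= rest_bound / 2 ^ Suc n"
    using rest_bound_nonneg scale_ge[of "Suc n"] by (intro divide_left_mono mult_pos_pos scale_pos) auto
  finally show ?thesis .
qed

lemma layer_summable: "summable (\<lambda>n. layer n c)"
proof -
  have "summable (\<lambda>n. layer (Suc n) c)"
  proof (rule summable_comparison_test')
    show "summable (\<lambda>n. rest_bound / 2 * (1/2) ^ n)" by (intro summable_mult summable_geometric) simp
    show "norm (layer (Suc n) c) <= rest_bound / 2 * (1/2) ^ n" for n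
      using layer_Suc_le[of n c] layer_nonneg[of "Suc n" c] by (simp add: power_one_over)
  qed
  then show ?thesis by (subst (asm) summable_Suc_iff)
qed

definition rest :: "'d quad => real" where "rest c = (\<Sum>n. layer (Suc n) c)"
definition flux :: "'d quad => real" where "flux c = (\<Sum>n. layer n c)"

lemma flux_split: "flux c = layer 0 c + rest c"
  using suminf_split_head[OF layer_summable, of c] by (simp add: flux_def rest_def)

lemma rest_bounds: "0 <= rest c" "rest c <= rest_bound"
proof -
  have s: "summable (\<lambda>n. layer (Suc n) c)" using layer_summable by (subst summable_Suc_iff)
  show "0 <= rest c" unfolding rest_def by (rule suminf_nonneg[OF s]) (rule layer_nonneg)
  have g: "(\<lambda>n. rest_bound / 2 * (1/2) ^ n) sums (rest_bound / 2 * (1 / (1 - 1/2)))"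
    by (intro sums_mult geometric_sums) simp
  have "rest c <= (\<Sum>n. rest_bound / 2 * (1/2) ^ n)"
    unfolding rest_def
  proof (rule suminf_le[OF _ s sums_summable[OF g]])
    show "layer (Suc n) c <= rest_bound / 2 * (1/2) ^ n" for n
      using layer_Suc_le[of n c] by (simp add: power_one_over)
  qed
  then show "rest c <= rest_bound" using sums_unique[OF g] by simp
qed

lemma flux_measurable [measurable]: "flux \<in> borel_fun" "rest \<in> borel_fun"
  unfolding flux_def rest_def by measurable

lemma flux_nonneg: "0 <= flux c"
  using rest_bounds layer_nonneg by (simp add: flux_split)

lemma flux_symmetric:
  "flux (w, v, v', w') = flux (v, w, v', w')" "flux (v, w, w', v') = flux (v, w, v', w')"
  by (simp_all add: flux_def layer_symmetric)

lemma mass_summable: "summable mass"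
proof (rule summable_comparison_test')
  show "summable (\<lambda>n. bound * (1/2) ^ n)" by (intro summable_mult summable_geometric) simp
  show "norm (mass n) <= bound * (1/2) ^ n" for n
    using decay(1)[of n] mass_nonneg by (simp add: power_one_over)
qed

lemma flux_integrable: "integrable coll flux"
  unfolding flux_def
proof (rule integrable_suminf)
  show "AE c in coll. summable (\<lambda>n. norm (layer n c))" using layer_summable by (simp add: layer_nonneg)
  show "summable (\<lambda>n. (LCINT c. norm (layer n c)))" using mass_summable by (simp add: layer_nonneg layer_integral)
qed (rule layer_integrable)

text \<open>The divergences of the layers telescope. The remainder is the integral of
  \<open>\<phi> * iterate n\<close>, which tends to 0 with \<open>mass n\<close>; what is left is
  minus the initial \<open>f0 - f1\<close>.\<close>

lemma flux_divergence:
  assumes \<phi> [measurable]: "\<phi> \<in> borel_fun" and B: "\<And>x. \<bar>\<phi> x\<bar> <= B"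
  shows "(LCINT c. flux c * pair_gradient \<phi> c) = (LBINT z. \<phi> z * (f1 z - f0 z))"
proof -
  have grad: "\<bar>pair_gradient \<phi> c\<bar> <= 4 * B" for c
    using B[of "fst c"] B[of "fst (snd c)"] B[of "fst (snd (snd c))"] B[of "snd (snd (snd c))"]
    by (simp add: pair_gradient_eq)
  have B0: "0 <= B" using B[of 0] by linarith
  have [measurable]: "pair_gradient \<phi> \<in> borel_fun"
    unfolding pair_gradient_eq by measurable
  have int: "integrable coll (\<lambda>c. layer n c * pair_gradient \<phi> c)" for n
    by (rule integrable_mult_bounded[OF layer_integrable]) (use grad in auto)
  let ?a = "\<lambda>n. (LBINT z. \<phi> z * iterate n z)"
  have int2: "integrable lborel (\<lambda>z. \<phi> z * iterate n z)" for n
  proof -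
    have "integrable lborel (\<lambda>z. iterate n z * \<phi> z)"
      by (rule integrable_mult_bounded[OF iterate_regular(1) _ B]) simp
    then show ?thesis by (simp add: mult.commute)
  qed
  have sums: "(\<lambda>n. (LCINT c. layer n c * pair_gradient \<phi> c)) sums (LCINT c. (\<Sum>n. layer n c * pair_gradient \<phi> c))"
  proof (rule sums_integral[OF int])
    show "AE c in coll. summable (\<lambda>n. norm (layer n c * pair_gradient \<phi> c))"
    proof (rule AE_I2)
      fix c
      have "summable (\<lambda>n. layer n c * \<bar>pair_gradient \<phi> c\<bar>)" by (rule summable_mult2[OF layer_summable])
      then show "summable (\<lambda>n. norm (layer n c * pair_gradient \<phi> c))"
        by (simp add: abs_mult layer_nonneg)
    qed
    show "summable (\<lambda>n. (LCINT c. norm (layer n c * pair_gradient \<phi> c)))"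
    proof (rule summable_comparison_test')
      show "summable (\<lambda>n. mass n * (4 * B))" by (intro summable_mult2 mass_summable)
      show "norm (LCINT c. norm (layer n c * pair_gradient \<phi> c)) <= mass n * (4 * B)" for n
      proof -
        have "(LCINT c. norm (layer n c * pair_gradient \<phi> c)) <= (LCINT c. layer n c * (4 * B))"
        proof (rule integral_mono)
          show "integrable coll (\<lambda>c. norm (layer n c * pair_gradient \<phi> c))"
            by (rule integrable_norm[OF int])
          show "norm (layer n c * pair_gradient \<phi> c) <= layer n c * (4 * B)" for c
            using mult_left_mono[OF grad[of c] layer_nonneg[of n c]] by (simp add: abs_mult layer_nonneg)
        qed (intro integrable_mult_left layer_integrable)
        moreover have "0 <= (LCINT c. norm (layer n c * pair_gradient \<phi> c))"
          by (intro integral_nonneg_AE) simp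
        ultimately show ?thesis by (simp add: layer_integral)
      qed
    qed
  qed
  have "(\<lambda>n. ?a n) \<longlonglongrightarrow> 0"
  proof (rule Lim_null_comparison)
    show "\<forall>\<^sub>F n in sequentially. norm (?a n) <= B * mass n"
    proof (rule always_eventually, rule allI)
      fix n
      have "norm (?a n) <= (LBINT z. \<bar>\<phi> z * iterate n z\<bar>)" using integral_abs_bound by simp
      also have "... <= (LBINT z. B * \<bar>iterate n z\<bar>)"
      proof (rule integral_mono)
        show "integrable lborel (\<lambda>z. \<bar>\<phi> z * iterate n z\<bar>)" by (rule integrable_abs[OF int2])
        show "integrable lborel (\<lambda>z. B * \<bar>iterate n z\<bar>)" using iterate_regular(1)[of n] by simp
        show "\<bar>\<phi> z * iterate n z\<bar> <= B * \<bar>iterate n z\<bar>" for z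
          using mult_right_mono[OF B[of z], of "\<bar>iterate n z\<bar>"] by (simp add: abs_mult)
      qed
      finally show "norm (?a n) <= B * mass n" by (simp add: mass_def)
    qed
    show "(\<lambda>n. B * mass n) \<longlonglongrightarrow> 0"
      using tendsto_mult_left[OF summable_LIMSEQ_zero[OF mass_summable], of B] by simp
  qed
  then have "(\<lambda>n. ?a (Suc n) - ?a n) sums (0 - ?a 0)" by (rule telescope_sums)
  moreover have "(LCINT c. layer n c * pair_gradient \<phi> c) = ?a (Suc n) - ?a n" for n
    unfolding layer_divergence[OF \<phi> B]
    using int2[of n] int2[of "Suc n"] by (simp add: right_diff_distrib del: iterate.simps)
  ultimately have "(LCINT c. (\<Sum>n. layer n c * pair_gradient \<phi> c)) = - ?a 0"
    using sums_unique2[OF sums] by simp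
  moreover have "(\<Sum>n. layer n c * pair_gradient \<phi> c) = flux c * pair_gradient \<phi> c" for c
    unfolding flux_def by (rule suminf_mult2[OF layer_summable, symmetric])
  moreover have "- ?a 0 = (LBINT z. \<phi> z * (f1 z - f0 z))"
    by (subst Bochner_Integration.integral_minus[symmetric]) (simp add: algebra_simps)
  ultimately show ?thesis by simp
qed

end

section \<open>Entropy of the steering flux\<close>

context steering
begin

text \<open>Bounds the contribution of the logarithms of \<open>m\<close> in layer \<open>n\<close>.
  The factor \<open>2 * K\<close> accounts for the two incoming velocities, and the bracket arises
  from \<open>1 + ln (1 + norm v + 2 * scale n)\<close> through
  \<open>ln_dilated_bound\<close>.\<close>

definition growth :: "nat => real" where
  "growth n = 2 * K * ((3 + ln (scale n)) * mass n + moment n)"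

lemma ln_scale: "ln (scale n) = real n * ln (10 * T\<^sup>2)" "0 <= ln (10 * T\<^sup>2)"
proof -
  have "1 <= T\<^sup>2" using T by (simp add: one_le_power)
  then have q: "1 <= 10 * T\<^sup>2" by linarith
  show "ln (scale n) = real n * ln (10 * T\<^sup>2)"
    unfolding scale_def by (rule ln_realpow)
  show "0 <= ln (10 * T\<^sup>2)" using q by (rule ln_ge_zero)
qed

lemma growth_nonneg: "0 <= growth n"
  using K ln_scale mass_nonneg moment_nonneg by (simp add: growth_def)

text \<open>\<open>ln (scale n)\<close> is linear in \<open>n\<close>, while \<open>mass\<close> and
  \<open>moment\<close> decay geometrically; the comparison series is the derivative of the
  geometric series.\<close>

lemma growth_summable: "summable growth"
proof (rule summable_comparison_test')
  let ?q = "ln (10 * T\<^sup>2)"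
  have "summable (\<lambda>n. real (Suc n) * (1/2::real) ^ n)"
    using geometric_deriv_sums[of "1/2::real"] by (auto simp: sums_iff)
  then show "summable (\<lambda>n. 2 * K * bound * (4 + ?q) * (real (Suc n) * (1/2) ^ n))"
    by (rule summable_mult)
  show "norm (growth n) <= 2 * K * bound * (4 + ?q) * (real (Suc n) * (1/2) ^ n)" for n
  proof -
    have q: "0 <= ?q" by (rule ln_scale)
    have "(3 + ln (scale n)) * mass n + moment n <= (3 + ln (scale n)) * (bound / 2 ^ n) + bound / 2 ^ n"
      using decay q by (intro add_mono mult_left_mono) (auto simp: ln_scale(1))
    also have "... = (4 + real n * ?q) * (bound / 2 ^ n)" by (simp add: ln_scale(1) algebra_simps)
    also have "... <= ((4 + ?q) * real (Suc n)) * (bound / 2 ^ n)"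
    proof (rule mult_right_mono)
      have "(4 + ?q) * real (Suc n) = 4 + real n * ?q + (4 * real n + ?q)" by (simp add: algebra_simps)
      then show "4 + real n * ?q <= (4 + ?q) * real (Suc n)" using q by simp
    qed (use bound_nonneg in simp)
    finally have "growth n <= 2 * K * (((4 + ?q) * real (Suc n)) * (bound / 2 ^ n))"
      unfolding growth_def using K by (intro mult_left_mono) auto
    then show ?thesis using growth_nonneg[of n] by (simp add: power_one_over mult_ac)
  qed
qed

text \<open>The corners of one rectangle are within \<open>2 * scale n\<close> of each other, so the
  logarithms of \<open>m\<close> at the incoming velocities can be estimated at whichever corner
  carries the iterate. That corner is Lebesgue distributed, and only an integral over one velocity
  remains.\<close>

lemma layer_growth:
  "(NCINT c. ennreal (layer n c * (lnp (m (fst c)) + lnp (m (fst (snd c)))))) <= ennreal (growth n)"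
proof -
  let ?s = "scale n"
  define G where "G x = 2 * K * (1 + ln (1 + norm x + 2 * ?s))" for x :: "real^'d"
  have s: "1 <= ?s" by (rule scale_ge_1)
  have [measurable]: "G \<in> borel_fun" unfolding G_def by measurable
  have ln_nonneg: "0 <= ln (1 + norm x + 2 * ?s)" for x :: "real^'d"
    using s by (intro ln_ge_zero) (simp add: add_nonneg_nonneg)
  have G: "0 <= G x" for x using K ln_nonneg[of x] by (simp add: G_def)
  have lnp_G: "lnp (m x) <= G q / 2" if "norm (x - q) <= 2 * ?s" for x q
  proof -
    have "1 + norm x <= 1 + norm q + 2 * ?s" using that norm_triangle_sub[of x q] by linarith
    then have "ln (1 + norm x) <= ln (1 + norm q + 2 * ?s)"
      by (intro ln_mono) (auto intro!: add_pos_nonneg)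
    then have "K * (1 + ln (1 + norm x)) <= K * (1 + ln (1 + norm q + 2 * ?s))"
      using K by (intro mult_left_mono) auto
    then show ?thesis using m_growth[of x] by (simp add: G_def)
  qed
  have "(NCINT c. ennreal (layer n c * (lnp (m (fst c)) + lnp (m (fst (snd c))))))
      <= (NCINT c. ennreal (corner_weight ?s c * (max 0 (iterate n (fst c)) * G (fst c)
      + max 0 (iterate n (fst (snd c))) * G (fst (snd c))
      + max 0 (- iterate n (fst (snd (snd c)))) * G (fst (snd (snd c)))
      + max 0 (- iterate n (snd (snd (snd c)))) * G (snd (snd (snd c)))) / 2))"
  proof (intro nn_integral_mono ennreal_leI)
    fix c :: "'d quad"
    obtain v w v' w' where c: "c = (v, w, v', w')" by (metis prod.exhaust)
    let ?Z = "corner_weight ?s c" and ?X = "lnp (m v) + lnp (m w)"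
    show "layer n c * (lnp (m (fst c)) + lnp (m (fst (snd c))))
      <= ?Z * (max 0 (iterate n (fst c)) * G (fst c)
      + max 0 (iterate n (fst (snd c))) * G (fst (snd c))
      + max 0 (- iterate n (fst (snd (snd c)))) * G (fst (snd (snd c)))
      + max 0 (- iterate n (snd (snd (snd c)))) * G (snd (snd (snd c)))) / 2"
    proof (cases "?Z = 0")
      case False
      then have d: "norm (v' - v) < ?s" "norm (w' - v) < ?s" "norm (v' - w) < ?s" "norm (w' - w) < ?s"
        using corner_weight_support[OF _ scale_pos] unfolding c by blast+
      have vw: "norm (v - w) <= 2 * ?s"
      proof -
        have "v - w = (v' - w) - (v' - v)" by simp
        then have "norm (v - w) <= norm (v' - w) + norm (v' - v)" by (metis norm_triangle_ineq4)
        then show ?thesis using d by linarith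
      qed
      have X: "?X <= G v" "?X <= G w" "?X <= G v'" "?X <= G w'"
        using lnp_G[of v v] lnp_G[of w v] lnp_G[of v w] lnp_G[of w w] lnp_G[of v v'] lnp_G[of w v']
          lnp_G[of v w'] lnp_G[of w w'] d vw s
        by (simp_all add: norm_minus_commute)
      have "layer n c * ?X = ?Z * (max 0 (iterate n v) * ?X + max 0 (iterate n w) * ?X
          + max 0 (- iterate n v') * ?X + max 0 (- iterate n w') * ?X) / 2"
        by (simp add: layer_eq c distrib_right mult.assoc)
      also have "... <= ?Z * (max 0 (iterate n v) * G v + max 0 (iterate n w) * G w
          + max 0 (- iterate n v') * G v' + max 0 (- iterate n w') * G w') / 2"
        using X corner_weight_nonneg[OF scale_pos]
        by (intro divide_right_mono mult_left_mono[of _ _ ?Z] add_mono mult_left_mono) auto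
      finally show ?thesis by (simp add: c)
    qed (simp add: layer_eq)
  qed
  also have "... = (NBINT v. ennreal (\<bar>iterate n v\<bar> * G v))"
    by (rule nn_integral_layer_weighted) (use G in measurable)
  also have "... <= (NBINT v. ennreal (2 * K * ((3 + ln ?s) * \<bar>iterate n v\<bar> + norm v * \<bar>iterate n v\<bar> / ?s)))"
  proof (intro nn_integral_mono ennreal_leI)
    fix v :: "real^'d"
    have "G v <= 2 * K * (3 + ln ?s + norm v / ?s)"
      unfolding G_def using K ln_dilated_bound[of "norm v" ?s] s by (intro mult_left_mono) auto
    then have "\<bar>iterate n v\<bar> * G v <= \<bar>iterate n v\<bar> * (2 * K * (3 + ln ?s + norm v / ?s))"
      by (intro mult_left_mono) auto
    then show "\<bar>iterate n v\<bar> * G v <= 2 * K * ((3 + ln ?s) * \<bar>iterate n v\<bar> + norm v * \<bar>iterate n v\<bar> / ?s)"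
      by (simp add: algebra_simps)
  qed
  also have "... = ennreal (LBINT v. 2 * K * ((3 + ln ?s) * \<bar>iterate n v\<bar> + norm v * \<bar>iterate n v\<bar> / ?s))"
  proof (rule nn_integral_eq_integral)
    show "integrable lborel (\<lambda>v. 2 * K * ((3 + ln ?s) * \<bar>iterate n v\<bar> + norm v * \<bar>iterate n v\<bar> / ?s))"
      using iterate_regular(1,2)[of n] by simp
    show "AE v in lborel. 0 <= 2 * K * ((3 + ln ?s) * \<bar>iterate n v\<bar> + norm v * \<bar>iterate n v\<bar> / ?s)"
      using K ln_scale s by (intro AE_I2 mult_nonneg_nonneg add_nonneg_nonneg) auto
  qed
  also have "(LBINT v. 2 * K * ((3 + ln ?s) * \<bar>iterate n v\<bar> + norm v * \<bar>iterate n v\<bar> / ?s)) = growth n"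
    using iterate_regular(1,2)[of n] by (simp add: growth_def mass_def moment_def)
  finally show ?thesis .
qed

lemma flux_growth:
  "(NCINT c. ennreal (flux c * (lnp (m (fst c)) + lnp (m (fst (snd c)))))) < \<infinity>"
proof -
  let ?X = "\<lambda>c::'d quad. lnp (m (fst c)) + lnp (m (fst (snd c)))"
  have X: "0 <= ?X c" for c by (simp add: lnp_nonneg)
  have "ennreal (flux c * ?X c) = (\<Sum>n. ennreal (layer n c * ?X c))" for c
  proof -
    have "flux c * ?X c = (\<Sum>n. layer n c * ?X c)"
      unfolding flux_def by (rule suminf_mult2[OF layer_summable])
    moreover have "(\<Sum>n. ennreal (layer n c * ?X c)) = ennreal (\<Sum>n. layer n c * ?X c)"
      by (intro suminf_ennreal2 mult_nonneg_nonneg layer_nonneg X summable_mult2[OF layer_summable])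
    ultimately show ?thesis by simp
  qed
  then have "(NCINT c. ennreal (flux c * ?X c)) = (NCINT c. (\<Sum>n. ennreal (layer n c * ?X c)))"
    by simp
  also have "... = (\<Sum>n. (NCINT c. ennreal (layer n c * ?X c)))"
    by (rule nn_integral_suminf) measurable
  also have "... <= (\<Sum>n. ennreal (growth n))"
    by (intro suminf_le layer_growth) auto
  also have "... = ennreal (\<Sum>n. growth n)"
    by (rule suminf_ennreal2[OF growth_nonneg growth_summable])
  also have "... < \<infinity>" by simp
  finally show ?thesis .
qed

text \<open>For a piece dominated by \<open>c * f\<close>, the logarithm of the piece itself is paid
  by the entropy of \<open>f\<close>, and the other factors contribute their own logarithms.\<close>

lemma lnp_piece:
  assumes "0 <= a" "a <= c * f" "0 <= c" "0 <= f" "0 <= x" "0 <= y"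
  shows "a * (ln 5 + lnp (a * (x * y))) <= a * (ln 5 + lnp c + (lnp x + lnp y)) + a * lnp f"
proof -
  have "lnp (a * (x * y)) <= lnp a + (lnp x + lnp y)"
    using lnp_mult[of a "x * y"] lnp_mult[of x y] assms by simp
  moreover have "lnp a <= lnp c + lnp f"
    using lnp_mono[of a "c * f"] lnp_mult[of c f] assms by simp
  ultimately have "ln 5 + lnp (a * (x * y)) <= (ln 5 + lnp c + (lnp x + lnp y)) + lnp f" by simp
  then have "a * (ln 5 + lnp (a * (x * y))) <= a * ((ln 5 + lnp c + (lnp x + lnp y)) + lnp f)"
    using assms(1) by (rule mult_left_mono)
  then show ?thesis by (simp add: distrib_left)
qed

text \<open>In the bottom layer each corner contributes at most the weight times \<open>f0\<close>
  or \<open>f1\<close>, so its logarithm integrates to the entropy of that density. The other layers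
  sum to a bounded function. What remains is the flux times a constant plus the logarithms of
  \<open>m\<close>, which is \<open>flux_growth\<close>.\<close>

lemma flux_entropy:
  "(NCINT c. ennreal (flux c * lnp (flux c * (m (fst c) * m (fst (snd c)))))) < \<infinity>"
proof -
  let ?Z = "corner_weight 1"
  let ?e0 = "\<lambda>x. f0 x * lnp (f0 x)" and ?e1 = "\<lambda>x. f1 x * lnp (f1 x)"
  let ?X = "\<lambda>c::'d quad. lnp (m (fst c)) + lnp (m (fst (snd c)))"
  define c0 where "c0 = 1 / rect_mass"
  have c0: "0 <= c0" using rect_mass_pos by (simp add: c0_def)
  define k where "k = ln 5 + lnp c0 + lnp rest_bound"
  have k: "0 <= k" by (simp add: k_def lnp_nonneg)
  have e: "0 <= ?e0 x" "0 <= ?e1 x" for x by (simp_all add: f_nonneg lnp_nonneg)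
  have Z: "0 <= ?Z c" "?Z c <= c0" for c
    using corner_weight_nonneg[of 1 c] corner_weight_le[of 1 c] by (simp_all add: c0_def)
  have scale0: "scale 0 = 1" by (simp add: scale_def)
  have point: "flux c * lnp (flux c * (m (fst c) * m (fst (snd c))))
      <= 5 * (flux c * (k + ?X c) + ?Z c * (?e0 (fst c) + ?e0 (fst (snd c)) + ?e1 (fst (snd (snd c))) + ?e1 (snd (snd (snd c)))))"
    for c :: "'d quad"
  proof -
    obtain v w v' w' where c: "c = (v, w, v', w')" by (metis prod.exhaust)
    let ?X = "lnp (m v) + lnp (m w)" and ?M = "m v * m w"
    define a1 where "a1 = ?Z c * max 0 (f0 v - f1 v) / 2"
    define a2 where "a2 = ?Z c * max 0 (f0 w - f1 w) / 2"
    define a3 where "a3 = ?Z c * max 0 (- (f0 v' - f1 v')) / 2"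
    define a4 where "a4 = ?Z c * max 0 (- (f0 w' - f1 w')) / 2"
    have half: "0 <= ?Z c * max 0 x / 2" "?Z c * max 0 x / 2 <= ?Z c * y" if "x <= y" "0 <= y" for x y
    proof -
      have "?Z c * max 0 x / 2 <= ?Z c * max 0 x" using Z(1)[of c] by (simp add: mult_nonneg_nonneg)
      also have "... <= ?Z c * y" using that Z(1) by (intro mult_left_mono) auto
      finally show "?Z c * max 0 x / 2 <= ?Z c * y" .
      show "0 <= ?Z c * max 0 x / 2" using Z(1)[of c] by simp
    qed
    have a: "0 <= a1" "0 <= a2" "0 <= a3" "0 <= a4"
      "a1 <= ?Z c * f0 v" "a2 <= ?Z c * f0 w" "a3 <= ?Z c * f1 v'" "a4 <= ?Z c * f1 w'"
      unfolding a1_def a2_def a3_def a4_def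
      using half[of "f0 v - f1 v" "f0 v"] half[of "f0 w - f1 w" "f0 w"]
        half[of "- (f0 v' - f1 v')" "f1 v'"] half[of "- (f0 w' - f1 w')" "f1 w'"]
      by (simp_all only: f_nonneg diff_le_self minus_diff_eq diff_le_eq le_add_same_cancel1)
    have Zc: "?Z c * f <= c0 * f" if "0 <= f" for f using Z(2)[of c] that by (rule mult_right_mono)
    have flux: "flux c = a1 + a2 + a3 + a4 + rest c"
      by (simp add: flux_split layer_eq a1_def a2_def a3_def a4_def scale0 c add_divide_distrib distrib_left)
    have "flux c * lnp (flux c * ?M) <= 5 * (a1 * (ln 5 + lnp (a1 * ?M)) + a2 * (ln 5 + lnp (a2 * ?M))
        + a3 * (ln 5 + lnp (a3 * ?M)) + a4 * (ln 5 + lnp (a4 * ?M)) + rest c * (ln 5 + lnp (rest c * ?M)))"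
      unfolding flux using a rest_bounds m_nonneg by (intro five_lnp_le) auto
    also have "... <= 5 * ((a1 * (k + ?X) + ?Z c * ?e0 v) + (a2 * (k + ?X) + ?Z c * ?e0 w)
        + (a3 * (k + ?X) + ?Z c * ?e1 v') + (a4 * (k + ?X) + ?Z c * ?e1 w') + rest c * (k + ?X))"
    proof -
      have piece: "x * (ln 5 + lnp (x * ?M)) <= x * (k + ?X) + ?Z c * (f * lnp f)"
        if x: "0 <= x" "x <= ?Z c * f" and f: "0 <= f" for x f
      proof -
        have "x * (ln 5 + lnp (x * ?M)) <= x * (ln 5 + lnp c0 + ?X) + x * lnp f"
          using x f c0 m_nonneg Zc[OF f] by (intro lnp_piece) auto
        also have "x * (ln 5 + lnp c0 + ?X) <= x * (k + ?X)"
          using x(1) by (intro mult_left_mono) (simp_all add: k_def lnp_nonneg)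
        also have "x * lnp f <= ?Z c * f * lnp f" using x(2) by (rule mult_right_mono) (simp add: lnp_nonneg)
        finally show ?thesis by (simp add: mult.assoc)
      qed
      have "rest c * (ln 5 + lnp (rest c * ?M)) <= rest c * (ln 5 + lnp rest_bound + ?X) + rest c * lnp 1"
        using rest_bounds[of c] rest_bound_nonneg m_nonneg by (intro lnp_piece) auto
      also have "... <= rest c * (k + ?X)"
        using rest_bounds(1)[of c] by (simp add: lnp_def[of 1]) (intro mult_left_mono, simp_all add: k_def lnp_nonneg)
      finally have "rest c * (ln 5 + lnp (rest c * ?M)) <= rest c * (k + ?X)" .
      then show ?thesis
        by (intro mult_left_mono[OF _ zero_le_numeral] add_mono
            piece[OF a(1) a(5) f_nonneg(1)] piece[OF a(2) a(6) f_nonneg(1)]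
            piece[OF a(3) a(7) f_nonneg(2)] piece[OF a(4) a(8) f_nonneg(2)])
    qed
    also have "... = 5 * (flux c * (k + ?X) + ?Z c * (?e0 v + ?e0 w + ?e1 v' + ?e1 w'))"
      unfolding flux by (simp add: distrib_left distrib_right)
    finally show ?thesis by (simp add: c)
  qed
  have "(NCINT c. ennreal (flux c * lnp (flux c * (m (fst c) * m (fst (snd c))))))
      <= (NCINT c. ennreal 5 * ((ennreal (k * flux c) + ennreal (flux c * ?X c)) +
        (ennreal (?Z c) * ennreal (?e0 (fst c)) + ennreal (?Z c) * ennreal (?e0 (fst (snd c)))
         + ennreal (?Z c) * ennreal (?e1 (fst (snd (snd c)))) + ennreal (?Z c) * ennreal (?e1 (snd (snd (snd c)))))))"
  proof (rule nn_integral_mono)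
    fix c :: "'d quad"
    have X: "0 <= ?X c" by (simp add: lnp_nonneg)
    have "ennreal (flux c * lnp (flux c * (m (fst c) * m (fst (snd c)))))
      <= ennreal (5 * ((k * flux c + flux c * ?X c) + (?Z c * ?e0 (fst c) + ?Z c * ?e0 (fst (snd c)) + ?Z c * ?e1 (fst (snd (snd c))) + ?Z c * ?e1 (snd (snd (snd c))))))"
      using point[of c] by (intro ennreal_leI) (simp add: algebra_simps)
    also have "... = ennreal 5 * ennreal ((k * flux c + flux c * ?X c) + (?Z c * ?e0 (fst c) + ?Z c * ?e0 (fst (snd c)) + ?Z c * ?e1 (fst (snd (snd c))) + ?Z c * ?e1 (snd (snd (snd c)))))"
      by (rule ennreal_mult) (simp_all add: f_nonneg lnp_nonneg Z(1) k flux_nonneg)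
    also have "ennreal ((k * flux c + flux c * ?X c) + (?Z c * ?e0 (fst c) + ?Z c * ?e0 (fst (snd c)) + ?Z c * ?e1 (fst (snd (snd c))) + ?Z c * ?e1 (snd (snd (snd c)))))
      = (ennreal (k * flux c) + ennreal (flux c * ?X c)) +
        (ennreal (?Z c) * ennreal (?e0 (fst c)) + ennreal (?Z c) * ennreal (?e0 (fst (snd c)))
         + ennreal (?Z c) * ennreal (?e1 (fst (snd (snd c)))) + ennreal (?Z c) * ennreal (?e1 (snd (snd (snd c)))))"
      using e Z k flux_nonneg X by (simp flip: ennreal_plus ennreal_mult)
    finally show "ennreal (flux c * lnp (flux c * (m (fst c) * m (fst (snd c)))))
      <= ennreal 5 * ((ennreal (k * flux c) + ennreal (flux c * ?X c)) +
        (ennreal (?Z c) * ennreal (?e0 (fst c)) + ennreal (?Z c) * ennreal (?e0 (fst (snd c)))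
         + ennreal (?Z c) * ennreal (?e1 (fst (snd (snd c)))) + ennreal (?Z c) * ennreal (?e1 (snd (snd (snd c))))))" .
  qed
  also have "... = ennreal 5 * (((NCINT c. ennreal (k * flux c)) + (NCINT c. ennreal (flux c * ?X c)))
      + ((NBINT x. ennreal (?e0 x)) + (NBINT x. ennreal (?e0 x))
        + (NBINT x. ennreal (?e1 x)) + (NBINT x. ennreal (?e1 x))))"
    using corner_marginal(1)[of "\<lambda>x. ennreal (?e0 x)" 1] corner_marginal(2)[of "\<lambda>x. ennreal (?e0 x)" 1]
      corner_marginal(3)[of "\<lambda>x. ennreal (?e1 x)" 1] corner_marginal(4)[of "\<lambda>x. ennreal (?e1 x)" 1]
    by (simp add: nn_integral_cmult nn_integral_add)
  also have "(NCINT c. ennreal (k * flux c)) = ennreal (LCINT c. k * flux c)"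
    by (rule nn_integral_eq_integral) (use flux_integrable k flux_nonneg in auto)
  also have "ennreal 5 * ((ennreal (LCINT c. k * flux c) + (NCINT c. ennreal (flux c * ?X c)))
      + ((NBINT x. ennreal (?e0 x)) + (NBINT x. ennreal (?e0 x))
        + (NBINT x. ennreal (?e1 x)) + (NBINT x. ennreal (?e1 x)))) < \<infinity>"
    using flux_growth f_entropy by (simp add: ennreal_mult_less_top)
  finally show ?thesis .
qed

end

context sphere_measure
begin

lemma steering_flux_exists:
  fixes f0 f1 m :: "real^'d => real"
  assumes "f0 \<in> borel_fun" "f1 \<in> borel_fun"
    and "\<And>x. 0 <= f0 x" "\<And>x. 0 <= f1 x"
    and "integrable lborel f0" "integrable lborel f1" "(LBINT x. f0 x) = (LBINT x. f1 x)"
    and "integrable lborel (\<lambda>x. norm x * f0 x)" "integrable lborel (\<lambda>x. norm x * f1 x)"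
    and "(NBINT x. ennreal (f0 x * lnp (f0 x))) < \<infinity>" "(NBINT x. ennreal (f1 x * lnp (f1 x))) < \<infinity>"
    and "m \<in> borel_fun" "\<And>x. 0 <= m x" "0 <= K" "\<And>x. lnp (m x) <= K * (1 + ln (1 + norm x))"
  obtains p :: "'d quad => real" where "p \<in> borel_fun" "\<And>c. 0 <= p c"
    "\<And>v w v' w'. p (w, v, v', w') = p (v, w, v', w')" "\<And>v w v' w'. p (v, w, w', v') = p (v, w, v', w')"
    "integrable coll p"
    "\<And>\<phi> B. \<phi> \<in> borel_fun ==> (\<And>x. \<bar>\<phi> x\<bar> <= B) ==>
      (LCINT c. p c * pair_gradient \<phi> c) = (LBINT z. \<phi> z * (f1 z - f0 z))"
    "(NCINT c. ennreal (p c * lnp (p c * (m (fst c) * m (fst (snd c)))))) < \<infinity>"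
proof -
  obtain \<tau> T where \<tau>: "smoothing_profile \<tau> T"
    and div: "\<And>r h \<phi> B. 0 < r ==> integrable lborel h ==> \<phi> \<in> borel_fun ==> (\<And>x. \<bar>\<phi> x\<bar> <= B) ==>
      (LCINT c. corner_weight r c * (h (fst c) * pair_gradient \<phi> c))
        = (LBINT z. \<phi> z * (dilated_conv r \<tau> h z - h z))"
    "\<And>r h \<phi> B. 0 < r ==> integrable lborel h ==> \<phi> \<in> borel_fun ==> (\<And>x. \<bar>\<phi> x\<bar> <= B) ==>
      integrable coll (\<lambda>c. corner_weight r c * (h (fst c) * pair_gradient \<phi> c))"
    by (rule smoothing_profile_exists) blast
  interpret P: smoothing_profile \<tau> T by fact
  interpret steering s \<tau> T f0 f1 m K
  proof unfold_locales
    fix r :: real and g :: "real^'d => real" assume r: "0 < r" and g: "integrable lborel g"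
    have conv: "integrable lborel (dilated_conv r \<tau> g)"
      using P.conv_weighted(1)[OF g r, of "\<lambda>_. 1" "\<lambda>_. 1"] g by simp
    \<comment> \<open>A constant test function has zero gradient, so smoothing preserves the
      integral.\<close>
    have "0 = (LBINT z. dilated_conv r \<tau> g z - g z)"
      using div(1)[OF r g, of "\<lambda>_. 1" 1] by (simp add: pair_gradient_eq)
    then show "(LBINT z. dilated_conv r \<tau> g z) = (LBINT z. g z)"
      using conv g by simp
  next
    show "integrable lborel (\<lambda>v. norm v * \<bar>f0 v - f1 v\<bar>)"
    proof -
      have "integrable lborel (\<lambda>v. \<bar>norm v * f0 v - norm v * f1 v\<bar>)" using assms by simp
      then show ?thesis by (simp add: abs_mult flip: right_diff_distrib)
    qed
  next
    fix r B :: real and g \<phi> :: "real^'d => real"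
    assume *: "0 < r" "integrable lborel g" "\<phi> \<in> borel_fun" "\<And>x. \<bar>\<phi> x\<bar> <= B"
    show "(LCINT c. corner_weight r c * (g (fst c) * pair_gradient \<phi> c))
        = (LBINT z. \<phi> z * (dilated_conv r \<tau> g z - g z))"
      by (rule div(1)[OF *])
    show "integrable coll (\<lambda>c. corner_weight r c * (g (fst c) * pair_gradient \<phi> c))"
      by (rule div(2)[OF *])
  qed (use assms in auto)
  show ?thesis
  proof (rule that[of flux])
    fix \<phi> :: "real^'d => real" and B assume "\<phi> \<in> borel_fun" "\<And>x. \<bar>\<phi> x\<bar> <= B"
    then show "(LCINT c. flux c * pair_gradient \<phi> c) = (LBINT z. \<phi> z * (f1 z - f0 z))"
      by (rule flux_divergence)
  qed (fact flux_measurable(1) flux_nonneg flux_symmetric flux_integrable flux_entropy)+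
qed

end

section \<open>Paths and the reference flux\<close>

text \<open>A path is only constrained on \<open>{0..T}\<close>; it becomes a measurable kernel after freezing it
  outside of that interval.\<close>

definition clamp_time :: "real => real => real" where
  "clamp_time T t = max 0 (min T t)"

lemma clamp_time_in: "0 <= T ==> clamp_time T t \<in> {0..T}"
  by (auto simp: clamp_time_def)

lemma clamp_time_id: "t \<in> {0..T} ==> clamp_time T t = t"
  by (auto simp: clamp_time_def)

lemma topspace_weak_topology: "topspace (weak_topology e :: (real^'d) measure topology) = prob_energy e"
proof -
  have "prob_energy e \<in> {{\<pi> \<in> prob_energy e. (\<integral> v. \<phi> v \<partial>\<pi>) \<in> U} | \<phi> U.
        continuous_on UNIV (\<phi> :: real^'d => real) \<and> bounded (range \<phi>) \<and> open (U :: real set)}"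
    by (intro CollectI exI[of _ "\<lambda>_. 0"] exI[of _ UNIV]) auto
  then show ?thesis
    unfolding weak_topology_def topology_generated_by_topspace by (intro equalityI subsetI) blast+
qed

lemma openin_weak_topology:
  fixes \<phi> :: "real^'d => real"
  assumes "continuous_on UNIV \<phi>" "bounded (range \<phi>)" "open U"
  shows "openin (weak_topology e) {\<pi> \<in> prob_energy e. (\<integral> v. \<phi> v \<partial>\<pi>) \<in> U}"
  unfolding weak_topology_def by (rule topology_generated_by_Basis) (use assms in blast)

lemma continuous_paths_in:
  assumes "\<pi> \<in> continuous_paths e T" "t \<in> {0..T}"
  shows "\<pi> t \<in> prob_energy e"
  using assms continuous_map_image_subset_topspace[of "top_of_set {0..T}" "weak_topology e" \<pi>]
  by (auto simp: continuous_paths_def topspace_weak_topology)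

lemma continuous_paths_integral:
  fixes \<phi> :: "real^'d => real"
  assumes \<pi>: "\<pi> \<in> continuous_paths e T" and \<phi>: "continuous_on UNIV \<phi>" "bounded (range \<phi>)"
  shows "continuous_on {0..T} (\<lambda>t. \<integral>v. \<phi> v \<partial>\<pi> t)"
proof -
  have "continuous_map (top_of_set {0..T}) euclidean (\<lambda>t. \<integral>v. \<phi> v \<partial>\<pi> t)"
    unfolding continuous_map_def
  proof (intro conjI allI impI)
    fix U :: "real set" assume "openin euclidean U"
    then have "open U" by simp
    have "openin (top_of_set {0..T}) {t \<in> topspace (top_of_set {0..T}). \<pi> t \<in> {\<pi> \<in> prob_energy e. (\<integral> v. \<phi> v \<partial>\<pi>) \<in> U}}"
      by (rule openin_continuous_map_preimage[OF _ openin_weak_topology[OF \<phi> \<open>open U\<close>]])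
        (use \<pi> in \<open>simp add: continuous_paths_def\<close>)
    moreover have "{t \<in> topspace (top_of_set {0..T}). \<pi> t \<in> {\<pi> \<in> prob_energy e. (\<integral> v. \<phi> v \<partial>\<pi>) \<in> U}}
        = {t \<in> topspace (top_of_set {0..T}). (\<integral>v. \<phi> v \<partial>\<pi> t) \<in> U}"
      using continuous_paths_in[OF \<pi>] by auto
    ultimately show "openin (top_of_set {0..T}) {t \<in> topspace (top_of_set {0..T}). (\<integral>v. \<phi> v \<partial>\<pi> t) \<in> U}"
      by simp
  qed simp
  then show ?thesis by simp
qed

lemma continuous_pathsI:
  fixes \<pi> :: "real => (real^'d) measure"
  assumes "\<And>t. t \<in> {0..T} ==> \<pi> t \<in> prob_energy e"
    and "\<And>\<phi>::real^'d => real. continuous_on UNIV \<phi> ==> bounded (range \<phi>) ==> continuous_on {0..T} (\<lambda>t. \<integral>v. \<phi> v \<partial>\<pi> t)"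
  shows "\<pi> \<in> continuous_paths e T"
proof -
  have "continuous_map (top_of_set {0..T}) (weak_topology e) \<pi>"
    unfolding weak_topology_def continuous_on_generated_topo_iff
  proof (intro conjI allI impI)
    fix A assume "A \<in> {{\<pi> \<in> prob_energy e. (\<integral> v. \<phi> v \<partial>\<pi>) \<in> U} | \<phi> U.
        continuous_on UNIV (\<phi> :: real^'d => real) \<and> bounded (range \<phi>) \<and> open (U :: real set)}"
    then obtain \<phi> :: "real^'d => real" and U where A: "A = {\<pi> \<in> prob_energy e. (\<integral> v. \<phi> v \<partial>\<pi>) \<in> U}"
      and \<phi>: "continuous_on UNIV \<phi>" "bounded (range \<phi>)" and U: "open U" by blast
    have "openin (top_of_set {0..T}) ({0..T} \<inter> (\<lambda>t. \<integral>v. \<phi> v \<partial>\<pi> t) -` U)"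
      using assms(2)[OF \<phi>] U continuous_openin_preimage_gen by blast
    moreover have "\<pi> -` A \<inter> topspace (top_of_set {0..T}) = {0..T} \<inter> (\<lambda>t. \<integral>v. \<phi> v \<partial>\<pi> t) -` U"
      using assms(1) by (auto simp: A)
    ultimately show "openin (top_of_set {0..T}) (\<pi> -` A \<inter> topspace (top_of_set {0..T}))" by simp
  next
    have "topspace (weak_topology e :: (real^'d) measure topology) = prob_energy e" by (rule topspace_weak_topology)
    then show "\<pi> ` topspace (top_of_set {0..T}) \<subseteq> \<Union> {{\<pi> \<in> prob_energy e. (\<integral> v. \<phi> v \<partial>\<pi>) \<in> U} | \<phi> U.
        continuous_on UNIV (\<phi> :: real^'d => real) \<and> bounded (range \<phi>) \<and> open (U :: real set)}"
      using assms(1) unfolding weak_topology_def topology_generated_by_topspace by auto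
  qed
  then show ?thesis by (simp add: continuous_paths_def)
qed

lemma continuous_paths_cadlag:
  assumes \<pi>: "\<pi> \<in> continuous_paths e T"
  shows "\<pi> \<in> cadlag_paths e T"
proof -
  have lim: "limitin (weak_topology e) \<pi> (\<pi> t) F"
    if t: "t \<in> {0..T}" and F: "F <= at t within {0..T}" for t F
    unfolding limitin_def
  proof (intro conjI allI impI)
    show "\<pi> t \<in> topspace (weak_topology e)"
      using continuous_paths_in[OF \<pi> t] by (simp add: topspace_weak_topology)
    fix U assume U: "openin (weak_topology e) U \<and> \<pi> t \<in> U"
    have "openin (top_of_set {0..T}) {t \<in> topspace (top_of_set {0..T}). \<pi> t \<in> U}"
      using \<pi> U unfolding continuous_paths_def mem_Collect_eq by (intro openin_continuous_map_preimage) auto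
    then obtain V where V: "open V" "{t \<in> {0..T}. \<pi> t \<in> U} = {0..T} \<inter> V"
      by (auto simp: openin_open)
    then have "t \<in> V" using t U by auto
    then have "\<forall>\<^sub>F x in at t within {0..T}. x \<in> V"
      using V(1) by (auto simp: eventually_at_topological)
    moreover have "\<forall>\<^sub>F x in at t within {0..T}. x \<in> {0..T}"
      by (auto simp: eventually_at_filter)
    ultimately have "\<forall>\<^sub>F x in at t within {0..T}. \<pi> x \<in> U"
      by eventually_elim (use V(2) in blast)
    then show "\<forall>\<^sub>F x in F. \<pi> x \<in> U" by (rule filter_leD[OF F])
  qed
  have right: "at_right t <= at t within {0..T}" if "t \<in> {0..<T}" for t
  proof -
    have "at_right t = at t within {t..T}" using that by (simp add: at_within_Icc_at_right)
    also have "... <= at t within {0..T}" using that by (intro at_le) auto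
    finally show ?thesis .
  qed
  have left: "at_left t <= at t within {0..T}" if "t \<in> {0<..T}" for t
  proof -
    have "at_left t = at t within {0..t}" using that by (simp add: at_within_Icc_at_left)
    also have "... <= at t within {0..T}" using that by (intro at_le) auto
    finally show ?thesis .
  qed
  show ?thesis
    unfolding cadlag_paths_def mem_Collect_eq
  proof (intro conjI ballI)
    show "limitin (weak_topology e) \<pi> (\<pi> t) (at_right t)" if "t \<in> {0..<T}" for t
      using lim[OF _ right[OF that]] that by simp
    show "\<exists>\<nu>. limitin (weak_topology e) \<pi> \<nu> (at_left t)" if "t \<in> {0<..T}" for t
      using lim[OF _ left[OF that]] that by auto
  qed (rule continuous_paths_in[OF \<pi>])
qed

lemma prob_energyD:
  assumes "\<pi> \<in> prob_energy e"
  shows "prob_space \<pi>" "sets \<pi> = sets borel" "space \<pi> = UNIV"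
    "(\<integral>\<^sup>+ v. ennreal ((norm v)\<^sup>2 / 2) \<partial>\<pi>) <= ennreal e" "(\<integral> v. v \<partial>\<pi>) = 0"
  using assms sets_eq_imp_space_eq[of \<pi> borel] by (auto simp: prob_energy_def)

text \<open>Closed sets generate the Borel sets, and the mass of a closed set is a limit of
  integrals of tent functions, each of which is continuous in time.\<close>

lemma continuous_paths_kernel:
  fixes \<pi> :: "real => (real^'d) measure"
  assumes \<pi>: "\<pi> \<in> continuous_paths e T" and T: "0 <= T"
  shows "(\<lambda>t. \<pi> (clamp_time T t)) \<in> borel \<rightarrow>\<^sub>M prob_algebra borel"
proof (rule measurable_prob_algebra_generated[where \<Omega>=UNIV and G="{C. closed C}"])
  show "sets (borel :: (real^'d) measure) = sigma_sets UNIV {C. closed C}" by (simp add: borel_eq_closed)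
  show "Int_stable {C :: (real^'d) set. closed C}" by (auto simp: Int_stable_def)
  have in_P: "\<pi> (clamp_time T t) \<in> prob_energy e" for t
    using continuous_paths_in[OF \<pi> clamp_time_in[OF T]] .
  show "prob_space (\<pi> (clamp_time T t))" "sets (\<pi> (clamp_time T t)) = sets borel" for t
    using prob_energyD[OF in_P] by auto
  fix C :: "(real^'d) set" assume "C \<in> {C. closed C}"
  then have C: "closed C" by simp
  show "(\<lambda>t. emeasure (\<pi> (clamp_time T t)) C) \<in> borel_fun"
  proof (cases "C = {}")
    case False
    let ?f = "\<lambda>n x. max 0 (1 - real n * infdist x C)"
    have cont: "continuous_on UNIV (\<lambda>t. \<integral>x. ?f n x \<partial>\<pi> (clamp_time T t))" for n
    proof -
      have "continuous_on {0..T} (\<lambda>t. \<integral>x. ?f n x \<partial>\<pi> t)"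
      proof (rule continuous_paths_integral[OF \<pi>])
        show "continuous_on UNIV (?f n)" by (intro continuous_intros)
        show "bounded (range (?f n))"
          by (rule boundedI[where B=1]) (auto simp: infdist_nonneg)
      qed
      moreover have "continuous_on UNIV (clamp_time T)" unfolding clamp_time_def by (intro continuous_intros)
      moreover have "clamp_time T ` UNIV \<subseteq> {0..T}" using clamp_time_in[OF T] by blast
      ultimately show ?thesis by (rule continuous_on_compose2)
    qed
    have "(\<lambda>t. measure (\<pi> (clamp_time T t)) C) \<in> borel_fun"
    proof (rule borel_measurable_LIMSEQ_real)
      show "(\<lambda>n. \<integral>x. ?f n x \<partial>\<pi> (clamp_time T t)) \<longlonglongrightarrow> measure (\<pi> (clamp_time T t)) C" for t
        using prob_energyD[OF in_P] C False
        by (intro tendsto_integral_tent prob_space.finite_measure) auto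
      show "(\<lambda>t. \<integral>x. ?f n x \<partial>\<pi> (clamp_time T t)) \<in> borel_fun" for n
        by (rule borel_measurable_continuous_onI[OF cont])
    qed
    moreover have "emeasure (\<pi> (clamp_time T t)) C = ennreal (measure (\<pi> (clamp_time T t)) C)" for t
      using prob_energyD[OF in_P[of t]] by (simp add: finite_measure.emeasure_eq_measure prob_space.finite_measure)
    ultimately show ?thesis by simp
  qed simp
qed auto

text \<open>\<open>boltzmann_flux\<close> averages two measures on sets; this carries the average
  over to integrals.\<close>

lemma nn_integral_mean_of_measures:
  fixes f :: "'a => ennreal"
  assumes sets: "sets N = sets M1" "sets M2 = sets M1"
    and em: "\<And>A. A \<in> sets M1 ==> emeasure N A = (emeasure M1 A + emeasure M2 A) / 2"
    and f: "f \<in> borel_measurable M1"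
  shows "(\<integral>\<^sup>+x. f x \<partial>N) = ((\<integral>\<^sup>+x. f x \<partial>M1) + (\<integral>\<^sup>+x. f x \<partial>M2)) / 2"
  using f
proof (induction rule: borel_measurable_induct)
  case (cong f g)
  then have "(\<integral>\<^sup>+x. f x \<partial>K) = (\<integral>\<^sup>+x. g x \<partial>K)" if "sets K = sets M1" for K
    using sets_eq_imp_space_eq[OF that] by (intro nn_integral_cong) auto
  with cong sets show ?case by simp
next
  case (set A)
  then show ?case using sets em by simp
next
  case (mult h c)
  have "h \<in> borel_measurable K" if "sets K = sets M1" for K
    using mult.hyps measurable_cong_sets[OF that refl] by blast
  with mult sets show ?case
    by (simp add: nn_integral_cmult ennreal_times_divide[symmetric] distrib_left[symmetric])
next
  case (add h v)
  have "h \<in> borel_measurable K \<and> v \<in> borel_measurable K" if "sets K = sets M1" for K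
    using add.hyps measurable_cong_sets[OF that refl] by blast
  with add sets show ?case
    by (simp add: nn_integral_add add_divide_distrib_ennreal ac_simps)
next
  case (seq U)
  have U: "U i \<in> borel_measurable K" if "sets K = sets M1" for K i
    using seq.hyps(1) measurable_cong_sets[OF that refl] by blast
  have SUP: "(\<integral>\<^sup>+x. (SUP i. U i) x \<partial>K) = (SUP i. \<integral>\<^sup>+x. U i x \<partial>K)" if "sets K = sets M1" for K
    using nn_integral_monotone_convergence_SUP[OF seq.hyps(3) U[OF that]] by (simp add: image_comp)
  have mono: "incseq (\<lambda>i. \<integral>\<^sup>+x. U i x \<partial>K)" for K
    using seq.hyps(3) by (auto simp: incseq_def le_fun_def intro!: nn_integral_mono)
  have "(\<integral>\<^sup>+x. (SUP i. U i) x \<partial>N) = (SUP i. ((\<integral>\<^sup>+x. U i x \<partial>M1) + (\<integral>\<^sup>+x. U i x \<partial>M2)) * inverse 2)"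
    using SUP[OF sets(1)] seq.IH by (simp add: divide_ennreal_def)
  also have "... = ((SUP i. \<integral>\<^sup>+x. U i x \<partial>M1) + (SUP i. \<integral>\<^sup>+x. U i x \<partial>M2)) * inverse 2"
    by (simp add: SUP_mult_right_ennreal[symmetric] ennreal_SUP_add[OF mono mono])
  finally show ?case using SUP[OF refl] SUP[OF sets(2)] by (simp add: divide_ennreal_def)
qed

section \<open>The reference flux as an iterated integral\<close>

locale boltzmann_kernel =
  fixes \<sigma> :: "(real^'d) measure"
  assumes haar: "haar_sphere \<sigma>" and card: "2 <= CARD('d)"
begin

definition s :: "(real^'d) measure" where "s = distr \<sigma> borel (\<lambda>u. u)"

lemma sets_sigma: "sets \<sigma> = sets (restrict_space borel (sphere 0 1))"
  using haar by (simp add: haar_sphere_def)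

lemma space_sigma: "space \<sigma> = sphere 0 1"
  using sets_eq_imp_space_eq[OF sets_sigma] by (simp add: space_restrict_space)

lemma measurable_sigma: "f \<in> borel_fun ==> f \<in> borel_measurable \<sigma>"
  using measurable_restrict_space1[of f borel borel "sphere 0 1"] measurable_cong_sets[OF sets_sigma refl] by blast

lemma nn_integral_s: "F \<in> borel_fun ==> (\<integral>\<^sup>+u. F u \<partial>s) = (\<integral>\<^sup>+u. F u \<partial>\<sigma>)"
  unfolding s_def by (subst nn_integral_distr) (auto intro!: measurable_sigma)

sublocale sphere_measure s
proof (rule sphere_measure.intro)
  have id: "(\<lambda>u. u) \<in> \<sigma> \<rightarrow>\<^sub>M borel" by (rule measurable_sigma) simp
  show "sets s = sets borel" by (simp add: s_def)
  have s_UNIV: "emeasure s UNIV = emeasure \<sigma> (space \<sigma>)"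
    unfolding s_def by (subst emeasure_distr[OF id]) simp_all
  then show "emeasure s UNIV ~= 0" using haar by (simp add: haar_sphere_def)
  show "finite_measure s"
    unfolding s_def using haar id by (intro finite_measure.finite_measure_distr) (auto simp: haar_sphere_def)
  show "AE u in s. norm u = 1"
    unfolding s_def by (subst AE_distr_iff[OF id]) (auto simp: space_sigma intro!: AE_I2)
  show "2 <= CARD('d)" by (rule card)
  show "rotation_invariant s"
    unfolding rotation_invariant_def
  proof (intro allI impI)
    fix R :: "real^'d^'d" assume R: "rotation_matrix R"
    have R\<sigma>: "(\<lambda>u. R *v u) \<in> \<sigma> \<rightarrow>\<^sub>M \<sigma>"
      unfolding measurable_cong_sets[OF sets_sigma sets_sigma]
      by (rule measurable_restrict_space3) (auto simp: rotation_matrix_norm[OF R])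
    have "distr s borel (\<lambda>u. R *v u) = distr \<sigma> borel (\<lambda>u. R *v u)"
      unfolding s_def by (subst distr_distr[OF _ id]) (auto simp: comp_def)
    also have "... = distr (distr \<sigma> \<sigma> (\<lambda>u. R *v u)) borel (\<lambda>u. u)"
      by (subst distr_distr[OF id R\<sigma>]) (simp add: comp_def)
    also have "... = s" using haar R by (simp add: haar_sphere_def s_def)
    finally show "distr s borel (\<lambda>u. R *v u) = s" .
  qed
qed

lemma nn_integral_collision_rate:
  assumes [measurable]: "f \<in> borel_fun"
  shows "(\<integral>\<^sup>+p. f p \<partial>collision_rate \<sigma> v w) = (\<integral>\<^sup>+u. ennreal (kernel_B (v - w) u) * f (post_velocities v w u) \<partial>s)"
proof -
  have [measurable]: "post_velocities v w \<in> borel_fun" "kernel_B (v - w) \<in> borel_fun"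
    by measurable
  have m: "post_velocities v w \<in> borel_measurable \<sigma>" "(\<lambda>u. ennreal (kernel_B (v - w) u)) \<in> borel_measurable \<sigma>"
    "(\<lambda>u. f (post_velocities v w u)) \<in> borel_measurable \<sigma>"
    by (rule measurable_sigma; measurable)+
  show ?thesis
    unfolding collision_rate_def using m
    by (simp add: nn_integral_distr nn_integral_density nn_integral_s)
qed

text \<open>The integral against \<open>ordered_flux\<close>, up to the factor \<open>1/2\<close>.\<close>

definition flux_integral :: "real => (real => (real^'d) measure) => ('d collision => ennreal) => ennreal" where
  "flux_integral T \<pi> f = (NBINT t. indicator {0..T} t * (\<integral>\<^sup>+v. (\<integral>\<^sup>+w. (\<integral>\<^sup>+u.
     ennreal (kernel_B (v - w) u) * f (t, v, w, post_velocities v w u) \<partial>s)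
       \<partial>\<pi> (clamp_time T t)) \<partial>\<pi> (clamp_time T t)))"

abbreviation kernel_path :: "real => (real => (real^'d) measure) => bool" where
  "kernel_path T \<pi> \<equiv> 0 <= T \<and> (\<lambda>t. \<pi> (clamp_time T t)) \<in> borel \<rightarrow>\<^sub>M prob_algebra borel"

text \<open>Measurability of the successive integrals, needed to move sums and suprema through
  \<open>flux_integral\<close>.\<close>

lemma flux_integral_layers:
  assumes \<pi>: "kernel_path T \<pi>" and [measurable]: "f \<in> borel_fun"
  defines "G \<equiv> \<lambda>t v w. \<integral>\<^sup>+u. ennreal (kernel_B (v - w) u) * f (t, v, w, post_velocities v w u) \<partial>s"
  shows "(\<lambda>w. G t v w) \<in> borel_measurable (\<pi> (clamp_time T t'))"
    and "(\<lambda>v. \<integral>\<^sup>+w. G t v w \<partial>\<pi> (clamp_time T t')) \<in> borel_measurable (\<pi> (clamp_time T t'))"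
    and "(\<lambda>t. \<integral>\<^sup>+v. \<integral>\<^sup>+w. G t v w \<partial>\<pi> (clamp_time T t) \<partial>\<pi> (clamp_time T t)) \<in> borel_fun"
proof -
  have sub: "(\<lambda>t. \<pi> (clamp_time T t)) \<in> borel \<rightarrow>\<^sub>M subprob_algebra borel"
    using \<pi> measurable_prob_algebraD by blast
  have sets: "sets (\<pi> (clamp_time T t)) = sets borel" for t
    using measurable_space[OF sub, of t] by (simp add: space_subprob_algebra)
  have G [measurable]: "(\<lambda>(t, v, w). G t v w) \<in> borel_measurable (borel \<Otimes>\<^sub>M (borel \<Otimes>\<^sub>M borel))"
    unfolding G_def by measurable
  have const: "(\<lambda>_. \<pi> (clamp_time T t')) \<in> borel \<rightarrow>\<^sub>M subprob_algebra (borel :: (real^'d) measure)"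
    using measurable_space[OF sub, of t'] by simp
  show "(\<lambda>w. G t v w) \<in> borel_measurable (\<pi> (clamp_time T t'))"
    unfolding measurable_cong_sets[OF sets refl] by measurable
  show "(\<lambda>v. \<integral>\<^sup>+w. G t v w \<partial>\<pi> (clamp_time T t')) \<in> borel_measurable (\<pi> (clamp_time T t'))"
    unfolding measurable_cong_sets[OF sets refl]
    by (rule nn_integral_measurable_subprob_algebra2[OF _ const]) measurable
  have "(\<lambda>p. \<integral>\<^sup>+w. G (fst p) (snd p) w \<partial>\<pi> (clamp_time T (fst p))) \<in> borel_measurable (borel \<Otimes>\<^sub>M borel)"
  proof (rule nn_integral_measurable_subprob_algebra2[OF _ measurable_compose[OF measurable_fst sub]])
    show "(\<lambda>(x, y). G (fst x) (snd x) y) \<in> borel_measurable ((borel \<Otimes>\<^sub>M borel) \<Otimes>\<^sub>M borel)"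
      unfolding G_def by measurable
  qed
  then have "(\<lambda>(t, v). \<integral>\<^sup>+w. G t v w \<partial>\<pi> (clamp_time T t)) \<in> borel_measurable (borel \<Otimes>\<^sub>M borel)"
    by (simp add: split_beta')
  then show "(\<lambda>t. \<integral>\<^sup>+v. \<integral>\<^sup>+w. G t v w \<partial>\<pi> (clamp_time T t) \<partial>\<pi> (clamp_time T t)) \<in> borel_fun"
    by (rule nn_integral_measurable_subprob_algebra2[OF _ sub])
qed

lemma flux_integral_cmult:
  assumes \<pi>: "kernel_path T \<pi>" and f [measurable]: "f \<in> borel_fun"
  shows "flux_integral T \<pi> (\<lambda>c. a * f c) = a * flux_integral T \<pi> f"
proof -
  note m = flux_integral_layers[OF \<pi> f]
  have "(\<integral>\<^sup>+u. ennreal (kernel_B (v - w) u) * (a * f (t, v, w, post_velocities v w u)) \<partial>s)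
      = a * (\<integral>\<^sup>+u. ennreal (kernel_B (v - w) u) * f (t, v, w, post_velocities v w u) \<partial>s)" for t v w
    by (subst nn_integral_cmult[symmetric]) (simp_all add: mult.left_commute)
  then show ?thesis
    unfolding flux_integral_def using m
    by (simp add: nn_integral_cmult mult.left_commute[of _ a])
qed

lemma flux_integral_add:
  assumes \<pi>: "kernel_path T \<pi>" and f [measurable]: "f \<in> borel_fun" and g [measurable]: "g \<in> borel_fun"
  shows "flux_integral T \<pi> (\<lambda>c. f c + g c) = flux_integral T \<pi> f + flux_integral T \<pi> g"
proof -
  note m = flux_integral_layers[OF \<pi> f] flux_integral_layers[OF \<pi> g]
  show ?thesis
    unfolding flux_integral_def distrib_left using m
    by (simp add: nn_integral_add distrib_left)
qed

lemma flux_integral_suminf: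
  assumes \<pi>: "kernel_path T \<pi>" and f [measurable]: "\<And>i. f i \<in> borel_fun"
  shows "flux_integral T \<pi> (\<lambda>c. \<Sum>i. f i c) = (\<Sum>i. flux_integral T \<pi> (f i))"
proof -
  note m = flux_integral_layers[OF \<pi> f]
  show ?thesis
    unfolding flux_integral_def using m
    by (simp add: nn_integral_suminf ennreal_suminf_cmult[symmetric] del: ennreal_suminf_cmult)
qed

lemma flux_integral_mono_SUP:
  assumes \<pi>: "kernel_path T \<pi>" and f [measurable]: "\<And>i. f i \<in> borel_fun" and inc: "incseq f"
  shows "flux_integral T \<pi> (\<lambda>c. SUP i. f i c) = (SUP i. flux_integral T \<pi> (f i))"
proof -
  note m = flux_integral_layers[OF \<pi> f]
  have le: "f i c <= f j c" if "i <= j" for i j c using incseqD[OF inc that] by (rule le_funD)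
  let ?P = "\<lambda>t. \<pi> (clamp_time T t)"
  let ?G = "\<lambda>i t v w. \<integral>\<^sup>+u. ennreal (kernel_B (v - w) u) * f i (t, v, w, post_velocities v w u) \<partial>s"
  have G: "?G i t v w <= ?G j t v w" if "i <= j" for i j t v w
    by (intro nn_integral_mono mult_left_mono le that) simp
  have 1: "(\<integral>\<^sup>+u. ennreal (kernel_B (v - w) u) * (SUP i. f i (t, v, w, post_velocities v w u)) \<partial>s)
      = (SUP i. ?G i t v w)" for t v w
    unfolding SUP_mult_left_ennreal
    by (rule nn_integral_monotone_convergence_SUP)
      (auto simp: incseq_def le_fun_def intro!: mult_left_mono le)
  have 2: "(\<integral>\<^sup>+w. (SUP i. ?G i t v w) \<partial>?P t') = (SUP i. \<integral>\<^sup>+w. ?G i t v w \<partial>?P t')" for t v t'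
    by (rule nn_integral_monotone_convergence_SUP) (auto simp: incseq_def le_fun_def intro!: G m)
  have 3: "(\<integral>\<^sup>+v. (SUP i. \<integral>\<^sup>+w. ?G i t v w \<partial>?P t') \<partial>?P t') = (SUP i. \<integral>\<^sup>+v. \<integral>\<^sup>+w. ?G i t v w \<partial>?P t' \<partial>?P t')" for t t'
    by (rule nn_integral_monotone_convergence_SUP)
      (auto simp: incseq_def le_fun_def intro!: nn_integral_mono G m)
  have 4: "(NBINT t. (SUP i. indicator {0..T} t * (\<integral>\<^sup>+v. \<integral>\<^sup>+w. ?G i t v w \<partial>?P t \<partial>?P t)))
      = (SUP i. (NBINT t. indicator {0..T} t * (\<integral>\<^sup>+v. \<integral>\<^sup>+w. ?G i t v w \<partial>?P t \<partial>?P t)))"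
    by (rule nn_integral_monotone_convergence_SUP)
      (use m in \<open>auto simp: incseq_def le_fun_def intro!: mult_left_mono nn_integral_mono G\<close>)
  show ?thesis
    unfolding flux_integral_def unfolding 1 2 3 unfolding SUP_mult_left_ennreal[of "indicator {0..T} _"] 4 ..
qed

end

lemma swap_in_eq: "swap_in c = (fst c, fst (snd (snd c)), fst (snd c), snd (snd (snd c)))"
  and swap_out_eq: "swap_out c = (fst c, fst (snd c), fst (snd (snd c)), snd (snd (snd (snd c))), fst (snd (snd (snd c))))"
  by (cases c; simp)+

lemma swap_collision_measurable [measurable]:
  "swap_in \<in> borel_fun" "swap_out \<in> borel_fun"
proof -
  have "continuous_on UNIV (\<lambda>c :: 'd::finite collision. (fst c, fst (snd (snd c)), fst (snd c), snd (snd (snd c))))"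
    "continuous_on UNIV (\<lambda>c :: 'd collision. (fst c, fst (snd c), fst (snd (snd c)), snd (snd (snd (snd c))), fst (snd (snd (snd c)))))"
    by (intro continuous_intros)+
  then show "swap_in \<in> borel_measurable (borel :: 'd::finite collision measure)" "swap_out \<in> borel_measurable (borel :: 'd collision measure)"
    by (simp_all add: swap_in_eq[abs_def] swap_out_eq[abs_def] borel_measurable_continuous_onI)
qed

lemma space_collision_space: "space (collision_space T) = {0..T} \<times> UNIV"
  by (simp add: collision_space_def space_restrict_space)

lemma collision_slab_borel [measurable]: "({0..T} \<times> UNIV :: 'd::finite collision set) \<in> sets borel"
  by (intro borel_closed closed_Times) auto

lemma sets_collision_spaceD: "A \<in> sets (collision_space T :: 'd::finite collision measure) ==> A \<in> sets borel"
  using collision_slab_borel by (auto simp: collision_space_def sets_restrict_space_iff)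

lemma swap_collision_measurable_space [measurable]:
  "swap_in \<in> collision_space T \<rightarrow>\<^sub>M collision_space T" "swap_out \<in> collision_space T \<rightarrow>\<^sub>M collision_space T"
  unfolding collision_space_def by (intro measurable_restrict_space3; auto simp: swap_in_eq swap_out_eq)+

lemma swap_collision_involutive [simp]: "swap_in (swap_in c) = c" "swap_out (swap_out c) = c"
  "swap_in (swap_out c) = swap_out (swap_in c)"
  by (simp_all add: swap_in_eq swap_out_eq)

context boltzmann_kernel
begin

lemma flux_integral_cong:
  assumes "\<And>t q. t \<in> {0..T} ==> f (t, q) = g (t, q)"
  shows "flux_integral T \<pi> f = flux_integral T \<pi> g"
  unfolding flux_integral_def
  by (intro nn_integral_cong) (auto simp: indicator_def assms)

lemma sets_ordered_flux: "sets (ordered_flux \<sigma> T \<pi>) = sets (collision_space T)"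
  unfolding ordered_flux_def by (simp add: sets_measure_of[OF sets.space_closed] sets.sigma_sets_eq)

lemma borel_measurable_collision_space:
  "f \<in> borel_fun ==> f \<in> borel_measurable (collision_space T)"
  unfolding collision_space_def by (rule measurable_restrict_space1)

lemma borel_measurable_ordered_flux:
  "f \<in> borel_fun ==> f \<in> borel_measurable (ordered_flux \<sigma> T \<pi>)"
  unfolding measurable_cong_sets[OF sets_ordered_flux refl] by (rule borel_measurable_collision_space)

text \<open>\<open>measure_of\<close> attains the prescribed values only once they are known to be
  countably additive, which is inherited from the iterated integral.\<close>

lemma emeasure_ordered_flux:
  assumes \<pi>: "kernel_path T \<pi>" and A: "A \<in> sets (collision_space T)"
  shows "emeasure (ordered_flux \<sigma> T \<pi>) A = (1/2) * flux_integral T \<pi> (indicator A)"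
proof -
  let ?\<mu> = "\<lambda>A. (1/2) * (\<integral>\<^sup>+ t\<in>{0..T}. (\<integral>\<^sup>+ v. (\<integral>\<^sup>+ vs. (\<integral>\<^sup>+ p.
          indicator A (t, v, vs, p) \<partial>collision_rate \<sigma> v vs) \<partial>\<pi> t) \<partial>\<pi> t) \<partial>lborel)"
  have eq: "?\<mu> A = (1/2) * flux_integral T \<pi> (indicator A)" if "A \<in> sets (collision_space T)" for A
  proof -
    have [measurable]: "A \<in> sets borel" using that by (rule sets_collision_spaceD)
    have "(\<integral>\<^sup>+ p. indicator A (t, v, w, p) \<partial>collision_rate \<sigma> v w)
        = (\<integral>\<^sup>+u. ennreal (kernel_B (v - w) u) * indicator A (t, v, w, post_velocities v w u) \<partial>s)" for t v w
      by (rule nn_integral_collision_rate) measurable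
    then show ?thesis
      unfolding flux_integral_def
      by (intro arg_cong[where f="(*) (1/2)"] nn_integral_cong) (auto simp: indicator_def clamp_time_id)
  qed
  show ?thesis
    unfolding eq[OF A, symmetric]
  proof (rule emeasure_measure_of[OF ordered_flux_def sets.space_closed])
    show "positive (sets (ordered_flux \<sigma> T \<pi>)) ?\<mu>"
      by (simp add: positive_def)
    show "countably_additive (sets (ordered_flux \<sigma> T \<pi>)) ?\<mu>"
    proof (rule countably_additiveI)
      fix A :: "nat => _" assume A: "range A \<subseteq> sets (ordered_flux \<sigma> T \<pi>)" "disjoint_family A"
        "(\<Union>i. A i) \<in> sets (ordered_flux \<sigma> T \<pi>)"
      then have Ai: "A i \<in> sets (collision_space T)" for i by (auto simp: sets_ordered_flux)
      have [measurable]: "A i \<in> sets borel" for i by (rule sets_collision_spaceD[OF Ai])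
      have "(\<Sum>i. ?\<mu> (A i)) = (\<Sum>i. (1/2) * flux_integral T \<pi> (indicator (A i)))"
        unfolding eq[OF Ai] ..
      also have "... = (1/2) * flux_integral T \<pi> (\<lambda>c. \<Sum>i. indicator (A i) c)"
        using \<pi> by (subst flux_integral_suminf) (auto simp: ennreal_suminf_cmult)
      also have "(\<lambda>c. \<Sum>i. indicator (A i) c :: ennreal) = indicator (\<Union>i. A i)"
        using suminf_indicator[OF A(2)] by auto
      also have "(1/2) * flux_integral T \<pi> (indicator (\<Union>i. A i)) = ?\<mu> (\<Union>i. A i)"
        using A(3) by (subst eq) (auto simp: sets_ordered_flux)
      finally show "(\<Sum>i. ?\<mu> (A i)) = ?\<mu> (\<Union>i. A i)" .
    qed
    show "A \<in> sets (ordered_flux \<sigma> T \<pi>)" using A by (simp add: sets_ordered_flux)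
  qed
qed

lemma nn_integral_ordered_flux_borel:
  assumes \<pi>: "kernel_path T \<pi>" and f: "f \<in> borel_fun"
  shows "(\<integral>\<^sup>+c. f c \<partial>ordered_flux \<sigma> T \<pi>) = (1/2) * flux_integral T \<pi> f"
  using f
proof (induction rule: borel_measurable_induct)
  case (cong f g)
  then have "f = g" by auto
  with cong show ?case by simp
next
  case (set A)
  then have [measurable]: "A \<in> sets borel" by simp
  let ?A = "A \<inter> ({0..T} \<times> UNIV)"
  have A: "?A \<in> sets (collision_space T)"
    unfolding collision_space_def sets_restrict_space by (rule image_eqI[of _ _ A]) (use set in auto)
  have "(\<integral>\<^sup>+c. indicator A c \<partial>ordered_flux \<sigma> T \<pi>) = (\<integral>\<^sup>+c. indicator ?A c \<partial>ordered_flux \<sigma> T \<pi>)"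
    using sets_eq_imp_space_eq[OF sets_ordered_flux, of T \<pi>]
    by (intro nn_integral_cong) (auto simp: space_collision_space indicator_def)
  also have "... = (1/2) * flux_integral T \<pi> (indicator ?A)"
    using A by (simp add: emeasure_ordered_flux[OF \<pi>] sets_ordered_flux)
  also have "flux_integral T \<pi> (indicator ?A) = flux_integral T \<pi> (indicator A)"
    by (rule flux_integral_cong) (auto simp: indicator_def)
  finally show ?case .
next
  case (mult h c)
  have "h \<in> borel_measurable (ordered_flux \<sigma> T \<pi>)"
    by (rule borel_measurable_ordered_flux[OF mult.hyps(2)])
  with mult show ?case
    by (simp add: nn_integral_cmult flux_integral_cmult[OF \<pi>] mult.left_commute)
next
  case (add h v)
  have "h \<in> borel_measurable (ordered_flux \<sigma> T \<pi>)" "v \<in> borel_measurable (ordered_flux \<sigma> T \<pi>)"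
    using add.hyps by (auto intro: borel_measurable_ordered_flux)
  with add show ?case
    by (simp add: nn_integral_add flux_integral_add[OF \<pi>] distrib_left)
next
  case (seq U)
  have U: "U i \<in> borel_measurable (ordered_flux \<sigma> T \<pi>)" for i
    by (rule borel_measurable_ordered_flux[OF seq.hyps(1)])
  have "(\<integral>\<^sup>+c. (SUP i. U i c) \<partial>ordered_flux \<sigma> T \<pi>) = (SUP i. (1/2) * flux_integral T \<pi> (U i))"
    using nn_integral_monotone_convergence_SUP[OF seq.hyps(3) U] seq.IH by simp
  also have "... = (1/2) * flux_integral T \<pi> (\<lambda>c. SUP i. U i c)"
    using flux_integral_mono_SUP[OF \<pi> seq.hyps(1,3)] by (simp add: SUP_mult_left_ennreal)
  finally show ?case by (simp add: image_comp Sup_fun_def)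
qed

lemma sets_boltzmann_flux: "sets (boltzmann_flux \<sigma> T \<pi>) = sets (collision_space T)"
  unfolding boltzmann_flux_def by (simp add: sets_measure_of[OF sets.space_closed] sets.sigma_sets_eq)

lemma space_boltzmann_flux: "space (boltzmann_flux \<sigma> T \<pi>) = {0..T} \<times> UNIV"
  using sets_eq_imp_space_eq[OF sets_boltzmann_flux] by (simp add: space_collision_space)

lemma emeasure_boltzmann_flux:
  assumes A: "A \<in> sets (collision_space T)"
  shows "emeasure (boltzmann_flux \<sigma> T \<pi>) A = (emeasure (ordered_flux \<sigma> T \<pi>) A
     + emeasure (distr (ordered_flux \<sigma> T \<pi>) (collision_space T) swap_out) A) / 2"
proof (rule emeasure_measure_of[OF boltzmann_flux_def sets.space_closed])
  show "positive (sets (boltzmann_flux \<sigma> T \<pi>)) (\<lambda>A. (emeasure (ordered_flux \<sigma> T \<pi>) A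
     + emeasure (distr (ordered_flux \<sigma> T \<pi>) (collision_space T) swap_out) A) / 2)"
    by (simp add: positive_def)
  show "countably_additive (sets (boltzmann_flux \<sigma> T \<pi>)) (\<lambda>A. (emeasure (ordered_flux \<sigma> T \<pi>) A
     + emeasure (distr (ordered_flux \<sigma> T \<pi>) (collision_space T) swap_out) A) / 2)"
  proof (rule countably_additiveI)
    fix A :: "nat => _" assume A: "range A \<subseteq> sets (boltzmann_flux \<sigma> T \<pi>)" "disjoint_family A"
    then have "range A \<subseteq> sets (ordered_flux \<sigma> T \<pi>)" "range A \<subseteq> sets (distr (ordered_flux \<sigma> T \<pi>) (collision_space T) swap_out)"
      by (simp_all add: sets_boltzmann_flux sets_ordered_flux)
    from suminf_emeasure[OF this(1) A(2)] suminf_emeasure[OF this(2) A(2)]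
    show "(\<Sum>i. (emeasure (ordered_flux \<sigma> T \<pi>) (A i) + emeasure (distr (ordered_flux \<sigma> T \<pi>) (collision_space T) swap_out) (A i)) / 2)
      = (emeasure (ordered_flux \<sigma> T \<pi>) (\<Union>i. A i) + emeasure (distr (ordered_flux \<sigma> T \<pi>) (collision_space T) swap_out) (\<Union>i. A i)) / 2"
      by (simp add: divide_ennreal_def ennreal_suminf_multc suminf_add[symmetric])
  qed
qed (use A in \<open>simp add: sets_boltzmann_flux\<close>)

text \<open>The factor \<open>1/4\<close> combines the \<open>1/2\<close> of
  \<open>ordered_flux\<close> with the average over the labelling of the outgoing pair.\<close>

lemma nn_integral_boltzmann_flux:
  assumes \<pi>: "kernel_path T \<pi>" and f: "f \<in> borel_measurable (collision_space T)"
  shows "(\<integral>\<^sup>+c. f c \<partial>boltzmann_flux \<sigma> T \<pi>)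
    = (1/4) * (flux_integral T \<pi> f + flux_integral T \<pi> (\<lambda>c. f (swap_out c)))"
proof -
  let ?O = "ordered_flux \<sigma> T \<pi>"
  let ?S = "{0..T} \<times> UNIV :: 'd collision set"
  \<comment> \<open>\<open>f\<close> is measurable on the slab; extended by zero it is Borel on the
    whole space.\<close>
  define g where "g c = f c * indicator ?S c" for c
  have g [measurable]: "g \<in> borel_fun"
    using f unfolding g_def collision_space_def by (subst (asm) borel_measurable_restrict_space_iff_ennreal) auto
  have so: "swap_out \<in> ?O \<rightarrow>\<^sub>M collision_space T"
    unfolding measurable_cong_sets[OF sets_ordered_flux refl] by measurable
  have gO: "g \<in> borel_measurable (collision_space T)"
    by (rule borel_measurable_collision_space[OF g])
  have "(\<integral>\<^sup>+c. f c \<partial>boltzmann_flux \<sigma> T \<pi>) = (\<integral>\<^sup>+c. g c \<partial>boltzmann_flux \<sigma> T \<pi>)"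
    by (intro nn_integral_cong) (simp add: space_boltzmann_flux g_def)
  also have "... = ((\<integral>\<^sup>+c. g c \<partial>?O) + (\<integral>\<^sup>+c. g c \<partial>distr ?O (collision_space T) swap_out)) / 2"
    using emeasure_boltzmann_flux gO
    by (intro nn_integral_mean_of_measures)
      (simp_all add: sets_ordered_flux sets_boltzmann_flux measurable_cong_sets[OF sets_ordered_flux refl])
  also have "(\<integral>\<^sup>+c. g c \<partial>distr ?O (collision_space T) swap_out) = (\<integral>\<^sup>+c. g (swap_out c) \<partial>?O)"
    by (rule nn_integral_distr[OF so]) (use gO in simp)
  also have "... = (1/2) * flux_integral T \<pi> (\<lambda>c. g (swap_out c))"
    by (rule nn_integral_ordered_flux_borel[OF \<pi>]) measurable
  also have "(\<integral>\<^sup>+c. g c \<partial>?O) = (1/2) * flux_integral T \<pi> g"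
    by (rule nn_integral_ordered_flux_borel[OF \<pi> g])
  also have "((1/2) * flux_integral T \<pi> g + (1/2) * flux_integral T \<pi> (\<lambda>c. g (swap_out c))) / 2
      = (1/4) * (flux_integral T \<pi> g + flux_integral T \<pi> (\<lambda>c. g (swap_out c)))"
  proof -
    have "(1/2 :: ennreal) * inverse 2 = 1/4"
      by (simp add: divide_ennreal_def ennreal_inverse_mult[symmetric])
    then have "(1/2 * (X + Y)) / 2 = 1/4 * (X + Y)" for X Y :: ennreal
      unfolding divide_ennreal_def by (metis mult.assoc mult.commute)
    then show ?thesis by (simp only: distrib_left[symmetric])
  qed
  also have "flux_integral T \<pi> g = flux_integral T \<pi> f"
    by (rule flux_integral_cong) (simp add: g_def)
  also have "flux_integral T \<pi> (\<lambda>c. g (swap_out c)) = flux_integral T \<pi> (\<lambda>c. f (swap_out c))"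
    by (rule flux_integral_cong) (simp add: g_def swap_out_eq)
  finally show ?thesis .
qed

text \<open>This is a relabelling of the two particles: the collision rule and the kernel are
  symmetric, and both velocities are drawn from the same measure.\<close>

lemma flux_integral_swap_both:
  assumes \<pi>: "kernel_path T \<pi>" and f [measurable]: "f \<in> borel_fun"
  shows "flux_integral T \<pi> (\<lambda>c. f (swap_in (swap_out c))) = flux_integral T \<pi> f"
  unfolding flux_integral_def
proof (rule nn_integral_cong, rule arg_cong[where f="(*) _"])
  fix t
  let ?p = "\<pi> (clamp_time T t)"
  have "?p \<in> space (prob_algebra borel)"
    using \<pi> measurable_space[of "\<lambda>t. \<pi> (clamp_time T t)" borel "prob_algebra borel" t] by simp
  then have p: "prob_space ?p" "sets ?p = sets borel" by (auto simp: space_prob_algebra)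
  interpret prob_space ?p by fact
  interpret pp: pair_sigma_finite ?p ?p ..
  note [measurable_cong] = p(2)
  let ?G = "\<lambda>v w. \<integral>\<^sup>+u. ennreal (kernel_B (v - w) u) * f (t, v, w, post_velocities v w u) \<partial>s"
  have "(\<integral>\<^sup>+u. ennreal (kernel_B (v - w) u) * f (swap_in (swap_out (t, v, w, post_velocities v w u))) \<partial>s) = ?G w v" for v w
  proof (rule nn_integral_cong)
    fix u
    have "swap_in (swap_out (t, v, w, post_velocities v w u)) = (t, w, v, post_velocities w v u)"
      by (simp add: post_velocities_def inner_diff_right algebra_simps)
    moreover have "kernel_B (v - w) u = kernel_B (w - v) u"
      by (simp add: kernel_B_def inner_diff_left abs_minus_commute)
    ultimately show "ennreal (kernel_B (v - w) u) * f (swap_in (swap_out (t, v, w, post_velocities v w u)))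
      = ennreal (kernel_B (w - v) u) * f (t, w, v, post_velocities w v u)" by simp
  qed
  then show "(\<integral>\<^sup>+v. (\<integral>\<^sup>+w. (\<integral>\<^sup>+u. ennreal (kernel_B (v - w) u) * f (swap_in (swap_out (t, v, w, post_velocities v w u))) \<partial>s) \<partial>?p) \<partial>?p)
      = (\<integral>\<^sup>+v. (\<integral>\<^sup>+w. ?G v w \<partial>?p) \<partial>?p)"
    using pp.Fubini'[of "\<lambda>v w. ?G w v"] by simp
qed

end

section \<open>Costs of fluxes given by a density\<close>

definition rate_fun :: "real => real" where
  "rate_fun x = x * ln x - (x - 1)"

lemma rate_fun_measurable [measurable]: "rate_fun \<in> borel_fun"
  unfolding rate_fun_def[abs_def] by measurable

lemma ennreal_half: "(1 / 2 :: ennreal) = ennreal (1 / 2)"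
  using divide_ennreal[of 1 2] by simp

lemma ennreal_quarter: "(1 / 4 :: ennreal) = ennreal (1 / 4)"
  using divide_ennreal[of 1 4] by simp

lemma prob_energy_norm:
  assumes "\<pi> \<in> prob_energy e" "0 <= e"
  shows "(\<integral>\<^sup>+v. ennreal (norm v) \<partial>\<pi>) <= ennreal (1/2 + e)"
proof -
  interpret prob_space \<pi> using prob_energyD(1)[OF assms(1)] .
  note [measurable_cong] = prob_energyD(2)[OF assms(1)]
  have "norm v <= 1/2 + (norm v)\<^sup>2 / 2" for v :: "real^'d"
    using zero_le_power2[of "norm v - 1"] unfolding power2_diff by simp
  then have "(\<integral>\<^sup>+v. ennreal (norm v) \<partial>\<pi>) <= (\<integral>\<^sup>+v. ennreal (1/2) + ennreal ((norm v)\<^sup>2 / 2) \<partial>\<pi>)"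
    by (intro nn_integral_mono, subst ennreal_plus[symmetric]) (simp, simp, rule ennreal_leI, fast)
  also have "... = ennreal (1/2) + (\<integral>\<^sup>+v. ennreal ((norm v)\<^sup>2 / 2) \<partial>\<pi>)"
    by (subst nn_integral_add) (simp_all add: emeasure_space_1)
  also have "... <= ennreal (1/2) + ennreal e"
    using prob_energyD(4)[OF assms(1)] by (rule add_left_mono)
  also have "... = ennreal (1/2 + e)" using assms(2) by (intro ennreal_plus[symmetric]) auto
  finally show ?thesis .
qed

lemma flux_measuresD:
  fixes Q :: "'d::finite collision measure"
  assumes Q: "Q \<in> flux_measures T"
  shows "sets Q = sets (collision_space T)" "space Q = {0..T} \<times> UNIV" "finite_measure Q"
    and "f \<in> borel_fun ==> f \<in> borel_measurable Q"
    and "F \<in> borel_fun ==> (\<integral>\<^sup>+c. F (swap_in c) \<partial>Q) = (\<integral>\<^sup>+c. F c \<partial>Q)"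
    and "F \<in> borel_fun ==> (\<integral>\<^sup>+c. F (swap_out c) \<partial>Q) = (\<integral>\<^sup>+c. F c \<partial>Q)"
proof -
  show sets: "sets Q = sets (collision_space T)" and "finite_measure Q"
    using Q by (auto simp: flux_measures_def)
  show "space Q = {0..T} \<times> UNIV"
    using sets_eq_imp_space_eq[OF sets] by (simp add: space_collision_space)
  show m: "f \<in> borel_measurable Q" if "f \<in> borel_fun" for f :: "'d collision => 'x::topological_space"
    unfolding measurable_cong_sets[OF sets refl] collision_space_def by (rule measurable_restrict_space1[OF that])
  have sw: "swap_in \<in> Q \<rightarrow>\<^sub>M Q" "swap_out \<in> Q \<rightarrow>\<^sub>M Q"
    unfolding measurable_cong_sets[OF sets sets] by measurable
  have inv: "distr Q Q swap_in = Q" "distr Q Q swap_out = Q"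
    using Q by (auto simp: flux_measures_def)
  show "(\<integral>\<^sup>+c. F (swap_in c) \<partial>Q) = (\<integral>\<^sup>+c. F c \<partial>Q)" if F: "F \<in> borel_fun" for F
    using nn_integral_distr[OF sw(1), of F] m[OF F] unfolding inv(1) by simp
  show "(\<integral>\<^sup>+c. F (swap_out c) \<partial>Q) = (\<integral>\<^sup>+c. F c \<partial>Q)" if F: "F \<in> borel_fun" for F
    using nn_integral_distr[OF sw(2), of F] m[OF F] unfolding inv(2) by simp
qed

lemma flux_measuresI:
  fixes Q :: "'d::finite collision measure"
  assumes sets: "sets Q = sets (collision_space T)" and "finite_measure Q"
    and i: "\<And>F :: 'd collision => ennreal. F \<in> borel_fun ==> (\<integral>\<^sup>+c. F (swap_in c) \<partial>Q) = (\<integral>\<^sup>+c. F c \<partial>Q)"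
    and o: "\<And>F :: 'd collision => ennreal. F \<in> borel_fun ==> (\<integral>\<^sup>+c. F (swap_out c) \<partial>Q) = (\<integral>\<^sup>+c. F c \<partial>Q)"
  shows "Q \<in> flux_measures T"
proof -
  have sw: "swap_in \<in> Q \<rightarrow>\<^sub>M Q" "swap_out \<in> Q \<rightarrow>\<^sub>M Q"
    unfolding measurable_cong_sets[OF sets sets] by measurable
  have "distr Q Q h = Q" if h: "h \<in> Q \<rightarrow>\<^sub>M Q"
    and inv: "\<And>F :: 'd collision => ennreal. F \<in> borel_fun ==> (\<integral>\<^sup>+c. F (h c) \<partial>Q) = (\<integral>\<^sup>+c. F c \<partial>Q)" for h
  proof (rule measure_eqI)
    fix A assume A: "A \<in> sets (distr Q Q h)"
    then have A': "A \<in> sets borel" using sets sets_collision_spaceD by auto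
    have "emeasure (distr Q Q h) A = (\<integral>\<^sup>+c. indicator A (h c) \<partial>Q)"
      using A nn_integral_distr[OF h, of "indicator A"] by simp
    also have "... = (\<integral>\<^sup>+c. indicator A c \<partial>Q)" by (rule inv) (use A' in simp)
    finally show "emeasure (distr Q Q h) A = emeasure Q A" using A by simp
  qed simp
  then show ?thesis
    using assms(1,2) sw i o unfolding flux_measures_def by blast
qed

context boltzmann_kernel
begin

abbreviation BF :: "real => (real => (real^'d) measure) => 'd collision measure" where
  "BF \<equiv> boltzmann_flux \<sigma>"

lemma borel_measurable_boltzmann_flux:
  "f \<in> borel_fun ==> f \<in> borel_measurable (BF T \<pi>)"
  unfolding measurable_cong_sets[OF sets_boltzmann_flux refl] by (rule borel_measurable_collision_space)

lemma nn_integral_boltzmann_flux_borel: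
  assumes \<pi>: "kernel_path T \<pi>" and f: "f \<in> borel_fun"
  shows "(\<integral>\<^sup>+c. f c \<partial>BF T \<pi>)
    = (1/4) * (flux_integral T \<pi> f + flux_integral T \<pi> (\<lambda>c. f (swap_out c)))"
  by (rule nn_integral_boltzmann_flux[OF \<pi> borel_measurable_collision_space[OF f]])

text \<open>The average over labellings gives invariance under \<open>swap_out\<close> at once;
  invariance under \<open>swap_in\<close> follows by composing with the relabelling in
  \<open>flux_integral_swap_both\<close>.\<close>

lemma nn_integral_boltzmann_flux_swap:
  assumes \<pi>: "kernel_path T \<pi>" and f [measurable]: "f \<in> borel_fun"
  shows "(\<integral>\<^sup>+c. f (swap_out c) \<partial>BF T \<pi>) = (\<integral>\<^sup>+c. f c \<partial>BF T \<pi>)"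
    and "(\<integral>\<^sup>+c. f (swap_in c) \<partial>BF T \<pi>) = (\<integral>\<^sup>+c. f c \<partial>BF T \<pi>)"
proof -
  have m: "(\<lambda>c. f (swap_out c)) \<in> borel_fun" "(\<lambda>c. f (swap_in c)) \<in> borel_fun"
    by measurable
  show "(\<integral>\<^sup>+c. f (swap_out c) \<partial>BF T \<pi>) = (\<integral>\<^sup>+c. f c \<partial>BF T \<pi>)"
    by (simp add: nn_integral_boltzmann_flux_borel[OF \<pi>] m f add.commute)
  have "flux_integral T \<pi> (\<lambda>c. f (swap_in c)) = flux_integral T \<pi> (\<lambda>c. f (swap_out c))"
    using flux_integral_swap_both[OF \<pi> m(2)] by simp
  moreover have "flux_integral T \<pi> (\<lambda>c. f (swap_in (swap_out c))) = flux_integral T \<pi> f"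
    by (rule flux_integral_swap_both[OF \<pi> f])
  ultimately show "(\<integral>\<^sup>+c. f (swap_in c) \<partial>BF T \<pi>) = (\<integral>\<^sup>+c. f c \<partial>BF T \<pi>)"
    by (simp add: nn_integral_boltzmann_flux_borel[OF \<pi>] m f add.commute)
qed

lemma nn_integral_boltzmann_flux_symmetric:
  assumes \<pi>: "kernel_path T \<pi>" and f: "f \<in> borel_fun"
    and sym: "\<And>c. f (swap_out c) = f c"
  shows "(\<integral>\<^sup>+c. f c \<partial>BF T \<pi>) = (1/2) * flux_integral T \<pi> f"
proof -
  have "(1/4 :: ennreal) + 1/4 = 1/2"
    unfolding ennreal_half ennreal_quarter by (subst ennreal_plus[symmetric]) simp_all
  then have "(1/4) * (X + X) = (1/2) * X" for X :: ennreal
    by (metis distrib_left distrib_right)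
  then show ?thesis
    by (simp only: nn_integral_boltzmann_flux_borel[OF \<pi> f] sym)
qed

text \<open>On unit vectors the kernel is at most \<open>norm v + norm w\<close>, and the energy
  bound controls first moments uniformly in time.\<close>

lemma finite_boltzmann_flux:
  assumes \<pi>: "\<pi> \<in> continuous_paths e T" and T: "0 <= T" and e: "0 <= e"
  shows "finite_measure (BF T \<pi>)"
proof
  have k: "kernel_path T \<pi>" using continuous_paths_kernel[OF \<pi> T] T by simp
  define S where "S = emeasure s UNIV"
  have S: "S < top" unfolding S_def by (rule emeasure_s_finite)
  let ?P = "\<lambda>t. \<pi> (clamp_time T t)"
  have inner: "(\<integral>\<^sup>+u. ennreal (kernel_B (v - w) u) \<partial>s) <= (ennreal (norm v) + ennreal (norm w)) * S" for v w
  proof -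
    have "(\<integral>\<^sup>+u. ennreal (kernel_B (v - w) u) \<partial>s) <= (\<integral>\<^sup>+u. (ennreal (norm v) + ennreal (norm w)) \<partial>s)"
    proof (rule nn_integral_mono_AE, use norm_s in eventually_elim)
      fix u :: "real^'d" assume "norm u = 1"
      then have "\<bar>(v - w) \<bullet> u\<bar> <= norm v + norm w"
        using Cauchy_Schwarz_ineq2[of "v - w" u] norm_triangle_ineq4[of v w] by simp
      then show "ennreal (kernel_B (v - w) u) <= ennreal (norm v) + ennreal (norm w)"
        by (simp add: kernel_B_def flip: ennreal_plus)
    qed
    also have "... = (ennreal (norm v) + ennreal (norm w)) * S"
      using sets_eq_imp_space_eq[OF sets_s] by (simp add: S_def)
    finally show ?thesis .
  qed
  have "flux_integral T \<pi> (\<lambda>_. 1) <= (NBINT t. indicator {0..T} t * ((ennreal (1/2 + e) + ennreal (1/2 + e)) * S))"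
    unfolding flux_integral_def mult_1_right
  proof (intro nn_integral_mono mult_left_mono)
    fix t
    have P: "?P t \<in> prob_energy e" using continuous_paths_in[OF \<pi> clamp_time_in[OF T]] .
    interpret prob_space "?P t" using prob_energyD(1)[OF P] .
    note [measurable_cong] = prob_energyD(2)[OF P]
    have "(\<integral>\<^sup>+v. (\<integral>\<^sup>+w. (\<integral>\<^sup>+u. ennreal (kernel_B (v - w) u) \<partial>s) \<partial>?P t) \<partial>?P t)
      <= (\<integral>\<^sup>+v. (\<integral>\<^sup>+w. (ennreal (norm v) + ennreal (norm w)) * S \<partial>?P t) \<partial>?P t)"
      by (intro nn_integral_mono inner)
    also have "... = ((\<integral>\<^sup>+v. ennreal (norm v) \<partial>?P t) + (\<integral>\<^sup>+w. ennreal (norm w) \<partial>?P t)) * S"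
      by (simp add: nn_integral_multc nn_integral_add emeasure_space_1)
    also have "... <= (ennreal (1/2 + e) + ennreal (1/2 + e)) * S"
      using prob_energy_norm[OF P e] by (intro mult_right_mono add_mono) auto
    finally show "(\<integral>\<^sup>+v. (\<integral>\<^sup>+w. (\<integral>\<^sup>+u. ennreal (kernel_B (v - w) u) \<partial>s) \<partial>?P t) \<partial>?P t) <= ..." .
  qed simp
  also have "... = ennreal T * ((ennreal (1/2 + e) + ennreal (1/2 + e)) * S)"
    using T by (subst nn_integral_multc) auto
  also have "... < top" using S by (intro ennreal_mult_less_top[THEN iffD2]) (simp add: ennreal_mult_less_top)
  finally have "flux_integral T \<pi> (\<lambda>_. 1) < top" .
  moreover have "emeasure (BF T \<pi>) (space (BF T \<pi>)) = (1/2) * flux_integral T \<pi> (\<lambda>_. 1)"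
    using nn_integral_boltzmann_flux_symmetric[OF k, of "\<lambda>_. 1"] by simp
  ultimately show "emeasure (BF T \<pi>) (space (BF T \<pi>)) ~= \<infinity>"
    by (simp add: ennreal_mult_eq_top_iff ennreal_half)
qed

lemma rate_J_density:
  assumes \<pi>: "\<pi> \<in> continuous_paths e T" and T: "0 <= T" and e: "0 <= e"
    and x: "x \<in> borel_fun" "\<And>c. 0 <= x c"
    and Q: "Q = density (BF T \<pi>) (\<lambda>c. ennreal (x c))" and bal: "(\<pi>, Q) \<in> balanced_pairs e T"
  shows "rate_J \<sigma> e T \<pi> Q = (\<integral>\<^sup>+c. ennreal (rate_fun (x c)) \<partial>BF T \<pi>)"
proof -
  interpret BF: finite_measure "BF T \<pi>" by (rule finite_boltzmann_flux[OF \<pi> T e])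
  have m: "(\<lambda>c. ennreal (x c)) \<in> borel_measurable (BF T \<pi>)"
    using borel_measurable_boltzmann_flux[OF x(1)] by simp
  have "(\<pi>, Q) \<in> ac_pairs \<sigma> e T"
    using bal \<pi> absolutely_continuousI_density[OF m] by (simp add: ac_pairs_def Q)
  moreover have "AE c in BF T \<pi>. ennreal (x c) = RN_deriv (BF T \<pi>) Q c"
    by (rule BF.RN_deriv_unique[OF m Q[symmetric]])
  then have "AE c in BF T \<pi>. enn2real (RN_deriv (BF T \<pi>) Q c) = x c"
    by eventually_elim (metis x(2) enn2real_ennreal)
  then have "(\<integral>\<^sup>+ c. (let x = enn2real (RN_deriv (BF T \<pi>) Q c) in ennreal (x * ln x - (x - 1))) \<partial>BF T \<pi>)
    = (\<integral>\<^sup>+c. ennreal (rate_fun (x c)) \<partial>BF T \<pi>)"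
    by (intro nn_integral_cong_AE) (auto simp: rate_fun_def Let_def elim!: eventually_mono)
  ultimately show ?thesis by (simp add: rate_J_def)
qed

text \<open>Brings a pair of finite cost into the form of a real density that is Borel on the whole
  space, by extension by zero; in this form it can be shifted in time and glued.\<close>

lemma rate_J_finiteE:
  assumes fin: "rate_J \<sigma> e T \<pi> Q < \<infinity>" and T: "0 <= T" and e: "0 <= e"
  obtains x where "x \<in> borel_fun" "\<And>c. 0 <= x c" "Q = density (BF T \<pi>) (\<lambda>c. ennreal (x c))"
    "\<pi> \<in> continuous_paths e T"
proof -
  have ac: "(\<pi>, Q) \<in> ac_pairs \<sigma> e T" using fin by (auto simp: rate_J_def split: if_splits)
  then have \<pi>: "\<pi> \<in> continuous_paths e T" and Q: "Q \<in> flux_measures T" "absolutely_continuous (BF T \<pi>) Q"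
    by (auto simp: ac_pairs_def balanced_pairs_def)
  interpret BF: finite_measure "BF T \<pi>" by (rule finite_boltzmann_flux[OF \<pi> T e])
  interpret Q: finite_measure Q by (rule flux_measuresD(3)[OF Q(1)])
  have sets: "sets Q = sets (BF T \<pi>)" using flux_measuresD(1)[OF Q(1)] by (simp add: sets_boltzmann_flux)
  define r where "r c = enn2real (RN_deriv (BF T \<pi>) Q c)" for c
  define x where "x c = indicator ({0..T} \<times> UNIV) c *\<^sub>R r c" for c
  have "r \<in> borel_measurable (collision_space T)"
    unfolding r_def[abs_def] measurable_cong_sets[OF sets_boltzmann_flux[of T \<pi>, symmetric] refl] by measurable
  then have "x \<in> borel_fun"
    unfolding x_def[abs_def] collision_space_def by (subst (asm) borel_measurable_restrict_space_iff) auto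
  moreover have "0 <= x c" for c by (simp add: x_def r_def)
  moreover have "Q = density (BF T \<pi>) (\<lambda>c. ennreal (x c))"
  proof -
    have "AE c in BF T \<pi>. RN_deriv (BF T \<pi>) Q c ~= \<infinity>"
      using BF.RN_deriv_finite[OF Q.sigma_finite_measure_axioms Q(2) sets] .
    then have "AE c in BF T \<pi>. RN_deriv (BF T \<pi>) Q c = ennreal (r c)"
      by eventually_elim (simp add: r_def less_top)
    then have ae: "AE c in BF T \<pi>. RN_deriv (BF T \<pi>) Q c = ennreal (x c)"
      using AE_space by eventually_elim (simp add: x_def space_boltzmann_flux)
    have "Q = density (BF T \<pi>) (RN_deriv (BF T \<pi>) Q)"
      using BF.density_RN_deriv[OF Q(2) sets] by simp
    also have "... = density (BF T \<pi>) (\<lambda>c. ennreal (x c))"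
      using borel_measurable_boltzmann_flux[OF \<open>x \<in> _\<close>] by (intro density_cong ae) auto
    finally show ?thesis .
  qed
  ultimately show ?thesis using that \<pi> by blast
qed

end

section \<open>Concatenation of paths\<close>

lemma integral_split_measures:
  fixes f :: "'a :: topological_space => real"
  assumes split: "\<And>F. F \<in> borel_fun ==> (\<integral>\<^sup>+c. F c \<partial>Q) = (\<integral>\<^sup>+c. F c \<partial>Q1) + (\<integral>\<^sup>+c. F (h c) \<partial>Q2)"
    and f: "f \<in> borel_fun"
    and int: "integrable Q f" "integrable Q1 f" "integrable Q2 (\<lambda>c. f (h c))"
  shows "(\<integral>c. f c \<partial>Q) = (\<integral>c. f c \<partial>Q1) + (\<integral>c. f (h c) \<partial>Q2)"
proof -
  show ?thesis
    unfolding real_lebesgue_integral_def[OF int(1)] real_lebesgue_integral_def[OF int(2)] real_lebesgue_integral_def[OF int(3)]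
    using int(2,3)[unfolded real_integrable_def] f by (simp add: split enn2real_plus less_top)
qed

context
  fixes T e :: real and \<phi> :: "real \<times> (real^'d) => real" and D :: "real \<times> (real^'d) => (real \<times> (real^'d)) \<Rightarrow>\<^sub>L real"
  assumes C1b: "C1b T \<phi> D" and T: "0 <= T"
begin

text \<open>Freezing the time variable outside the interval turns functions on the slab into
  globally continuous, hence Borel, ones.\<close>

lemma C1b_continuous:
  "continuous_on UNIV (\<lambda>(t, v). \<phi> (clamp_time T t, v))" "continuous_on UNIV (\<lambda>(t, v). D (clamp_time T t, v))"
proof -
  have "continuous_on ({0..T} \<times> UNIV) \<phi>"
    using C1b by (intro has_derivative_continuous_on) (auto simp: C1b_def)
  moreover have "continuous_on ({0..T} \<times> UNIV) D" using C1b by (simp add: C1b_def)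
  moreover have "continuous_on UNIV (\<lambda>(t, v :: real^'d). (clamp_time T t, v))"
    unfolding clamp_time_def split_beta' by (intro continuous_intros)
  moreover have "(\<lambda>(t, v :: real^'d). (clamp_time T t, v)) ` UNIV \<subseteq> {0..T} \<times> UNIV"
    using clamp_time_in[OF T] by auto
  ultimately show "continuous_on UNIV (\<lambda>(t, v). \<phi> (clamp_time T t, v))" "continuous_on UNIV (\<lambda>(t, v). D (clamp_time T t, v))"
    using continuous_on_compose2[where f="\<lambda>(t, v :: real^'d). (clamp_time T t, v)" and s=UNIV]
    by (auto simp: split_beta' comp_def)
qed

lemma C1b_bound:
  obtains K where "0 <= K" "\<And>t v. \<bar>\<phi> (clamp_time T t, v)\<bar> <= K" "\<And>t v. \<bar>blinfun_apply (D (clamp_time T t, v)) (1, 0)\<bar> <= K"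
proof -
  obtain K1 K2 where K: "\<And>p. p \<in> {0..T} \<times> UNIV ==> \<bar>\<phi> p\<bar> <= K1" "\<And>p. p \<in> {0..T} \<times> UNIV ==> norm (D p) <= K2"
    using C1b unfolding C1b_def bounded_iff real_norm_def by (metis (no_types, lifting) image_eqI)
  show ?thesis
  proof
    have slab: "(clamp_time T t, v) \<in> {0..T} \<times> UNIV" for t and v :: "real^'d"
      using clamp_time_in[OF T] by simp
    show "\<bar>\<phi> (clamp_time T t, v)\<bar> <= max K1 K2" for t v using K(1)[OF slab, of t v] by simp
    show "\<bar>blinfun_apply (D (clamp_time T t, v)) (1, 0)\<bar> <= max K1 K2" for t v
      using norm_blinfun[of "D (clamp_time T t, v)" "(1, 0)"] K(2)[OF slab, of t v] by (simp add: norm_Pair)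
    then show "0 <= max K1 K2" using abs_ge_zero order_trans by blast
  qed
qed

lemma C1b_time_derivative:
  assumes \<pi>: "\<pi> \<in> continuous_paths e T"
  defines "w \<equiv> \<lambda>t. \<integral>v. blinfun_apply (D (clamp_time T t, v)) (1, 0) \<partial>\<pi> (clamp_time T t)"
  shows "w \<in> borel_fun" "\<exists>K. \<forall>t. \<bar>w t\<bar> <= K"
proof -
  have "continuous_on UNIV (\<lambda>(t, v). blinfun_apply (D (clamp_time T t, v)) (1, 0))"
    using C1b_continuous(2) unfolding split_beta' by (intro continuous_intros)
  then have [measurable]: "(\<lambda>(t, v). blinfun_apply (D (clamp_time T t, v)) (1, 0)) \<in> borel_measurable (borel \<Otimes>\<^sub>M borel)"
    unfolding borel_prod by (rule borel_measurable_continuous_onI)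
  have L [measurable]: "(\<lambda>t. \<pi> (clamp_time T t)) \<in> borel \<rightarrow>\<^sub>M subprob_algebra borel"
    using continuous_paths_kernel[OF \<pi> T] by (rule measurable_prob_algebraD)
  obtain K where K: "0 <= K" "\<And>t v. \<bar>blinfun_apply (D (clamp_time T t, v)) (1, 0)\<bar> <= K"
    using C1b_bound by metis
  have P: "\<pi> (clamp_time T t) \<in> prob_energy e" for t
    using continuous_paths_in[OF \<pi> clamp_time_in[OF T]] .
  have int: "integrable (\<pi> (clamp_time T t)) (\<lambda>v. blinfun_apply (D (clamp_time T t, v)) (1, 0))" for t
  proof -
    interpret prob_space "\<pi> (clamp_time T t)" using prob_energyD(1)[OF P] .
    have "(\<lambda>v. blinfun_apply (D (clamp_time T t, v)) (1, 0)) \<in> borel_measurable (\<pi> (clamp_time T t))"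
      unfolding measurable_cong_sets[OF prob_energyD(2)[OF P] refl] by measurable
    then show ?thesis using K by (intro integrable_const_bound[of _ K]) auto
  qed
  have "(\<lambda>t. enn2real (\<integral>\<^sup>+v. ennreal (blinfun_apply (D (clamp_time T t, v)) (1, 0)) \<partial>\<pi> (clamp_time T t))
      - enn2real (\<integral>\<^sup>+v. ennreal (- blinfun_apply (D (clamp_time T t, v)) (1, 0)) \<partial>\<pi> (clamp_time T t))) \<in> borel_fun"
    by (intro borel_measurable_diff borel_measurable_enn2real nn_integral_measurable_subprob_algebra2[OF _ L]) measurable
  then show "w \<in> borel_fun"
    unfolding w_def real_lebesgue_integral_def[OF int] .
  have "\<bar>w t\<bar> <= K" for t
  proof -
    interpret prob_space "\<pi> (clamp_time T t)" using prob_energyD(1)[OF P] .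
    have "norm (w t) <= (\<integral>v. K \<partial>\<pi> (clamp_time T t))"
      unfolding w_def using K int by (intro Bochner_Integration.integral_norm_bound_integral) auto
    then show ?thesis by (simp add: prob_space)
  qed
  then show "\<exists>K. \<forall>t. \<bar>w t\<bar> <= K" by blast
qed

lemma C1b_gradient:
  defines "G \<equiv> \<lambda>c. collision_gradient \<phi> (clamp_time T (fst c), snd c)"
  shows "G \<in> borel_fun" "\<exists>K. \<forall>c. \<bar>G c\<bar> <= K"
    and "\<And>Q. Q \<in> flux_measures T ==> integrable Q G"
    and "\<And>Q. Q \<in> flux_measures T ==> (\<integral>c. G c \<partial>Q) = (\<integral>c. collision_gradient \<phi> c \<partial>Q)"
proof -
  have G: "G c = (\<lambda>(t, v). \<phi> (clamp_time T t, v)) (fst c, fst (snd (snd (snd c))))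
      + (\<lambda>(t, v). \<phi> (clamp_time T t, v)) (fst c, snd (snd (snd (snd c))))
      - (\<lambda>(t, v). \<phi> (clamp_time T t, v)) (fst c, fst (snd c)) - (\<lambda>(t, v). \<phi> (clamp_time T t, v)) (fst c, fst (snd (snd c)))" for c
    unfolding G_def by (cases c) simp
  have "continuous_on UNIV G"
    unfolding G by (intro continuous_intros continuous_on_compose2[OF C1b_continuous(1)]) auto
  then show m: "G \<in> borel_fun" by (rule borel_measurable_continuous_onI)
  obtain K where K: "\<And>t v. \<bar>\<phi> (clamp_time T t, v)\<bar> <= K" using C1b_bound by metis
  have bd: "\<bar>G c\<bar> <= 4 * K" for c
    using K[of "fst c" "fst (snd (snd (snd c)))"] K[of "fst c" "snd (snd (snd (snd c)))"]
      K[of "fst c" "fst (snd c)"] K[of "fst c" "fst (snd (snd c))"] unfolding G by (simp add: abs_le_iff)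
  then show "\<exists>K. \<forall>c. \<bar>G c\<bar> <= K" by blast
  fix Q :: "'d collision measure" assume Q: "Q \<in> flux_measures T"
  interpret finite_measure Q using flux_measuresD(3)[OF Q] .
  show "integrable Q G"
    using bd by (intro integrable_const_bound[of _ "4 * K"] flux_measuresD(4)[OF Q m]) auto
  show "(\<integral>c. G c \<partial>Q) = (\<integral>c. collision_gradient \<phi> c \<partial>Q)"
    unfolding G_def by (intro Bochner_Integration.integral_cong) (auto simp: flux_measuresD(2)[OF Q] clamp_time_id)
qed

end

section \<open>Gluing two paths and their fluxes\<close>

definition time_shift :: "real => 'd::finite collision => 'd collision" where
  "time_shift a c = (fst c + a, snd c)"

lemma time_shift_measurable [measurable]: "time_shift a \<in> borel_fun"
proof -
  have "continuous_on UNIV (\<lambda>c :: 'd::finite collision. (fst c + a, snd c))" by (intro continuous_intros)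
  then show "time_shift a \<in> borel_measurable (borel :: 'd::finite collision measure)"
    unfolding time_shift_def[abs_def] by (rule borel_measurable_continuous_onI)
qed

lemma C1b_subset:
  fixes \<phi> :: "real \<times> (real^'d) => real"
  assumes "C1b T \<phi> D" "T' <= T"
  shows "C1b T' \<phi> D"
proof -
  have sub: "{0..T'} \<times> UNIV \<subseteq> {0..T} \<times> (UNIV :: (real^'d) set)" using assms(2) by auto
  show ?thesis
    unfolding C1b_def
  proof (intro conjI ballI)
    fix p :: "real \<times> (real^'d)" assume "p \<in> {0..T'} \<times> UNIV"
    then have "(\<phi> has_derivative blinfun_apply (D p)) (at p within {0..T} \<times> UNIV)"
      using assms(1) sub unfolding C1b_def by (meson subsetD)
    then show "(\<phi> has_derivative blinfun_apply (D p)) (at p within {0..T'} \<times> UNIV)"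
      by (rule has_derivative_subset[OF _ sub])
  qed (use assms(1) in \<open>auto simp: C1b_def intro: continuous_on_subset[OF _ sub] bounded_subset[OF _ image_mono[OF sub]]\<close>)
qed

lemma C1b_shift:
  fixes \<phi> :: "real \<times> (real^'d) => real"
  assumes C: "C1b (T1 + T2) \<phi> D" and T1: "0 <= T1"
  shows "C1b T2 (\<lambda>p. \<phi> (fst p + T1, snd p)) (\<lambda>p. D (fst p + T1, snd p))"
proof -
  let ?h = "\<lambda>p :: real \<times> (real^'d). (fst p + T1, snd p)"
  have sub: "?h ` ({0..T2} \<times> UNIV) \<subseteq> {0..T1 + T2} \<times> (UNIV :: (real^'d) set)" using T1 by auto
  have h': "(?h has_derivative (\<lambda>x. x)) (at p within S)" for p S
  proof -
    have "(?h has_derivative (\<lambda>x. (fst x + 0, snd x))) (at p within S)" by (intro derivative_intros)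
    then show ?thesis by simp
  qed
  have "continuous_on ({0..T2} \<times> UNIV) ?h" by (intro continuous_intros)
  then have "continuous_on ({0..T2} \<times> UNIV) (\<lambda>p. D (?h p))"
    using C sub continuous_on_compose2[of "{0..T1 + T2} \<times> UNIV" D "{0..T2} \<times> UNIV" ?h] by (simp add: C1b_def)
  moreover have "((\<lambda>p. \<phi> (?h p)) has_derivative blinfun_apply (D (?h p))) (at p within {0..T2} \<times> UNIV)"
    if "p \<in> {0..T2} \<times> UNIV" for p
  proof -
    have "(\<phi> has_derivative blinfun_apply (D (?h p))) (at (?h p) within {0..T1 + T2} \<times> UNIV)"
      using C sub that unfolding C1b_def by (meson imageI subsetD)
    then have "(\<phi> has_derivative blinfun_apply (D (?h p))) (at (?h p) within ?h ` ({0..T2} \<times> UNIV))"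
      by (rule has_derivative_subset[OF _ sub])
    from has_derivative_in_compose[OF h' this] show ?thesis by simp
  qed
  moreover have "bounded ((\<lambda>p. \<phi> (?h p)) ` ({0..T2} \<times> UNIV))" "bounded ((\<lambda>p. D (?h p)) ` ({0..T2} \<times> UNIV))"
    using C bounded_subset[OF _ image_mono[OF sub]] unfolding C1b_def by (auto simp: image_image)
  ultimately show ?thesis unfolding C1b_def by (intro conjI ballI)
qed

lemma collision_gradient_shift:
  "collision_gradient (\<lambda>p. \<phi> (fst p + a, snd p)) c = collision_gradient \<phi> (time_shift a c)"
  by (cases c) (simp add: time_shift_def)

definition concat_path :: "real => (real => 'a) => (real => 'a) => real => 'a" where
  "concat_path T1 \<pi>1 \<pi>2 t = (if t <= T1 then \<pi>1 t else \<pi>2 (t - T1))"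

lemma continuous_paths_concat:
  fixes \<pi>1 \<pi>2 :: "real => (real^'d) measure"
  assumes \<pi>1: "\<pi>1 \<in> continuous_paths e T1" and \<pi>2: "\<pi>2 \<in> continuous_paths e T2"
    and T: "0 <= T1" "0 <= T2" and eq: "\<pi>1 T1 = \<pi>2 0"
  shows "concat_path T1 \<pi>1 \<pi>2 \<in> continuous_paths e (T1 + T2)"
proof (rule continuous_pathsI)
  fix t assume "t \<in> {0..T1 + T2}"
  then show "concat_path T1 \<pi>1 \<pi>2 t \<in> prob_energy e"
    using continuous_paths_in[OF \<pi>1, of t] continuous_paths_in[OF \<pi>2, of "t - T1"] by (auto simp: concat_path_def)
next
  fix \<phi> :: "real^'d => real" assume \<phi>: "continuous_on UNIV \<phi>" "bounded (range \<phi>)"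
  have 1: "continuous_on {0..T1} (\<lambda>t. \<integral>v. \<phi> v \<partial>\<pi>1 t)"
    by (rule continuous_paths_integral[OF \<pi>1 \<phi>])
  have 2: "continuous_on {T1..T1 + T2} (\<lambda>t. \<integral>v. \<phi> v \<partial>\<pi>2 (t - T1))"
    by (rule continuous_on_compose2[OF continuous_paths_integral[OF \<pi>2 \<phi>]]) (auto intro!: continuous_intros)
  have "continuous_on ({0..T1} \<union> {T1..T1 + T2}) (\<lambda>t. if t <= T1 then \<integral>v. \<phi> v \<partial>\<pi>1 t else \<integral>v. \<phi> v \<partial>\<pi>2 (t - T1))"
    by (rule continuous_on_cases[OF _ _ 1 2]) (auto simp: eq)
  moreover have "{0..T1} \<union> {T1..T1 + T2} = {0..T1 + T2}" using T by auto
  moreover have "(\<lambda>t. if t <= T1 then \<integral>v. \<phi> v \<partial>\<pi>1 t else \<integral>v. \<phi> v \<partial>\<pi>2 (t - T1)) = (\<lambda>t. \<integral>v. \<phi> v \<partial>concat_path T1 \<pi>1 \<pi>2 t)"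
    by (auto simp: concat_path_def)
  ultimately show "continuous_on {0..T1 + T2} (\<lambda>t. \<integral>v. \<phi> v \<partial>concat_path T1 \<pi>1 \<pi>2 t)" by metis
qed

text \<open>The first balance equation is tested with \<open>\<phi>\<close> and the second with
  \<open>\<phi>\<close> shifted by \<open>T1\<close>; the boundary terms at the junction
  cancel.\<close>

lemma balanced_pairs_concat:
  assumes b1: "(\<pi>1, Q1) \<in> balanced_pairs e T1" and b2: "(\<pi>2, Q2) \<in> balanced_pairs e T2"
    and \<pi>1: "\<pi>1 \<in> continuous_paths e T1" and \<pi>2: "\<pi>2 \<in> continuous_paths e T2"
    and T: "0 <= T1" "0 <= T2" and eq: "\<pi>1 T1 = \<pi>2 0"
    and Q: "Q \<in> flux_measures (T1 + T2)"
    and split: "\<And>F. F \<in> borel_fun ==> (\<integral>\<^sup>+c. F c \<partial>Q) = (\<integral>\<^sup>+c. F c \<partial>Q1) + (\<integral>\<^sup>+c. F (time_shift T1 c) \<partial>Q2)"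
  shows "(concat_path T1 \<pi>1 \<pi>2, Q) \<in> balanced_pairs e (T1 + T2)"
proof -
  let ?\<pi> = "concat_path T1 \<pi>1 \<pi>2" and ?T = "T1 + T2"
  have T': "0 <= ?T" using T by simp
  have \<pi>: "?\<pi> \<in> continuous_paths e ?T" by (rule continuous_paths_concat[OF \<pi>1 \<pi>2 T eq])
  have Q12: "Q1 \<in> flux_measures T1" "Q2 \<in> flux_measures T2"
    using b1 b2 by (auto simp: balanced_pairs_def)
  have "(\<integral> v. \<phi> (?T, v) \<partial>?\<pi> ?T) - (\<integral> v. \<phi> (0, v) \<partial>?\<pi> 0)
        - (LINT t:{0..?T}|lborel. (\<integral> v. blinfun_apply (D (t, v)) (1, 0) \<partial>?\<pi> t))
        - (\<integral> c. collision_gradient \<phi> c \<partial>Q) = 0" if C: "C1b ?T \<phi> D" for \<phi> D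
  proof -
    have C1: "C1b T1 \<phi> D" using C1b_subset[OF C] T by simp
    let ?\<phi>2 = "\<lambda>p. \<phi> (fst p + T1, snd p)" and ?D2 = "\<lambda>p. D (fst p + T1, snd p)"
    have C2: "C1b T2 ?\<phi>2 ?D2" by (rule C1b_shift[OF C T(1)])
    let ?w1 = "\<lambda>t. \<integral>v. blinfun_apply (D (clamp_time T1 t, v)) (1, 0) \<partial>\<pi>1 (clamp_time T1 t)"
    let ?w2 = "\<lambda>t. \<integral>v. blinfun_apply (D (clamp_time T2 t + T1, v)) (1, 0) \<partial>\<pi>2 (clamp_time T2 t)"
    note w1 = C1b_time_derivative[OF C1 T(1) \<pi>1]
    note w2 = C1b_time_derivative[OF C2 T(2) \<pi>2, simplified]
    note [measurable] = w1(1) w2(1)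
    obtain K1 K2 where K: "\<And>t. \<bar>?w1 t\<bar> <= K1" "\<And>t. \<bar>?w2 t\<bar> <= K2" using w1(2) w2(2) by blast
    have int: "integrable lborel (\<lambda>t. indicator A t * w t)"
      if [measurable]: "w \<in> borel_fun" and "\<And>t. \<bar>w t\<bar> <= K" and A [measurable]: "A \<in> sets borel" and A2: "A \<subseteq> {a..b}"
      for A a b K and w :: "real => real"
    proof (rule Bochner_Integration.integrable_bound)
      show "integrable lborel (\<lambda>t. indicator {a..b} t * K)"
        by (cases "a <= b") (simp_all add: integrable_indicator_iff)
      have "0 <= K" using that(2) abs_ge_zero order_trans by blast
      then show "AE t in lborel. norm (indicator A t * w t) <= norm (indicator {a..b} t * K)"
        using that(2) subsetD[OF A2] by (intro AE_I2) (auto simp: indicator_def)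
    qed measurable
    have "(LINT t:{0..?T}|lborel. (\<integral> v. blinfun_apply (D (t, v)) (1, 0) \<partial>?\<pi> t))
      = (LBINT t. indicator {0..T1} t * ?w1 t + indicator {T1<..?T} t * ?w2 (t - T1))"
      unfolding set_lebesgue_integral_def
      using T by (intro Bochner_Integration.integral_cong)
        (auto simp: indicator_def concat_path_def clamp_time_id)
    also have "... = (LBINT t. indicator {0..T1} t * ?w1 t) + (LBINT t. indicator {T1<..?T} t * ?w2 (t - T1))"
      using K T by (intro Bochner_Integration.integral_add int[where a=0 and b="?T"]) auto
    also have "(LBINT t. indicator {T1<..?T} t * ?w2 (t - T1)) = (LBINT t. indicator {T1<..?T} (T1 + 1 * t) * ?w2 ((T1 + 1 * t) - T1))"
      by (subst lborel_integral_real_affine[where c=1 and t=T1]) auto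
    also have "... = (LBINT t. indicator {0..T2} t * ?w2 t)"
    proof (rule integral_cong_AE)
      \<comment> \<open>The half-open and the closed interval differ only in the junction
        time.\<close>
      have "AE t in lborel. t ~= (0::real)" by (rule AE_lborel_singleton)
      then show "AE t in lborel. indicator {T1<..?T} (T1 + 1 * t) * ?w2 ((T1 + 1 * t) - T1) = indicator {0..T2} t * ?w2 t"
        by eventually_elim (auto simp: indicator_def)
    qed measurable
    also have "(LBINT t. indicator {0..T1} t * ?w1 t) = (LINT t:{0..T1}|lborel. (\<integral> v. blinfun_apply (D (t, v)) (1, 0) \<partial>\<pi>1 t))"
      unfolding set_lebesgue_integral_def
      by (intro Bochner_Integration.integral_cong) (auto simp: indicator_def clamp_time_id)
    also have "(LBINT t. indicator {0..T2} t * ?w2 t) = (LINT t:{0..T2}|lborel. (\<integral> v. blinfun_apply (?D2 (t, v)) (1, 0) \<partial>\<pi>2 t))"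
      unfolding set_lebesgue_integral_def
      by (intro Bochner_Integration.integral_cong) (auto simp: indicator_def clamp_time_id)
    finally have time: "(LINT t:{0..?T}|lborel. (\<integral> v. blinfun_apply (D (t, v)) (1, 0) \<partial>?\<pi> t))
      = (LINT t:{0..T1}|lborel. (\<integral> v. blinfun_apply (D (t, v)) (1, 0) \<partial>\<pi>1 t))
        + (LINT t:{0..T2}|lborel. (\<integral> v. blinfun_apply (?D2 (t, v)) (1, 0) \<partial>\<pi>2 t))" .
    let ?G = "\<lambda>c. collision_gradient \<phi> (clamp_time ?T (fst c), snd c)"
    note G = C1b_gradient[OF C T']
    obtain K where K: "\<And>c. \<bar>?G c\<bar> <= K" using G(2) by blast
    have iQ: "integrable Q' (\<lambda>c. ?G (h c))" if "Q' \<in> flux_measures T'" "h \<in> borel_fun" for Q' T' h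
    proof -
      interpret finite_measure Q' using flux_measuresD(3)[OF that(1)] .
      show ?thesis
        using K measurable_compose[OF that(2) G(1)]
        by (intro integrable_const_bound[of _ K] flux_measuresD(4)[OF that(1)]) auto
    qed
    have "(\<integral>c. ?G c \<partial>Q) = (\<integral>c. ?G c \<partial>Q1) + (\<integral>c. ?G (time_shift T1 c) \<partial>Q2)"
      using iQ[OF Q12(1), of "\<lambda>c. c"] iQ[OF Q12(2) time_shift_measurable]
      by (intro integral_split_measures split G(1) G(3)[OF Q]) auto
    also have "(\<integral>c. ?G c \<partial>Q) = (\<integral>c. collision_gradient \<phi> c \<partial>Q)" by (rule G(4)[OF Q])
    also have "(\<integral>c. ?G c \<partial>Q1) = (\<integral>c. collision_gradient \<phi> c \<partial>Q1)"
      using T by (intro Bochner_Integration.integral_cong) (auto simp: flux_measuresD(2)[OF Q12(1)] clamp_time_id)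
    also have "(\<integral>c. ?G (time_shift T1 c) \<partial>Q2) = (\<integral>c. collision_gradient ?\<phi>2 c \<partial>Q2)"
      unfolding collision_gradient_shift
      using T by (intro Bochner_Integration.integral_cong) (auto simp: flux_measuresD(2)[OF Q12(2)] clamp_time_id time_shift_def)
    finally have grad: "(\<integral>c. collision_gradient \<phi> c \<partial>Q) = (\<integral>c. collision_gradient \<phi> c \<partial>Q1) + (\<integral>c. collision_gradient ?\<phi>2 c \<partial>Q2)" .
    have e1: "(\<integral> v. \<phi> (T1, v) \<partial>\<pi>1 T1) - (\<integral> v. \<phi> (0, v) \<partial>\<pi>1 0)
        - (LINT t:{0..T1}|lborel. (\<integral> v. blinfun_apply (D (t, v)) (1, 0) \<partial>\<pi>1 t))
        - (\<integral> c. collision_gradient \<phi> c \<partial>Q1) = 0" using b1 C1 by (simp add: balanced_pairs_def)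
    have e2: "(\<integral> v. ?\<phi>2 (T2, v) \<partial>\<pi>2 T2) - (\<integral> v. ?\<phi>2 (0, v) \<partial>\<pi>2 0)
        - (LINT t:{0..T2}|lborel. (\<integral> v. blinfun_apply (?D2 (t, v)) (1, 0) \<partial>\<pi>2 t))
        - (\<integral> c. collision_gradient ?\<phi>2 c \<partial>Q2) = 0" using b2 C2 unfolding balanced_pairs_def by blast
    have "?\<pi> 0 = \<pi>1 0" "?\<pi> ?T = \<pi>2 T2" using T eq by (auto simp: concat_path_def)
    then show ?thesis using e1 e2 eq by (simp add: time grad add.commute)
  qed
  then show ?thesis
    unfolding balanced_pairs_def using continuous_paths_cadlag[OF \<pi>] Q by blast
qed

text \<open>\<open>cycles\<close> with free end points and with the total mass as a parameter:
  comparing cycles at different base points requires journeys between them.\<close>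

definition bridges ::
  "real => real => (real^'d) measure => (real^'d) measure => ennreal => ((real => (real^'d) measure) \<times> 'd collision measure) set" where
  "bridges e T \<mu> \<nu> m = {(\<pi>, Q) \<in> balanced_pairs e T. \<pi> 0 = \<mu> \<and> \<pi> T = \<nu> \<and> emeasure Q (space Q) = m}"

definition bridge_cost ::
  "(real^'d) measure => real => real => (real^'d) measure => (real^'d) measure => ennreal => ennreal" where
  "bridge_cost \<sigma> e T \<mu> \<nu> m = (INF (\<pi>, Q) \<in> bridges e T \<mu> \<nu> m. rate_J \<sigma> e T \<pi> Q)"

lemma swap_time_shift: "swap_in (time_shift a c) = time_shift a (swap_in c)" "swap_out (time_shift a c) = time_shift a (swap_out c)"
  by (simp_all add: time_shift_def swap_in_eq swap_out_eq)

context boltzmann_kernel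
begin

lemma flux_integral_concat:
  assumes \<pi>1: "kernel_path T1 \<pi>1" and \<pi>2: "kernel_path T2 \<pi>2"
    and f [measurable]: "f \<in> borel_fun"
  shows "flux_integral (T1 + T2) (concat_path T1 \<pi>1 \<pi>2) f
    = flux_integral T1 \<pi>1 f + flux_integral T2 \<pi>2 (\<lambda>c. f (time_shift T1 c))"
proof -
  define R where "R p t = (\<integral>\<^sup>+v. (\<integral>\<^sup>+w. (\<integral>\<^sup>+u. ennreal (kernel_B (v - w) u) * f (t, v, w, post_velocities v w u) \<partial>s) \<partial>p) \<partial>p)"
    for p and t :: real
  let ?P1 = "\<lambda>t. \<pi>1 (clamp_time T1 t)" and ?P2 = "\<lambda>t. \<pi>2 (clamp_time T2 t)"
  have [measurable]: "(\<lambda>t. R (?P1 t) t) \<in> borel_fun"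
    unfolding R_def by (rule flux_integral_layers(3)[OF \<pi>1 f])
  have [measurable]: "(\<lambda>t. R (?P2 t) (t + T1)) \<in> borel_fun"
    using flux_integral_layers(3)[OF \<pi>2, of "\<lambda>c. f (time_shift T1 c)"] unfolding R_def by (simp add: time_shift_def)
  have m2: "(\<lambda>t. R (?P2 (t - T1)) t) \<in> borel_fun"
  proof -
    have "(\<lambda>t. (\<lambda>t. R (?P2 t) (t + T1)) (t - T1)) \<in> borel_fun" by measurable
    then show ?thesis by simp
  qed
  note [measurable] = m2
  have "flux_integral (T1 + T2) (concat_path T1 \<pi>1 \<pi>2) f
    = (NBINT t. indicator {0..T1} t * R (?P1 t) t + indicator {T1<..T1 + T2} t * R (?P2 (t - T1)) t)"
    unfolding flux_integral_def R_def[symmetric]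
    using \<pi>1 \<pi>2 by (intro nn_integral_cong) (auto simp: indicator_def concat_path_def clamp_time_id)
  also have "... = (NBINT t. indicator {0..T1} t * R (?P1 t) t) + (NBINT t. indicator {T1<..T1 + T2} t * R (?P2 (t - T1)) t)"
    by (rule nn_integral_add) measurable
  also have "(NBINT t. indicator {T1<..T1 + T2} t * R (?P2 (t - T1)) t)
      = (NBINT t. indicator {T1<..T1 + T2} (T1 + 1 * t) * R (?P2 (T1 + 1 * t - T1)) (T1 + 1 * t))"
    by (subst nn_integral_real_affine[where c=1 and t=T1]) auto
  also have "... = (NBINT t. indicator {0..T2} t * R (?P2 t) (t + T1))"
  proof (rule nn_integral_cong_AE)
    have "AE t in lborel. t ~= (0::real)" by (rule AE_lborel_singleton)
    then show "AE t in lborel. indicator {T1<..T1 + T2} (T1 + 1 * t) * R (?P2 (T1 + 1 * t - T1)) (T1 + 1 * t) = indicator {0..T2} t * R (?P2 t) (t + T1)"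
      by eventually_elim (auto simp: indicator_def add.commute)
  qed
  finally show ?thesis
    unfolding flux_integral_def R_def by (simp add: time_shift_def)
qed

lemma nn_integral_boltzmann_flux_concat:
  assumes \<pi>1: "\<pi>1 \<in> continuous_paths e T1" and \<pi>2: "\<pi>2 \<in> continuous_paths e T2"
    and T: "0 <= T1" "0 <= T2" and eq: "\<pi>1 T1 = \<pi>2 0"
    and f [measurable]: "f \<in> borel_fun"
  shows "(\<integral>\<^sup>+c. f c \<partial>BF (T1 + T2) (concat_path T1 \<pi>1 \<pi>2))
    = (\<integral>\<^sup>+c. f c \<partial>BF T1 \<pi>1) + (\<integral>\<^sup>+c. f (time_shift T1 c) \<partial>BF T2 \<pi>2)"
proof -
  have k1: "kernel_path T1 \<pi>1" using continuous_paths_kernel[OF \<pi>1 T(1)] T by simp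
  have k2: "kernel_path T2 \<pi>2" using continuous_paths_kernel[OF \<pi>2 T(2)] T by simp
  have k: "kernel_path (T1 + T2) (concat_path T1 \<pi>1 \<pi>2)"
    using continuous_paths_kernel[OF continuous_paths_concat[OF \<pi>1 \<pi>2 T eq]] T by simp
  have m: "(\<lambda>c. f (time_shift T1 c)) \<in> borel_fun" "(\<lambda>c. f (swap_out c)) \<in> borel_fun"
    by measurable
  show ?thesis
    unfolding nn_integral_boltzmann_flux_borel[OF k f] nn_integral_boltzmann_flux_borel[OF k1 f]
      nn_integral_boltzmann_flux_borel[OF k2 m(1)]
      flux_integral_concat[OF k1 k2 f] flux_integral_concat[OF k1 k2 m(2)] swap_time_shift
    by (simp only: distrib_left add_ac)
qed

text \<open>The reference flux of the glued path is the sum of the two reference fluxes, the second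
  one shifted in time. Gluing the two densities therefore adds up the masses and the costs.\<close>

lemma bridges_concat:
  assumes e: "0 <= e" and T: "0 <= T1" "0 <= T2"
    and b1: "(\<pi>1, Q1) \<in> bridges e T1 \<mu> \<nu> m1" and b2: "(\<pi>2, Q2) \<in> bridges e T2 \<nu> \<rho> m2"
    and J1: "rate_J \<sigma> e T1 \<pi>1 Q1 < \<infinity>" and J2: "rate_J \<sigma> e T2 \<pi>2 Q2 < \<infinity>"
  obtains \<pi> Q where "(\<pi>, Q) \<in> bridges e (T1 + T2) \<mu> \<rho> (m1 + m2)"
    and "rate_J \<sigma> e (T1 + T2) \<pi> Q = rate_J \<sigma> e T1 \<pi>1 Q1 + rate_J \<sigma> e T2 \<pi>2 Q2"
proof -
  obtain x1 where x1: "x1 \<in> borel_fun" "\<And>c. 0 <= x1 c" "Q1 = density (BF T1 \<pi>1) (\<lambda>c. ennreal (x1 c))"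
    and \<pi>1: "\<pi>1 \<in> continuous_paths e T1" using rate_J_finiteE[OF J1 T(1) e] by blast
  obtain x2 where x2: "x2 \<in> borel_fun" "\<And>c. 0 <= x2 c" "Q2 = density (BF T2 \<pi>2) (\<lambda>c. ennreal (x2 c))"
    and \<pi>2: "\<pi>2 \<in> continuous_paths e T2" using rate_J_finiteE[OF J2 T(2) e] by blast
  note [measurable] = x1(1) x2(1)
  let ?\<pi> = "concat_path T1 \<pi>1 \<pi>2" and ?T = "T1 + T2"
  have eq: "\<pi>1 T1 = \<pi>2 0" using b1 b2 by (simp add: bridges_def)
  have T': "0 <= ?T" using T by simp
  have \<pi>: "?\<pi> \<in> continuous_paths e ?T" by (rule continuous_paths_concat[OF \<pi>1 \<pi>2 T eq])
  have k1: "kernel_path T1 \<pi>1" using continuous_paths_kernel[OF \<pi>1 T(1)] T by simp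
  have k2: "kernel_path T2 \<pi>2" using continuous_paths_kernel[OF \<pi>2 T(2)] T by simp
  define x where "x c = (if fst c <= T1 then x1 c else x2 (time_shift (- T1) c))" for c
  have x [measurable]: "x \<in> borel_fun" unfolding x_def[abs_def] by measurable
  have x0: "0 <= x c" for c using x1(2) x2(2) by (simp add: x_def)
  define Q where "Q = density (BF ?T ?\<pi>) (\<lambda>c. ennreal (x c))"
  have split: "(\<integral>\<^sup>+c. f (x c) c \<partial>BF ?T ?\<pi>) = (\<integral>\<^sup>+c. f (x1 c) c \<partial>BF T1 \<pi>1) + (\<integral>\<^sup>+c. f (x2 c) (time_shift T1 c) \<partial>BF T2 \<pi>2)"
    if [measurable]: "(\<lambda>(y, c). f y c) \<in> borel_measurable (borel \<Otimes>\<^sub>M borel)" for f :: "real => 'd collision => ennreal"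
  proof -
    have "(\<integral>\<^sup>+c. f (x c) c \<partial>BF ?T ?\<pi>) = (\<integral>\<^sup>+c. f (x c) c \<partial>BF T1 \<pi>1) + (\<integral>\<^sup>+c. f (x (time_shift T1 c)) (time_shift T1 c) \<partial>BF T2 \<pi>2)"
      by (rule nn_integral_boltzmann_flux_concat[OF \<pi>1 \<pi>2 T eq]) measurable
    also have "(\<integral>\<^sup>+c. f (x c) c \<partial>BF T1 \<pi>1) = (\<integral>\<^sup>+c. f (x1 c) c \<partial>BF T1 \<pi>1)"
      by (intro nn_integral_cong) (auto simp: space_boltzmann_flux x_def)
    also have "(\<integral>\<^sup>+c. f (x (time_shift T1 c)) (time_shift T1 c) \<partial>BF T2 \<pi>2) = (\<integral>\<^sup>+c. f (x2 c) (time_shift T1 c) \<partial>BF T2 \<pi>2)"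
    proof (rule nn_integral_cong_AE)
      \<comment> \<open>At the junction the glued density takes its value from \<open>x1\<close>;
        collisions at a single instant form a null set.\<close>
      have "AE c in BF T2 \<pi>2. fst c ~= 0"
      proof -
        have "(\<integral>\<^sup>+c. indicator {c. fst c = 0} c \<partial>BF T2 \<pi>2) = (1/2) * flux_integral T2 \<pi>2 (indicator {c. fst c = 0})"
          by (rule nn_integral_boltzmann_flux_symmetric[OF k2]) (auto simp: swap_out_eq indicator_def)
        also have "flux_integral T2 \<pi>2 (indicator {c. fst c = 0}) = (NBINT (t::real). 0)"
          unfolding flux_integral_def
        proof (rule nn_integral_cong_AE)
          have "AE t in lborel. t ~= (0::real)" by (rule AE_lborel_singleton)
          then show "AE t in lborel. indicator {0..T2} t * (\<integral>\<^sup>+v. (\<integral>\<^sup>+w. (\<integral>\<^sup>+u. ennreal (kernel_B (v - w) u) *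
              indicator {c. fst c = 0} (t, v, w, post_velocities v w u) \<partial>s) \<partial>\<pi>2 (clamp_time T2 t)) \<partial>\<pi>2 (clamp_time T2 t)) = 0"
            by eventually_elim (simp add: indicator_def)
        qed
        finally have "(\<integral>\<^sup>+c. indicator {c. fst c = 0} c \<partial>BF T2 \<pi>2) = 0" by simp
        then have "AE c in BF T2 \<pi>2. indicator {c. fst c = 0} c = (0::ennreal)"
          by (subst (asm) nn_integral_0_iff_AE) (auto intro!: borel_measurable_boltzmann_flux)
        then show ?thesis by eventually_elim (auto simp: indicator_def split: if_splits)
      qed
      then show "AE c in BF T2 \<pi>2. f (x (time_shift T1 c)) (time_shift T1 c) = f (x2 c) (time_shift T1 c)"
        using AE_space by eventually_elim (auto simp: space_boltzmann_flux x_def time_shift_def)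
    qed
    finally show ?thesis .
  qed
  have Q12: "Q1 \<in> flux_measures T1" "Q2 \<in> flux_measures T2"
    using b1 b2 by (auto simp: bridges_def balanced_pairs_def)
  have dens: "(\<integral>\<^sup>+c. F c \<partial>density (BF T' \<pi>') (\<lambda>c. ennreal (y c))) = (\<integral>\<^sup>+c. ennreal (y c) * F c \<partial>BF T' \<pi>')"
    if "F \<in> borel_fun" "y \<in> borel_fun" for F y T' \<pi>'
    using that by (intro nn_integral_density borel_measurable_boltzmann_flux) measurable
  have Qsplit: "(\<integral>\<^sup>+c. F c \<partial>Q) = (\<integral>\<^sup>+c. F c \<partial>Q1) + (\<integral>\<^sup>+c. F (time_shift T1 c) \<partial>Q2)"
    if F [measurable]: "F \<in> borel_fun" for F
  proof -
    have m: "(\<lambda>c. F (time_shift T1 c)) \<in> borel_fun" by measurable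
    show ?thesis
      unfolding Q_def x1(3) x2(3) dens[OF F x] dens[OF F x1(1)] dens[OF m x2(1)]
      by (rule split) measurable
  qed
  have mass: "emeasure Q (space Q) = m1 + m2"
    using Qsplit[of "\<lambda>_. 1"] b1 b2 by (simp add: bridges_def)
  have Q: "Q \<in> flux_measures ?T"
  proof (rule flux_measuresI)
    show "sets Q = sets (collision_space ?T)" by (simp add: Q_def sets_boltzmann_flux)
    have "m1 ~= \<infinity>" "m2 ~= \<infinity>"
      using finite_measure.emeasure_finite[OF flux_measuresD(3)[OF Q12(1)], of "space Q1"]
        finite_measure.emeasure_finite[OF flux_measuresD(3)[OF Q12(2)], of "space Q2"] b1 b2 by (auto simp: bridges_def)
    then show "finite_measure Q" by (intro finite_measureI) (simp add: mass)
    fix F :: "'d collision => ennreal" assume F [measurable]: "F \<in> borel_fun"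
    have m: "(\<lambda>c. F (swap_in c)) \<in> borel_fun" "(\<lambda>c. F (swap_out c)) \<in> borel_fun"
      "(\<lambda>c. F (time_shift T1 c)) \<in> borel_fun" by measurable
    show "(\<integral>\<^sup>+c. F (swap_in c) \<partial>Q) = (\<integral>\<^sup>+c. F c \<partial>Q)"
      unfolding Qsplit[OF m(1)] Qsplit[OF F] swap_time_shift
      using flux_measuresD(5)[OF Q12(1) F] flux_measuresD(5)[OF Q12(2) m(3)] by simp
    show "(\<integral>\<^sup>+c. F (swap_out c) \<partial>Q) = (\<integral>\<^sup>+c. F c \<partial>Q)"
      unfolding Qsplit[OF m(2)] Qsplit[OF F] swap_time_shift
      using flux_measuresD(6)[OF Q12(1) F] flux_measuresD(6)[OF Q12(2) m(3)] by simp
  qed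
  have b: "(\<pi>1, Q1) \<in> balanced_pairs e T1" "(\<pi>2, Q2) \<in> balanced_pairs e T2"
    using b1 b2 by (auto simp: bridges_def)
  have bal: "(?\<pi>, Q) \<in> balanced_pairs e ?T"
    by (rule balanced_pairs_concat[OF b \<pi>1 \<pi>2 T eq Q Qsplit])
  moreover have "?\<pi> 0 = \<mu>" "?\<pi> ?T = \<rho>" using T eq b1 b2 by (auto simp: bridges_def concat_path_def)
  ultimately have "(?\<pi>, Q) \<in> bridges e ?T \<mu> \<rho> (m1 + m2)" using mass by (simp add: bridges_def)
  moreover have "rate_J \<sigma> e ?T ?\<pi> Q = rate_J \<sigma> e T1 \<pi>1 Q1 + rate_J \<sigma> e T2 \<pi>2 Q2"
    unfolding rate_J_density[OF \<pi> T' e x x0 Q_def bal] rate_J_density[OF \<pi>1 T(1) e x1(1,2,3) b(1)]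
      rate_J_density[OF \<pi>2 T(2) e x2(1,2,3) b(2)]
    by (rule split) measurable
  ultimately show ?thesis by (rule that)
qed

text \<open>Glues nearly optimal bridges; there is something to show only when both costs are
  finite.\<close>

lemma bridge_cost_concat:
  assumes e: "0 <= e" and T: "0 <= T1" "0 <= T2"
  shows "bridge_cost \<sigma> e (T1 + T2) \<mu> \<rho> (m1 + m2) <= bridge_cost \<sigma> e T1 \<mu> \<nu> m1 + bridge_cost \<sigma> e T2 \<nu> \<rho> m2"
proof (rule ennreal_le_epsilon)
  fix \<epsilon> :: real assume fin: "bridge_cost \<sigma> e T1 \<mu> \<nu> m1 + bridge_cost \<sigma> e T2 \<nu> \<rho> m2 < top" and \<epsilon>: "0 < \<epsilon>"
  have near: "\<exists>p\<in>bridges e T \<mu> \<nu> m. (case p of (\<pi>, Q) => rate_J \<sigma> e T \<pi> Q) < bridge_cost \<sigma> e T \<mu> \<nu> m + ennreal (\<epsilon> / 2)"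
    if "bridge_cost \<sigma> e T \<mu> \<nu> m < top" for T \<mu> \<nu> m
  proof -
    have "bridge_cost \<sigma> e T \<mu> \<nu> m < bridge_cost \<sigma> e T \<mu> \<nu> m + ennreal (\<epsilon> / 2)"
      using that \<epsilon> by (cases "bridge_cost \<sigma> e T \<mu> \<nu> m") (auto simp: ennreal_plus[symmetric] simp del: ennreal_plus intro!: ennreal_lessI)
    then show ?thesis
      by (subst (asm) bridge_cost_def) (simp only: INF_less_iff)
  qed
  obtain \<pi>1 Q1 where b1: "(\<pi>1, Q1) \<in> bridges e T1 \<mu> \<nu> m1" "rate_J \<sigma> e T1 \<pi>1 Q1 < bridge_cost \<sigma> e T1 \<mu> \<nu> m1 + ennreal (\<epsilon> / 2)"
    using near[of T1 \<mu> \<nu> m1] fin by (auto simp: less_top)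
  obtain \<pi>2 Q2 where b2: "(\<pi>2, Q2) \<in> bridges e T2 \<nu> \<rho> m2" "rate_J \<sigma> e T2 \<pi>2 Q2 < bridge_cost \<sigma> e T2 \<nu> \<rho> m2 + ennreal (\<epsilon> / 2)"
    using near[of T2 \<nu> \<rho> m2] fin by (auto simp: less_top)
  have f: "rate_J \<sigma> e T1 \<pi>1 Q1 < \<infinity>" "rate_J \<sigma> e T2 \<pi>2 Q2 < \<infinity>"
    using b1(2) b2(2) by (auto simp: top_unique intro: order_less_le_trans)
  obtain \<pi> Q where b: "(\<pi>, Q) \<in> bridges e (T1 + T2) \<mu> \<rho> (m1 + m2)"
    and J: "rate_J \<sigma> e (T1 + T2) \<pi> Q = rate_J \<sigma> e T1 \<pi>1 Q1 + rate_J \<sigma> e T2 \<pi>2 Q2"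
    using bridges_concat[OF e T b1(1) b2(1) f] by blast
  have "bridge_cost \<sigma> e (T1 + T2) \<mu> \<rho> (m1 + m2) <= rate_J \<sigma> e (T1 + T2) \<pi> Q"
    unfolding bridge_cost_def by (rule INF_lower2[OF b]) simp
  also have "... <= (bridge_cost \<sigma> e T1 \<mu> \<nu> m1 + ennreal (\<epsilon> / 2)) + (bridge_cost \<sigma> e T2 \<nu> \<rho> m2 + ennreal (\<epsilon> / 2))"
    unfolding J using b1(2) b2(2) by (intro add_mono less_imp_le)
  also have "... = bridge_cost \<sigma> e T1 \<mu> \<nu> m1 + bridge_cost \<sigma> e T2 \<nu> \<rho> m2 + (ennreal (\<epsilon> / 2) + ennreal (\<epsilon> / 2))"
    by (simp only: add_ac)
  also have "ennreal (\<epsilon> / 2) + ennreal (\<epsilon> / 2) = ennreal \<epsilon>"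
    using \<epsilon> by (subst ennreal_plus[symmetric]) auto
  finally show "bridge_cost \<sigma> e (T1 + T2) \<mu> \<rho> (m1 + m2) <= bridge_cost \<sigma> e T1 \<mu> \<nu> m1 + bridge_cost \<sigma> e T2 \<nu> \<rho> m2 + ennreal \<epsilon>" .
qed

lemma mean_cost_bridge: "mean_cost \<sigma> e \<mu> q T = bridge_cost \<sigma> e T \<mu> \<mu> (ennreal (T * q)) / ennreal T"
proof -
  have "cycles e T \<mu> q = bridges e T \<mu> \<mu> (ennreal (T * q))"
    by (auto simp: cycles_def bridges_def)
  then show ?thesis by (simp add: mean_cost_def bridge_cost_def)
qed

end

section \<open>Linear interpolation of densities\<close>

text \<open>The flux \<open>p\<close> is constant in time because the interpolation has constant
  speed; the \<open>2\<close> in \<open>p_flux\<close> compensates the \<open>1/2\<close> of the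
  reference flux. Positivity inside the interval allows dividing by the densities there, and the two
  end times are negligible.\<close>

locale interpolation = boltzmann_kernel \<sigma> for \<sigma> :: "(real^'d) measure" +
  fixes e T :: real and f0 f1 :: "real^'d => real" and p :: "'d quad => real"
  assumes e: "0 <= e" and T: "0 < T"
    and f0 [measurable]: "f0 \<in> borel_fun" and f1 [measurable]: "f1 \<in> borel_fun"
    and f0_nonneg: "\<And>v. 0 <= f0 v" and f1_nonneg: "\<And>v. 0 <= f1 v"
    and f0_energy: "density lborel f0 \<in> prob_energy e" and f1_energy: "density lborel f1 \<in> prob_energy e"
    and pos: "\<And>t v. t \<in> {0<..<T} ==> 0 < (1 - t / T) * f0 v + t / T * f1 v"
    and p [measurable]: "p \<in> borel_fun" and p_nonneg: "\<And>c. 0 <= p c"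
    and p_in: "\<And>v w v' w'. p (w, v, v', w') = p (v, w, v', w')"
    and p_out: "\<And>v w v' w'. p (v, w, w', v') = p (v, w, v', w')"
    and p_int: "integrable coll p"
    and p_flux: "\<And>\<phi> B. \<phi> \<in> borel_fun ==> (\<And>x. \<bar>\<phi> x\<bar> <= B) ==>
      (\<integral>c. p c * pair_gradient \<phi> c \<partial>coll) = 2 / T * (LBINT z. \<phi> z * (f1 z - f0 z))"
begin

definition ft :: "real => real^'d => real" where
  "ft t v = (1 - t / T) * f0 v + t / T * f1 v"

definition path :: "real => (real^'d) measure" where
  "path t = density lborel (\<lambda>v. ennreal (ft t v))"

lemma ft_measurable [measurable]: "(\<lambda>x. ft (fst x) (snd x)) \<in> borel_fun" "ft t \<in> borel_fun"
  unfolding ft_def[abs_def] by measurable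

lemma ft_nonneg: "t \<in> {0..T} ==> 0 <= ft t v"
  using T f0_nonneg f1_nonneg by (auto simp: ft_def intro!: add_nonneg_nonneg mult_nonneg_nonneg)

lemma ft_le: "t \<in> {0..T} ==> ft t v <= f0 v + f1 v"
  unfolding ft_def using T f0_nonneg[of v] f1_nonneg[of v]
  by (intro add_mono mult_left_le_one_le) auto

lemma ft_pos: "t \<in> {0<..<T} ==> 0 < ft t v"
  using pos by (simp add: ft_def)

lemma f_nn_integral: "(NBINT v. ennreal (f0 v)) = 1" "(NBINT v. ennreal (f1 v)) = 1"
  using prob_space.emeasure_space_1[OF prob_energyD(1)[OF f0_energy]] prob_space.emeasure_space_1[OF prob_energyD(1)[OF f1_energy]]
  by (simp_all add: emeasure_density)

lemma f_integrable: "integrable lborel f0" "integrable lborel f1"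
  using f0_nonneg f1_nonneg f_nn_integral by (auto intro!: integrableI_nonneg)

lemma integrable_mean:
  assumes "density lborel (\<lambda>v. ennreal (f v)) \<in> prob_energy e" "f \<in> borel_fun" "\<And>v. 0 <= f v"
  shows "integrable lborel (\<lambda>v::real^'d. f v *\<^sub>R v)"
proof -
  have "(\<integral>\<^sup>+v. ennreal (norm v) \<partial>density lborel (\<lambda>v. ennreal (f v))) < \<infinity>"
    using order_le_less_trans[OF prob_energy_norm[OF assms(1) e]] by simp
  then have "integrable (density lborel (\<lambda>v. ennreal (f v))) (\<lambda>v. v)"
    by (intro integrableI_bounded) auto
  then show ?thesis using assms by (subst (asm) integrable_density) auto
qed

lemma path_energy:
  assumes t: "t \<in> {0..T}"
  shows "path t \<in> prob_energy e"
proof -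
  have a: "0 <= 1 - t / T" "0 <= t / T" using t T by auto
  have dens: "(\<integral>\<^sup>+v. F v \<partial>path t) = ennreal (1 - t / T) * (\<integral>\<^sup>+v. F v \<partial>density lborel f0) + ennreal (t / T) * (\<integral>\<^sup>+v. F v \<partial>density lborel f1)"
    if [measurable]: "F \<in> borel_fun" for F
  proof -
    have lin: "ennreal (A * x + B * y) * z = ennreal A * (ennreal x * z) + ennreal B * (ennreal y * z)"
      if "0 <= A" "0 <= B" "0 <= x" "0 <= y" for A B x y z
      using that by (simp add: ennreal_mult distrib_right mult.assoc)
    have "(\<integral>\<^sup>+v. F v \<partial>path t) = (NBINT v. ennreal (ft t v) * F v)"
      unfolding path_def by (rule nn_integral_density) measurable
    also have "... = (NBINT v. ennreal (1 - t / T) * (ennreal (f0 v) * F v) + ennreal (t / T) * (ennreal (f1 v) * F v))"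
      unfolding ft_def by (intro nn_integral_cong lin a f0_nonneg f1_nonneg)
    finally have "(\<integral>\<^sup>+v. F v \<partial>path t) = (NBINT v. ennreal (1 - t / T) * (ennreal (f0 v) * F v) + ennreal (t / T) * (ennreal (f1 v) * F v))" .
    then show ?thesis by (simp add: nn_integral_add nn_integral_cmult nn_integral_density)
  qed
  have sum: "ennreal (1 - t / T) * ennreal c + ennreal (t / T) * ennreal c = ennreal c" if "0 <= c" for c
  proof -
    have "ennreal (1 - t / T) * ennreal c + ennreal (t / T) * ennreal c = ennreal (1 - t / T + t / T) * ennreal c"
      by (subst ennreal_plus[OF a]) (simp only: distrib_right)
    then show ?thesis by simp
  qed
  show ?thesis
    unfolding prob_energy_def mem_Collect_eq
  proof (intro conjI)
    show "sets (path t) = sets borel" by (simp add: path_def)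
    have "(\<integral>\<^sup>+v. 1 \<partial>path t) = 1"
      using sum[of 1] f_nn_integral by (subst dens) (simp_all add: emeasure_density)
    then show "prob_space (path t)" by (intro prob_spaceI) simp
    have "(\<integral>\<^sup>+ v. ennreal ((norm v)\<^sup>2 / 2) \<partial>path t) <= ennreal (1 - t / T) * ennreal e + ennreal (t / T) * ennreal e"
      using prob_energyD(4)[OF f0_energy] prob_energyD(4)[OF f1_energy]
      by (subst dens) (auto intro!: add_mono mult_left_mono)
    then show "(\<integral>\<^sup>+ v. ennreal ((norm v)\<^sup>2 / 2) \<partial>path t) <= ennreal e" using sum[OF e] by simp
    have int: "integrable lborel (\<lambda>v::real^'d. f0 v *\<^sub>R v)" "integrable lborel (\<lambda>v::real^'d. f1 v *\<^sub>R v)"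
      using integrable_mean f0_energy f1_energy f0_nonneg f1_nonneg by auto
    have zero: "(LBINT v. f0 v *\<^sub>R v) = 0" "(LBINT v. f1 v *\<^sub>R v) = 0"
      using prob_energyD(5)[OF f0_energy] prob_energyD(5)[OF f1_energy] f0_nonneg f1_nonneg
      by (simp_all add: integral_density)
    have "(\<integral>v. v \<partial>path t) = (LBINT v. ft t v *\<^sub>R v)"
      unfolding path_def using ft_nonneg[OF t] by (intro integral_density) auto
    also have "... = (LBINT v. (1 - t / T) *\<^sub>R (f0 v *\<^sub>R v) + (t / T) *\<^sub>R (f1 v *\<^sub>R v))"
      by (simp add: ft_def scaleR_add_left)
    also have "... = 0"
      using int by (subst Bochner_Integration.integral_add)
        (simp_all only: Bochner_Integration.integral_scaleR_right zero integrable_scaleR_right scaleR_zero_right add_0)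
    finally show "(\<integral>v. v \<partial>path t) = 0" .
  qed
qed

lemma path_integral:
  fixes \<phi> :: "real^'d => real"
  assumes t: "t \<in> {0..T}" and [measurable]: "\<phi> \<in> borel_fun" and bd: "\<And>v. \<bar>\<phi> v\<bar> <= B"
  shows "(\<integral>v. \<phi> v \<partial>path t) = (1 - t / T) * (LBINT v. \<phi> v * f0 v) + t / T * (LBINT v. \<phi> v * f1 v)"
proof -
  have i: "integrable lborel (\<lambda>v. \<phi> v * f0 v)" "integrable lborel (\<lambda>v. \<phi> v * f1 v)"
    using integrable_mult_bounded[OF f_integrable(1), of \<phi> B] integrable_mult_bounded[OF f_integrable(2), of \<phi> B] bd
    by (simp_all add: mult.commute)
  have "(\<integral>v. \<phi> v \<partial>path t) = (LBINT v. ft t v * \<phi> v)"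
    unfolding path_def using ft_nonneg[OF t] by (subst integral_density) auto
  also have "... = (LBINT v. (1 - t / T) * (\<phi> v * f0 v) + t / T * (\<phi> v * f1 v))"
    by (simp add: ft_def algebra_simps)
  also have "... = (1 - t / T) * (LBINT v. \<phi> v * f0 v) + t / T * (LBINT v. \<phi> v * f1 v)"
    using i by (subst Bochner_Integration.integral_add) auto
  finally show ?thesis .
qed

lemma path_continuous: "path \<in> continuous_paths e T"
proof (rule continuous_pathsI[OF path_energy])
  fix \<phi> :: "real^'d => real" assume \<phi>: "continuous_on UNIV \<phi>" "bounded (range \<phi>)"
  then obtain B where B: "\<And>v. \<bar>\<phi> v\<bar> <= B" by (auto simp: bounded_iff)
  have "continuous_on {0..T} (\<lambda>t. (1 - t / T) * (LBINT v. \<phi> v * f0 v) + t / T * (LBINT v. \<phi> v * f1 v))"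
    using T by (intro continuous_intros) auto
  then show "continuous_on {0..T} (\<lambda>t. \<integral>v. \<phi> v \<partial>path t)"
    using path_integral[OF _ borel_measurable_continuous_onI[OF \<phi>(1)] B] by (subst continuous_on_cong[OF refl]) auto
qed

lemma kernel_path: "kernel_path T path"
  using continuous_paths_kernel[OF path_continuous] T by simp

lemma path_ends: "path 0 = density lborel f0" "path T = density lborel f1"
  using T by (simp_all add: path_def ft_def)

text \<open>The density of the flux relative to the reference flux, which itself has the density of
  the divisor relative to \<open>coll\<close>, up to constant and labelling.\<close>

definition xi :: "'d collision => real" where
  "xi c = p (snd c) / (ft (clamp_time T (fst c)) (fst (snd c)) * ft (clamp_time T (fst c)) (fst (snd (snd c))))"

lemma clamp_measurable [measurable]: "clamp_time T \<in> borel_fun"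
  unfolding clamp_time_def[abs_def] by measurable

lemma ft_clamp_measurable [measurable]:
  "(\<lambda>c :: 'd collision. ft (clamp_time T (fst c)) (fst (snd c))) \<in> borel_fun"
  "(\<lambda>c :: 'd collision. ft (clamp_time T (fst c)) (fst (snd (snd c)))) \<in> borel_fun"
  unfolding ft_def by measurable

lemma xi_measurable [measurable]: "xi \<in> borel_fun"
  unfolding xi_def[abs_def] by measurable

lemma xi_nonneg: "0 <= xi c"
  using T p_nonneg ft_nonneg[OF clamp_time_in[of T]] by (simp add: xi_def)

lemma xi_swap: "xi (swap_in c) = xi c" "xi (swap_out c) = xi c"
  using p_in p_out by (cases c; simp add: xi_def mult.commute)+

lemma flux_integral_path:
  assumes [measurable]: "F \<in> borel_fun"
  shows "flux_integral T path F = (NBINT t. indicator {0..T} t *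
    (\<integral>\<^sup>+q. ennreal (ft t (fst q) * ft t (fst (snd q))) * F (t, q) \<partial>coll))"
  unfolding flux_integral_def
proof (rule nn_integral_cong)
  fix t :: real
  have G [measurable]: "(\<lambda>(v, w). \<integral>\<^sup>+u. ennreal (kernel_B (v - w) u) * F (t, v, w, post_velocities v w u) \<partial>s) \<in> borel_measurable (borel \<Otimes>\<^sub>M borel)"
    by measurable
  have "(\<integral>\<^sup>+v. (\<integral>\<^sup>+w. (\<integral>\<^sup>+u. ennreal (kernel_B (v - w) u) * F (t, v, w, post_velocities v w u) \<partial>s) \<partial>path t) \<partial>path t)
      = (\<integral>\<^sup>+q. ennreal (ft t (fst q) * ft t (fst (snd q))) * F (t, q) \<partial>coll)" if t: "t \<in> {0..T}"
  proof -
    have "(\<integral>\<^sup>+v. (\<integral>\<^sup>+w. (\<integral>\<^sup>+u. ennreal (kernel_B (v - w) u) * F (t, v, w, post_velocities v w u) \<partial>s) \<partial>path t) \<partial>path t)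
      = (NBINT v. ennreal (ft t v) * (NBINT w. ennreal (ft t w) * (\<integral>\<^sup>+u. ennreal (kernel_B (v - w) u) * F (t, v, w, post_velocities v w u) \<partial>s)))"
      unfolding path_def by (simp add: nn_integral_density)
    also have "... = (NBINT v. (NBINT w. (\<integral>\<^sup>+u. ennreal (kernel_B (v - w) u) *
        (ennreal (ft t v * ft t w) * F (t, v, w, post_velocities v w u)) \<partial>s)))"
      using ft_nonneg[OF t]
      by (simp add: nn_integral_cmult[symmetric] ennreal_mult mult_ac)
    also have "... = (\<integral>\<^sup>+q. ennreal (ft t (fst q) * ft t (fst (snd q))) * F (t, q) \<partial>coll)"
      by (subst nn_integral_coll) auto
    finally show ?thesis .
  qed
  then show "indicator {0..T} t * (\<integral>\<^sup>+v. (\<integral>\<^sup>+w. (\<integral>\<^sup>+u. ennreal (kernel_B (v - w) u) *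
       F (t, v, w, post_velocities v w u) \<partial>s) \<partial>path (clamp_time T t)) \<partial>path (clamp_time T t))
     = indicator {0..T} t * (\<integral>\<^sup>+q. ennreal (ft t (fst q) * ft t (fst (snd q))) * F (t, q) \<partial>coll)"
    by (auto simp: indicator_def clamp_time_id)
qed

definition flux :: "'d collision measure" where
  "flux = density (BF T path) (\<lambda>c. ennreal (xi c))"

lemma nn_integral_flux:
  assumes F [measurable]: "F \<in> borel_fun" and sym: "\<And>c. F (swap_out c) = F c"
  shows "(\<integral>\<^sup>+c. F c \<partial>flux) = (1/2) * (NBINT t. indicator {0..T} t * (\<integral>\<^sup>+q. ennreal (p q) * F (t, q) \<partial>coll))"
proof -
  have "(\<integral>\<^sup>+c. F c \<partial>flux) = (\<integral>\<^sup>+c. ennreal (xi c) * F c \<partial>BF T path)"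
    unfolding flux_def by (intro nn_integral_density borel_measurable_boltzmann_flux) measurable
  also have "... = (1/2) * flux_integral T path (\<lambda>c. ennreal (xi c) * F c)"
    by (rule nn_integral_boltzmann_flux_symmetric[OF kernel_path]) (auto simp: xi_swap sym)
  also have "flux_integral T path (\<lambda>c. ennreal (xi c) * F c)
      = (NBINT t. indicator {0..T} t * (\<integral>\<^sup>+q. ennreal (ft t (fst q) * ft t (fst (snd q))) * (ennreal (xi (t, q)) * F (t, q)) \<partial>coll))"
    by (rule flux_integral_path) measurable
  also have "... = (NBINT t. indicator {0..T} t * (\<integral>\<^sup>+q. ennreal (p q) * F (t, q) \<partial>coll))"
  proof (rule nn_integral_cong_AE)
    \<comment> \<open>At the end times a density may vanish, and the division by zero in
      \<open>xi\<close> would lose the value of \<open>p\<close>.\<close>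
    have "AE t in lborel. t ~= 0 \<and> t ~= T"
      using AE_lborel_singleton[of "0::real"] AE_lborel_singleton[of T] by eventually_elim simp
    then show "AE t in lborel. indicator {0..T} t * (\<integral>\<^sup>+q. ennreal (ft t (fst q) * ft t (fst (snd q))) * (ennreal (xi (t, q)) * F (t, q)) \<partial>coll)
      = indicator {0..T} t * (\<integral>\<^sup>+q. ennreal (p q) * F (t, q) \<partial>coll)"
    proof eventually_elim
      case (elim t)
      have "ennreal (ft t (fst q) * ft t (fst (snd q))) * (ennreal (xi (t, q)) * F (t, q)) = ennreal (p q) * F (t, q)"
        if "t \<in> {0..T}" for q
      proof -
        have t: "t \<in> {0<..<T}" using that elim by auto
        have "ft t (fst q) * ft t (fst (snd q)) * xi (t, q) = p q"
          using ft_pos[OF t, of "fst q"] ft_pos[OF t, of "fst (snd q)"] that by (simp add: xi_def clamp_time_id)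
        then show ?thesis
          using ft_nonneg[OF that] xi_nonneg by (simp add: mult.assoc[symmetric] ennreal_mult[symmetric])
      qed
      then show ?case by (auto simp: indicator_def)
    qed
  qed
  finally show ?thesis .
qed

lemma flux_mass: "emeasure flux (space flux) = ennreal (T / 2 * (\<integral>q. p q \<partial>coll))"
proof -
  have "emeasure flux (space flux) = (\<integral>\<^sup>+c. 1 \<partial>flux)" by simp
  also have "... = (1/2) * (NBINT t. indicator {0..T} t * (\<integral>\<^sup>+q. ennreal (p q) * 1 \<partial>coll))"
    by (rule nn_integral_flux) auto
  also have "(\<integral>\<^sup>+q. ennreal (p q) * 1 \<partial>coll) = ennreal (\<integral>q. p q \<partial>coll)"
    using nn_integral_eq_integral[OF p_int] p_nonneg by simp
  also have "(1/2) * (NBINT t. indicator {0..T} t * ennreal (\<integral>q. p q \<partial>coll)) = ennreal (T / 2 * (\<integral>q. p q \<partial>coll))"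
  proof -
    have "(NBINT t. indicator {0..T} t * ennreal (\<integral>q. p q \<partial>coll)) = ennreal T * ennreal (\<integral>q. p q \<partial>coll)"
      using T by (subst nn_integral_multc) auto
    also have "(1/2) * ... = ennreal (1/2 * (T * (\<integral>q. p q \<partial>coll)))"
      unfolding ennreal_half using T ennreal_mult'[of "1/2" "T * (\<integral>q. p q \<partial>coll)"] ennreal_mult'[of T "\<integral>q. p q \<partial>coll"] by simp
    finally show ?thesis by simp
  qed
  finally show ?thesis .
qed

lemma flux_flux_measures: "flux \<in> flux_measures T"
proof (rule flux_measuresI)
  show "sets flux = sets (collision_space T)" by (simp add: flux_def sets_boltzmann_flux)
  show "finite_measure flux" by (rule finite_measureI) (simp add: flux_mass)
  fix F :: "'d collision => ennreal" assume [measurable]: "F \<in> borel_fun"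
  have d: "(\<integral>\<^sup>+c. G c \<partial>flux) = (\<integral>\<^sup>+c. ennreal (xi c) * G c \<partial>BF T path)" if "G \<in> borel_fun" for G
    unfolding flux_def using that by (intro nn_integral_density borel_measurable_boltzmann_flux) measurable
  have "(\<integral>\<^sup>+c. ennreal (xi (swap_in c)) * F (swap_in c) \<partial>BF T path) = (\<integral>\<^sup>+c. ennreal (xi c) * F c \<partial>BF T path)"
    by (rule nn_integral_boltzmann_flux_swap(2)[OF kernel_path]) measurable
  then show "(\<integral>\<^sup>+c. F (swap_in c) \<partial>flux) = (\<integral>\<^sup>+c. F c \<partial>flux)"
    by (simp add: d xi_swap)
  have "(\<integral>\<^sup>+c. ennreal (xi (swap_out c)) * F (swap_out c) \<partial>BF T path) = (\<integral>\<^sup>+c. ennreal (xi c) * F c \<partial>BF T path)"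
    by (rule nn_integral_boltzmann_flux_swap(1)[OF kernel_path]) measurable
  then show "(\<integral>\<^sup>+c. F (swap_out c) \<partial>flux) = (\<integral>\<^sup>+c. F c \<partial>flux)"
    by (simp add: d xi_swap)
qed

text \<open>Lebesgue measure on the time interval, kept as a finite measure on the whole line so
  that product measures and Fubini apply directly.\<close>

definition slab :: "real measure" where
  "slab = density lborel (indicator {0..T})"

lemma nn_integral_slab: "g \<in> borel_fun ==> (\<integral>\<^sup>+t. g t \<partial>slab) = (NBINT t. indicator {0..T} t * g t)"
  unfolding slab_def by (subst nn_integral_density) auto

lemma integral_slab: "g \<in> borel_fun ==> (\<integral>t. g t \<partial>slab) = (LINT t:{0..T}|lborel. g t)" for g :: "real => real"
proof -
  have "slab = density lborel (\<lambda>t. ennreal (indicator {0..T} t))" by (simp add: slab_def ennreal_indicator)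
  then show "g \<in> borel_fun ==> ?thesis" by (simp add: integral_density set_lebesgue_integral_def)
qed

lemma finite_slab: "finite_measure slab"
proof (rule finite_measureI)
  have "emeasure slab (space slab) = (\<integral>\<^sup>+t. 1 \<partial>slab)" by simp
  also have "... = emeasure lborel {0..T}"
    by (subst nn_integral_slab) simp_all
  finally show "emeasure slab (space slab) ~= \<infinity>" using T by simp
qed

lemma integral_flux:
  assumes g [measurable]: "g \<in> borel_fun" and sym: "\<And>c. g (swap_out c) = g c" and bd: "\<And>c. \<bar>g c\<bar> <= B"
  shows "(\<integral>c. g c \<partial>flux) = (1/2) * (\<integral>t. (\<integral>q. p q * g (t, q) \<partial>coll) \<partial>slab)"
proof -
  let ?P = "density coll (\<lambda>q. ennreal (p q))"
  have "emeasure ?P (space ?P) = ennreal (\<integral>q. p q \<partial>coll)"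
  proof -
    have "emeasure ?P (space ?P) = (\<integral>\<^sup>+q. 1 \<partial>?P)" by simp
    also have "... = (\<integral>\<^sup>+q. ennreal (p q) \<partial>coll)" by (subst nn_integral_density) auto
    finally show ?thesis using nn_integral_eq_integral[OF p_int] p_nonneg by simp
  qed
  then interpret P: finite_measure ?P by (intro finite_measureI) simp
  interpret S: finite_measure slab by (rule finite_slab)
  interpret SP: pair_sigma_finite slab ?P ..
  have sets: "sets (slab \<Otimes>\<^sub>M ?P) = sets (borel :: 'd collision measure)"
    unfolding borel_prod[symmetric, where 'a=real] by (rule sets_pair_measure_cong) (simp_all add: slab_def)
  note [measurable_cong] = sets
  interpret SP': finite_measure "slab \<Otimes>\<^sub>M ?P"
    by (rule finite_measure_pair_measure) unfold_locales
  interpret F: finite_measure flux by (rule flux_measuresD(3)[OF flux_flux_measures])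
  have nn: "(\<integral>\<^sup>+c. F c \<partial>flux) = (1/2) * (\<integral>\<^sup>+c. F c \<partial>(slab \<Otimes>\<^sub>M ?P))"
    if [measurable]: "F \<in> borel_fun" and s: "\<And>c. F (swap_out c) = F c" for F
  proof -
    have m: "(\<lambda>t. \<integral>\<^sup>+q. F (t, q) \<partial>?P) \<in> borel_measurable slab"
      by (rule P.borel_measurable_nn_integral) measurable
    have "(\<integral>\<^sup>+c. F c \<partial>(slab \<Otimes>\<^sub>M ?P)) = (\<integral>\<^sup>+t. (\<integral>\<^sup>+q. F (t, q) \<partial>?P) \<partial>slab)"
      by (rule P.nn_integral_fst[symmetric]) measurable
    also have "... = (NBINT t. indicator {0..T} t * (\<integral>\<^sup>+q. F (t, q) \<partial>?P))"
      using m by (intro nn_integral_slab) (simp add: slab_def)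
    also have "... = (NBINT t. indicator {0..T} t * (\<integral>\<^sup>+q. ennreal (p q) * F (t, q) \<partial>coll))"
      by (subst nn_integral_density) auto
    finally show ?thesis using nn_integral_flux[OF that(1) s] by simp
  qed
  have intF: "integrable flux g"
    using bd by (intro F.integrable_const_bound[of _ B] flux_measuresD(4)[OF flux_flux_measures g]) auto
  have intSP: "integrable (slab \<Otimes>\<^sub>M ?P) g"
    using bd by (intro SP'.integrable_const_bound[of _ B]) auto
  have h: "enn2real ((1/2) * X) = (1/2) * enn2real X" for X
    unfolding enn2real_mult ennreal_half by (subst enn2real_ennreal) simp_all
  have "(\<integral>c. g c \<partial>flux) = (1/2) * (\<integral>c. g c \<partial>(slab \<Otimes>\<^sub>M ?P))"
    unfolding real_lebesgue_integral_def[OF intF] real_lebesgue_integral_def[OF intSP]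
    using sym by (simp add: nn h right_diff_distrib)
  also have "(\<integral>c. g c \<partial>(slab \<Otimes>\<^sub>M ?P)) = (\<integral>t. (\<integral>q. g (t, q) \<partial>?P) \<partial>slab)"
    using SP.integral_fst'[OF intSP] by simp
  also have "... = (\<integral>t. (\<integral>q. p q * g (t, q) \<partial>coll) \<partial>slab)"
    using p_nonneg by (intro Bochner_Integration.integral_cong[OF refl], subst integral_density) auto
  finally show ?thesis .
qed

end

section \<open>The balance equation along the interpolation\<close>

context interpolation
begin

text \<open>The integrands of the time term and the flux term add up to the time derivative of
  \<open>ft t v * \<phi> (t, v)\<close>; Fubini and the fundamental theorem of calculus for fixed
  \<open>v\<close> leave the boundary terms.\<close>

lemma balance:
  assumes C: "C1b T \<phi> D"
  shows "(\<integral> v. \<phi> (T, v) \<partial>path T) - (\<integral> v. \<phi> (0, v) \<partial>path 0)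
        - (LINT t:{0..T}|lborel. (\<integral> v. blinfun_apply (D (t, v)) (1, 0) \<partial>path t))
        - (\<integral> c. collision_gradient \<phi> c \<partial>flux) = 0"
proof -
  have T0: "0 <= T" using T by simp
  define u where "u t v = \<phi> (clamp_time T t, v)" for t v
  define d where "d t v = blinfun_apply (D (clamp_time T t, v)) (1, 0)" for t v
  obtain K where K: "0 <= K" "\<And>t v. \<bar>u t v\<bar> <= K" "\<And>t v. \<bar>d t v\<bar> <= K"
    using C1b_bound[OF C T0] unfolding u_def d_def by metis
  have cu: "continuous_on UNIV (\<lambda>(t, v). u t v)"
    using C1b_continuous(1)[OF C T0] by (simp add: u_def)
  have cd: "continuous_on UNIV (\<lambda>(t, v). d t v)"
    using C1b_continuous(2)[OF C T0] unfolding d_def split_beta' by (intro continuous_intros)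
  have [measurable]: "(\<lambda>(t, v). u t v) \<in> borel_measurable (borel \<Otimes>\<^sub>M borel)"
    "(\<lambda>(t, v). d t v) \<in> borel_measurable (borel \<Otimes>\<^sub>M borel)"
    unfolding borel_prod using cu cd by (intro borel_measurable_continuous_onI; simp)+
  have [measurable]: "u t \<in> borel_fun" "d t \<in> borel_fun" for t
    using measurable_Pair2[of "\<lambda>(t, v). u t v" borel borel borel t] measurable_Pair2[of "\<lambda>(t, v). d t v" borel borel borel t] by simp_all
  let ?G = "\<lambda>c. collision_gradient \<phi> (clamp_time T (fst c), snd c)"
  note G = C1b_gradient[OF C T0]
  obtain B where B: "\<And>c. \<bar>?G c\<bar> <= B" using G(2) by blast
  \<comment> \<open>The flux term at time \<open>t\<close>: the factor \<open>2 / T\<close> of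
    \<open>p_flux\<close> has met the \<open>1/2\<close> of the reference flux.\<close>
  define g where "g t = (LBINT v. u t v * (f1 v - f0 v) / T)" for t
  have "(\<integral> c. collision_gradient \<phi> c \<partial>flux) = (\<integral>c. ?G c \<partial>flux)"
    by (rule G(4)[OF flux_flux_measures, symmetric])
  also have "... = (1/2) * (\<integral>t. (\<integral>q. p q * ?G (t, q) \<partial>coll) \<partial>slab)"
  proof (rule integral_flux[OF G(1) _ B])
    show "?G (swap_out c) = ?G c" for c by (cases c) simp
  qed
  also have "... = (\<integral>t. (1/2) * (\<integral>q. p q * ?G (t, q) \<partial>coll) \<partial>slab)" by simp
  also have "... = (\<integral>t. g t \<partial>slab)"
  proof (rule Bochner_Integration.integral_cong[OF refl])
    fix t
    have "(\<lambda>q. p q * ?G (t, q)) = (\<lambda>q. p q * pair_gradient (u t) q)"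
      by (rule ext) (auto simp: pair_gradient_def u_def split: prod.split)
    then have "(\<integral>q. p q * ?G (t, q) \<partial>coll) = 2 / T * (LBINT v. u t v * (f1 v - f0 v))"
      using p_flux[of "u t" K] K(2) by simp
    then show "(1/2) * (\<integral>q. p q * ?G (t, q) \<partial>coll) = g t" by (simp add: g_def)
  qed
  finally have grad: "(\<integral> c. collision_gradient \<phi> c \<partial>flux) = (\<integral>t. g t \<partial>slab)" .
  define w where "w t = (\<integral>v. d t v \<partial>path (clamp_time T t))" for t
  have wm [measurable]: "w \<in> borel_fun" and "\<exists>K. \<forall>t. \<bar>w t\<bar> <= K"
    using C1b_time_derivative[OF C T0 path_continuous] unfolding w_def d_def by auto
  have "(LINT t:{0..T}|lborel. (\<integral> v. blinfun_apply (D (t, v)) (1, 0) \<partial>path t)) = (LINT t:{0..T}|lborel. w t)"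
    by (intro set_lebesgue_integral_cong) (auto simp: w_def d_def clamp_time_id)
  also have "... = (\<integral>t. w t \<partial>slab)" by (rule integral_slab[symmetric]) measurable
  finally have time: "(LINT t:{0..T}|lborel. (\<integral> v. blinfun_apply (D (t, v)) (1, 0) \<partial>path t)) = (\<integral>t. w t \<partial>slab)" .
  define f where "f t v = ft (clamp_time T t) v" for t v
  have f_bd: "\<bar>f t v\<bar> <= f0 v + f1 v" for t v
    using ft_nonneg[OF clamp_time_in[OF T0]] ft_le[OF clamp_time_in[OF T0]] by (simp add: f_def)
  have [measurable]: "(\<lambda>(t, v). f t v) \<in> borel_measurable (borel \<Otimes>\<^sub>M borel)"
    unfolding f_def ft_def by measurable
  have [measurable]: "f t \<in> borel_fun" for t unfolding f_def by measurable
  define H where "H t v = f t v * d t v + u t v * (f1 v - f0 v) / T" for t v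
  have H [measurable]: "(\<lambda>(t, v). H t v) \<in> borel_measurable (borel \<Otimes>\<^sub>M borel)"
    unfolding H_def by measurable
  have H_bd: "\<bar>H t v\<bar> <= (K + K / T) * (f0 v + f1 v)" for t v
  proof -
    have "\<bar>f t v * d t v\<bar> <= (f0 v + f1 v) * K"
      unfolding abs_mult using f_bd K by (intro mult_mono) (auto simp: f0_nonneg f1_nonneg)
    moreover have "\<bar>u t v * (f1 v - f0 v) / T\<bar> <= K * (f0 v + f1 v) / T"
      unfolding abs_divide abs_mult using K T f0_nonneg[of v] f1_nonneg[of v]
      by (intro divide_mono mult_mono) auto
    ultimately have "\<bar>H t v\<bar> <= (f0 v + f1 v) * K + K * (f0 v + f1 v) / T"
      unfolding H_def by (rule order_trans[OF abs_triangle_ineq add_mono])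
    also have "... = (K + K / T) * (f0 v + f1 v)" by (simp only: distrib_right mult.commute times_divide_eq_left)
    finally show ?thesis .
  qed
  have int_u: "integrable lborel (\<lambda>v. u t v * (f1 v - f0 v) / T)" for t
    using integrable_mult_bounded[of lborel "\<lambda>v. f1 v - f0 v" "u t" K] f_integrable K(2) by (simp add: mult.commute)
  have int_f: "integrable lborel (f t)" for t
    using f_integrable unfolding f_def ft_def by simp
  have int_d: "integrable lborel (\<lambda>v. f t v * d t v)" for t
    using integrable_mult_bounded[OF int_f, of "d t" K] K(3) by simp
  have inner: "(LBINT v. H t v) = w t + g t" for t
  proof -
    have "w t = (LBINT v. f t v * d t v)"
      unfolding w_def path_def using ft_nonneg[OF clamp_time_in[OF T0]]
      by (subst integral_density) (auto simp: f_def)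
    then show ?thesis
      unfolding H_def g_def using int_u int_d by simp
  qed
  interpret S: finite_measure slab by (rule finite_slab)
  interpret SL: pair_sigma_finite slab lborel ..
  have sets: "sets slab = sets borel" by (simp add: slab_def)
  have HSL: "(\<lambda>(t, v). H t v) \<in> borel_measurable (slab \<Otimes>\<^sub>M lborel)"
    using H unfolding measurable_cong_sets[OF sets_pair_measure_cong[OF sets sets_lborel] refl] .
  have int_H: "integrable (slab \<Otimes>\<^sub>M lborel) (\<lambda>(t, v). H t v)"
  proof (rule integrableI_bounded[OF HSL])
    have "(\<integral>\<^sup>+x. ennreal (norm (case x of (t, v) => H t v)) \<partial>(slab \<Otimes>\<^sub>M lborel))
        = (\<integral>\<^sup>+t. (NBINT v. ennreal \<bar>H t v\<bar>) \<partial>slab)"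
      using HSL by (subst lborel.nn_integral_fst[symmetric]) auto
    also have "... <= (\<integral>\<^sup>+t. (NBINT v. ennreal ((K + K / T) * (f0 v + f1 v))) \<partial>slab)"
      using H_bd by (intro nn_integral_mono ennreal_leI)
    also have "... = (NBINT v. ennreal ((K + K / T) * (f0 v + f1 v))) * emeasure slab (space slab)"
      by simp
    also have "... < \<infinity>"
    proof -
      have "integrable lborel (\<lambda>v. (K + K / T) * (f0 v + f1 v))"
        using f_integrable by simp
      then have "(NBINT v. ennreal ((K + K / T) * (f0 v + f1 v))) < \<infinity>"
        using K T f0_nonneg f1_nonneg by (subst nn_integral_eq_integral) auto
      moreover have "emeasure slab (space slab) < \<infinity>" using S.emeasure_finite[of "space slab"] by (simp add: less_top[symmetric])
      ultimately show ?thesis by (simp add: ennreal_mult_less_top)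
    qed
    finally show "(\<integral>\<^sup>+x. ennreal (norm (case x of (t, v) => H t v)) \<partial>(slab \<Otimes>\<^sub>M lborel)) < \<infinity>" .
  qed
  have "integrable slab g"
  proof (rule S.integrable_const_bound)
    show "g \<in> borel_measurable slab"
      unfolding measurable_cong_sets[OF sets refl] g_def by measurable
    have "\<bar>g t\<bar> <= (LBINT v. K * (f0 v + f1 v) / T)" for t
    proof -
      have "norm (g t) <= (LBINT v. K * (f0 v + f1 v) / T)"
        unfolding g_def
      proof (rule Bochner_Integration.integral_norm_bound_integral[OF int_u])
        show "integrable lborel (\<lambda>v. K * (f0 v + f1 v) / T)" using f_integrable by simp
        show "norm (u t v * (f1 v - f0 v) / T) <= K * (f0 v + f1 v) / T" for v
          unfolding real_norm_def abs_divide abs_mult using K T f0_nonneg[of v] f1_nonneg[of v]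
          by (intro divide_mono mult_mono) auto
      qed
      then show ?thesis by simp
    qed
    then show "AE t in slab. norm (g t) <= (LBINT v. K * (f0 v + f1 v) / T)" by simp
  qed
  moreover have "integrable slab w"
  proof -
    obtain K' where "\<And>t. \<bar>w t\<bar> <= K'" using \<open>\<exists>K. \<forall>t. \<bar>w t\<bar> <= K\<close> by blast
    then show ?thesis
      using wm by (intro S.integrable_const_bound[of _ K']) (auto simp: measurable_cong_sets[OF sets refl])
  qed
  ultimately have "(\<integral>t. w t \<partial>slab) + (\<integral>t. g t \<partial>slab) = (\<integral>t. (LBINT v. H t v) \<partial>slab)"
    by (simp add: inner)
  also have "... = (LBINT v. (\<integral>t. H t v \<partial>slab))"
    using SL.Fubini_integral[OF int_H] by simp
  also have "... = (LBINT v. f1 v * \<phi> (T, v) - f0 v * \<phi> (0, v))"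
  proof (rule Bochner_Integration.integral_cong[OF refl])
    fix v
    have der: "((\<lambda>t. ft t v * \<phi> (t, v)) has_vector_derivative H t v) (at t within {0..T})" if t: "t \<in> {0..T}" for t
    proof -
      have "((\<lambda>t. (t, v)) has_derivative (\<lambda>x. (x, 0))) (at t within {0..T})"
        by (intro has_derivative_Pair has_derivative_ident has_derivative_const)
      moreover have "(\<phi> has_derivative blinfun_apply (D (t, v))) (at (t, v) within (\<lambda>t. (t, v)) ` {0..T})"
      proof (rule has_derivative_subset)
        show "(\<phi> has_derivative blinfun_apply (D (t, v))) (at (t, v) within {0..T} \<times> UNIV)"
          using C t unfolding C1b_def by blast
      qed auto
      ultimately have "((\<lambda>t. \<phi> (t, v)) has_derivative (\<lambda>x. blinfun_apply (D (t, v)) (x, 0))) (at t within {0..T})"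
        by (rule has_derivative_in_compose)
      moreover have "(\<lambda>x. blinfun_apply (D (t, v)) (x, 0)) = (\<lambda>x. x *\<^sub>R d t v)"
      proof
        fix x :: real
        have "blinfun_apply (D (t, v)) (x *\<^sub>R (1, 0)) = x *\<^sub>R d t v"
          unfolding blinfun.scaleR_right d_def clamp_time_id[OF t] ..
        then show "blinfun_apply (D (t, v)) (x, 0) = x *\<^sub>R d t v"
          unfolding scaleR_Pair scaleR_zero_right real_scaleR_def mult_1_right .
      qed
      ultimately have "((\<lambda>t. \<phi> (t, v)) has_vector_derivative d t v) (at t within {0..T})"
        unfolding has_vector_derivative_def by metis
      then have \<phi>': "((\<lambda>t. \<phi> (t, v)) has_real_derivative d t v) (at t within {0..T})"
        by (simp add: has_real_derivative_iff_has_vector_derivative)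
      have "((\<lambda>t. (1 - t / T) * f0 v + t / T * f1 v) has_real_derivative ((f1 v - f0 v) / T)) (at t within {0..T})"
        using T by (auto intro!: derivative_eq_intros simp: field_simps)
      from DERIV_mult[OF this \<phi>']
      show ?thesis
        using t by (simp add: has_real_derivative_iff_has_vector_derivative[symmetric] H_def f_def u_def ft_def clamp_time_id algebra_simps)
    qed
    have cont: "continuous_on {0..T} (\<lambda>t. H t v)"
    proof -
      have "continuous_on {0..T} (\<lambda>t. (\<lambda>(t, v). u t v) (t, v))" "continuous_on {0..T} (\<lambda>t. (\<lambda>(t, v). d t v) (t, v))"
        by (rule continuous_on_compose2[OF cu] continuous_on_compose2[OF cd]; auto intro!: continuous_intros)+
      then have "continuous_on {0..T} (\<lambda>t. u t v)" "continuous_on {0..T} (\<lambda>t. d t v)" by simp_all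
      then show ?thesis unfolding H_def f_def ft_def clamp_time_def using T by (intro continuous_intros) auto
    qed
    have "(\<lambda>t. H t v) \<in> borel_fun" by measurable
    then have "(\<integral>t. H t v \<partial>slab) = (LBINT t. indicator {0..T} t *\<^sub>R H t v)"
      by (simp add: integral_slab set_lebesgue_integral_def)
    also have "... = ft T v * \<phi> (T, v) - ft 0 v * \<phi> (0, v)"
      by (rule integral_FTC_Icc[OF T0 der cont]) auto
    finally show "(\<integral>t. H t v \<partial>slab) = f1 v * \<phi> (T, v) - f0 v * \<phi> (0, v)" using T by (simp add: ft_def)
  qed
  also have "... = (\<integral>v. \<phi> (T, v) \<partial>path T) - (\<integral>v. \<phi> (0, v) \<partial>path 0)"
  proof -
    have uT: "u T = (\<lambda>v. \<phi> (T, v))" "u 0 = (\<lambda>v. \<phi> (0, v))" using T by (auto simp: u_def clamp_time_id)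
    have m: "(\<lambda>v. \<phi> (T, v)) \<in> borel_fun" "(\<lambda>v. \<phi> (0, v)) \<in> borel_fun"
      unfolding uT[symmetric] by measurable
    have "integrable lborel (\<lambda>v. f1 v * u T v)" "integrable lborel (\<lambda>v. f0 v * u 0 v)"
      using integrable_mult_bounded[OF f_integrable(2), of "u T" K] integrable_mult_bounded[OF f_integrable(1), of "u 0" K] K by auto
    then have "(LBINT v. f1 v * \<phi> (T, v) - f0 v * \<phi> (0, v)) = (LBINT v. f1 v * \<phi> (T, v)) - (LBINT v. f0 v * \<phi> (0, v))"
      unfolding uT by (rule Bochner_Integration.integral_diff)
    then show ?thesis
      unfolding path_ends using m f0_nonneg f1_nonneg by (simp add: integral_density)
  qed
  finally show ?thesis unfolding time grad by simp
qed

lemma bridge: "(path, flux) \<in> bridges e T (density lborel f0) (density lborel f1) (ennreal (T / 2 * (\<integral>q. p q \<partial>coll)))"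
  using continuous_paths_cadlag[OF path_continuous] flux_flux_measures balance
  by (auto simp: bridges_def balanced_pairs_def path_ends flux_mass)

lemma rate_J_flux: "rate_J \<sigma> e T path flux = (\<integral>\<^sup>+c. ennreal (rate_fun (xi c)) \<partial>BF T path)"
  using T e bridge
  by (intro rate_J_density[OF path_continuous]) (auto simp: xi_nonneg flux_def bridges_def)

end

section \<open>Maxwellians and densities with polynomial tails\<close>

lemma nn_integral_prod_vec:
  fixes f :: "'n::finite => real => ennreal"
  assumes f: "\<And>i. f i \<in> borel_fun"
  shows "(NBINT v. (\<Prod>i\<in>UNIV. f i ((v :: real^'n) $ i))) = (\<Prod>i\<in>UNIV. (NBINT x. f i x))"
proof -
  \<comment> \<open>Recovers the index of a basis vector, in order to reindex products over
    \<open>Basis\<close>.\<close>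
  define k where "k b = (THE i. b = axis i (1::real))" for b :: "real^'n"
  have k: "k (axis i 1) = i" for i
    unfolding k_def by (rule the_equality) (auto simp: axis_eq_axis)
  have inj: "inj (\<lambda>i. axis i (1::real) :: real^'n)" by (rule inj_on_inverseI[of _ k]) (simp add: k)
  have basis: "(Basis :: (real^'n) set) = range (\<lambda>i. axis i 1)" by (auto simp: Basis_vec_def)
  have re: "(\<Prod>b\<in>Basis. F (k b) b) = (\<Prod>i\<in>UNIV. F i (axis i 1))" for F :: "'n => real^'n => ennreal"
    unfolding basis by (subst prod.reindex[OF inj]) (simp add: k comp_def)
  have "(NBINT v. (\<Prod>i\<in>UNIV. f i ((v :: real^'n) $ i))) = (NBINT v. (\<Prod>b\<in>Basis. f (k b) ((v :: real^'n) \<bullet> b)))"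
  proof (rule nn_integral_cong)
    fix v :: "real^'n"
    show "(\<Prod>i\<in>UNIV. f i (v $ i)) = (\<Prod>b\<in>Basis. f (k b) (v \<bullet> b))"
      using re[of "\<lambda>i b. f i (v \<bullet> b)"] by (simp add: inner_axis)
  qed
  also have "... = (\<Prod>b\<in>Basis. (NBINT x. f (k b) x))"
    by (rule nn_integral_lborel_prod) (simp_all add: f)
  also have "... = (\<Prod>i\<in>UNIV. (NBINT x. f i x))" by (rule re)
  finally show ?thesis .
qed

text \<open>Each coordinate contributes half of its second moment to the energy, by the product
  structure; the mean vanishes because the density is even.\<close>

lemma prob_energy_prod_density:
  fixes h :: "real => real"
  assumes h [measurable]: "h \<in> borel_fun" and nn: "\<And>x. 0 <= h x" and even: "\<And>x. h (- x) = h x"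
    and one: "(NBINT x. ennreal (h x)) = 1"
    and two: "(NBINT x. ennreal (x\<^sup>2 * h x)) <= ennreal m" and m: "0 <= m" "real CARD('d) * m / 2 <= e"
  shows "density lborel (\<lambda>v :: real^'d. ennreal (\<Prod>i\<in>UNIV. h (v $ i))) \<in> prob_energy e"
proof -
  let ?H = "\<lambda>v :: real^'d. \<Prod>i\<in>UNIV. h (v $ i)"
  let ?M = "density lborel (\<lambda>v :: real^'d. ennreal (?H v))"
  have H0: "0 <= ?H v" for v by (intro prod_nonneg nn)
  have [measurable]: "?H \<in> borel_fun" by measurable
  have "(NBINT v. ennreal (?H v)) = 1"
    using nn_integral_prod_vec[of "\<lambda>(i::'d) x. ennreal (h x)"] nn by (simp add: prod_ennreal one)
  then have prob: "prob_space ?M" by (intro prob_spaceI) (simp add: emeasure_density)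
  have "(\<integral>\<^sup>+v. ennreal ((norm v)\<^sup>2 / 2) \<partial>?M) = (NBINT v. (\<Sum>j\<in>UNIV. ennreal ((v $ j)\<^sup>2 / 2 * ?H v)))"
  proof -
    have "ennreal (?H v) * ennreal ((norm v)\<^sup>2 / 2) = (\<Sum>j\<in>UNIV. ennreal ((v $ j)\<^sup>2 / 2 * ?H v))" for v
    proof -
      have "(norm v)\<^sup>2 = (\<Sum>j\<in>UNIV. (v $ j)\<^sup>2)"
        unfolding power2_norm_eq_inner inner_vec_def by (simp add: power2_eq_square)
      then have "?H v * ((norm v)\<^sup>2 / 2) = (\<Sum>j\<in>UNIV. (v $ j)\<^sup>2 / 2 * ?H v)"
        by (simp add: sum_distrib_left sum_divide_distrib mult.commute)
      then show ?thesis using H0[of v] by (simp add: ennreal_mult[symmetric] sum_ennreal)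
    qed
    then show ?thesis by (subst nn_integral_density) auto
  qed
  also have "... = (\<Sum>j\<in>UNIV. (NBINT v. ennreal ((v $ j)\<^sup>2 / 2 * ?H v)))"
    by (rule nn_integral_sum) measurable
  also have "... <= (\<Sum>j\<in>(UNIV :: 'd set). ennreal (m / 2))"
  proof (rule sum_mono)
    fix j :: 'd
    let ?f = "\<lambda>i x. if i = j then ennreal (x\<^sup>2 / 2 * h x) else ennreal (h x)"
    have "ennreal ((v $ j)\<^sup>2 / 2 * ?H v) = (\<Prod>i\<in>UNIV. ?f i (v $ i))" for v :: "real^'d"
    proof -
      have "(\<Prod>i\<in>UNIV. ?f i (v $ i)) = (\<Prod>i\<in>UNIV. ennreal ((if i = j then (v $ j)\<^sup>2 / 2 else 1) * h (v $ i)))"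
        by (intro prod.cong) auto
      also have "... = ennreal (\<Prod>i\<in>UNIV. (if i = j then (v $ j)\<^sup>2 / 2 else 1) * h (v $ i))"
        using nn by (intro prod_ennreal) auto
      also have "(\<Prod>i\<in>UNIV. (if i = j then (v $ j)\<^sup>2 / 2 else 1) * h (v $ i)) = (v $ j)\<^sup>2 / 2 * ?H v"
        by (subst prod.distrib) simp
      finally show ?thesis by simp
    qed
    then have "(NBINT v. ennreal ((v $ j)\<^sup>2 / 2 * ?H v)) = (\<Prod>i\<in>UNIV. (NBINT x. ?f i x))"
      by (simp only:) (rule nn_integral_prod_vec, measurable)
    also have "... = (\<Prod>i\<in>UNIV. if i = j then (NBINT x. ennreal (x\<^sup>2 / 2 * h x)) else 1)"
      by (intro prod.cong) (auto simp: one)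
    also have "... = (NBINT x. ennreal (1/2) * ennreal (x\<^sup>2 * h x))"
    proof -
      have "ennreal (x\<^sup>2 / 2 * h x) = ennreal (1/2) * ennreal (x\<^sup>2 * h x)" for x
        using ennreal_mult'[of "1/2" "x\<^sup>2 * h x"] by simp
      then show ?thesis by simp
    qed
    also have "... = ennreal (1/2) * (NBINT x. ennreal (x\<^sup>2 * h x))"
      by (rule nn_integral_cmult) measurable
    also have "... <= ennreal (1/2) * ennreal m" by (rule mult_left_mono[OF two]) simp
    also have "... = ennreal (m / 2)" using ennreal_mult'[of "1/2" m] by simp
    finally show "(NBINT v. ennreal ((v $ j)\<^sup>2 / 2 * ?H v)) <= ennreal (m / 2)" .
  qed
  also have "... = ennreal (real CARD('d) * m / 2)"
    using m by (subst sum_ennreal) auto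
  also have "... <= ennreal e" using m by (intro ennreal_leI)
  finally have energy: "(\<integral>\<^sup>+v. ennreal ((norm v)\<^sup>2 / 2) \<partial>?M) <= ennreal e" .
  have "distr ?M borel uminus = ?M"
  proof (rule measure_eqI_nn_integral)
    fix F :: "real^'d => ennreal" assume "F \<in> borel_measurable ?M"
    then have [measurable]: "F \<in> borel_fun" by simp
    have orth: "orthogonal_transformation (uminus :: real^'d => real^'d)"
      by (simp add: orthogonal_transformation_def linear_uminus)
    have "(\<integral>\<^sup>+v. F v \<partial>distr ?M borel uminus) = (NBINT v. ennreal (?H v) * F (- v))"
      by (subst nn_integral_distr, measurable, subst nn_integral_density) auto
    also have "... = (NBINT v. ennreal (?H (- v)) * F (- v))" by (simp add: even)
    also have "... = (NBINT v. ennreal (?H v) * F v)"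
      by (rule nn_integral_lborel_orthogonal[OF orth, of "\<lambda>v. ennreal (?H v) * F v"]) measurable
    also have "... = (\<integral>\<^sup>+v. F v \<partial>?M)" by (subst nn_integral_density) auto
    finally show "(\<integral>\<^sup>+v. F v \<partial>distr ?M borel uminus) = (\<integral>\<^sup>+v. F v \<partial>?M)" .
  qed simp
  then have "(\<integral>v. v \<partial>?M) = (\<integral>v. v \<partial>distr ?M borel uminus)" by simp
  also have "... = (\<integral>v. - v \<partial>?M)" by (rule integral_distr) measurable
  also have "... = - (\<integral>v. v \<partial>?M)" by simp
  finally have "2 *\<^sub>R (\<integral>v. v \<partial>?M) = 0" unfolding scaleR_2 by (metis add.right_inverse)
  then show ?thesis using prob energy by (simp add: prob_energy_def)
qed

definition maxw :: "real => real^'d => real" where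
  "maxw \<epsilon> v = (\<Prod>i\<in>UNIV. normal_density 0 (sqrt (2 * \<epsilon> / real CARD('d))) (v $ i))"

lemma maxwellian_density: "maxwellian \<epsilon> = density lborel (\<lambda>v. ennreal (maxw \<epsilon> v))"
  by (simp add: maxwellian_def maxw_def)

lemma maxw_measurable [measurable]: "maxw \<epsilon> \<in> borel_fun"
  unfolding maxw_def[abs_def] by measurable

lemma maxw_pos: "0 < \<epsilon> ==> 0 < maxw \<epsilon> (v :: real^'d)"
  unfolding maxw_def by (intro prod_pos normal_density_pos) simp

text \<open>The density depends on the kinetic energy only; this is what makes it invariant under
  collisions.\<close>

lemma maxw_eq:
  assumes "0 < \<epsilon>"
  shows "maxw \<epsilon> (v :: real^'d) = (1 / sqrt (2 * pi * (2 * \<epsilon> / real CARD('d)))) ^ CARD('d) * exp (- (norm v)\<^sup>2 / (2 * (2 * \<epsilon> / real CARD('d))))"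
proof -
  have "(norm v)\<^sup>2 = (\<Sum>j\<in>UNIV. (v $ j)\<^sup>2)"
    unfolding power2_norm_eq_inner inner_vec_def by (simp add: power2_eq_square)
  then have "exp (- (norm v)\<^sup>2 / (2 * (2 * \<epsilon> / real CARD('d)))) = (\<Prod>j\<in>UNIV. exp (- (v $ j)\<^sup>2 / (2 * (2 * \<epsilon> / real CARD('d)))))"
    by (simp add: exp_sum[symmetric] sum_negf sum_divide_distrib sum_distrib_right)
  then show ?thesis
    using assms by (simp add: maxw_def normal_density_def prod_dividef prod.distrib power_one_over)
qed

lemma maxwellian_energy:
  assumes "0 < \<epsilon>" "\<epsilon> <= e"
  shows "(maxwellian \<epsilon> :: (real^'d) measure) \<in> prob_energy e"
proof -
  let ?s = "sqrt (2 * \<epsilon> / real CARD('d))"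
  have s: "0 < ?s" using assms by simp
  have two: "has_bochner_integral lborel (\<lambda>x. normal_density 0 ?s x * x\<^sup>2) (?s\<^sup>2)"
    using normal_moment_even[OF s, of 0 1] by simp
  show ?thesis
    unfolding maxwellian_def
  proof (rule prob_energy_prod_density[where m="?s\<^sup>2"])
    show "(NBINT x. ennreal (normal_density 0 ?s x)) = 1"
      using s by (subst nn_integral_eq_integral) auto
    show "(NBINT x. ennreal (x\<^sup>2 * normal_density 0 ?s x)) <= ennreal (?s\<^sup>2)"
      using two by (subst nn_integral_eq_integral) (auto simp: has_bochner_integral_iff mult.commute)
    show "real CARD('d) * ?s\<^sup>2 / 2 <= e" using assms by simp
  qed (auto simp: normal_density_def)
qed

lemma maxw_bounded:
  assumes "0 < \<epsilon>"
  shows "maxw \<epsilon> (v :: real^'d) <= (1 / sqrt (2 * pi * (2 * \<epsilon> / real CARD('d)))) ^ CARD('d)"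
proof -
  have "exp (- (norm v)\<^sup>2 / (2 * (2 * \<epsilon> / real CARD('d)))) <= 1" using assms by simp
  then show ?thesis unfolding maxw_eq[OF assms] using assms
    by (intro mult_left_le) auto
qed

text \<open>A polynomial decay, since the logarithm of the reciprocal of the density must be bounded by
  \<open>ln (1 + norm v)\<close>.\<close>

definition tail_profile :: "real => real" where
  "tail_profile x = 1 / (1 + x\<^sup>2)\<^sup>2"

lemma tail_profile_measurable [measurable]: "tail_profile \<in> borel_fun"
  unfolding tail_profile_def[abs_def] by measurable

lemma tail_profile_pos: "0 < tail_profile x" "tail_profile x <= 1"
proof -
  have "1 <= 1 + x\<^sup>2" by simp
  then have 1: "1 <= (1 + x\<^sup>2)\<^sup>2" by (rule one_le_power)
  have "0 < (1 + x\<^sup>2)\<^sup>2" using 1 by linarith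
  with 1 show "0 < tail_profile x" "tail_profile x <= 1" by (auto simp only: tail_profile_def divide_le_eq_1_pos zero_less_divide_1_iff)
qed

lemma tail_profile_integrable: "integrable lborel tail_profile" "integrable lborel (\<lambda>x. x\<^sup>2 * tail_profile x)"
proof -
  have "integrable lborel (\<lambda>x::real. inverse (1 + x\<^sup>2))"
    using integrable_inverse_1_plus_square by (simp add: set_integrable_def)
  moreover have "tail_profile x <= inverse (1 + x\<^sup>2)" "x\<^sup>2 * tail_profile x <= inverse (1 + x\<^sup>2)" for x
  proof -
    have "1 <= 1 + x\<^sup>2" by simp
    then have pos: "0 < 1 + x\<^sup>2" by linarith
    have "1 * (1 + x\<^sup>2) <= (1 + x\<^sup>2)\<^sup>2" "x\<^sup>2 * (1 + x\<^sup>2) <= (1 + x\<^sup>2)\<^sup>2"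
      unfolding power2_eq_square[of "1 + x\<^sup>2"] by (intro mult_right_mono; simp)+
    then show "tail_profile x <= inverse (1 + x\<^sup>2)" "x\<^sup>2 * tail_profile x <= inverse (1 + x\<^sup>2)"
      using pos by (auto simp: tail_profile_def divide_simps)
  qed
  ultimately show "integrable lborel tail_profile" "integrable lborel (\<lambda>x. x\<^sup>2 * tail_profile x)"
    using tail_profile_pos(1) by (auto intro!: Bochner_Integration.integrable_bound[of lborel "\<lambda>x. inverse (1 + x\<^sup>2)"] simp: less_imp_le abs_mult)
qed

lemma maxw_scaleR:
  assumes "0 < \<epsilon>" "0 < r"
  shows "r ^ CARD('d) * maxw (r\<^sup>2 * \<epsilon>) (r *\<^sub>R v) = maxw \<epsilon> (v :: real^'d)"
proof -
  let ?s = "sqrt (2 * \<epsilon> / real CARD('d))"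
  have s: "sqrt (2 * (r\<^sup>2 * \<epsilon>) / real CARD('d)) = r * ?s"
    using assms by (simp add: real_sqrt_mult real_sqrt_divide)
  have s0: "0 < ?s" using assms by simp
  have *: "r * normal_density 0 (r * s) (r * x) = normal_density 0 s x" if "0 < s" for x s
  proof -
    have "sqrt (2 * pi * (r * s)\<^sup>2) = r * sqrt (2 * pi * s\<^sup>2)"
      using assms by (simp add: real_sqrt_mult power_mult_distrib)
    moreover have "(r * x)\<^sup>2 / (2 * (r * s)\<^sup>2) = x\<^sup>2 / (2 * s\<^sup>2)"
      using assms by (simp add: power_mult_distrib)
    ultimately show ?thesis using assms by (simp add: normal_density_def)
  qed
  have "r ^ CARD('d) * maxw (r\<^sup>2 * \<epsilon>) (r *\<^sub>R v) = (\<Prod>i\<in>(UNIV::'d set). r * normal_density 0 (r * ?s) (r * v $ i))"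
    unfolding maxw_def s by (simp add: prod.distrib)
  also have "... = maxw \<epsilon> v" unfolding maxw_def *[OF s0] ..
  finally show ?thesis .
qed

section \<open>Collision rates at equilibrium\<close>

context boltzmann_kernel
begin

definition maxw_pair :: "real => 'd quad => real" where
  "maxw_pair \<epsilon> q = maxw \<epsilon> (fst q) * maxw \<epsilon> (fst (snd q))"

lemma maxw_pair_measurable [measurable]: "maxw_pair \<epsilon> \<in> borel_fun"
  unfolding maxw_pair_def[abs_def] by measurable

lemma maxw_pair_pos: "0 < \<epsilon> ==> 0 < maxw_pair \<epsilon> q"
  by (simp add: maxw_pair_def maxw_pos)

lemma nn_integral_maxwellian_collisions:
  assumes \<epsilon>: "0 < \<epsilon>" and F [measurable]: "F \<in> borel_fun"
  shows "(\<integral>\<^sup>+v. (\<integral>\<^sup>+w. (\<integral>\<^sup>+u. ennreal (kernel_B (v - w) u) * F (v, w, post_velocities v w u) \<partial>s) \<partial>maxwellian \<epsilon>) \<partial>maxwellian \<epsilon>)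
    = (\<integral>\<^sup>+q. ennreal (maxw_pair \<epsilon> q) * F q \<partial>coll)"
proof -
  have [measurable]: "(\<lambda>(v, w). \<integral>\<^sup>+u. ennreal (kernel_B (v - w) u) * F (v, w, post_velocities v w u) \<partial>s) \<in> borel_measurable (borel \<Otimes>\<^sub>M borel)"
    by measurable
  have "(\<integral>\<^sup>+v. (\<integral>\<^sup>+w. (\<integral>\<^sup>+u. ennreal (kernel_B (v - w) u) * F (v, w, post_velocities v w u) \<partial>s) \<partial>maxwellian \<epsilon>) \<partial>maxwellian \<epsilon>)
    = (NBINT v. ennreal (maxw \<epsilon> v) * (NBINT w. ennreal (maxw \<epsilon> w) * (\<integral>\<^sup>+u. ennreal (kernel_B (v - w) u) * F (v, w, post_velocities v w u) \<partial>s)))"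
    unfolding maxwellian_density by (simp add: nn_integral_density)
  also have "... = (NBINT v. (NBINT w. (\<integral>\<^sup>+u. ennreal (kernel_B (v - w) u) *
      (ennreal (maxw_pair \<epsilon> (v, w, post_velocities v w u)) * F (v, w, post_velocities v w u)) \<partial>s)))"
  proof -
    have "ennreal (maxw \<epsilon> v) * (ennreal (maxw \<epsilon> w) * (B * X)) = B * (ennreal (maxw \<epsilon> v * maxw \<epsilon> w) * X)" for v w :: "real^'d" and B X
      using maxw_pos[OF \<epsilon>, THEN less_imp_le, of v] by (simp add: ennreal_mult' mult_ac)
    then show ?thesis by (simp add: nn_integral_cmult[symmetric] maxw_pair_def)
  qed
  also have "... = (\<integral>\<^sup>+q. ennreal (maxw_pair \<epsilon> q) * F q \<partial>coll)"
    by (subst nn_integral_coll) auto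
  finally show ?thesis .
qed

lemma typical_q_coll:
  assumes \<epsilon>: "0 < \<epsilon>"
  shows "typical_q \<sigma> \<epsilon> = (1/2) * (\<integral>\<^sup>+q. ennreal (maxw_pair \<epsilon> q) \<partial>coll)"
proof -
  have "(\<integral>\<^sup>+u. ennreal (kernel_B (v - w) u) \<partial>\<sigma>) = (\<integral>\<^sup>+u. ennreal (kernel_B (v - w) u) * 1 \<partial>s)" for v w
    by (subst nn_integral_s) auto
  then show ?thesis
    unfolding typical_q_def using nn_integral_maxwellian_collisions[OF \<epsilon>, of "\<lambda>_. 1"] by simp
qed

text \<open>The rate is the mass of the reference flux of the constant Maxwellian path during unit
  time.\<close>

lemma typical_q_finite:
  assumes \<epsilon>: "0 < \<epsilon>"
  shows "typical_q \<sigma> \<epsilon> < top"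
proof -
  let ?M = "maxwellian \<epsilon> :: (real^'d) measure"
  have M: "?M \<in> prob_energy \<epsilon>" using maxwellian_energy[OF \<epsilon> order_refl] .
  have c: "(\<lambda>_. ?M) \<in> continuous_paths \<epsilon> 1"
    by (rule continuous_pathsI) (auto intro: M)
  have k: "kernel_path 1 (\<lambda>_. ?M)" using continuous_paths_kernel[OF c] by simp
  interpret finite_measure "BF 1 (\<lambda>_. ?M)" by (rule finite_boltzmann_flux[OF c]) (use \<epsilon> in auto)
  have "emeasure (BF 1 (\<lambda>_. ?M)) (space (BF 1 (\<lambda>_. ?M))) = (1/2) * flux_integral 1 (\<lambda>_. ?M) (\<lambda>_. 1)"
    using nn_integral_boltzmann_flux_symmetric[OF k, of "\<lambda>_. 1"] by simp
  also have "flux_integral 1 (\<lambda>_. ?M) (\<lambda>_. 1) = (\<integral>\<^sup>+q. ennreal (maxw_pair \<epsilon> q) * 1 \<partial>coll)"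
    unfolding flux_integral_def nn_integral_maxwellian_collisions[OF \<epsilon>, of "\<lambda>_. 1", OF borel_measurable_const]
    by (subst nn_integral_multc) auto
  finally show ?thesis
    using emeasure_finite[of "space (BF 1 (\<lambda>_. ?M))"] typical_q_coll[OF \<epsilon>] by (simp add: less_top)
qed

text \<open>The Maxwellian weight is positive everywhere, so a zero rate would make
  \<open>coll\<close> the null measure; but a weighted marginal of \<open>coll\<close> is Lebesgue
  measure.\<close>

lemma typical_q_pos:
  assumes \<epsilon>: "0 < \<epsilon>"
  shows "0 < typical_q \<sigma> \<epsilon>"
proof (rule ccontr)
  assume "\<not> 0 < typical_q \<sigma> \<epsilon>"
  then have "(\<integral>\<^sup>+q. ennreal (maxw_pair \<epsilon> q) \<partial>coll) = 0"
    using typical_q_coll[OF \<epsilon>] by (simp add: ennreal_half zero_less_iff_neq_zero)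
  then have "AE q in coll. ennreal (maxw_pair \<epsilon> q) = 0"
    by (subst (asm) nn_integral_0_iff_AE) auto
  then have null: "AE q in coll. False"
    by eventually_elim (metis maxw_pair_pos[OF \<epsilon>] ennreal_eq_0_iff not_le)
  have "(NBINT v. indicator (cball (0::real^'d) 1) v) = (\<integral>\<^sup>+c. ennreal (corner_weight 1 c) * indicator (cball 0 1) (fst c) \<partial>coll)"
  proof (rule corner_marginal(1)[symmetric])
    have "cball (0::real^'d) 1 \<in> sets borel" by simp
    then show "indicator (cball (0::real^'d) 1) \<in> borel_fun" by (rule borel_measurable_indicator)
  qed simp
  also have "... = (\<integral>\<^sup>+c. 0 \<partial>coll)"
    by (rule nn_integral_cong_AE) (use null in eventually_elim, simp)
  finally have "emeasure lborel (cball (0::real^'d) 1) = 0" by simp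
  then show False using emeasure_cball[of 1 "0 :: real^'d"] unit_ball_vol_pos[of "real CARD('d)"] by simp
qed

text \<open>Substitute \<open>r *\<^sub>R v\<close> and \<open>r *\<^sub>R w\<close>: the
  Maxwellians change their energy by \<open>r\<^sup>2\<close>, and the kernel is homogeneous of
  degree one.\<close>

lemma typical_q_scale:
  assumes \<epsilon>: "0 < \<epsilon>" and r: "0 < r"
  shows "typical_q \<sigma> (r\<^sup>2 * \<epsilon>) = ennreal r * typical_q \<sigma> \<epsilon>"
proof -
  have r\<epsilon>: "0 < r\<^sup>2 * \<epsilon>" using assms by simp
  let ?N = "CARD('d)"
  let ?J = "\<lambda>v w :: real^'d. \<integral>\<^sup>+u. ennreal (kernel_B (v - w) u) \<partial>s"
  have [measurable]: "(\<lambda>(v, w). ?J v w) \<in> borel_measurable (borel \<Otimes>\<^sub>M borel)" by measurable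
  have coll: "(\<integral>\<^sup>+q. ennreal (maxw_pair \<epsilon> q) \<partial>coll) = (NBINT v. (NBINT w. ennreal (maxw \<epsilon> v * maxw \<epsilon> w) * ?J v w))" for \<epsilon>
    by (subst nn_integral_coll) (auto simp: maxw_pair_def nn_integral_cmult[symmetric] mult.commute)
  have hom: "?J (r *\<^sub>R v) (r *\<^sub>R w) = ennreal r * ?J v w" for v w
  proof -
    have "kernel_B (r *\<^sub>R v - r *\<^sub>R w) u = r * kernel_B (v - w) u" for u
      using r by (simp add: kernel_B_def scaleR_diff_right[symmetric] abs_mult)
    then show ?thesis using r by (simp add: ennreal_mult' nn_integral_cmult)
  qed
  have M: "ennreal (r ^ ?N) * (ennreal (r ^ ?N) * (ennreal (maxw (r\<^sup>2 * \<epsilon>) (r *\<^sub>R v) * maxw (r\<^sup>2 * \<epsilon>) (r *\<^sub>R w)) * X))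
      = ennreal (maxw \<epsilon> v * maxw \<epsilon> w) * X" for v w :: "real^'d" and X
  proof -
    have "r ^ ?N * (r ^ ?N * (maxw (r\<^sup>2 * \<epsilon>) (r *\<^sub>R v) * maxw (r\<^sup>2 * \<epsilon>) (r *\<^sub>R w))) = maxw \<epsilon> v * maxw \<epsilon> w"
      using maxw_scaleR[OF assms, of v] maxw_scaleR[OF assms, of w] by (metis mult.assoc mult.left_commute)
    moreover have "ennreal a * (ennreal a * (ennreal b * X)) = ennreal (a * (a * b)) * X" if "0 <= a" for a b
      using that by (simp add: ennreal_mult' mult.assoc)
    ultimately show ?thesis using r by simp
  qed
  have "(\<integral>\<^sup>+q. ennreal (maxw_pair (r\<^sup>2 * \<epsilon>) q) \<partial>coll)
    = (NBINT v. ennreal (r ^ ?N) * (NBINT w. ennreal (maxw (r\<^sup>2 * \<epsilon>) (r *\<^sub>R v) * maxw (r\<^sup>2 * \<epsilon>) w) * ?J (r *\<^sub>R v) w))"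
    unfolding coll by (rule nn_integral_lborel_scaleR[OF _ r]) measurable
  also have "... = (NBINT v. ennreal (r ^ ?N) * (NBINT w. ennreal (r ^ ?N) * (ennreal (maxw (r\<^sup>2 * \<epsilon>) (r *\<^sub>R v) * maxw (r\<^sup>2 * \<epsilon>) (r *\<^sub>R w)) * ?J (r *\<^sub>R v) (r *\<^sub>R w))))"
    by (intro nn_integral_cong arg_cong[where f="(*) _"] nn_integral_lborel_scaleR[OF _ r]) measurable
  also have "... = (NBINT v. (NBINT w. ennreal r * (ennreal (maxw \<epsilon> v * maxw \<epsilon> w) * ?J v w)))"
    unfolding hom by (simp add: nn_integral_cmult[symmetric] M mult.left_commute)
  also have "... = ennreal r * (\<integral>\<^sup>+q. ennreal (maxw_pair \<epsilon> q) \<partial>coll)"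
    unfolding coll by (simp add: nn_integral_cmult)
  finally show ?thesis
    unfolding typical_q_coll[OF \<epsilon>] typical_q_coll[OF r\<epsilon>] by (simp only: mult.left_commute)
qed

text \<open>The exchange of normal components conserves energy when \<open>u\<close> is a unit
  vector, which holds for almost every direction.\<close>

lemma AE_coll_energy:
  "AE q in coll. (norm (fst (snd (snd q))))\<^sup>2 + (norm (snd (snd (snd q))))\<^sup>2 = (norm (fst q))\<^sup>2 + (norm (fst (snd q)))\<^sup>2"
proof -
  let ?E = "\<lambda>q :: 'd quad. (norm (fst (snd (snd q))))\<^sup>2 + (norm (snd (snd (snd q))))\<^sup>2 = (norm (fst q))\<^sup>2 + (norm (fst (snd q)))\<^sup>2"
  have "(\<integral>\<^sup>+q. indicator {q. \<not> ?E q} q \<partial>coll) = (NBINT v. (NBINT w. (\<integral>\<^sup>+u. ennreal (kernel_B (v - w) u) * indicator {q. \<not> ?E q} (v, w, post_velocities v w u) \<partial>s)))"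
    by (rule nn_integral_coll) measurable
  also have "... = (NBINT (v::real^'d). (NBINT (w::real^'d). (\<integral>\<^sup>+(u::real^'d). 0 \<partial>s)))"
  proof (rule nn_integral_cong, rule nn_integral_cong, rule nn_integral_cong_AE, use norm_s in eventually_elim)
    fix v w u :: "real^'d" assume "norm u = 1"
    then have "u \<bullet> u = 1" by (simp add: dot_square_norm)
    then have "?E (v, w, post_velocities v w u)"
      unfolding power2_norm_eq_inner post_velocities_def
      by (simp add: inner_add_left inner_add_right inner_diff_left inner_diff_right inner_commute algebra_simps)
    then show "ennreal (kernel_B (v - w) u) * indicator {q. \<not> ?E q} (v, w, post_velocities v w u) = 0" by simp
  qed
  finally have "(\<integral>\<^sup>+q. indicator {q. \<not> ?E q} q \<partial>coll) = 0" by simp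
  then have "AE q in coll. indicator {q. \<not> ?E q} q = (0::ennreal)"
    by (subst (asm) nn_integral_0_iff_AE) auto
  then show ?thesis by eventually_elim (auto simp: indicator_def split: if_splits)
qed

lemma maxw_pair_invariant:
  assumes \<epsilon>: "0 < \<epsilon>"
  shows "AE q in coll. maxw_pair \<epsilon> (fst (snd (snd q)), snd (snd (snd q)), fst q, fst (snd q)) = maxw_pair \<epsilon> q"
  using AE_coll_energy
proof eventually_elim
  case (elim q)
  have "maxw \<epsilon> v * maxw \<epsilon> w = ((1 / sqrt (2 * pi * (2 * \<epsilon> / real CARD('d)))) ^ CARD('d))\<^sup>2 *
      exp (- ((norm v)\<^sup>2 + (norm w)\<^sup>2) / (2 * (2 * \<epsilon> / real CARD('d))))" for v w :: "real^'d"
    unfolding maxw_eq[OF \<epsilon>] by (simp add: power2_eq_square mult_exp_exp diff_divide_distrib left_diff_distrib)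
  then show ?case using elim by (simp add: maxw_pair_def)
qed

end

section \<open>Stationary loops at a Maxwellian\<close>

context boltzmann_kernel
begin

definition qr :: "real => real" where
  "qr \<epsilon> = enn2real (typical_q \<sigma> \<epsilon>)"

lemma typical_q_qr: "0 < \<epsilon> ==> typical_q \<sigma> \<epsilon> = ennreal (qr \<epsilon>)"
  using typical_q_finite by (simp add: qr_def less_top)

lemma qr_pos: "0 < \<epsilon> ==> 0 < qr \<epsilon>"
  using typical_q_pos typical_q_finite by (simp add: qr_def enn2real_positive_iff)

lemma qr_scale: "0 < \<epsilon> ==> 0 < r ==> qr (r\<^sup>2 * \<epsilon>) = r * qr \<epsilon>"
  unfolding qr_def by (simp add: typical_q_scale enn2real_mult)

text \<open>The constant path with \<open>c\<close> times the equilibrium flux. Its divergence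
  vanishes because \<open>maxw_pair\<close> is invariant under reversal, and its density relative to
  the reference flux is the constant \<open>c\<close>. For \<open>c = 1\<close> the cost is
  zero.\<close>

lemma maxwellian_loop:
  assumes \<epsilon>: "0 < \<epsilon>" "\<epsilon> <= e" and T: "0 < T" and c: "0 < c"
  shows "bridge_cost \<sigma> e T (maxwellian \<epsilon>) (maxwellian \<epsilon>) (ennreal (T * (c * qr \<epsilon>))) <= ennreal (T * (qr \<epsilon> * rate_fun c))"
proof -
  let ?m = "maxw \<epsilon> :: real^'d => real"
  let ?p = "\<lambda>q. c * maxw_pair \<epsilon> q"
  have nn: "(\<integral>\<^sup>+q. ennreal (maxw_pair \<epsilon> q) \<partial>coll) = ennreal (2 * qr \<epsilon>)"
  proof -
    have "ennreal (1/2) * (\<integral>\<^sup>+q. ennreal (maxw_pair \<epsilon> q) \<partial>coll) = ennreal (qr \<epsilon>)"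
      using typical_q_coll[OF \<epsilon>(1)] typical_q_qr[OF \<epsilon>(1)] ennreal_half by simp
    then have "ennreal 2 * (ennreal (1/2) * (\<integral>\<^sup>+q. ennreal (maxw_pair \<epsilon> q) \<partial>coll)) = ennreal 2 * ennreal (qr \<epsilon>)" by simp
    then show ?thesis
      using ennreal_mult'[of 2 "1/2"] ennreal_mult'[of 2 "qr \<epsilon>"] by (simp only: mult.assoc[symmetric]) simp
  qed
  have int: "integrable coll (maxw_pair \<epsilon>)"
    using maxw_pair_pos[OF \<epsilon>(1)] nn by (intro integrableI_nonneg) (auto simp: less_imp_le)
  have val: "(\<integral>q. maxw_pair \<epsilon> q \<partial>coll) = 2 * qr \<epsilon>"
    using maxw_pair_pos[OF \<epsilon>(1)] qr_pos[OF \<epsilon>(1)] nn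
    by (subst integral_eq_nn_integral) (auto simp: less_imp_le)
  have en: "density lborel ?m \<in> prob_energy e"
    using maxwellian_energy[OF \<epsilon>, where 'd='d] by (simp add: maxwellian_density)
  have m0: "0 <= ?m v" for v using maxw_pos[OF \<epsilon>(1), of v] by simp
  interpret I: interpolation \<sigma> e T ?m ?m ?p
  proof unfold_locales
    show "0 <= e" using \<epsilon> by simp
    show "0 < (1 - t / T) * ?m v + t / T * ?m v" for t v
      unfolding distrib_right[symmetric] using maxw_pos[OF \<epsilon>(1), of v] by simp
    show "integrable coll ?p" using int by simp
    fix \<phi> :: "real^'d => real" and B assume [measurable]: "\<phi> \<in> borel_fun" and B: "\<And>x. \<bar>\<phi> x\<bar> <= B"
    \<comment> \<open>The loss term of the gradient; the gain term is its image under reversal and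
      has the same integral.\<close>
    define F where "F q = maxw_pair \<epsilon> q * (\<phi> (fst q) + \<phi> (fst (snd q)))" for q
    have F: "integrable coll F"
      unfolding F_def
    proof (rule integrable_mult_bounded[OF int])
      show "\<bar>\<phi> (fst q) + \<phi> (fst (snd q))\<bar> <= 2 * B" for q
        using B[of "fst q"] B[of "fst (snd q)"] by linarith
    qed measurable
    define R where "R q = F (case q of (v, w, v', w') => (v', w', v, w))" for q
    have R: "integrable coll R" "(\<integral>q. R q \<partial>coll) = (\<integral>q. F q \<partial>coll)"
      using integral_coll_swap(3,4)[OF F] unfolding R_def[abs_def] by blast+
    have "(\<integral>q. ?p q * pair_gradient \<phi> q \<partial>coll) = (\<integral>q. c * (R q - F q) \<partial>coll)"
    proof (rule integral_cong_AE)
      show "AE q in coll. ?p q * pair_gradient \<phi> q = c * (R q - F q)"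
        using maxw_pair_invariant[OF \<epsilon>(1)]
        by eventually_elim (auto simp: R_def F_def pair_gradient_def algebra_simps split: prod.split)
      show "(\<lambda>q. c * (R q - F q)) \<in> borel_measurable coll"
        using F R(1) by (intro borel_measurable_times borel_measurable_diff borel_measurable_const) (auto dest: borel_measurable_integrable)
      show "(\<lambda>q. ?p q * pair_gradient \<phi> q) \<in> borel_measurable coll"
        unfolding pair_gradient_eq by measurable
    qed
    also have "... = c * ((\<integral>q. R q \<partial>coll) - (\<integral>q. F q \<partial>coll))"
      using F R(1) by simp
    finally show "(\<integral>q. ?p q * pair_gradient \<phi> q \<partial>coll) = 2 / T * (LBINT z. \<phi> z * (?m z - ?m z))"
      by (simp add: R(2))
  qed (use \<epsilon> T c en m0 maxw_pos[OF \<epsilon>(1)] maxw_pair_pos[OF \<epsilon>(1)] in \<open>auto simp: less_imp_le maxw_pair_def mult.commute\<close>)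
  have ft: "I.ft t v = ?m v" for t v
    unfolding I.ft_def distrib_right[symmetric] by simp
  have xi: "I.xi q = c" for q
    unfolding I.xi_def ft using maxw_pos[OF \<epsilon>(1), of "fst (snd q)"] maxw_pos[OF \<epsilon>(1), of "fst (snd (snd q))"]
    by (simp add: maxw_pair_def)
  have "rate_J \<sigma> e T I.path I.flux = (\<integral>\<^sup>+q. ennreal (rate_fun c) * 1 \<partial>BF T I.path)"
    unfolding I.rate_J_flux xi by simp
  also have "... = (1/2) * flux_integral T I.path (\<lambda>_. ennreal (rate_fun c) * 1)"
    by (rule nn_integral_boltzmann_flux_symmetric[OF I.kernel_path]) auto
  also have "flux_integral T I.path (\<lambda>_. ennreal (rate_fun c) * 1)
      = ennreal (rate_fun c) * flux_integral T I.path (\<lambda>_. 1)"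
    by (rule flux_integral_cmult[OF I.kernel_path]) simp
  also have "flux_integral T I.path (\<lambda>_. 1) = ennreal T * ennreal (2 * qr \<epsilon>)"
    using T by (subst I.flux_integral_path) (simp_all add: ft maxw_pair_def[symmetric] nn nn_integral_multc)
  also have "(1/2) * (ennreal (rate_fun c) * (ennreal T * ennreal (2 * qr \<epsilon>))) = ennreal (T * (qr \<epsilon> * rate_fun c))"
  proof -
    have "ennreal (1/2) * (ennreal (rate_fun c) * (ennreal T * ennreal (2 * qr \<epsilon>))) = ennreal (1/2 * (T * (2 * qr \<epsilon> * rate_fun c)))"
      using T qr_pos[OF \<epsilon>(1)] ennreal_mult'[of "1/2" "T * (2 * qr \<epsilon> * rate_fun c)"]
        ennreal_mult'[of T "2 * qr \<epsilon> * rate_fun c"] ennreal_mult'[of "2 * qr \<epsilon>" "rate_fun c"]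
      by (simp only: mult.left_commute mult.commute)
    then show ?thesis unfolding ennreal_half by simp
  qed
  finally have J: "rate_J \<sigma> e T I.path I.flux = ennreal (T * (qr \<epsilon> * rate_fun c))" .
  have "T / 2 * (\<integral>q. ?p q \<partial>coll) = T * (c * qr \<epsilon>)" by (simp add: val)
  then have "(I.path, I.flux) \<in> bridges e T (maxwellian \<epsilon>) (maxwellian \<epsilon>) (ennreal (T * (c * qr \<epsilon>)))"
    using I.bridge unfolding maxwellian_density by (simp only:)
  then show ?thesis
    unfolding bridge_cost_def J[symmetric] by (rule INF_lower2) simp
qed

end

text \<open>An infinite integral of the positive part of \<open>f * ln f\<close> would make
  \<open>entropy_H\<close> infinite whatever the negative part is; hence the positive part is
  integrable.\<close>

lemma finite_entropy_density:
  assumes \<mu>: "(\<mu> :: (real^'d) measure) \<in> finite_entropy e"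
  obtains f where "f \<in> borel_fun" "\<And>v. 0 <= f v" "\<mu> = density lborel (\<lambda>v. ennreal (f v))"
    "density lborel (\<lambda>v. ennreal (f v)) \<in> prob_energy e"
    "(NBINT v. ennreal (f v * lnp (f v))) < \<infinity>"
proof -
  have P: "\<mu> \<in> prob_energy e" and H: "entropy_H e \<mu> < \<infinity>" using \<mu> by (auto simp: finite_entropy_def)
  then have ac: "absolutely_continuous lborel \<mu>" by (auto simp: entropy_H_def split: if_splits)
  interpret \<mu>: prob_space \<mu> using prob_energyD(1)[OF P] .
  define f where "f v = enn2real (RN_deriv lborel \<mu> v)" for v
  have f [measurable]: "f \<in> borel_fun" unfolding f_def[abs_def] by measurable
  have sets: "sets \<mu> = sets lborel" using prob_energyD(2)[OF P] by simp
  have "AE v in lborel. RN_deriv lborel \<mu> v ~= \<infinity>"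
    by (rule sigma_finite_measure.RN_deriv_finite[OF sigma_finite_lborel \<mu>.sigma_finite_measure_axioms ac sets])
  then have ae: "AE v in lborel. RN_deriv lborel \<mu> v = ennreal (f v)"
    by eventually_elim (simp add: f_def less_top)
  have "\<mu> = density lborel (RN_deriv lborel \<mu>)"
    using sigma_finite_measure.density_RN_deriv[OF sigma_finite_lborel ac sets] by simp
  also have "... = density lborel (\<lambda>v. ennreal (f v))"
    by (intro density_cong ae) auto
  finally have eq: "\<mu> = density lborel (\<lambda>v. ennreal (f v))" .
  have "(NBINT v. ennreal (f v * ln (f v))) ~= \<infinity>"
  proof
    assume "(NBINT v. ennreal (f v * ln (f v))) = \<infinity>"
    then have "entropy_H e \<mu> = \<infinity>"
      using ac by (simp add: entropy_H_def Let_def f_def)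
    with H show False by simp
  qed
  moreover have "ennreal (f v * ln (f v)) = ennreal (f v * lnp (f v))" for v
    by (cases "0 <= ln (f v)") (auto simp: lnp_def f_def max_def ennreal_neg mult_nonneg_nonpos)
  ultimately have "(NBINT v. ennreal (f v * lnp (f v))) < \<infinity>" by (simp add: less_top)
  then show ?thesis using that[OF f _ eq] P unfolding eq[symmetric] by (simp add: f_def)
qed

text \<open>A product of rescaled \<open>tail_profile\<close> densities: positive, bounded, and with
  a reciprocal bounded by a multiple of a power of \<open>1 + norm v\<close>.\<close>

lemma reference_density_exists:
  fixes e :: real
  assumes e: "0 < e"
  obtains g :: "real^'d => real" and K where "g \<in> borel_fun" "\<And>v. 0 < g v"
    "density lborel (\<lambda>v. ennreal (g v)) \<in> prob_energy e" "(NBINT v. ennreal (g v * lnp (g v))) < \<infinity>"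
    "0 <= K" "\<And>v. lnp (1 / g v) <= K * (1 + ln (1 + norm v))"
proof -
  define Z where "Z = (LBINT x. tail_profile x)"
  define V where "V = (LBINT x. x\<^sup>2 * tail_profile x)"
  have V: "0 <= V" unfolding V_def using tail_profile_pos(1) by (intro Bochner_Integration.integral_nonneg) (simp add: less_imp_le)
  have "\<not> (AE x in lborel. tail_profile x = 0)"
  proof
    assume "AE x in lborel. tail_profile x = 0"
    \<comment> \<open>An unsatisfiable property holding almost everywhere makes the whole line a
      null set.\<close>
    then have "AE x in lborel. (x::real) ~= x"
      by eventually_elim (use tail_profile_pos(1) in \<open>metis less_irrefl\<close>)
    then have "(UNIV :: real set) \<in> null_sets lborel" by (simp add: AE_iff_null)
    then have "emeasure lborel (UNIV :: real set) = 0" by (rule null_setsD1)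
    then show False by simp
  qed
  then have "Z ~= 0"
    unfolding Z_def using integral_nonneg_eq_0_iff_AE[OF tail_profile_integrable(1)] tail_profile_pos(1) by (auto simp: less_imp_le)
  moreover have "0 <= Z" unfolding Z_def using tail_profile_pos(1) by (intro Bochner_Integration.integral_nonneg) (simp add: less_imp_le)
  ultimately have Z: "0 < Z" by simp
  have nZ: "(NBINT x. ennreal (tail_profile x)) = ennreal Z"
    unfolding Z_def using tail_profile_integrable(1) tail_profile_pos(1) by (intro nn_integral_eq_integral) (auto simp: less_imp_le)
  have nV: "(NBINT x. ennreal (x\<^sup>2 * tail_profile x)) = ennreal V"
    unfolding V_def using tail_profile_integrable(2) tail_profile_pos(1) by (intro nn_integral_eq_integral) (auto simp: less_imp_le)
  \<comment> \<open>The width for which the bound on the energy becomes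
    \<open>e * (V / (V + 1))\<close>; \<open>V + 1\<close> is a divisor that is positive for every
    \<open>V \<ge> 0\<close>.\<close>
  define a where "a = sqrt (2 * e * Z / (real CARD('d) * (V + 1)))"
  have a: "0 < a" using e Z V by (simp add: a_def)
  define h where "h x = tail_profile (x / a) / (a * Z)" for x
  have h [measurable]: "h \<in> borel_fun" unfolding h_def[abs_def] by measurable
  have h0: "0 < h x" for x using a Z tail_profile_pos(1) by (simp add: h_def)
  have ha: "h (a * y) = tail_profile y / (a * Z)" for y using a by (simp add: h_def)
  have one: "(NBINT x. ennreal (h x)) = 1"
  proof -
    have "(NBINT x. ennreal (h x)) = ennreal a * (NBINT y. ennreal (h (0 + a * y)))"
      using a nn_integral_real_affine[of "\<lambda>x. ennreal (h x)" a 0] by simp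
    also have "... = (NBINT y. ennreal (1 / Z) * ennreal (tail_profile y))"
      using a Z by (subst nn_integral_cmult[symmetric]) (auto simp: ha ennreal_mult'[symmetric])
    also have "... = ennreal (1 / Z) * ennreal Z" by (subst nn_integral_cmult) (auto simp: nZ)
    also have "... = 1" using Z by (simp add: ennreal_mult'[symmetric])
    finally show ?thesis .
  qed
  have two: "(NBINT x. ennreal (x\<^sup>2 * h x)) = ennreal (a\<^sup>2 * V / Z)"
  proof -
    have "(NBINT x. ennreal (x\<^sup>2 * h x)) = ennreal a * (NBINT y. ennreal ((0 + a * y)\<^sup>2 * h (0 + a * y)))"
      using a nn_integral_real_affine[of "\<lambda>x. ennreal (x\<^sup>2 * h x)" a 0] by simp
    also have "... = (NBINT y. ennreal (a\<^sup>2 / Z) * ennreal (y\<^sup>2 * tail_profile y))"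
    proof -
      have "a * ((0 + a * y)\<^sup>2 * h (0 + a * y)) = a\<^sup>2 / Z * (y\<^sup>2 * tail_profile y)" for y
        using a Z unfolding add_0 ha power_mult_distrib by simp
      then have "ennreal a * ennreal ((0 + a * y)\<^sup>2 * h (0 + a * y)) = ennreal (a\<^sup>2 / Z) * ennreal (y\<^sup>2 * tail_profile y)" for y
        using a Z ennreal_mult'[of a "(0 + a * y)\<^sup>2 * h (0 + a * y)"] ennreal_mult'[of "a\<^sup>2 / Z" "y\<^sup>2 * tail_profile y"] by simp
      then show ?thesis by (subst nn_integral_cmult[symmetric]) auto
    qed
    also have "... = ennreal (a\<^sup>2 / Z) * ennreal V" by (subst nn_integral_cmult) (auto simp: nV)
    also have "... = ennreal (a\<^sup>2 * V / Z)" using Z by (simp add: ennreal_mult'[symmetric])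
    finally show ?thesis .
  qed
  define g where "g v = (\<Prod>i\<in>UNIV. h (v $ i))" for v :: "real^'d"
  have g [measurable]: "g \<in> borel_fun" unfolding g_def[abs_def] by measurable
  have g0: "0 < g v" for v unfolding g_def by (intro prod_pos h0)
  have gE: "density lborel (\<lambda>v. ennreal (g v)) \<in> prob_energy e"
    unfolding g_def
  proof (rule prob_energy_prod_density[OF h _ _ one])
    show "(NBINT x. ennreal (x\<^sup>2 * h x)) <= ennreal (a\<^sup>2 * V / Z)" by (simp add: two)
    show "h (- x) = h x" for x by (simp add: h_def tail_profile_def)
    have "real CARD('d) * (a\<^sup>2 * V / Z) / 2 = e * (V / (V + 1))"
    proof -
      have *: "n * (2 * e * Z / (n * w) * V / Z) / 2 = e * (V / w)" if "n ~= 0" "w ~= 0" for n w :: real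
        using that Z by simp
      have a2: "a\<^sup>2 = 2 * e * Z / (real CARD('d) * (V + 1))" using e Z V by (simp add: a_def)
      show ?thesis unfolding a2 by (rule *) (use V in simp_all)
    qed
    also have "... <= e * 1" using e V by (intro mult_left_mono) auto
    finally show "real CARD('d) * (a\<^sup>2 * V / Z) / 2 <= e" by simp
    show "0 <= a\<^sup>2 * V / Z" using V Z by simp
  qed (use h0 in \<open>simp add: less_imp_le\<close>)
  have fin: "(NBINT v. ennreal (g v * lnp (g v))) < \<infinity>"
  proof -
    have le: "g v <= (1 / (a * Z)) ^ CARD('d)" for v
    proof -
      have "g v <= (\<Prod>i\<in>(UNIV::'d set). 1 / (a * Z))"
        unfolding g_def using h0 tail_profile_pos(2) a Z
        by (intro prod_mono) (auto simp: h_def less_imp_le divide_right_mono)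
      then show ?thesis by simp
    qed
    have "(NBINT v. ennreal (g v * lnp (g v))) <= (NBINT v. ennreal (lnp ((1 / (a * Z)) ^ CARD('d))) * ennreal (g v))"
    proof (rule nn_integral_mono)
      fix v
      have "g v * lnp (g v) <= g v * lnp ((1 / (a * Z)) ^ CARD('d))"
        using g0[of v] by (intro mult_left_mono lnp_mono le) auto
      then have "ennreal (g v * lnp (g v)) <= ennreal (g v * lnp ((1 / (a * Z)) ^ CARD('d)))" by (rule ennreal_leI)
      also have "... = ennreal (g v) * ennreal (lnp ((1 / (a * Z)) ^ CARD('d)))"
        by (rule ennreal_mult') (use g0[of v] in simp)
      finally show "ennreal (g v * lnp (g v)) <= ennreal (lnp ((1 / (a * Z)) ^ CARD('d))) * ennreal (g v)"
        by (simp only: mult.commute)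
    qed
    also have "... = ennreal (lnp ((1 / (a * Z)) ^ CARD('d))) * (NBINT v. ennreal (g v))"
      by (rule nn_integral_cmult) measurable
    also have "(NBINT v. ennreal (g v)) = 1"
      using prob_space.emeasure_space_1[OF prob_energyD(1)[OF gE]] by (simp add: emeasure_density)
    finally show ?thesis by (rule order_le_less_trans) simp
  qed
  \<comment> \<open>Every factor of the product satisfies
    \<open>1 / h (v $ i) \<le> a * Z * ((1 + 1 / a) * (1 + norm v)) ^ 4\<close>; \<open>b\<close>
    collects the constants of all coordinates.\<close>
  define b where "b = (a * Z * (1 + 1 / a) ^ 4) ^ CARD('d)"
  have tail: "lnp (1 / g v) <= (lnp b + 4 * real CARD('d)) * (1 + ln (1 + norm v))" for v
  proof -
    have "1 / h (v $ i) <= a * Z * ((1 + 1 / a) * (1 + norm v)) ^ 4" for i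
    proof -
      let ?x = "\<bar>v $ i\<bar> / a"
      have x: "0 <= ?x" using a by simp
      have "1 + ?x\<^sup>2 <= (1 + ?x)\<^sup>2" using x by (simp add: power2_sum)
      then have "(1 + ?x\<^sup>2)\<^sup>2 <= ((1 + ?x)\<^sup>2)\<^sup>2" by (intro power_mono) auto
      also have "... = (1 + ?x) ^ 4" by (simp add: power_mult[symmetric])
      also have "... <= ((1 + 1 / a) * (1 + norm v)) ^ 4"
      proof (rule power_mono)
        have "?x <= norm v / a" using component_le_norm_cart[of v i] a by (intro divide_right_mono) auto
        moreover have "(1 + 1 / a) * (1 + norm v) = 1 + norm v / a + (1 / a + norm v)" by (simp add: algebra_simps)
        moreover have "0 <= 1 / a + norm v" using a by simp
        ultimately show "1 + ?x <= (1 + 1 / a) * (1 + norm v)" by linarith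
      qed (use x in simp)
      finally have "(1 + ?x\<^sup>2)\<^sup>2 <= ((1 + 1 / a) * (1 + norm v)) ^ 4" .
      moreover have "1 / h (v $ i) = a * Z * (1 + ?x\<^sup>2)\<^sup>2"
        by (simp add: h_def tail_profile_def power_divide)
      ultimately show ?thesis using a Z by (simp add: mult_left_mono)
    qed
    then have "(\<Prod>i\<in>UNIV. 1 / h (v $ i)) <= (\<Prod>i\<in>(UNIV :: 'd set). a * Z * ((1 + 1 / a) * (1 + norm v)) ^ 4)"
      using h0 by (intro prod_mono) (auto simp: less_imp_le)
    then have "1 / g v <= b * (1 + norm v) ^ (4 * CARD('d))"
      by (simp add: g_def prod_dividef b_def power_mult_distrib power_mult mult.assoc)
    then have "lnp (1 / g v) <= lnp (b * (1 + norm v) ^ (4 * CARD('d)))"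
      using g0[of v] by (intro lnp_mono) auto
    also have "... <= lnp b + lnp ((1 + norm v) ^ (4 * CARD('d)))"
      using a Z by (intro lnp_mult) (auto simp: b_def)
    also have "lnp ((1 + norm v) ^ (4 * CARD('d))) = 4 * real CARD('d) * ln (1 + norm v)"
    proof -
      have "1 <= (1 + norm v) ^ (4 * CARD('d))" by (intro one_le_power) simp
      moreover have "0 < 1 + norm v" using norm_ge_zero[of v] by linarith
      ultimately show ?thesis by (simp add: lnp_ge_1 ln_realpow)
    qed
    also have "lnp b + 4 * real CARD('d) * ln (1 + norm v) <= (lnp b + 4 * real CARD('d)) * (1 + ln (1 + norm v))"
      using lnp_nonneg[of b] by (simp add: algebra_simps)
    finally show ?thesis .
  qed
  show ?thesis
    by (rule that[OF g g0 gE fin _ tail]) (simp add: lnp_nonneg)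
qed

section \<open>Finite cost of the interpolation\<close>

lemma rate_fun_le: "0 <= x ==> rate_fun x <= 1 + x * lnp x"
proof -
  assume x: "0 <= x"
  have "x * ln x <= x * lnp x" using x by (intro mult_left_mono) (simp_all add: lnp_def)
  then show ?thesis using x by (simp add: rate_fun_def)
qed

text \<open>Applying \<open>ln x \<le> x - 1\<close> to \<open>x = t powr (-1/2)\<close> gives the
  integrable bound \<open>2 * t powr (-1/2)\<close>.\<close>

lemma nn_integral_neg_ln:
  "(NBINT t. indicator {0..1} t * ennreal (- ln t)) < \<infinity>"
proof -
  have "((\<lambda>x::real. x powr (-1/2)) has_integral (1 powr (-1/2 + 1) / (-1/2 + 1))) {0..1}"
    by (rule has_integral_powr_from_0) auto
  then have I: "(NBINT x. ennreal (indicator {0..1} x * x powr (-1/2))) = ennreal (1 powr (-1/2 + 1) / (-1/2 + 1))"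
    by (rule nn_integral_has_integral_lebesgue[rotated]) auto
  have "(NBINT t. indicator {0..1} t * ennreal (- ln t)) <= (NBINT t. ennreal 2 * ennreal (indicator {0..1} t * t powr (-1/2)))"
  proof (rule nn_integral_mono)
    fix t :: real
    have "- ln t <= 2 * t powr (-1/2)" if "0 <= t"
    proof (cases "t = 0")
      case False
      then have "ln (t powr (-1/2)) <= t powr (-1/2) - 1" using that by (intro ln_le_minus_one) simp
      then show ?thesis using that False by (simp add: ln_powr)
    qed simp
    then show "indicator {0..1} t * ennreal (- ln t) <= ennreal 2 * ennreal (indicator {0..1} t * t powr (-1/2))"
      by (cases "t \<in> {0..1}") (auto simp: ennreal_mult'[symmetric] intro!: ennreal_leI simp del: ennreal_numeral)
  qed
  also have "... = ennreal 2 * ennreal (1 powr (-1/2 + 1) / (-1/2 + 1))"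
    using I by (subst nn_integral_cmult) auto
  also have "... < \<infinity>" by (simp add: ennreal_mult_less_top)
  finally show ?thesis .
qed

lemma nn_integral_neg_ln_reverse:
  "(NBINT t. indicator {0..1} t * ennreal (- ln (1 - t))) < \<infinity>"
proof -
  have "(NBINT t. indicator {0..1} t * ennreal (- ln t))
    = ennreal \<bar>- 1\<bar> * (NBINT t. indicator {0..1} (1 + (- 1) * t) * ennreal (- ln (1 + (- 1) * t)))"
    by (rule nn_integral_real_affine) auto
  also have "... = (NBINT t. indicator {0..1} t * ennreal (- ln (1 - t)))"
    by (simp, intro nn_integral_cong) (auto simp: indicator_def)
  finally show ?thesis using nn_integral_neg_ln by simp
qed

text \<open>If an end point of the path is \<open>1 / m\<close>, then \<open>a\<close> can be \<open>t\<close> or \<open>1 - t\<close>: the degeneracy of the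
  density at the other end point only costs an integrable logarithm.\<close>

lemma (in interpolation) cost_finite:
  assumes m [measurable]: "m \<in> borel_fun" and m0: "\<And>v. 0 <= m v"
    and a [measurable]: "a \<in> borel_fun" and a01: "\<And>t. t \<in> {0<..<T} ==> 0 < a t \<and> a t <= 1"
    and lower: "\<And>t v. t \<in> {0<..<T} ==> a t <= m v * ft t v"
    and p_fin: "(\<integral>\<^sup>+q. ennreal (p q * lnp (p q * (m (fst q) * m (fst (snd q))))) \<partial>coll) < \<infinity>"
    and a_fin: "(NBINT t. indicator {0..T} t * ennreal (- ln (a t))) < \<infinity>"
  shows "rate_J \<sigma> e T path flux < \<infinity>"
proof -
  interpret BF: finite_measure "BF T path"
    by (rule finite_boltzmann_flux[OF path_continuous]) (use T e in auto)
  define P where "P = (\<integral>\<^sup>+q. ennreal (p q * lnp (p q * (m (fst q) * m (fst (snd q))))) \<partial>coll)"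
  define R where "R = (\<integral>\<^sup>+q. ennreal (p q) \<partial>coll)"
  have R: "R < \<infinity>" unfolding R_def using nn_integral_eq_integral[OF p_int] p_nonneg by simp
  have [measurable]: "(\<lambda>c. ennreal (xi c)) \<in> borel_measurable (BF T path)" "(\<lambda>c. ennreal (lnp (xi c))) \<in> borel_measurable (BF T path)"
    by (rule borel_measurable_boltzmann_flux, measurable)+
  have "rate_J \<sigma> e T path flux <= (\<integral>\<^sup>+c. 1 + ennreal (xi c) * ennreal (lnp (xi c)) \<partial>BF T path)"
    unfolding rate_J_flux
  proof (rule nn_integral_mono)
    fix c
    have "ennreal (rate_fun (xi c)) <= ennreal (1 + xi c * lnp (xi c))"
      by (intro ennreal_leI rate_fun_le xi_nonneg)
    also have "... = 1 + ennreal (xi c) * ennreal (lnp (xi c))"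
      using xi_nonneg[of c] lnp_nonneg[of "xi c"] by (simp add: ennreal_mult)
    finally show "ennreal (rate_fun (xi c)) <= 1 + ennreal (xi c) * ennreal (lnp (xi c))" .
  qed
  also have "... = emeasure (BF T path) (space (BF T path)) + (\<integral>\<^sup>+c. ennreal (xi c) * ennreal (lnp (xi c)) \<partial>BF T path)"
    by (subst nn_integral_add) auto
  also have "(\<integral>\<^sup>+c. ennreal (xi c) * ennreal (lnp (xi c)) \<partial>BF T path) = (\<integral>\<^sup>+c. ennreal (lnp (xi c)) \<partial>flux)"
    unfolding flux_def by (subst nn_integral_density) auto
  also have "... = (1/2) * (NBINT t. indicator {0..T} t * (\<integral>\<^sup>+q. ennreal (p q) * ennreal (lnp (xi (t, q))) \<partial>coll))"
    by (rule nn_integral_flux) (auto simp: xi_swap)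
  also have "(NBINT t. indicator {0..T} t * (\<integral>\<^sup>+q. ennreal (p q) * ennreal (lnp (xi (t, q))) \<partial>coll))
      <= (NBINT t. indicator {0..T} t * P + ennreal 2 * R * (indicator {0..T} t * ennreal (- ln (a t))))"
  proof (rule nn_integral_mono_AE)
    have "AE t in lborel. t ~= 0 \<and> t ~= T"
      using AE_lborel_singleton[of "0::real"] AE_lborel_singleton[of T] by eventually_elim simp
    then show "AE t in lborel. indicator {0..T} t * (\<integral>\<^sup>+q. ennreal (p q) * ennreal (lnp (xi (t, q))) \<partial>coll)
      <= indicator {0..T} t * P + ennreal 2 * R * (indicator {0..T} t * ennreal (- ln (a t)))"
    proof eventually_elim
      case (elim t)
      show ?case
      proof (cases "t \<in> {0..T}")
        case True
        then have t: "t \<in> {0<..<T}" using elim by auto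
        note at = a01[OF t]
        have "ennreal (p q) * ennreal (lnp (xi (t, q))) <= ennreal (p q * lnp (p q * (m (fst q) * m (fst (snd q))))) + ennreal (2 * - ln (a t)) * ennreal (p q)" for q
        proof -
          have inv: "1 / ft t v <= m v / a t" for v
            using lower[OF t, of v] ft_pos[OF t, of v] at by (simp add: field_simps)
          have "1 / ft t (fst q) * (1 / ft t (fst (snd q))) <= (m (fst q) / a t) * (m (fst (snd q)) / a t)"
            using ft_pos[OF t] m0 at by (intro mult_mono inv) (auto simp: less_imp_le)
          then have "p q * (1 / ft t (fst q) * (1 / ft t (fst (snd q)))) <= p q * ((m (fst q) / a t) * (m (fst (snd q)) / a t))"
            by (rule mult_left_mono[OF _ p_nonneg])
          \<comment> \<open>Both incoming densities are at least \<open>a t\<close> over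
            \<open>m\<close>, whence the square of \<open>a t\<close> and an additional term
            \<open>2 * - ln (a t)\<close> that does not depend on the collision.\<close>
          then have le: "xi (t, q) <= (p q * (m (fst q) * m (fst (snd q)))) * (1 / (a t)\<^sup>2)"
            using True by (simp add: xi_def clamp_time_id power2_eq_square)
          have "lnp (xi (t, q)) <= lnp ((p q * (m (fst q) * m (fst (snd q)))) * (1 / (a t)\<^sup>2))"
            by (intro lnp_mono le xi_nonneg)
          also have "... <= lnp (p q * (m (fst q) * m (fst (snd q)))) + lnp (1 / (a t)\<^sup>2)"
            using p_nonneg m0 by (intro lnp_mult) auto
          also have "lnp (1 / (a t)\<^sup>2) = 2 * - ln (a t)"
          proof -
            have "(a t)\<^sup>2 <= 1" using at by (simp add: power_le_one)
            then have "1 <= 1 / (a t)\<^sup>2" using at by simp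
            then show ?thesis using at by (simp add: lnp_ge_1 ln_div ln_realpow)
          qed
          finally have "p q * lnp (xi (t, q)) <= p q * (lnp (p q * (m (fst q) * m (fst (snd q)))) + 2 * - ln (a t))"
            by (rule mult_left_mono[OF _ p_nonneg])
          then have "ennreal (p q * lnp (xi (t, q))) <= ennreal (p q * lnp (p q * (m (fst q) * m (fst (snd q)))) + (2 * - ln (a t)) * p q)"
            by (intro ennreal_leI) (simp add: algebra_simps)
          also have "... = ennreal (p q * lnp (p q * (m (fst q) * m (fst (snd q))))) + ennreal ((2 * - ln (a t)) * p q)"
            using p_nonneg[of q] lnp_nonneg at by (intro ennreal_plus mult_nonneg_nonneg) auto
          also have "ennreal ((2 * - ln (a t)) * p q) = ennreal (2 * - ln (a t)) * ennreal (p q)"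
            by (rule ennreal_mult') (use at in auto)
          also have "ennreal (p q * lnp (xi (t, q))) = ennreal (p q) * ennreal (lnp (xi (t, q)))"
            by (rule ennreal_mult'[OF p_nonneg])
          finally show ?thesis .
        qed
        then have "(\<integral>\<^sup>+q. ennreal (p q) * ennreal (lnp (xi (t, q))) \<partial>coll)
          <= (\<integral>\<^sup>+q. ennreal (p q * lnp (p q * (m (fst q) * m (fst (snd q))))) + ennreal (2 * - ln (a t)) * ennreal (p q) \<partial>coll)"
          by (rule nn_integral_mono)
        also have "... = P + ennreal (2 * - ln (a t)) * R"
          unfolding P_def R_def by (subst nn_integral_add) (auto simp: nn_integral_cmult)
        also have "ennreal (2 * - ln (a t)) = ennreal 2 * ennreal (- ln (a t))" by (rule ennreal_mult') simp
        finally show ?thesis using True by (simp add: mult_ac)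
      qed simp
    qed
  qed
  also have "... = ennreal T * P + ennreal 2 * R * (NBINT t. indicator {0..T} t * ennreal (- ln (a t)))"
    using T by (subst nn_integral_add) (auto simp: nn_integral_cmult nn_integral_multc)
  finally have "rate_J \<sigma> e T path flux <= emeasure (BF T path) (space (BF T path)) +
    (1/2) * (ennreal T * P + ennreal 2 * R * (NBINT t. indicator {0..T} t * ennreal (- ln (a t))))"
    by (simp add: mult_left_mono add_left_mono)
  also have "... < \<infinity>"
    using R p_fin a_fin BF.emeasure_finite[of "space (BF T path)"]
    by (simp add: P_def[symmetric] ennreal_mult_less_top ennreal_half less_top[symmetric] ennreal_mult_eq_top_iff)
  finally show ?thesis .
qed

lemma (in boltzmann_kernel) interpolation_bridge:
  fixes f0 f1 g :: "real^'d => real"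
  assumes e: "0 <= e"
    and f0 [measurable]: "f0 \<in> borel_fun" and f1 [measurable]: "f1 \<in> borel_fun"
    and n0: "\<And>v. 0 <= f0 v" and n1: "\<And>v. 0 <= f1 v"
    and E0: "density lborel f0 \<in> prob_energy e" and E1: "density lborel f1 \<in> prob_energy e"
    and H0: "(NBINT v. ennreal (f0 v * lnp (f0 v))) < \<infinity>" and H1: "(NBINT v. ennreal (f1 v * lnp (f1 v))) < \<infinity>"
    and g [measurable]: "g \<in> borel_fun" and g0: "\<And>v. 0 < g v"
    and K: "0 <= K" "\<And>v. lnp (1 / g v) <= K * (1 + ln (1 + norm v))"
    and a [measurable]: "a \<in> borel_fun" and a01: "\<And>t. t \<in> {0<..<1} ==> 0 < a t \<and> a t <= 1"
    and lower: "\<And>t v. t \<in> {0<..<1} ==> a t * g v <= (1 - t) * f0 v + t * f1 v"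
    and a_fin: "(NBINT t. indicator {0..1} t * ennreal (- ln (a t))) < \<infinity>"
  obtains m where "0 <= m" "bridge_cost \<sigma> e 1 (density lborel f0) (density lborel f1) (ennreal m) < \<infinity>"
proof -
  have one: "(NBINT v. ennreal (f0 v)) = 1" "(NBINT v. ennreal (f1 v)) = 1"
    using prob_space.emeasure_space_1[OF prob_energyD(1)[OF E0]] prob_space.emeasure_space_1[OF prob_energyD(1)[OF E1]]
    by (simp_all add: emeasure_density)
  have i: "integrable lborel f0" "integrable lborel f1"
    using n0 n1 one by (auto intro!: integrableI_nonneg)
  have ni: "integrable lborel (\<lambda>v. norm v * f v)"
    if [measurable]: "f \<in> borel_fun" and "\<And>v. 0 <= f v" "density lborel f \<in> prob_energy e" for f :: "real^'d => real"
  proof (rule integrableI_nonneg)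
    have "(NBINT v. ennreal (norm v * f v)) = (\<integral>\<^sup>+v. ennreal (norm v) \<partial>density lborel f)"
      using that(2) by (subst nn_integral_density) (auto simp: ennreal_mult'[symmetric] mult.commute)
    also have "... < \<infinity>" using order_le_less_trans[OF prob_energy_norm[OF that(3) e]] by simp
    finally show "(NBINT v. ennreal (norm v * f v)) < \<infinity>" .
  qed (use that in auto)
  have eq: "(LBINT x. f0 x) = (LBINT x. f1 x)"
    using one n0 n1 by (simp add: integral_eq_nn_integral)
  have m: "(\<lambda>v. 1 / g v) \<in> borel_fun" by measurable
  have m0: "0 <= 1 / g v" for v using g0[of v] by simp
  obtain p0 :: "'d quad => real" where p0 [measurable]: "p0 \<in> borel_fun" and p0_nn: "\<And>c. 0 <= p0 c"
    and sym: "\<And>v w v' w'. p0 (w, v, v', w') = p0 (v, w, v', w')" "\<And>v w v' w'. p0 (v, w, w', v') = p0 (v, w, v', w')"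
    and p0_int: "integrable coll p0"
    and p0_flux: "\<And>\<phi> B. \<phi> \<in> borel_fun ==> (\<And>x. \<bar>\<phi> x\<bar> <= B) ==>
      (\<integral>c. p0 c * pair_gradient \<phi> c \<partial>coll) = (LBINT z. \<phi> z * (f1 z - f0 z))"
    and p0_fin: "(\<integral>\<^sup>+c. ennreal (p0 c * lnp (p0 c * (1 / g (fst c) * (1 / g (fst (snd c)))))) \<partial>coll) < \<infinity>"
    by (rule steering_flux_exists[OF f0 f1 n0 n1 i eq ni[OF f0 n0 E0] ni[OF f1 n1 E1] H0 H1 m m0 K]) blast
  \<comment> \<open>The steering flux is doubled because the reference flux carries a factor
    \<open>1/2\<close>.\<close>
  interpret I: interpolation \<sigma> e 1 f0 f1 "\<lambda>c. 2 * p0 c"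
  proof unfold_locales
    show "0 < (1 - t / 1) * f0 v + t / 1 * f1 v" if "t \<in> {0<..<1}" for t v
    proof -
      have "0 < a t * g v" using a01[OF that] g0[of v] by simp
      from order_less_le_trans[OF this lower[OF that]] show ?thesis by simp
    qed
    show "integrable coll (\<lambda>c. 2 * p0 c)" using p0_int by simp
    fix \<phi> :: "real^'d => real" and B assume \<phi>: "\<phi> \<in> borel_fun" "\<And>x. \<bar>\<phi> x\<bar> <= B"
    have "(\<integral>c. 2 * p0 c * pair_gradient \<phi> c \<partial>coll) = 2 * (\<integral>c. p0 c * pair_gradient \<phi> c \<partial>coll)"
      by (simp add: mult.assoc)
    then show "(\<integral>c. 2 * p0 c * pair_gradient \<phi> c \<partial>coll) = 2 / 1 * (LBINT z. \<phi> z * (f1 z - f0 z))"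
      using p0_flux[OF \<phi>] by simp
  qed (use e n0 n1 E0 E1 p0_nn sym in auto)
  have J: "rate_J \<sigma> e 1 I.path I.flux < \<infinity>"
  proof (rule I.cost_finite[OF m m0 a a01])
    show "a t <= 1 / g v * I.ft t v" if "t \<in> {0<..<1}" for t v
      using lower[OF that, of v] g0[of v] by (simp add: I.ft_def field_simps)
    let ?m = "\<lambda>q. 1 / g (fst q) * (1 / g (fst (snd q)))"
    have "(\<integral>\<^sup>+q. ennreal (2 * p0 q * lnp (2 * p0 q * ?m q)) \<partial>coll)
      <= (\<integral>\<^sup>+q. ennreal (2 * lnp 2) * ennreal (p0 q) + ennreal 2 * ennreal (p0 q * lnp (p0 q * ?m q)) \<partial>coll)"
    proof (rule nn_integral_mono)
      fix q :: "'d quad"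
      have "lnp (2 * p0 q * ?m q) <= lnp 2 + lnp (p0 q * ?m q)"
        using lnp_mult[of 2 "p0 q * ?m q"] p0_nn[of q] m0 by (simp add: mult.assoc)
      then have "2 * p0 q * lnp (2 * p0 q * ?m q) <= 2 * p0 q * (lnp 2 + lnp (p0 q * ?m q))"
        using p0_nn[of q] by (intro mult_left_mono) auto
      then have "ennreal (2 * p0 q * lnp (2 * p0 q * ?m q)) <= ennreal ((2 * lnp 2) * p0 q + 2 * (p0 q * lnp (p0 q * ?m q)))"
        by (intro ennreal_leI) (simp only: distrib_left mult_ac)
      also have "... = ennreal ((2 * lnp 2) * p0 q) + ennreal (2 * (p0 q * lnp (p0 q * ?m q)))"
        using p0_nn[of q] lnp_nonneg by (intro ennreal_plus mult_nonneg_nonneg) auto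
      also have "ennreal ((2 * lnp 2) * p0 q) = ennreal (2 * lnp 2) * ennreal (p0 q)"
        by (rule ennreal_mult') (simp add: lnp_nonneg)
      also have "ennreal (2 * (p0 q * lnp (p0 q * ?m q))) = ennreal 2 * ennreal (p0 q * lnp (p0 q * ?m q))"
        by (rule ennreal_mult') simp
      finally show "ennreal (2 * p0 q * lnp (2 * p0 q * ?m q)) <= ennreal (2 * lnp 2) * ennreal (p0 q) + ennreal 2 * ennreal (p0 q * lnp (p0 q * ?m q))" .
    qed
    also have "... = ennreal (2 * lnp 2) * (\<integral>\<^sup>+q. ennreal (p0 q) \<partial>coll) + ennreal 2 * (\<integral>\<^sup>+q. ennreal (p0 q * lnp (p0 q * ?m q)) \<partial>coll)"
      by (subst nn_integral_add) (auto simp: nn_integral_cmult simp del: ennreal_numeral)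
    also have "... < \<infinity>"
      using p0_fin nn_integral_eq_integral[OF p0_int] p0_nn by (simp add: ennreal_mult_less_top)
    finally show "(\<integral>\<^sup>+q. ennreal (2 * p0 q * lnp (2 * p0 q * ?m q)) \<partial>coll) < \<infinity>" .
  qed (use a_fin in auto)
  show ?thesis
  proof (rule that)
    show "0 <= 1 / 2 * (\<integral>q. 2 * p0 q \<partial>coll)" using p0_nn by (simp add: Bochner_Integration.integral_nonneg)
    show "bridge_cost \<sigma> e 1 (density lborel f0) (density lborel f1) (ennreal (1 / 2 * (\<integral>q. 2 * p0 q \<partial>coll))) < \<infinity>"
      unfolding bridge_cost_def by (rule order_le_less_trans[OF INF_lower2[OF I.bridge] J]) simp
  qed
qed

section \<open>The mean cost per unit time\<close>

text \<open>Asks only for the integrability of the positive part of the entropy, which is what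
  connecting two densities uses and what is easily checked for Maxwellians.\<close>

definition regular_measures :: "real => (real^'d) measure set" where
  "regular_measures e = {density lborel (\<lambda>v. ennreal (f v)) | f. f \<in> borel_fun \<and> (\<forall>v. 0 <= f v)
     \<and> density lborel (\<lambda>v. ennreal (f v)) \<in> prob_energy e \<and> (NBINT v. ennreal (f v * lnp (f v))) < \<infinity>}"

lemma finite_entropy_regular: "finite_entropy e \<subseteq> (regular_measures e :: (real^'d) measure set)"
proof
  fix \<mu> :: "(real^'d) measure" assume "\<mu> \<in> finite_entropy e"
  then obtain f where "f \<in> borel_fun" "\<And>v. 0 <= f v" "\<mu> = density lborel (\<lambda>v. ennreal (f v))"
    "density lborel (\<lambda>v. ennreal (f v)) \<in> prob_energy e" "(NBINT v. ennreal (f v * lnp (f v))) < \<infinity>"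
    by (rule finite_entropy_density) blast
  then show "\<mu> \<in> regular_measures e" unfolding regular_measures_def by blast
qed

lemma maxwellian_regular:
  assumes "0 < \<epsilon>" "\<epsilon> <= e"
  shows "(maxwellian \<epsilon> :: (real^'d) measure) \<in> regular_measures e"
proof -
  let ?m = "maxw \<epsilon> :: real^'d => real"
  define C where "C = (1 / sqrt (2 * pi * (2 * \<epsilon> / real CARD('d)))) ^ CARD('d)"
  have E: "density lborel (\<lambda>v. ennreal (?m v)) \<in> prob_energy e"
    using maxwellian_energy[OF assms, where 'd='d] by (simp add: maxwellian_density)
  have m0: "0 <= ?m v" for v using maxw_pos[OF assms(1), of v] by simp
  have "(NBINT v. ennreal (?m v * lnp (?m v))) <= (NBINT v. ennreal (?m v) * ennreal (lnp C))"
  proof (rule nn_integral_mono)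
    fix v :: "real^'d"
    have "?m v * lnp (?m v) <= ?m v * lnp C"
      unfolding C_def by (intro mult_left_mono lnp_mono m0 maxw_bounded assms)
    then have "ennreal (?m v * lnp (?m v)) <= ennreal (?m v * lnp C)" by (rule ennreal_leI)
    also have "... = ennreal (?m v) * ennreal (lnp C)" by (rule ennreal_mult'[OF m0])
    finally show "ennreal (?m v * lnp (?m v)) <= ennreal (?m v) * ennreal (lnp C)" .
  qed
  also have "... = (NBINT v. ennreal (?m v)) * ennreal (lnp C)" by (rule nn_integral_multc) measurable
  also have "(NBINT v. ennreal (?m v)) = 1"
    using prob_space.emeasure_space_1[OF prob_energyD(1)[OF E]] by (simp add: emeasure_density)
  finally have "(NBINT v. ennreal (?m v * lnp (?m v))) < \<infinity>" by (rule order_le_less_trans) simp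
  then show ?thesis
    unfolding regular_measures_def maxwellian_density using E m0 maxw_measurable by blast
qed

context boltzmann_kernel
begin

lemma bridge_cost_concat_real:
  assumes "0 <= e" "0 <= T1" "0 <= T2" "0 <= m1" "0 <= m2"
  shows "bridge_cost \<sigma> e (T1 + T2) \<mu> \<rho> (ennreal (m1 + m2))
    <= bridge_cost \<sigma> e T1 \<mu> \<nu> (ennreal m1) + bridge_cost \<sigma> e T2 \<nu> \<rho> (ennreal m2)"
  using bridge_cost_concat[OF assms(1-3), of \<mu> \<rho> "ennreal m1" "ennreal m2" \<nu>] assms(4,5) by simp

text \<open>Travels through the reference density \<open>g\<close> in two unit steps. The
  interpolation is bounded below by \<open>t * g\<close> on the way to \<open>g\<close> and by
  \<open>(1 - t) * g\<close> on the way from it, and both factors have integrable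
  logarithms.\<close>

lemma regular_connected:
  assumes e: "0 < e" and \<mu>: "\<mu> \<in> regular_measures e" and \<nu>: "\<nu> \<in> regular_measures e"
  obtains m where "0 <= m" "bridge_cost \<sigma> e 2 \<mu> \<nu> (ennreal m) < \<infinity>"
proof -
  obtain g :: "real^'d => real" and K where g: "g \<in> borel_fun" "\<And>v. 0 < g v"
    "density lborel (\<lambda>v. ennreal (g v)) \<in> prob_energy e" "(NBINT v. ennreal (g v * lnp (g v))) < \<infinity>"
    "0 <= K" "\<And>v. lnp (1 / g v) <= K * (1 + ln (1 + norm v))"
    by (rule reference_density_exists[OF e]) blast
  have g0: "0 <= g v" for v using g(2)[of v] by simp
  obtain f where f: "\<mu> = density lborel (\<lambda>v. ennreal (f v))" "f \<in> borel_fun" "\<And>v. 0 <= f v"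
    "density lborel (\<lambda>v. ennreal (f v)) \<in> prob_energy e" "(NBINT v. ennreal (f v * lnp (f v))) < \<infinity>"
    using \<mu> unfolding regular_measures_def by blast
  obtain h where h: "\<nu> = density lborel (\<lambda>v. ennreal (h v))" "h \<in> borel_fun" "\<And>v. 0 <= h v"
    "density lborel (\<lambda>v. ennreal (h v)) \<in> prob_energy e" "(NBINT v. ennreal (h v * lnp (h v))) < \<infinity>"
    using \<nu> unfolding regular_measures_def by blast
  obtain m1 where m1: "0 <= m1" "bridge_cost \<sigma> e 1 (density lborel f) (density lborel g) (ennreal m1) < \<infinity>"
  proof (rule interpolation_bridge[of e f g g K "\<lambda>t. t"])
    show "t * g v <= (1 - t) * f v + t * g v" if "t \<in> {0<..<1}" for t v using that f(3)[of v] by simp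
  qed (use e f g g0 nn_integral_neg_ln in auto)
  obtain m2 where m2: "0 <= m2" "bridge_cost \<sigma> e 1 (density lborel g) (density lborel h) (ennreal m2) < \<infinity>"
  proof (rule interpolation_bridge[of e g h g K "\<lambda>t. 1 - t"])
    show "(1 - t) * g v <= (1 - t) * g v + t * h v" if "t \<in> {0<..<1}" for t v using that h(3)[of v] by simp
  qed (use e h g g0 nn_integral_neg_ln_reverse in auto)
  have "bridge_cost \<sigma> e (1 + 1) \<mu> \<nu> (ennreal (m1 + m2)) < \<infinity>"
    using order_le_less_trans[OF bridge_cost_concat_real[of e 1 1 m1 m2 \<mu> \<nu> "density lborel g"]] e m1 m2 f(1) h(1) by simp
  then show ?thesis using that[of "m1 + m2"] m1(1) m2(1) by simp
qed

text \<open>The number of collisions must be exactly \<open>T * q\<close>. The journeys to and from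
  a Maxwellian use fixed numbers, and the loop there runs at the multiple \<open>c\<close> of its
  typical rate that supplies the rest. For long times \<open>c\<close> stays below
  \<open>c0\<close>, so the cost grows at most linearly.\<close>

lemma bridge_cost_linear_bound:
  assumes e: "0 < e" and \<mu>: "\<mu> \<in> regular_measures e" and \<nu>: "\<nu> \<in> regular_measures e" and q: "0 < q"
  obtains T1 C K where "0 < T1" "C < top" "0 <= K"
    "\<And>T. T1 <= T ==> bridge_cost \<sigma> e T \<mu> \<nu> (ennreal (T * q)) <= C + ennreal (T * K)"
proof -
  let ?M = "maxwellian e :: (real^'d) measure"
  have M: "?M \<in> regular_measures e" using maxwellian_regular[OF e order_refl] .
  obtain m1 where m1: "0 <= m1" "bridge_cost \<sigma> e 2 \<mu> ?M (ennreal m1) < \<infinity>" by (rule regular_connected[OF e \<mu> M])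
  obtain m2 where m2: "0 <= m2" "bridge_cost \<sigma> e 2 ?M \<nu> (ennreal m2) < \<infinity>" by (rule regular_connected[OF e M \<nu>])
  have qe: "0 < qr e" by (rule qr_pos[OF e])
  define c0 where "c0 = 2 * q / qr e"
  have c0: "0 < c0" using q qe by (simp add: c0_def)
  show ?thesis
  proof (rule that)
    \<comment> \<open>\<open>T \<ge> 8\<close> gives \<open>T - 4 \<ge> T / 2\<close>, whence
      \<open>c \<le> c0\<close>; the second bound leaves at least half of the collisions to the
      loop, so that \<open>r\<close> is positive.\<close>
    show "0 < max 8 (2 * (m1 + m2) / q)" by simp
    show "bridge_cost \<sigma> e 2 \<mu> ?M (ennreal m1) + bridge_cost \<sigma> e 2 ?M \<nu> (ennreal m2) < top" using m1 m2 by simp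
    show "0 <= qr e * (1 + c0 * lnp c0)" using qe c0 by (simp add: lnp_nonneg)
    fix T assume "max 8 (2 * (m1 + m2) / q) <= T"
    then have T: "8 <= T" "2 * (m1 + m2) <= T * q" using q by (auto simp: field_simps)
    define r where "r = T * q - m1 - m2"
    have Tq: "0 < T * q" using T q by simp
    have r: "0 < r" "r <= T * q" using T m1(1) m2(1) Tq by (auto simp: r_def)
    define c where "c = r / ((T - 4) * qr e)"
    have c: "0 < c" using r T qe by (simp add: c_def)
    have "r * qr e <= 2 * q * ((T - 4) * qr e)"
    proof -
      have "8 * q <= T * q" using T q by (intro mult_right_mono) auto
      then have "r <= 2 * q * (T - 4)" using r by (simp add: algebra_simps)
      then have "r * qr e <= (2 * q * (T - 4)) * qr e" using qe by (intro mult_right_mono) auto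
      then show ?thesis by (simp add: mult_ac)
    qed
    then have cc: "c <= c0" using T qe by (simp add: c_def c0_def divide_simps mult_ac)
    have loop: "bridge_cost \<sigma> e (T - 4) ?M ?M (ennreal r) <= ennreal (T * (qr e * (1 + c0 * lnp c0)))"
    proof -
      have "(T - 4) * (c * qr e) = r" using T qe by (simp add: c_def)
      then have "bridge_cost \<sigma> e (T - 4) ?M ?M (ennreal r) <= ennreal ((T - 4) * (qr e * rate_fun c))"
        using maxwellian_loop[OF e order_refl _ c, of "T - 4"] T by simp
      also have "(T - 4) * (qr e * rate_fun c) <= (T - 4) * (qr e * (1 + c0 * lnp c0))"
      proof -
        have "rate_fun c <= 1 + c * lnp c" using rate_fun_le c by simp
        also have "... <= 1 + c0 * lnp c0" using c cc by (intro add_left_mono mult_mono lnp_mono) (auto simp: lnp_nonneg)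
        finally show ?thesis using T qe by (intro mult_left_mono) auto
      qed
      also have "... <= T * (qr e * (1 + c0 * lnp c0))" using qe c0 by (intro mult_right_mono) (auto simp: lnp_nonneg)
      finally show ?thesis by (simp add: ennreal_leI)
    qed
    have "bridge_cost \<sigma> e (2 + ((T - 4) + 2)) \<mu> \<nu> (ennreal (m1 + (r + m2)))
      <= bridge_cost \<sigma> e 2 \<mu> ?M (ennreal m1) + bridge_cost \<sigma> e ((T - 4) + 2) ?M \<nu> (ennreal (r + m2))"
      using e T m1 m2 r by (intro bridge_cost_concat_real) auto
    also have "... <= bridge_cost \<sigma> e 2 \<mu> ?M (ennreal m1) + (bridge_cost \<sigma> e (T - 4) ?M ?M (ennreal r) + bridge_cost \<sigma> e 2 ?M \<nu> (ennreal m2))"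
      using e T m1 m2 r by (intro add_left_mono bridge_cost_concat_real) auto
    also have "... <= bridge_cost \<sigma> e 2 \<mu> ?M (ennreal m1) + (ennreal (T * (qr e * (1 + c0 * lnp c0))) + bridge_cost \<sigma> e 2 ?M \<nu> (ennreal m2))"
      by (intro add_left_mono add_right_mono loop)
    finally show "bridge_cost \<sigma> e T \<mu> \<nu> (ennreal (T * q)) <= bridge_cost \<sigma> e 2 \<mu> ?M (ennreal m1) + bridge_cost \<sigma> e 2 ?M \<nu> (ennreal m2)
      + ennreal (T * (qr e * (1 + c0 * lnp c0)))"
      by (simp add: r_def add_ac)
  qed
qed

lemma mean_cost_finite:
  assumes e: "0 < e" and \<mu>: "\<mu> \<in> regular_measures e" and q: "0 < q"
  shows "\<exists>T>0. mean_cost \<sigma> e \<mu> q T < top"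
proof -
  obtain T1 C K where *: "0 < T1" "C < top" "0 <= K"
    "\<And>T. T1 <= T ==> bridge_cost \<sigma> e T \<mu> \<mu> (ennreal (T * q)) <= C + ennreal (T * K)"
    by (rule bridge_cost_linear_bound[OF e \<mu> \<mu> q]) blast
  have "bridge_cost \<sigma> e T1 \<mu> \<mu> (ennreal (T1 * q)) < top"
    using *(2) order_le_less_trans[OF *(4)[OF order_refl]] by simp
  then have "mean_cost \<sigma> e \<mu> q T1 < top"
    using *(1) by (simp add: mean_cost_bridge divide_ennreal_def ennreal_mult_less_top inverse_ennreal)
  then show ?thesis using *(1) by blast
qed

text \<open>Travel from \<open>\<mu>\<close> to \<open>\<nu>\<close>, repeat a cycle at \<open>\<nu>\<close>, and travel back: the cost of the two
  journeys is bounded.\<close>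

lemma mean_cost_compare:
  assumes e: "0 < e" and \<mu>: "\<mu> \<in> regular_measures e" and \<nu>: "\<nu> \<in> regular_measures e" and q: "0 < q" and S: "0 < S"
  obtains C T0 where "0 <= C" "0 < T0" "\<And>T. T0 <= T ==> mean_cost \<sigma> e \<mu> q T <= ennreal (C / T) + mean_cost \<sigma> e \<nu> q S"
proof -
  obtain Tp Cp Kp where p: "0 < Tp" "Cp < top" "0 <= Kp"
    "\<And>T. Tp <= T ==> bridge_cost \<sigma> e T \<mu> \<nu> (ennreal (T * q)) <= Cp + ennreal (T * Kp)"
    by (rule bridge_cost_linear_bound[OF e \<mu> \<nu> q]) blast
  obtain Tr Cr Kr where r: "0 < Tr" "Cr < top" "0 <= Kr"
    "\<And>T. Tr <= T ==> bridge_cost \<sigma> e T \<nu> \<mu> (ennreal (T * q)) <= Cr + ennreal (T * Kr)"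
    by (rule bridge_cost_linear_bound[OF e \<nu> \<mu> q]) blast
  define a where "a = bridge_cost \<sigma> e S \<nu> \<nu> (ennreal (S * q))"
  have go: "bridge_cost \<sigma> e (Tp + real n * S) \<mu> \<nu> (ennreal ((Tp + real n * S) * q)) <= (Cp + ennreal (Tp * Kp)) + of_nat n * a" for n
  proof (induction n)
    case 0
    then show ?case using p(4)[OF order_refl] by simp
  next
    case (Suc n)
    have "bridge_cost \<sigma> e ((Tp + real n * S) + S) \<mu> \<nu> (ennreal ((Tp + real n * S) * q + S * q))
      <= bridge_cost \<sigma> e (Tp + real n * S) \<mu> \<nu> (ennreal ((Tp + real n * S) * q)) + a"
      unfolding a_def using e p(1) S q by (intro bridge_cost_concat_real) auto
    also have "... <= (Cp + ennreal (Tp * Kp) + of_nat n * a) + a" by (rule add_right_mono[OF Suc])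
    finally show ?case by (simp add: algebra_simps)
  qed
  define D where "D = (Cp + ennreal (Tp * Kp)) + (Cr + ennreal ((Tr + S) * Kr))"
  have D: "D < top" using p(2) r(2) by (simp add: D_def)
  then obtain C where C: "D = ennreal C" "0 <= C" by (cases D) auto
  have "mean_cost \<sigma> e \<mu> q T <= ennreal (C / T) + mean_cost \<sigma> e \<nu> q S" if T: "Tp + Tr <= T" for T
  proof -
    have T0: "0 < T" using T p(1) r(1) by simp
    \<comment> \<open>As many cycles as fit, so that the time left for the way back lies between
      \<open>Tr\<close> and \<open>Tr + S\<close>.\<close>
    define n where "n = nat \<lfloor>(T - Tp - Tr) / S\<rfloor>"
    define u where "u = T - (Tp + real n * S)"
    have "0 <= (T - Tp - Tr) / S" using T S by simp
    then have n: "real n <= (T - Tp - Tr) / S" "(T - Tp - Tr) / S < real n + 1"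
      unfolding n_def by (auto simp: of_nat_nat)
    then have nS: "real n * S <= T - Tp - Tr" "T - Tp - Tr < real n * S + S" using S by (auto simp: field_simps)
    then have u: "Tr <= u" "u <= Tr + S" by (auto simp: u_def)
    have "T = (Tp + real n * S) + u" by (simp add: u_def)
    then have "bridge_cost \<sigma> e T \<mu> \<mu> (ennreal (T * q)) = bridge_cost \<sigma> e ((Tp + real n * S) + u) \<mu> \<mu> (ennreal ((Tp + real n * S) * q + u * q))"
      by (simp add: distrib_right)
    also have "... <= bridge_cost \<sigma> e (Tp + real n * S) \<mu> \<nu> (ennreal ((Tp + real n * S) * q)) + bridge_cost \<sigma> e u \<nu> \<mu> (ennreal (u * q))"
      using e p(1) r(1) S q u by (intro bridge_cost_concat_real) auto
    also have "... <= ((Cp + ennreal (Tp * Kp)) + of_nat n * a) + (Cr + ennreal ((Tr + S) * Kr))"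
    proof (rule add_mono[OF go])
      have "bridge_cost \<sigma> e u \<nu> \<mu> (ennreal (u * q)) <= Cr + ennreal (u * Kr)" by (rule r(4)[OF u(1)])
      also have "... <= Cr + ennreal ((Tr + S) * Kr)"
        using u(2) r(3) by (intro add_left_mono ennreal_leI mult_right_mono)
      finally show "bridge_cost \<sigma> e u \<nu> \<mu> (ennreal (u * q)) <= Cr + ennreal ((Tr + S) * Kr)" .
    qed
    also have "... = D + of_nat n * a" by (simp only: D_def add_ac)
    also have "... <= D + ennreal (T / S) * a"
    proof -
      have "real n <= T / S" using n(1) p(1) r(1) S divide_right_mono[of "T - Tp - Tr" T S] by simp
      then have "of_nat n <= ennreal (T / S)" by (simp add: ennreal_of_nat_eq_real_of_nat ennreal_leI)
      then show ?thesis by (intro add_left_mono mult_right_mono) auto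
    qed
    finally have le: "bridge_cost \<sigma> e T \<mu> \<mu> (ennreal (T * q)) <= D + ennreal (T / S) * a" .
    have "mean_cost \<sigma> e \<mu> q T <= (D + ennreal (T / S) * a) / ennreal T"
      unfolding mean_cost_bridge by (rule divide_right_mono_ennreal[OF le])
    also have "... = ennreal (C / T) + a / ennreal S"
    proof -
      have "ennreal (T / S) * inverse (ennreal T) = inverse (ennreal S)"
        using T0 S by (simp add: inverse_ennreal ennreal_mult'[symmetric] divide_simps)
      then have "ennreal (T / S) * a * inverse (ennreal T) = a * inverse (ennreal S)"
        by (metis mult.commute mult.assoc)
      moreover have "ennreal C / ennreal T = ennreal (C / T)" using C(2) T0 by (rule divide_ennreal)
      ultimately show ?thesis unfolding C(1) divide_ennreal_def distrib_right by simp
    qed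
    finally show ?thesis by (simp add: mean_cost_bridge a_def)
  qed
  then show ?thesis using that[OF C(2), of "Tp + Tr"] p(1) r(1) by simp
qed

end

section \<open>Limit, convexity and zero set of the mean cost\<close>

context boltzmann_kernel
begin

definition cost_inf :: "real => (real^'d) measure => real => ennreal" where
  "cost_inf e \<mu> q = (INF T\<in>{0<..}. mean_cost \<sigma> e \<mu> q T)"

lemma tendsto_const_over: "((\<lambda>T::real. C / T) \<longlongrightarrow> 0) at_top"
  by (rule tendsto_divide_0[OF tendsto_const filterlim_at_top_imp_at_infinity[OF filterlim_ident]])

text \<open>A single good cycle at \<open>\<nu>\<close>, repeated, serves all long times at
  \<open>\<mu>\<close> up to an error \<open>C / T\<close>. With \<open>\<nu> = \<mu>\<close> this
  is convergence, with different measures it is independence.\<close>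

lemma eventually_mean_cost_less:
  assumes e: "0 < e" and \<mu>: "\<mu> \<in> regular_measures e" and \<nu>: "\<nu> \<in> regular_measures e" and q: "0 < q"
    and less: "cost_inf e \<nu> q < b"
  shows "\<forall>\<^sub>F T in at_top. mean_cost \<sigma> e \<mu> q T < b"
proof -
  obtain S where S: "0 < S" "mean_cost \<sigma> e \<nu> q S < b"
    using less by (auto simp: cost_inf_def INF_less_iff)
  then obtain x where x: "mean_cost \<sigma> e \<nu> q S = ennreal x" "0 <= x"
    by (cases "mean_cost \<sigma> e \<nu> q S") auto
  obtain C T0 where C: "0 <= C" "0 < T0" "\<And>T. T0 <= T ==> mean_cost \<sigma> e \<mu> q T <= ennreal (C / T) + mean_cost \<sigma> e \<nu> q S"
    by (rule mean_cost_compare[OF e \<mu> \<nu> q S(1)]) blast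
  have "((\<lambda>T. ennreal (C / T + x)) \<longlongrightarrow> ennreal (0 + x)) at_top"
    by (intro tendsto_ennrealI tendsto_add tendsto_const tendsto_const_over)
  then have "\<forall>\<^sub>F T in at_top. ennreal (C / T + x) < b"
    by (rule order_tendstoD) (use S(2) x in simp)
  then show ?thesis
    using eventually_ge_at_top[of T0]
  proof eventually_elim
    case (elim T)
    have "ennreal (C / T) + ennreal x = ennreal (C / T + x)" using C(1,2) elim(2) x(2) by simp
    then show ?case using C(3)[OF elim(2)] elim(1) x(1) by simp
  qed
qed

lemma cost_inf_le: "0 < T ==> cost_inf e \<mu> q <= mean_cost \<sigma> e \<mu> q T"
  unfolding cost_inf_def by (rule INF_lower) simp

lemma cost_inf_independent:
  assumes e: "0 < e" and \<mu>: "\<mu> \<in> regular_measures e" and \<nu>: "\<nu> \<in> regular_measures e" and q: "0 < q"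
  shows "cost_inf e \<mu> q = cost_inf e \<nu> q"
proof -
  have "cost_inf e \<mu> q <= cost_inf e \<nu> q" if \<mu>: "\<mu> \<in> regular_measures e" and \<nu>: "\<nu> \<in> regular_measures e" for \<mu> \<nu>
  proof (rule ccontr)
    assume "\<not> cost_inf e \<mu> q <= cost_inf e \<nu> q"
    then have "\<forall>\<^sub>F T in at_top. mean_cost \<sigma> e \<mu> q T < cost_inf e \<mu> q"
      by (intro eventually_mean_cost_less[OF e \<mu> \<nu> q]) simp
    then have "\<forall>\<^sub>F T::real in at_top. False"
      using eventually_gt_at_top[of 0] by eventually_elim (use cost_inf_le in \<open>meson leD\<close>)
    then show False by simp
  qed
  then show ?thesis using \<mu> \<nu> by (intro antisym) auto
qed

lemma mean_cost_tendsto: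
  assumes e: "0 < e" and \<mu>: "\<mu> \<in> regular_measures e" and q: "0 < q"
  shows "(mean_cost \<sigma> e \<mu> q \<longlongrightarrow> cost_inf e \<mu> q) at_top"
proof (rule order_tendstoI)
  fix a assume a: "a < cost_inf e \<mu> q"
  show "\<forall>\<^sub>F T in at_top. a < mean_cost \<sigma> e \<mu> q T"
    using eventually_gt_at_top[of 0] by eventually_elim (use cost_inf_le order_less_le_trans[OF a] in blast)
qed (rule eventually_mean_cost_less[OF e \<mu> \<mu> q])

lemma cost_inf_finite:
  assumes "0 < e" "\<mu> \<in> regular_measures e" "0 < q"
  shows "cost_inf e \<mu> q < top"
  using mean_cost_finite[OF assms] cost_inf_le order_le_less_trans by blast

lemma cost_inf_convex:
  fixes x y r s :: real
  assumes e: "0 < e" and \<mu>: "\<mu> \<in> regular_measures e" and x: "0 < x" "0 < y" and r: "0 < r" "0 < s" "r + s = 1"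
  shows "cost_inf e \<mu> (r * x + s * y) <= ennreal r * cost_inf e \<mu> x + ennreal s * cost_inf e \<mu> y"
proof (rule tendsto_lowerbound)
  have scale: "filterlim (\<lambda>T. c * T) at_top at_top" if "0 < c" for c :: real
    using that by (intro filterlim_tendsto_pos_mult_at_top[OF tendsto_const]) (auto simp: filterlim_ident)
  have lim: "((\<lambda>T. mean_cost \<sigma> e \<mu> q (c * T)) \<longlongrightarrow> cost_inf e \<mu> q) at_top" if "0 < q" "0 < c" for q c
    using filterlim_compose[OF mean_cost_tendsto[OF e \<mu> that(1)] scale[OF that(2)]] .
  show "((\<lambda>T. ennreal r * mean_cost \<sigma> e \<mu> x (r * T) + ennreal s * mean_cost \<sigma> e \<mu> y (s * T)) \<longlongrightarrow>
      ennreal r * cost_inf e \<mu> x + ennreal s * cost_inf e \<mu> y) at_top"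
    by (intro tendsto_add ennreal_tendsto_cmult lim x r) auto
  show "\<forall>\<^sub>F T in at_top. cost_inf e \<mu> (r * x + s * y) <= ennreal r * mean_cost \<sigma> e \<mu> x (r * T) + ennreal s * mean_cost \<sigma> e \<mu> y (s * T)"
    using eventually_gt_at_top[of 0]
  proof eventually_elim
    case (elim T)
    have w: "ennreal c * (X / ennreal (c * T)) = X / ennreal T" if "0 < c" for c X
    proof -
      have "ennreal c * inverse (ennreal (c * T)) = inverse (ennreal T)"
        using that elim by (simp add: inverse_ennreal ennreal_mult'[symmetric])
      then show ?thesis unfolding divide_ennreal_def by (metis mult.commute mult.assoc)
    qed
    have "T = r * T + s * T" using r(3) by (metis distrib_right mult_1)
    then have "bridge_cost \<sigma> e T \<mu> \<mu> (ennreal (T * (r * x + s * y))) = bridge_cost \<sigma> e (r * T + s * T) \<mu> \<mu> (ennreal ((r * T) * x + (s * T) * y))"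
      by (simp add: distrib_left mult_ac)
    also have "... <= bridge_cost \<sigma> e (r * T) \<mu> \<mu> (ennreal ((r * T) * x)) + bridge_cost \<sigma> e (s * T) \<mu> \<mu> (ennreal ((s * T) * y))"
      using e r x elim by (intro bridge_cost_concat_real) auto
    finally have le: "bridge_cost \<sigma> e T \<mu> \<mu> (ennreal (T * (r * x + s * y)))
      <= bridge_cost \<sigma> e (r * T) \<mu> \<mu> (ennreal ((r * T) * x)) + bridge_cost \<sigma> e (s * T) \<mu> \<mu> (ennreal ((s * T) * y))" .
    have "cost_inf e \<mu> (r * x + s * y) <= mean_cost \<sigma> e \<mu> (r * x + s * y) T" by (rule cost_inf_le[OF elim])
    also have "... <= (bridge_cost \<sigma> e (r * T) \<mu> \<mu> (ennreal ((r * T) * x)) + bridge_cost \<sigma> e (s * T) \<mu> \<mu> (ennreal ((s * T) * y))) / ennreal T"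
      unfolding mean_cost_bridge by (rule divide_right_mono_ennreal[OF le])
    also have "... = ennreal r * mean_cost \<sigma> e \<mu> x (r * T) + ennreal s * mean_cost \<sigma> e \<mu> y (s * T)"
      unfolding mean_cost_bridge w[OF r(1)] w[OF r(2)] by (rule add_divide_distrib_ennreal)
    finally show ?case .
  qed
qed simp

lemma cost_inf_zero:
  assumes e: "0 < e" and \<mu>: "\<mu> \<in> regular_measures e" and q: "0 < q" "q <= qr e"
  shows "cost_inf e \<mu> q = 0"
proof -
  have qe: "0 < qr e" by (rule qr_pos[OF e])
  \<comment> \<open>The collision rate scales like the square root of the energy, so the energy
    \<open>r\<^sup>2 * e\<close> has exactly the rate \<open>q\<close>.\<close>
  define r where "r = q / qr e"
  have r: "0 < r" "r <= 1" using q qe by (auto simp: r_def)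
  have \<epsilon>: "0 < r\<^sup>2 * e" "r\<^sup>2 * e <= e" using r e by (auto simp: power_le_one)
  have qr: "qr (r\<^sup>2 * e) = q" using qr_scale[OF e r(1)] qe by (simp add: r_def)
  let ?M = "maxwellian (r\<^sup>2 * e) :: (real^'d) measure"
  have "bridge_cost \<sigma> e 1 ?M ?M (ennreal (1 * (1 * q))) <= ennreal (1 * (q * rate_fun 1))"
    using maxwellian_loop[OF \<epsilon>, of 1 1] unfolding qr by simp
  then have "mean_cost \<sigma> e ?M q 1 = 0" by (simp add: mean_cost_bridge rate_fun_def)
  then have "cost_inf e ?M q = 0" using cost_inf_le[of 1 e ?M q] by simp
  then show ?thesis
    using cost_inf_independent[OF e \<mu> maxwellian_regular[OF \<epsilon>] q(1)] by simp
qed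

lemma rate_i_pos: "0 < q ==> rate_i \<sigma> e \<mu> q = cost_inf e \<mu> q"
  by (simp add: rate_i_def cost_inf_def)

lemma rate_i_0:
  assumes e: "0 < e" and \<mu>: "\<mu> \<in> regular_measures e"
  shows "rate_i \<sigma> e \<mu> 0 = 0"
proof -
  have "\<forall>\<^sub>F q in at_right 0. cost_inf e \<mu> q = 0"
    using eventually_at_right_less[of "0::real"] eventually_at_right_real[OF qr_pos[OF e]]
    by eventually_elim (use cost_inf_zero[OF e \<mu>] in auto)
  then have "(cost_inf e \<mu> \<longlongrightarrow> 0) (at_right 0)" by (rule tendsto_eventually)
  then have "Liminf (at_right 0) (cost_inf e \<mu>) = 0" by (rule lim_imp_Liminf[rotated]) simp
  then show ?thesis by (simp add: rate_i_def cost_inf_def[abs_def])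
qed

lemma rate_i_zero:
  assumes e: "0 < e" and \<mu>: "\<mu> \<in> regular_measures e" and q: "0 <= q" "q <= qr e"
  shows "rate_i \<sigma> e \<mu> q = 0"
  using rate_i_0[OF e \<mu>] rate_i_pos cost_inf_zero[OF e \<mu>] q by (cases "q = 0") auto

text \<open>A finite convex function on the open half-line is continuous, and near 0 the function
  vanishes identically. Continuity then extends convexity to the end point.\<close>

lemma rate_i_continuous_convex:
  assumes e: "0 < e" and \<mu>: "\<mu> \<in> regular_measures e"
  shows "continuous_on {0..} (rate_i \<sigma> e \<mu>)"
    and "\<And>x y s. 0 <= x ==> 0 <= y ==> s \<in> {0..1} ==> rate_i \<sigma> e \<mu> ((1 - s) * x + s * y)
      <= ennreal (1 - s) * rate_i \<sigma> e \<mu> x + ennreal s * rate_i \<sigma> e \<mu> y"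
proof -
  define I where "I q = enn2real (rate_i \<sigma> e \<mu> q)" for q
  have I: "rate_i \<sigma> e \<mu> q = ennreal (I q)" if "0 <= q" for q
    using that rate_i_0[OF e \<mu>] rate_i_pos[of q e \<mu>] cost_inf_finite[OF e \<mu>, of q]
    by (cases "q = 0") (auto simp: I_def less_top)
  have I0: "0 <= I q" for q by (simp add: I_def)
  have conv0: "I (r * x + s * y) <= r * I x + s * I y" if "0 < x" "0 < y" "0 < r" "0 < s" "r + s = 1" for x y r s
  proof -
    have "0 < r * x + s * y" using that by (simp add: add_pos_pos)
    then have "ennreal (I (r * x + s * y)) <= ennreal r * ennreal (I x) + ennreal s * ennreal (I y)"
      using cost_inf_convex[OF e \<mu> that] that I by (simp add: rate_i_pos[symmetric])
    also have "... = ennreal (r * I x + s * I y)"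
      using that I0 by (simp add: ennreal_mult)
    finally show ?thesis using that I0 by (subst (asm) ennreal_le_iff) auto
  qed
  have "convex_on {0<..} I"
  proof (rule convex_onI)
    show "convex {0::real<..}" by simp
    show "I ((1 - t) *\<^sub>R x + t *\<^sub>R y) <= (1 - t) * I x + t * I y"
      if "0 < t" "t < 1" "x \<in> {0<..}" "y \<in> {0<..}" for t x y
      using conv0[of x y "1 - t" t] that by simp
  qed
  then have pos: "continuous_on {0<..} I" by (intro convex_on_continuous) auto
  have contI: "continuous_on {0..} I"
    unfolding continuous_on_eq_continuous_within
  proof
    fix q :: real assume "q \<in> {0..}"
    show "continuous (at q within {0..}) I"
    proof (cases "q = 0")
      case True
      have "\<forall>\<^sub>F q in at 0 within {0..}. I q = 0"
        unfolding eventually_at using qr_pos[OF e] rate_i_zero[OF e \<mu>]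
        by (intro exI[of _ "qr e"]) (auto simp: I_def dist_real_def)
      then have "(I \<longlongrightarrow> 0) (at 0 within {0..})" by (rule tendsto_eventually)
      then show ?thesis using True rate_i_0[OF e \<mu>] by (simp add: continuous_within I_def)
    next
      case False
      then have "isCont I q" using pos \<open>q \<in> {0..}\<close> by (simp add: continuous_on_eq_continuous_at)
      then show ?thesis by (rule continuous_at_imp_continuous_at_within)
    qed
  qed
  have "continuous_on {0..} (\<lambda>q. ennreal (I q))"
    by (intro continuous_on_ennreal contI)
  then show "continuous_on {0..} (rate_i \<sigma> e \<mu>)"
    by (subst continuous_on_cong[OF refl, of _ _ "\<lambda>q. ennreal (I q)"]) (auto simp: I)
  fix x y s :: real assume x: "0 <= x" and y: "0 <= y" and s: "s \<in> {0..1}"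
  have "I ((1 - s) * x + s * y) <= (1 - s) * I x + s * I y"
  proof (cases "s = 0 \<or> s = 1")
    case False
    then have s': "0 < 1 - s" "0 < s" using s by auto
    \<comment> \<open>Convexity is known at positive arguments; both points are shifted by
      \<open>\<delta>\<close>, which then tends to 0.\<close>
    have lim: "((\<lambda>\<delta>. I (z + \<delta>)) \<longlongrightarrow> I z) (at_right 0)" if z: "0 <= z" for z
    proof (rule continuous_on_tendsto_compose[OF contI])
      have "((\<lambda>\<delta>. z + \<delta>) \<longlongrightarrow> z + 0) (at_right 0)" by (intro tendsto_intros)
      then show "((\<lambda>\<delta>. z + \<delta>) \<longlongrightarrow> z) (at_right 0)" by simp
      show "\<forall>\<^sub>F \<delta> in at_right 0. z + \<delta> \<in> {0..}"
        using eventually_at_right_less[of "0::real"] by eventually_elim (use z in simp)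
    qed (use z in simp)
    show ?thesis
    proof (rule tendsto_le)
      show "((\<lambda>\<delta>. (1 - s) * I (x + \<delta>) + s * I (y + \<delta>)) \<longlongrightarrow> (1 - s) * I x + s * I y) (at_right 0)"
        by (intro tendsto_intros lim x y)
      show "((\<lambda>\<delta>. I (((1 - s) * x + s * y) + \<delta>)) \<longlongrightarrow> I ((1 - s) * x + s * y)) (at_right 0)"
        using s x y by (intro lim) auto
      show "\<forall>\<^sub>F \<delta> in at_right 0. I (((1 - s) * x + s * y) + \<delta>) <= (1 - s) * I (x + \<delta>) + s * I (y + \<delta>)"
        using eventually_at_right_less[of "0::real"]
      proof eventually_elim
        case (elim \<delta>)
        have "((1 - s) * x + s * y) + \<delta> = (1 - s) * (x + \<delta>) + s * (y + \<delta>)" by (simp add: algebra_simps)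
        then show ?case using conv0[of "x + \<delta>" "y + \<delta>" "1 - s" s] elim x y s' by simp
      qed
    qed simp
  qed auto
  then have "ennreal (I ((1 - s) * x + s * y)) <= ennreal ((1 - s) * I x + s * I y)" by (rule ennreal_leI)
  also have "... = ennreal (1 - s) * ennreal (I x) + ennreal s * ennreal (I y)"
    using s I0 by (simp add: ennreal_mult)
  finally show "rate_i \<sigma> e \<mu> ((1 - s) * x + s * y) <= ennreal (1 - s) * rate_i \<sigma> e \<mu> x + ennreal s * rate_i \<sigma> e \<mu> y"
    using I[of "(1 - s) * x + s * y"] I[OF x] I[OF y] s x y by simp
qed

end

theorem proposition2p2:
  fixes \<sigma> :: "(real^'d) measure" and e :: real
  assumes "CARD('d) \<ge> 2" and "haar_sphere \<sigma>" and "e > 0"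
  shows
    "(\<forall>\<mu>\<in>finite_entropy e. \<forall>\<nu>\<in>finite_entropy e. \<forall>q\<ge>0. rate_i \<sigma> e \<mu> q = rate_i \<sigma> e \<nu> q) \<and>
     (\<forall>\<mu>\<in>finite_entropy e.
        continuous_on {0..} (rate_i \<sigma> e \<mu>) \<and>
        (\<forall>x\<ge>0. \<forall>y\<ge>0. \<forall>s\<in>{0..1}.
           rate_i \<sigma> e \<mu> ((1 - s) * x + s * y)
             \<le> ennreal (1 - s) * rate_i \<sigma> e \<mu> x + ennreal s * rate_i \<sigma> e \<mu> y) \<and>
        (\<forall>q>0. (mean_cost \<sigma> e \<mu> q \<longlongrightarrow> rate_i \<sigma> e \<mu> q) at_top) \<and>
        (\<forall>q\<ge>0. ennreal q \<le> typical_q \<sigma> e \<longrightarrow> rate_i \<sigma> e \<mu> q = 0))"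
proof -
  interpret boltzmann_kernel \<sigma> using assms by unfold_locales auto
  note e = \<open>e > 0\<close>
  have reg: "\<mu> \<in> regular_measures e" if "\<mu> \<in> finite_entropy e" for \<mu> :: "(real^'d) measure"
    using that finite_entropy_regular by blast
  show ?thesis
  proof (intro conjI ballI allI impI)
    fix \<mu> \<nu> :: "(real^'d) measure" and q :: real
    assume \<mu>: "\<mu> \<in> finite_entropy e" and \<nu>: "\<nu> \<in> finite_entropy e" and q: "0 <= q"
    show "rate_i \<sigma> e \<mu> q = rate_i \<sigma> e \<nu> q"
      using cost_inf_independent[OF e reg[OF \<mu>] reg[OF \<nu>], of q] rate_i_0[OF e reg[OF \<mu>]] rate_i_0[OF e reg[OF \<nu>]] q
      by (cases "q = 0") (auto simp: rate_i_pos)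
  next
    fix \<mu> :: "(real^'d) measure" assume \<mu>: "\<mu> \<in> finite_entropy e"
    show "continuous_on {0..} (rate_i \<sigma> e \<mu>)" by (rule rate_i_continuous_convex(1)[OF e reg[OF \<mu>]])
    show "rate_i \<sigma> e \<mu> ((1 - s) * x + s * y) <= ennreal (1 - s) * rate_i \<sigma> e \<mu> x + ennreal s * rate_i \<sigma> e \<mu> y"
      if "0 <= x" "0 <= y" "s \<in> {0..1}" for x y s
      using that by (rule rate_i_continuous_convex(2)[OF e reg[OF \<mu>]])
    show "(mean_cost \<sigma> e \<mu> q \<longlongrightarrow> rate_i \<sigma> e \<mu> q) at_top" if "0 < q" for q
      unfolding rate_i_pos[OF that] by (rule mean_cost_tendsto[OF e reg[OF \<mu>] that])
    show "rate_i \<sigma> e \<mu> q = 0" if "0 <= q" "ennreal q <= typical_q \<sigma> e" for q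
    proof (rule rate_i_zero[OF e reg[OF \<mu>] that(1)])
      show "q <= qr e" using that typical_q_qr[OF e] qr_pos[OF e] by simp
    qed
  qed
qed

end
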